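(* Let $\Psi$ be a payoff function and let $\pi^{b_\Psi}=(D^{0,b_{\Psi}},R^{0,b_{\Psi}})$ be the double barrier strategy with dividend barrier $b=b_{\Psi}$ and capital injection barrier $0$. Then $(D^{0,b_{\Psi}},R^{0,b_{\Psi}})$ is an optimal strategy for the auxiliary problem, i.e. $$V_{\Psi}(x)=\sup_{\pi\in\Pi}J_{\Psi}(x;\pi)=J_{\Psi}(x;\pi^{b_{\Psi}}),\qquad x>0.$$
   Context: Notation: $\mathbb{R}_+=[0,\infty)$, $a\vee b=\max$, $a\wedge b=\min$, $\Delta Z_t=Z_t-Z_{t-}$; time integrals against $dD$, $dR$ include a possible jump at time $0$. $X=(X_t)_{t\ge0}$ is a spectrally positive Lévy process (no downward jumps), not a subordinator, on a filtered space $(\Omega,\mathcal F,\mathbb F,\mathbb P)$ satisfying the usual conditions; $\mathbb E_x$ is expectation under the law $\mathbb{P}_x$ of $X$ started at $x$. Its Laplace exponent, defined by $\mathbb E_0[e^{-\theta X_t}]=e^{t\psi(\theta)}$, $\theta\ge0$, is $\psi(\theta)=c\theta+\frac{\sigma^2}2\theta^2+\int_{(0,\infty)}(e^{-\theta z}-1+\theta z\mathbf 1_{\{z<1\}})\nu(dz)$ with $c\in\mathbb R,\sigma\ge0$, $\int(1\wedge z^2)\nu(dz)<\infty$, and $\mathbb E_0[X_1]=-\psi'(0+)<\infty$. $N$ is a Poisson process with intensity $\gamma>0$ and arrival times $(T_n)_{n\ge1}$, independent of $X$; $\tau$ is exponential with mean $1/\lambda>0$, independent of $X$ and $N$. $X$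 and $N$ are $\mathbb F$-adapted with increments after time $t$ independent of $\mathcal F_t$, and $\tau$ is independent of $\mathbb F$. Let $r>0$, $q:=r+\lambda$, $\phi>1$. A payoff function is a continuous concave function $\Psi:\mathbb R_+\to\mathbb R_+$ with $\Psi'_+(0+)\le\phi$ and $\Psi'_+(\infty)\in[0,1]$ ($\Psi'_+$ is the right derivative). The admissible set $\Pi$ is the set of pairs $\pi=(D,R)$ of non-decreasing, càdlàg, adapted processes ($D_{0-}=R_{0-}=0$) such that $U_t^\pi:=X_t-D_t+R_t\ge0$ and $D_t=\int_0^t\Delta D_s\,dN_s$ for all $t\ge0$, and $\mathbb E_x[\int_0^\infty e^{-(r+\lambda)t}dR_t]<\infty$. The objective and value function are $$J_\Psi(x;\pi)=\mathbb E_x\Big[\int_0^\tau e^{-rt}d(D_t-\phi R_t)+e^{-r\tau}\Psi(U^\pi_\tau)\Big],\qquad V_\Psi(x)=\sup_{\pi\in\Pi}J_\Psi(x;\pi).$$ For $b>0$, the double barrier strategy $\pi^b=(D^{0,b},R^{0,b})$ is $$D_t^{0,b}=\sum_{n\ge1}\big((U_{T_n-}^{0,b}+\Delta X_{T_n}-b)\vee0\big)\mathbf 1_{\{T_n\le t\}},\quad R_t^{0,b}=-\inf_{s\le t}\big((X_s-D_s^{0,b})\wedge0\big),\quad U_t^{0,b}=X_t-D_t^{0,b}+R_t^{0,b}.$$ Finally $b_\Psi:=\inf\{b>0:\ \frac{d}{dx}J_\Psi(x;\pi^b)|_{x=b}\le1\}$ ($\inf\emptyset=+\infty$). *)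

theory Defs
  imports "HOL-Probability.Probability"
begin

section \<open>Paths\<close>

definition cadlag :: "(real \<Rightarrow> real) \<Rightarrow> bool" where
  "cadlag f \<longleftrightarrow>
     (\<forall>t\<ge>0. continuous (at_right t) f) \<and> (\<forall>t>0. \<exists>l. (f \<longlongrightarrow> l) (at_left t))"

text \<open>Paths are indexed by \<open>[0,\<infinity>)\<close>. Continuing them by \<open>0\<close> to the negative half-line encodes the
  convention \<open>D\<^sub>0\<^sub>- = R\<^sub>0\<^sub>- = 0\<close>: a value \<open>D\<^sub>0 > 0\<close> is a jump at time \<open>0\<close>, and an atom at \<open>0\<close>
  of the associated Lebesgue-Stieltjes measure.\<close>

definition zero_ext :: "(real \<Rightarrow> real) \<Rightarrow> real \<Rightarrow> real" where
  "zero_ext f t = (if t < 0 then 0 else f t)"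

definition left_lim :: "(real \<Rightarrow> real) \<Rightarrow> real \<Rightarrow> real" where
  "left_lim f t = Lim (at_left t) (zero_ext f)"

definition jump :: "(real \<Rightarrow> real) \<Rightarrow> real \<Rightarrow> real" where
  "jump f t = f t - left_lim f t"

definition stieltjes_measure :: "(real \<Rightarrow> real) \<Rightarrow> real measure" where
  "stieltjes_measure f = interval_measure (zero_ext f)"


section \<open>The driving processes\<close>

definition events_of :: "'a measure \<Rightarrow> (real \<Rightarrow> 'a \<Rightarrow> real) \<Rightarrow> real set \<Rightarrow> 'a set set" where
  "events_of M Y I = sigma_sets (space M) {Y t -` A \<inter> space M | t A. t \<in> I \<and> A \<in> sets borel}"

definition levy_process :: "'a measure \<Rightarrow> (real \<Rightarrow> 'a \<Rightarrow> real) \<Rightarrow> bool" where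
  "levy_process M Y \<longleftrightarrow>
     prob_space M \<and>
     (\<forall>t\<ge>0. Y t \<in> borel_measurable M) \<and>
     (AE \<omega> in M. Y 0 \<omega> = 0 \<and> cadlag (\<lambda>t. Y t \<omega>)) \<and>
     (\<forall>s\<ge>0. prob_space.indep_set M (events_of M Y {0..s})
                (events_of M (\<lambda>t \<omega>. Y t \<omega> - Y s \<omega>) {s..})) \<and>
     (\<forall>s\<ge>0. \<forall>t\<ge>0. distr M borel (\<lambda>\<omega>. Y (s + t) \<omega> - Y s \<omega>) = distr M borel (Y t))"

definition subordinator :: "'a measure \<Rightarrow> (real \<Rightarrow> 'a \<Rightarrow> real) \<Rightarrow> bool" where
  "subordinator M Y \<longleftrightarrow> levy_process M Y \<and> (AE \<omega> in M. mono_on {0..} (\<lambda>t. Y t \<omega>))"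

definition spectrally_positive_levy_process :: "'a measure \<Rightarrow> (real \<Rightarrow> 'a \<Rightarrow> real) \<Rightarrow> bool" where
  "spectrally_positive_levy_process M Y \<longleftrightarrow>
     levy_process M Y \<and> (AE \<omega> in M. \<forall>t>0. jump (\<lambda>s. Y s \<omega>) t \<ge> 0) \<and> \<not> subordinator M Y"

definition poisson_process :: "'a measure \<Rightarrow> real \<Rightarrow> (real \<Rightarrow> 'a \<Rightarrow> nat) \<Rightarrow> bool" where
  "poisson_process M \<gamma> N \<longleftrightarrow>
     levy_process M (\<lambda>t \<omega>. real (N t \<omega>)) \<and>
     (\<forall>t>0. distr M (count_space UNIV) (N t) = measure_pmf (poisson_pmf (\<gamma> * t)))"

definition laplace_exponent :: "real \<Rightarrow> real \<Rightarrow> real measure \<Rightarrow> real \<Rightarrow> real" where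
  "laplace_exponent c \<sigma> \<nu> \<theta> =
     c * \<theta> + \<sigma>\<^sup>2 / 2 * \<theta>\<^sup>2
       + (LINT z:{0<..}|\<nu>. exp (- \<theta> * z) - 1 + \<theta> * z * indicator {..<1} z)"

definition usual_filtration :: "'a measure \<Rightarrow> (real \<Rightarrow> 'a measure) \<Rightarrow> bool" where
  "usual_filtration M F \<longleftrightarrow>
     (\<forall>t\<ge>0. subalgebra M (F t)) \<and>
     (\<forall>s\<ge>0. \<forall>t\<ge>s. sets (F s) \<subseteq> sets (F t)) \<and>
     (\<forall>t\<ge>0. sets (F t) = (\<Inter>s\<in>{t<..}. sets (F s))) \<and>
     complete_measure M \<and> null_sets M \<subseteq> sets (F 0)"

text \<open>The measure \<open>M\<close> plays the role of \<open>\<P>\<^sub>0\<close>; the law \<open>\<P>\<^sub>x\<close> is realised on the same space by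
  replacing \<open>X\<close> with \<open>x + X\<close>. The joint law of the increments of \<open>(X, N)\<close> after \<open>t\<close> is independent
  of \<open>F t\<close>. Independence of \<open>\<tau>\<close> from \<open>X\<close> and \<open>N\<close> is contained in its independence of the whole
  filtration, to which \<open>X\<close> and \<open>N\<close> are adapted. Since \<open>X\<close> has no negative jumps, the expectation of
  \<open>X 1\<close> always exists in \<open>(-\<infinity>, \<infinity>]\<close> and equals \<open>- \<psi>'(0+)\<close>; so its finiteness is integrability.\<close>

locale levy_dividend_model = prob_space M
  for M :: "'a measure" +
  fixes F :: "real \<Rightarrow> 'a measure"
    and X :: "real \<Rightarrow> 'a \<Rightarrow> real"
    and N :: "real \<Rightarrow> 'a \<Rightarrow> nat"
    and \<tau> :: "'a \<Rightarrow> real"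
    and c \<sigma> :: real
    and \<nu> :: "real measure"
    and \<gamma> lam :: real
  assumes filtration: "usual_filtration M F"
    and X_levy: "spectrally_positive_levy_process M X"
    and sigma_nonneg: "\<sigma> \<ge> 0"
    and nu_sets: "sets \<nu> = sets borel"
    and nu_support: "emeasure \<nu> {..0} = 0"
    and nu_integrable: "set_integrable \<nu> {0<..} (\<lambda>z. min 1 (z\<^sup>2))"
    and X_exponent: "\<And>t \<theta>. t \<ge> 0 \<Longrightarrow> \<theta> \<ge> 0 \<Longrightarrow>
          expectation (\<lambda>\<omega>. exp (- \<theta> * X t \<omega>)) = exp (t * laplace_exponent c \<sigma> \<nu> \<theta>)"
    and X_mean: "integrable M (X 1)"
    and gamma_pos: "\<gamma> > 0"
    and N_poisson: "poisson_process M \<gamma> N"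
    and X_N_indep: "indep_set (events_of M X {0..}) (events_of M (\<lambda>t \<omega>. real (N t \<omega>)) {0..})"
    and X_adapted: "\<And>t. t \<ge> 0 \<Longrightarrow> X t \<in> borel_measurable (F t)"
    and N_adapted: "\<And>t. t \<ge> 0 \<Longrightarrow> (\<lambda>\<omega>. real (N t \<omega>)) \<in> borel_measurable (F t)"
    and increments_indep: "\<And>t. t \<ge> 0 \<Longrightarrow>
          indep_set (sets (F t))
            (sigma_sets (space M)
              (events_of M (\<lambda>s \<omega>. X s \<omega> - X t \<omega>) {t..} \<union>
               events_of M (\<lambda>s \<omega>. real (N s \<omega>) - real (N t \<omega>)) {t..}))"
    and lam_pos: "lam > 0"
    and tau_exponential: "distributed M lborel \<tau> (\<lambda>t. ennreal (exponential_density lam t))"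
    and tau_indep:
          "indep_set {\<tau> -` A \<inter> space M | A. A \<in> sets borel}
            (sigma_sets (space M) (\<Union>t\<in>{0..}. sets (F t)))"

definition start_at :: "real \<Rightarrow> (real \<Rightarrow> 'a \<Rightarrow> real) \<Rightarrow> real \<Rightarrow> 'a \<Rightarrow> real" where
  "start_at x X t \<omega> = x + X t \<omega>"


section \<open>Payoff functions\<close>

definition right_deriv :: "(real \<Rightarrow> real) \<Rightarrow> real \<Rightarrow> real" where
  "right_deriv f x = Lim (at_right x) (\<lambda>y. (f y - f x) / (y - x))"

definition payoff_function :: "real \<Rightarrow> (real \<Rightarrow> real) \<Rightarrow> bool" where
  "payoff_function \<phi> \<Psi> \<longleftrightarrow>
     (\<forall>x\<ge>0. \<Psi> x \<ge> 0) \<and> continuous_on {0..} \<Psi> \<and> concave_on {0..} \<Psi> \<and>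
     (\<exists>l\<le>\<phi>. (right_deriv \<Psi> \<longlongrightarrow> l) (at_right 0)) \<and>
     (\<exists>l\<in>{0..1}. (right_deriv \<Psi> \<longlongrightarrow> l) at_top)"


section \<open>The control problem\<close>

text \<open>Below, \<open>Y\<close> is the uncontrolled surplus, initial value included.\<close>

type_synonym 'a strategy = "(real \<Rightarrow> 'a \<Rightarrow> real) \<times> (real \<Rightarrow> 'a \<Rightarrow> real)"

definition admissible ::
  "'a measure \<Rightarrow> (real \<Rightarrow> 'a measure) \<Rightarrow> (real \<Rightarrow> 'a \<Rightarrow> nat) \<Rightarrow> real \<Rightarrow> (real \<Rightarrow> 'a \<Rightarrow> real)
    \<Rightarrow> 'a strategy set" where
  "admissible M F N q Y = {(D, R).
     (\<forall>t\<ge>0. D t \<in> borel_measurable (F t) \<and> R t \<in> borel_measurable (F t)) \<and>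
     (AE \<omega> in M.
        mono_on {0..} (\<lambda>t. D t \<omega>) \<and> 0 \<le> D 0 \<omega> \<and> cadlag (\<lambda>t. D t \<omega>) \<and>
        mono_on {0..} (\<lambda>t. R t \<omega>) \<and> 0 \<le> R 0 \<omega> \<and> cadlag (\<lambda>t. R t \<omega>) \<and>
        (\<forall>t\<ge>0. Y t \<omega> - D t \<omega> + R t \<omega> \<ge> 0) \<and>
        (\<forall>t\<ge>0. D t \<omega> = (LINT s:{0..t}|stieltjes_measure (\<lambda>s. real (N s \<omega>)).
                          jump (\<lambda>s. D s \<omega>) s))) \<and>
     (\<integral>\<^sup>+\<omega>. (\<integral>\<^sup>+t\<in>{0..}. ennreal (exp (- q * t)) \<partial>stieltjes_measure (\<lambda>t. R t \<omega>)) \<partial>M) < \<infinity>}"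

definition objective ::
  "'a measure \<Rightarrow> ('a \<Rightarrow> real) \<Rightarrow> real \<Rightarrow> real \<Rightarrow> (real \<Rightarrow> real) \<Rightarrow> (real \<Rightarrow> 'a \<Rightarrow> real)
    \<Rightarrow> 'a strategy \<Rightarrow> real" where
  "objective M \<tau> r \<phi> \<Psi> Y = (\<lambda>(D, R).
     (LINT \<omega>|M.
        (LINT t:{0..\<tau> \<omega>}|stieltjes_measure (\<lambda>t. D t \<omega>). exp (- r * t))
        - \<phi> * (LINT t:{0..\<tau> \<omega>}|stieltjes_measure (\<lambda>t. R t \<omega>). exp (- r * t))
        + exp (- r * \<tau> \<omega>) * \<Psi> (Y (\<tau> \<omega>) \<omega> - D (\<tau> \<omega>) \<omega> + R (\<tau> \<omega>) \<omega>)))"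

text \<open>The supremum is taken in the extended reals, so that it is meaningful without an a priori
  bound.\<close>

definition value_function ::
  "'a measure \<Rightarrow> (real \<Rightarrow> 'a measure) \<Rightarrow> (real \<Rightarrow> 'a \<Rightarrow> nat) \<Rightarrow> ('a \<Rightarrow> real) \<Rightarrow> real \<Rightarrow> real \<Rightarrow> real
    \<Rightarrow> (real \<Rightarrow> real) \<Rightarrow> (real \<Rightarrow> 'a \<Rightarrow> real) \<Rightarrow> ereal" where
  "value_function M F N \<tau> r lam \<phi> \<Psi> Y =
     (SUP \<pi>\<in>admissible M F N (r + lam) Y. ereal (objective M \<tau> r \<phi> \<Psi> Y \<pi>))"


section \<open>Double barrier strategies\<close>

text \<open>Pathwise, the equations defining the double barrier strategy are implicit: \<open>D\<close> is a sum of
  terms containing \<open>U\<close>, which contains \<open>D\<close>. They are solved recursively over the arrival times: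
  \<open>dividends_upto y T b n\<close> is the cumulative dividend process that ignores all arrivals after the
  \<open>n\<close>-th. Lemma \<open>barrier_dividends_iff\<close> below shows that the result is the unique solution of
  the implicit equations.\<close>

definition arrival_time :: "(real \<Rightarrow> nat) \<Rightarrow> nat \<Rightarrow> real" where
  "arrival_time m n = Inf {t. 0 \<le> t \<and> n \<le> m t}"

definition injections :: "(real \<Rightarrow> real) \<Rightarrow> (real \<Rightarrow> real) \<Rightarrow> real \<Rightarrow> real" where
  "injections y d t = - (INF s\<in>{0..t}. min (y s - d s) 0)"

definition controlled :: "(real \<Rightarrow> real) \<Rightarrow> (real \<Rightarrow> real) \<Rightarrow> real \<Rightarrow> real" where
  "controlled y d t = y t - d t + injections y d t"

primrec dividends_upto ::
  "(real \<Rightarrow> real) \<Rightarrow> (nat \<Rightarrow> real) \<Rightarrow> real \<Rightarrow> nat \<Rightarrow> real \<Rightarrow> real" where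
  "dividends_upto y T b 0 = (\<lambda>t. 0)"
| "dividends_upto y T b (Suc n) = (\<lambda>t. dividends_upto y T b n t +
     (if T (Suc n) \<le> t
      then max (left_lim (controlled y (dividends_upto y T b n)) (T (Suc n))
                  + jump y (T (Suc n)) - b) 0
      else 0))"

definition barrier_dividends ::
  "(real \<Rightarrow> real) \<Rightarrow> (real \<Rightarrow> nat) \<Rightarrow> real \<Rightarrow> real \<Rightarrow> real" where
  "barrier_dividends y m b t = dividends_upto y (arrival_time m) b (m t) t"

definition double_barrier ::
  "(real \<Rightarrow> 'a \<Rightarrow> real) \<Rightarrow> (real \<Rightarrow> 'a \<Rightarrow> nat) \<Rightarrow> real \<Rightarrow> 'a strategy" where
  "double_barrier Y N b =
     (\<lambda>t \<omega>. barrier_dividends (\<lambda>s. Y s \<omega>) (\<lambda>s. N s \<omega>) b t,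
      \<lambda>t \<omega>. injections (\<lambda>s. Y s \<omega>) (barrier_dividends (\<lambda>s. Y s \<omega>) (\<lambda>s. N s \<omega>) b) t)"

definition barrier_level ::
  "'a measure \<Rightarrow> (real \<Rightarrow> 'a \<Rightarrow> real) \<Rightarrow> (real \<Rightarrow> 'a \<Rightarrow> nat) \<Rightarrow> ('a \<Rightarrow> real) \<Rightarrow> real \<Rightarrow> real
    \<Rightarrow> (real \<Rightarrow> real) \<Rightarrow> ereal" where
  "barrier_level M X N \<tau> r \<phi> \<Psi> = Inf {ereal b | b. b > 0 \<and>
     (\<exists>d\<le>1. ((\<lambda>x. objective M \<tau> r \<phi> \<Psi> (start_at x X) (double_barrier (start_at x X) N b))
               has_real_derivative d) (at b))}"

lemma left_lim_cong:
  assumes "\<And>s. 0 \<le> s \<Longrightarrow> s < t \<Longrightarrow> f s = g s"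
  shows "left_lim f t = left_lim g t"
proof -
  have "eventually (\<lambda>s. zero_ext f s = zero_ext g s) (at_left t)"
    using assms by (auto simp: eventually_at_filter zero_ext_def)
  then have "(zero_ext f \<longlongrightarrow> l) (at_left t) = (zero_ext g \<longlongrightarrow> l) (at_left t)" for l
    by (rule tendsto_cong)
  then show ?thesis unfolding left_lim_def Topological_Spaces.Lim_def by presburger
qed

lemma controlled_cong:
  assumes "\<And>s. 0 \<le> s \<Longrightarrow> s < t \<Longrightarrow> d s = e s" "0 \<le> u" "u < t"
  shows "controlled y d u = controlled y e u"
proof -
  have "(\<lambda>s. min (y s - d s) 0) ` {0..u} = (\<lambda>s. min (y s - e s) 0) ` {0..u}"
    using assms by (intro image_cong) auto
  then show ?thesis using assms by (simp add: controlled_def injections_def)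
qed

lemma arrival_time_le_iff:
  fixes m :: "real \<Rightarrow> nat"
  assumes mono: "mono_on {0..} m" and cad: "cadlag (\<lambda>t. real (m t))"
    and unb: "\<And>n. \<exists>t\<ge>0. n \<le> m t" and t: "t \<ge> 0"
  shows "arrival_time m n \<le> t \<longleftrightarrow> n \<le> m t"
proof
  let ?S = "{t. 0 \<le> t \<and> n \<le> m t}"
  have bdd: "bdd_below ?S" by (auto intro: bdd_belowI[of _ 0])
  show "arrival_time m n \<le> t" if "n \<le> m t"
    unfolding arrival_time_def using that t bdd by (intro cInf_lower) auto
  show "n \<le> m t" if le: "arrival_time m n \<le> t"
  proof (rule ccontr)
    assume "\<not> n \<le> m t"
    then have lt: "m t < n" by simp
    have "((\<lambda>s. real (m s)) \<longlongrightarrow> real (m t)) (at_right t)"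
      using cad t by (simp add: cadlag_def continuous_within)
    then have "eventually (\<lambda>s. real (m s) < real n) (at_right t)"
      using lt by (intro order_tendstoD) auto
    then obtain u where u: "u > t" "\<And>s. t < s \<Longrightarrow> s < u \<Longrightarrow> m s < n"
      by (auto simp: eventually_at_right_field)
    have ne: "?S \<noteq> {}" using unb[of n] by auto
    have "arrival_time m n < u" using le u by simp
    then obtain s where s: "s \<in> ?S" "s < u"
      using cInf_less_iff[OF ne bdd] unfolding arrival_time_def by auto
    have "s > t"
    proof (rule ccontr)
      assume "\<not> s > t"
      then have "m s \<le> m t" using s t mono by (auto simp: mono_on_def)
      then show False using s lt by auto
    qed
    then show False using u(2)[of s] s by auto
  qed
qed

lemma barrier_dividends_iff:
  fixes m :: "real \<Rightarrow> nat" and y d :: "real \<Rightarrow> real"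
  assumes mono: "mono_on {0..} m" and cad: "cadlag (\<lambda>t. real (m t))"
    and unb: "\<And>n. \<exists>t\<ge>0. n \<le> m t"
  shows "(\<forall>t\<ge>0. d t = (\<Sum>n | 1 \<le> n \<and> arrival_time m n \<le> t.
              max (left_lim (controlled y d) (arrival_time m n) + jump y (arrival_time m n) - b) 0))
         \<longleftrightarrow> (\<forall>t\<ge>0. d t = barrier_dividends y m b t)"
    (is "?L \<longleftrightarrow> ?R")
proof -
  let ?T = "arrival_time m"
  let ?D = "dividends_upto y ?T b"
  let ?B = "barrier_dividends y m b"
  define a where "a e n = max (left_lim (controlled y e) (?T n) + jump y (?T n) - b) 0" for e n
  have T: "?T n \<le> t \<longleftrightarrow> n \<le> m t" if "t \<ge> 0" for n t
    using arrival_time_le_iff[OF mono cad unb that] .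
  have T_nonneg: "?T n \<ge> 0" for n
    unfolding arrival_time_def using unb[of n] by (intro cInf_greatest) auto
  have index: "{n. 1 \<le> n \<and> ?T n \<le> t} = {1..m t}" if "t \<ge> 0" for t
    by (simp add: T[OF that] set_eq_iff)
  have a_cong: "a d n = a e n" if "\<And>s. 0 \<le> s \<Longrightarrow> s < ?T n \<Longrightarrow> d s = e s" for d e n
  proof -
    have "left_lim (controlled y d) (?T n) = left_lim (controlled y e) (?T n)"
    proof (rule left_lim_cong)
      fix s assume "0 \<le> s" "s < ?T n"
      with that show "controlled y d s = controlled y e s" by (rule controlled_cong)
    qed
    then show ?thesis by (simp only: a_def)
  qed
  have D_sum: "?D k t = (\<Sum>n\<in>{1..k}. if ?T n \<le> t then a (?D (n - 1)) n else 0)" for k t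
    by (induction k) (simp_all add: a_def)
  have B_sum: "?B t = (\<Sum>n\<in>{1..m t}. a (?D (n - 1)) n)" if "t \<ge> 0" for t
  proof -
    have "(\<Sum>n\<in>{1..m t}. if ?T n \<le> t then a (?D (n - 1)) n else 0)
            = (\<Sum>n\<in>{1..m t}. a (?D (n - 1)) n)"
      by (intro sum.cong refl) (simp add: T[OF that])
    then show ?thesis by (simp only: barrier_dividends_def D_sum[of "m t" t])
  qed
  have B_eq: "?B s = ?D n s" if s: "0 \<le> s" "s < ?T (Suc n)" for s n
  proof -
    have "m s \<le> n" using T[OF s(1), of "Suc n"] s by auto
    then have "(\<Sum>i\<in>{1..n}. if ?T i \<le> s then a (?D (i - 1)) i else 0)
             = (\<Sum>i\<in>{1..m s}. a (?D (i - 1)) i)"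
      by (intro sum.mono_neutral_cong_right) (auto simp: T[OF s(1)])
    then show ?thesis by (simp only: B_sum[OF s(1)] D_sum[of n s])
  qed
  have L_iff: "?L \<longleftrightarrow> (\<forall>t\<ge>0. d t = (\<Sum>n\<in>{1..m t}. a d n))"
    unfolding a_def using index by (metis (no_types, lifting))
  show ?thesis unfolding L_iff
  proof
    assume eq: "\<forall>t\<ge>0. d t = ?B t"
    show "\<forall>t\<ge>0. d t = (\<Sum>n\<in>{1..m t}. a d n)"
    proof (intro allI impI)
      fix t :: real assume t: "t \<ge> 0"
      have "a (?D (n - 1)) n = a d n" if "n \<in> {1..m t}" for n
        using that eq B_eq[of _ "n - 1"] by (intro a_cong) auto
      then show "d t = (\<Sum>n\<in>{1..m t}. a d n)" using eq B_sum[OF t] t by simp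
    qed
  next
    assume L: "\<forall>t\<ge>0. d t = (\<Sum>n\<in>{1..m t}. a d n)"
    have *: "\<forall>t. 0 \<le> t \<and> m t \<le> k \<longrightarrow> d t = ?B t" for k
    proof (induction k)
      case 0
      then show ?case using L B_sum by auto
    next
      case (Suc k)
      have "d t = ?B t" if t: "0 \<le> t" "m t \<le> Suc k" for t
      proof -
        have "a d n = a (?D (n - 1)) n" if n: "n \<in> {1..m t}" for n
        proof (rule a_cong)
          fix s assume s: "0 \<le> s" "s < ?T n"
          then have "m s < n" using T[OF s(1), of n] by auto
          then have "m s \<le> k" using n t by auto
          then have "d s = ?B s" using Suc s by auto
          also have "\<dots> = ?D (n - 1) s" using B_eq[of s "n - 1"] s n by auto
          finally show "d s = ?D (n - 1) s" .
        qed
        then show ?thesis using L B_sum t by simp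
      qed
      then show ?case by auto
    qed
    show "\<forall>t\<ge>0. d t = ?B t" using * by blast
  qed
qed

end

(*
 No dividend can be paid between two arrivals of N, so the problem is a dynamic program whose stages
 end at independent exponential times. A stage started at surplus u depends only on the joint law of
 (X_T, I_T), where T is exponential with rate lam + gamma + r and I is the running maximum of -X: minimal
 injection leads to X_T + max(u, I_T) at cost phi * (max(u, I_T) - u). The Bellman operator is monotone,
 preserves concavity and the non-decreasing phi-Lipschitz functions, and its iterates increase from a
 constant subsolution, below an affine supersolution, to a concave fixed point V. By concavity the best
 payment brings the surplus down to the smallest b maximising V(u) - u. First passage and memorylessness
 of T factorise the law of (X_T, I_T) and exclude the atoms that would spoil the differentiability of
 stage values; the slope of V at 0 exceeds 1 and b is b_Psi. The strong Markov property at the arrivals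
 and an exponential envelope of the paths show that V dominates every strategy, with equality for the
 double barrier. The model holds only up to null sets, so all paths are first made regular.
*)
theory Submission
 imports Defs
begin

text \<open>Discounting at rate r is killing at an independent exponential time: a discounted
  Stieltjes integral of a path is the mean of that path at such a time. Payments, terminal payoff
  and arrivals are thus all read off at exponential times, and memorylessness replaces stochastic
  calculus. The Lipschitz constant is \<phi> because a unit of surplus can at best save a unit of
  injection; this also makes minimal injection optimal. The slope of V at 0 exceeds 1 because -X
  becomes positive at once, so that a small reserve saves injections of nearly its own size. The
  payoff may have countably many kinks; they are smoothed by a law without atoms: the tail of I_T is
  multiplicative, and an atom of X_T at y would create atoms at y + x for all small x. The value of
  a barrier b' < b is a fixed point v of another equation. In the equation for V - v slopes contract
  by the factor gamma / (lam + gamma + r), while V has slope above 1 left of b; hence v has slope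
  above 1 at b'. This makes b equal to b_Psi without an explicit formula for v.\<close>

abbreviation Bor :: "'b measure => ('b => 'c::topological_space) set" where "Bor == borel_measurable"

notation iff (infixr "<->" 25) and LIMSEQ ("((_)/ ----> (_))" [60, 60] 60) and tendsto (infixr "--->" 55)

abbreviation borel2 :: "(real \<times> real) measure" where "borel2 == borel \<Otimes>\<^sub>M borel"

section \<open>Barrier and impulse operators\<close>

definition tame :: "real => (real => real) => bool" where
 "tame L v <-> (ALL x y. 0 <= x & x <= y --> 0 <= v y - v x & v y - v x <= L * (y - x))"

definition barrier_op :: "real => (real => real) => real => real" where
 "barrier_op b v u = v (min u b) + max 0 (u - b)"

definition impulse_op :: "(real => real) => real => real" where
 "impulse_op v u = (SUP y\<in>{0..u}. v y - y) + u"

text \<open>With \<open>p\<close> the pair of an increment and the running maximum of its negative,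
  this is the surplus at the end of a stage begun at \<open>x\<close> under minimal injection. The
  outer \<open>max 0\<close> is inactive where \<open>0 <= fst p + snd p\<close>; it keeps every
  value in the domain on which tame functions are controlled.\<close>

definition reflected :: "real => real \<times> real => real" where
 "reflected x p = max 0 (fst p + max x (snd p))"

lemma tameD:
 assumes "tame L v" "0 <= x" "x <= y"
 shows "v x <= v y" "v y <= v x + L * (y - x)" using assms unfolding tame_def by (smt (verit))+

lemma tameI:
 assumes "!!x y. 0 <= x ==> x <= y ==> v x <= v y"
  "!!x y. 0 <= x ==> x <= y ==> v y <= v x + L * (y - x)"
 shows "tame L v" using assms unfolding tame_def by (auto simp: algebra_simps)

lemma tame_lipschitz:
 assumes "tame L v" "0 <= x" "0 <= y"
 shows "abs (v x - v y) <= L * abs (x - y)" using tameD[OF assms(1), of x y] tameD[OF assms(1), of y x] assms by (cases "x <= y") auto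

lemma tame_const_nonneg: "tame L v ==> 0 <= L" using tameD[of L v 0 1] by simp

lemma tame_continuous:
 assumes "tame L v" shows "continuous_on UNIV (%u. v (max 0 u))"
proof (rule lipschitz_on_continuous_on)
 show "L-lipschitz_on UNIV (%u. v (max 0 u))"
 proof (rule lipschitz_onI)
  fix x y :: real
  have "abs (v (max 0 x) - v (max 0 y)) <= L * abs (max 0 x - max 0 y)" by (rule tame_lipschitz[OF assms]) auto
  also have "... <= L * abs (x - y)" by (rule mult_left_mono) (auto simp: tame_const_nonneg[OF assms])
  finally show "dist (v (max 0 x)) (v (max 0 y)) <= L * dist x y" by (simp add: dist_real_def)
 qed (rule tame_const_nonneg[OF assms])
qed

lemma tame_measurable [measurable (raw)]:
 assumes "tame L v" "f \<in> Bor M"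
 shows "(%w. v (max 0 (f w))) \<in> Bor M" using measurable_compose[OF assms(2) borel_measurable_continuous_onI[OF tame_continuous[OF assms(1)]]] by simp

lemma tame_continuous_on: "tame L v ==> continuous_on {0..} v" using continuous_on_subset[OF tame_continuous, of L v "{0..}"] by (rule continuous_on_eq) auto

lemma reflected_nonneg [simp]: "0 <= reflected x p" by (simp add: reflected_def)

lemma reflected_mono: "x <= y ==> reflected x p <= reflected y p" by (auto simp: reflected_def)

lemma reflected_diff:
 "x <= y ==> reflected y p - reflected x p <= max y (snd p) - max x (snd p)" by (auto simp: reflected_def)

text \<open>The surplus splits into \<open>min u b\<close> and the excess over \<open>b\<close>. The
  first part enters with slope at most \<open>L\<close>, the second with slope 1, which
  \<open>1 <= L\<close> absorbs.\<close>

lemma tame_barrier_op: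
 assumes "tame L v" "1 <= L" "b >= 0"
 shows "tame L (barrier_op b v)"
proof (rule tameI)
 fix x y :: real assume xy: "0 <= x" "x <= y"
 have le: "min x b <= min y b" "0 <= min x b" using xy assms by auto
 show "barrier_op b v x <= barrier_op b v y" using tameD(1)[OF assms(1) le(2,1)] xy by (auto simp: barrier_op_def)
 have "barrier_op b v y <= v (min x b) + L * (min y b - min x b) + max 0 (y - b)" using tameD(2)[OF assms(1) le(2,1)] by (auto simp: barrier_op_def)
 also have "max 0 (y - b) <= max 0 (x - b) + L * (max 0 (y - b) - max 0 (x - b))"
 proof -
  have "0 <= max 0 (y - b) - max 0 (x - b)" using xy by auto
  from mult_right_mono[OF assms(2) this] show ?thesis unfolding mult_1_left by (simp only: diff_le_eq add.commute)
 qed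
 also have "v (min x b) + L * (min y b - min x b) + ...
   = v (min x b) + max 0 (x - b) + L * ((min y b + max 0 (y - b)) - (min x b + max 0 (x - b)))" by (simp add: algebra_simps)
 also have "(min y b + max 0 (y - b)) - (min x b + max 0 (x - b)) = y - x" by auto
 finally show "barrier_op b v y <= barrier_op b v x + L * (y - x)" by (simp add: barrier_op_def)
qed

lemma impulse_bdd:
 assumes "tame L v"
 shows "bdd_above ((%y. v y - y) ` {0..u})" using tameD(1)[OF assms] by (intro bdd_aboveI[of _ "v u"]) fastforce

lemma impulse_ge:
 assumes "tame L v" "0 <= y" "y <= u"
 shows "v y + (u - y) <= impulse_op v u" using cSUP_upper[OF _ impulse_bdd[OF assms(1)], of y u] assms by (simp add: impulse_op_def)

lemma impulse_le:
 assumes "u >= 0" "!!y. 0 <= y ==> y <= u ==> v y + (u - y) <= K"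
 shows "impulse_op v u <= K"
proof -
 have "(SUP y\<in>{0..u}. v y - y) <= K - u" using assms by (intro cSUP_least) (auto simp: algebra_simps)
 thus ?thesis by (simp add: impulse_op_def)
qed

lemma tame_impulse_op:
 assumes v: "tame L v" and L: "1 <= L"
 shows "tame L (impulse_op v)"
proof (rule tameI)
 fix x y :: real assume xy: "0 <= x" "x <= y"
 show "impulse_op v x <= impulse_op v y"
 proof (rule impulse_le[OF xy(1)])
  fix z assume z: "0 <= z" "z <= x"
  show "v z + (x - z) <= impulse_op v y" using impulse_ge[OF v z(1), of y] z xy by linarith
 qed
 have Lxy: "y - x <= L * (y - x)" using mult_right_mono[OF L, of "y - x"] xy by simp
 show "impulse_op v y <= impulse_op v x + L * (y - x)"
 proof (rule impulse_le)
  fix z assume z: "0 <= z" "z <= y"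
  show "v z + (y - z) <= impulse_op v x + L * (y - x)"
  proof (cases "z <= x")
   case True thus ?thesis using impulse_ge[OF v z(1) True] Lxy by linarith
  next
   case False
   hence "v z <= v x + L * (z - x)" using tameD(2)[OF v xy(1), of z] by simp
   moreover have "v x <= impulse_op v x" using impulse_ge[OF v xy(1), of x] by simp
   moreover have "y - z <= L * (y - z)" using mult_right_mono[OF L, of "y - z"] z by simp
   ultimately show ?thesis by (simp add: algebra_simps)
  qed
 qed (use xy in simp)
qed

text \<open>Target and surplus \<open>(y, u)\<close> range over the convex set
  \<open>0 <= y <= u\<close>, where \<open>v y + (u - y)\<close> is jointly concave; a partial
  supremum of such a function is concave.\<close>

lemma concave_impulse_op:
 assumes v: "tame L v" and cc: "concave_on {0..} v"
 shows "concave_on {0..} (impulse_op v)" unfolding concave_on_iff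
proof (intro conjI ballI allI impI)
 fix x y a b :: real assume *: "x \<in> {0..}" "y \<in> {0..}" "0 <= a" "0 <= b" "a + b = 1"
 have key: "a * (v s + (x - s)) + b * (v t + (y - t)) <= impulse_op v (a *\<^sub>R x + b *\<^sub>R y)"
  if "0 <= s" "s <= x" "0 <= t" "t <= y" for s t
 proof -
  have "a * v s + b * v t <= v (a * s + b * t)" using cc that * unfolding concave_on_iff by force
  moreover have "a * s + b * t <= a * x + b * y" using that * by (intro add_mono mult_left_mono) auto
  moreover have "0 <= a * s + b * t" using that * by auto
  ultimately show ?thesis using impulse_ge[OF v, of "a * s + b * t" "a * x + b * y"] by (simp add: algebra_simps)
 qed
 show "a * impulse_op v x + b * impulse_op v y <= impulse_op v (a *\<^sub>R x + b *\<^sub>R y)" (is "_ <= ?R")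
 proof -
  \<comment> \<open>The two suprema are taken one after the other. Each divides by a weight, so a
    zero weight is a separate case.\<close>
  have 1: "b * impulse_op v y <= ?R - a * (v s + (x - s))" if s: "0 <= s" "s <= x" for s
  proof (cases "b = 0")
   case True thus ?thesis using key[OF s, of 0] * by simp
  next
   case False
   hence b: "b > 0" using * by simp
   have "impulse_op v y <= (?R - a * (v s + (x - s))) / b" using key[OF s] * b by (intro impulse_le) (auto simp: field_simps)
   thus ?thesis using b by (simp add: field_simps)
  qed
  show ?thesis
  proof (cases "a = 0")
   case True thus ?thesis using 1[of 0] * by simp
  next
   case False
   hence a: "a > 0" using * by simp
   have "impulse_op v x <= (?R - b * impulse_op v y) / a" using 1 * a by (intro impulse_le) (auto simp: field_simps)
   thus ?thesis using a by (simp add: field_simps)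
  qed
 qed
qed simp

lemma concave_slopes:
 fixes f :: "real => real"
 assumes cc: "concave_on {0..} f" and xy: "0 <= x" "x < y" "y < z"
 shows "(f z - f y) / (z - y) <= (f z - f x) / (z - x)"
  and "(f z - f x) / (z - x) <= (f y - f x) / (y - x)"
  and "(f z - f y) / (z - y) <= (f y - f x) / (y - x)"
proof -
 define a where "a = (y - x) / (z - x)"
 have a: "0 <= a" "a <= 1" "1 - a = (z - y) / (z - x)" using xy by (auto simp: a_def field_simps)
 have "((z - y) / (z - x)) * f x + ((y - x) / (z - x)) * f z
   <= f (((z - y) / (z - x)) *\<^sub>R x + ((y - x) / (z - x)) *\<^sub>R z)" using concave_onD[OF cc a(1,2), of x z] xy unfolding a(3) by (simp add: a_def)
 also have "((z - y) / (z - x)) *\<^sub>R x + ((y - x) / (z - x)) *\<^sub>R z = y"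
 proof -
  have "(z - y) * x + (y - x) * z = y * (z - x)" by (simp add: algebra_simps)
  hence "((z - y) * x + (y - x) * z) / (z - x) = y" using xy by simp
  thus ?thesis by (simp add: add_divide_distrib)
 qed
 finally have "((z - y) * f x + (y - x) * f z) / (z - x) <= f y" by (simp add: add_divide_distrib)
 hence "(z - y) * f x + (y - x) * f z <= f y * (z - x)" using xy by (simp add: pos_divide_le_eq)
 thus "(f z - f y) / (z - y) <= (f z - f x) / (z - x)"
  "(f z - f x) / (z - x) <= (f y - f x) / (y - x)"
  "(f z - f y) / (z - y) <= (f y - f x) / (y - x)" using xy by (simp_all add: divide_le_eq le_divide_eq mult.commute) (simp_all add: field_simps)
qed

lemma concave_slope_antimono:
 fixes f :: "real => real"
 assumes cc: "concave_on {0..} f" and "0 <= x" "x < y" "y <= z" "z < w"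
 shows "(f w - f z) / (w - z) <= (f y - f x) / (y - x)"
proof (cases "y = z")
 case True thus ?thesis using concave_slopes(3)[OF cc] assms by auto
next
 case False
 hence "y < z" using assms by simp
 thus ?thesis using concave_slopes(3)[OF cc, of x y z] concave_slopes(3)[OF cc, of y z w] assms by linarith
qed

lemma concave_on_limit:
 fixes f :: "nat => real => real"
 assumes "!!n. concave_on S (f n)" "!!x. x \<in> S ==> (%n. f n x) ----> g x"
 shows "concave_on S g"
proof -
 have S: "convex S" using assms(1)[of 0] by (simp add: concave_on_iff)
 show ?thesis unfolding concave_on_iff
 proof (intro conjI ballI allI impI)
  fix x y a b assume *: "x \<in> S" "y \<in> S" "0 <= a" "0 <= (b::real)" "a + b = 1"
  have m: "a *\<^sub>R x + b *\<^sub>R y \<in> S" using S * by (simp add: convex_def)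
  show "a * g x + b * g y <= g (a *\<^sub>R x + b *\<^sub>R y)"
  proof (rule LIMSEQ_le)
   show "(%n. a * f n x + b * f n y) ----> a * g x + b * g y" by (intro tendsto_intros assms *)
   show "(%n. f n (a *\<^sub>R x + b *\<^sub>R y)) ----> g (a *\<^sub>R x + b *\<^sub>R y)" by (intro assms m)
   show "EX N. ALL n>=N. a * f n x + b * f n y <= f n (a *\<^sub>R x + b *\<^sub>R y)" using assms(1) * unfolding concave_on_iff by blast
  qed
 qed fact
qed

section \<open>The one-stage problem\<close>

text \<open>\<open>\<mu>\<close> stands for the joint law of the increment and of the running
  maximum of its negative at the end of a stage. In \<open>payoff_growth\<close> the slope exceeds 1
  by \<open>r / (2 * lam)\<close> so that, weighted by \<open>lam\<close>, it becomes
  \<open>lam + r / 2\<close>, still below \<open>lam + r\<close>: this gap yields an affine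
  supersolution of slope below 1.\<close>

locale stage_problem = prob_space \<mu> for \<mu> :: "(real \<times> real) measure" +
 fixes lam \<gamma> r \<phi> :: real and \<Psi> :: "real => real"
 assumes sets_mu [measurable_cong]: "sets \<mu> = sets borel2"
  and integrable_fst: "integrable \<mu> fst" and integrable_snd: "integrable \<mu> snd"
  and above_infimum: "AE p in \<mu>. 0 <= fst p + snd p"
  and snd_positive: "AE p in \<mu>. 0 < snd p"
  and no_atom_fst: "!!x. AE p in \<mu>. fst p ~= x"
  and no_atom_snd: "!!x. 0 < x ==> AE p in \<mu>. snd p ~= x"
  and lam_pos: "0 < lam" and gamma_pos: "0 < \<gamma>" and r_pos: "0 < r" and phi_gt_1: "1 < \<phi>"
  and payoff_nonneg: "!!u. 0 <= u ==> 0 <= \<Psi> u"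
  and payoff_tame: "tame \<phi> \<Psi>"
  and payoff_concave: "concave_on {0..} \<Psi>"
  and payoff_growth: "EX C. ALL u>=0. \<Psi> u <= (1 + r / (2 * lam)) * u + C"
begin

definition rate where "rate = lam + \<gamma> + r"

text \<open>A stage ends at rate \<open>rate\<close>: with probability \<open>lam / rate\<close> by
  \<tau>, with \<open>\<gamma> / rate\<close> by an arrival, and with \<open>r / rate\<close> by
  discounting read as killing, which pays nothing. For the same reason the injections up to that
  time are charged in full, without a discount factor.\<close>

definition gain :: "(real => real) => real => real \<times> real => real" where
 "gain W x p = (lam * \<Psi> (reflected x p) + \<gamma> * W (reflected x p)) / rate - \<phi> * (max x (snd p) - x)"

definition stage :: "(real => real) => real => real" where
 "stage W x = (LINT p|\<mu>. gain W x p)"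

lemma rate_pos: "0 < rate" using lam_pos gamma_pos r_pos by (simp add: rate_def)

lemma gain_measurable [measurable]:
 assumes "tame L W" shows "gain W x \<in> Bor \<mu>"
proof -
 note [measurable] = tame_measurable[OF assms] tame_measurable[OF payoff_tame]
 show ?thesis unfolding gain_def reflected_def by measurable
qed

lemma reflected_le: "reflected x p <= abs x + abs (fst p) + abs (snd p)" by (auto simp: reflected_def)

lemma gain_integrable:
 assumes "tame L W" shows "integrable \<mu> (gain W x)"
proof (rule Bochner_Integration.integrable_bound)
 let ?B = "%p. (lam * (abs (\<Psi> 0) + \<phi> * (abs x + abs (fst p) + abs (snd p))) + \<gamma> * (abs (W 0) + L * (abs x + abs (fst p) + abs (snd p)))) / rate
  + \<phi> * (abs (snd p) + abs x)"
 show "integrable \<mu> ?B" using integrable_fst integrable_snd by simp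
 show "gain W x \<in> Bor \<mu>" using assms by measurable
 show "AE p in \<mu>. norm (gain W x p) <= norm (?B p)"
 proof (rule AE_I2)
  fix p
  have *: "abs (v (reflected x p)) <= abs (v 0) + L * (abs x + abs (fst p) + abs (snd p))" if "tame L v" for L v
  proof -
   have "abs (v (reflected x p) - v 0) <= L * abs (reflected x p - 0)" using that by (rule tame_lipschitz) auto
   also have "... <= L * (abs x + abs (fst p) + abs (snd p))" using reflected_le[of x p] tame_const_nonneg[OF that] by (intro mult_left_mono) auto
   finally show ?thesis by linarith
  qed
  have "abs (gain W x p) <= (lam * abs (\<Psi> (reflected x p)) + \<gamma> * abs (W (reflected x p))) / rate + \<phi> * abs (max x (snd p) - x)"
   unfolding gain_def using lam_pos gamma_pos rate_pos phi_gt_1 by (auto simp: abs_mult intro!: order_trans[OF abs_triangle_ineq4] add_mono divide_right_mono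
      order_trans[OF abs_triangle_ineq])
  also have "... <= ?B p"
  proof (intro add_mono divide_right_mono mult_left_mono *)
   show "abs (max x (snd p) - x) <= abs (snd p) + abs x" by (auto simp: max_def)
  qed (use payoff_tame assms lam_pos gamma_pos rate_pos phi_gt_1 in auto)
  finally show "norm (gain W x p) <= norm (?B p)" unfolding real_norm_def by linarith
 qed
qed

text \<open>Of an extra endowment \<open>y - x\<close>, the part \<open>?e\<close> raises the
  reflected level by at most that much, and the remainder saves injections at price \<phi>. Both are
  worth at most \<phi> per unit, since \<open>\<Psi>\<close> and \<open>W\<close> have slopes at
  most \<phi> and \<open>(lam + \<gamma>) / rate < 1\<close>.\<close>

lemma gain_incr:
 assumes W: "tame \<phi> W" and xy: "x <= y"
 shows "gain W x p <= gain W y p" "gain W y p <= gain W x p + \<phi> * (y - x)"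
proof -
 let ?d = "reflected y p - reflected x p" and ?e = "max y (snd p) - max x (snd p)"
 have de: "0 <= ?d" "?d <= ?e" "?e <= y - x" using reflected_mono[OF xy, of p] reflected_diff[OF xy, of p] xy by auto
 have P: "0 <= \<Psi> (reflected y p) - \<Psi> (reflected x p)" "\<Psi> (reflected y p) - \<Psi> (reflected x p) <= \<phi> * ?d"
  using tameD[OF payoff_tame, of "reflected x p" "reflected y p"] reflected_mono[OF xy] by auto
 have Q: "0 <= W (reflected y p) - W (reflected x p)" "W (reflected y p) - W (reflected x p) <= \<phi> * ?d" using tameD[OF W, of "reflected x p" "reflected y p"] reflected_mono[OF xy] by auto
 define a where "a = \<Psi> (reflected y p) - \<Psi> (reflected x p)"
 define b where "b = W (reflected y p) - W (reflected x p)"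
 have diff: "gain W y p - gain W x p = (lam * a + \<gamma> * b) / rate + \<phi> * ((y - x) - ?e)" using rate_pos unfolding gain_def a_def b_def by (simp add: field_simps)
 have lo: "0 <= (lam * a + \<gamma> * b) / rate" using P Q lam_pos gamma_pos rate_pos unfolding a_def b_def by (intro divide_nonneg_pos add_nonneg_nonneg) auto
 have "0 <= \<phi> * ((y - x) - ?e)" using de phi_gt_1 by simp
 with lo diff show "gain W x p <= gain W y p" by linarith
 have "lam * a + \<gamma> * b <= lam * (\<phi> * ?d) + \<gamma> * (\<phi> * ?d)" using P Q lam_pos gamma_pos unfolding a_def b_def by (intro add_mono mult_left_mono) auto
 also have "... = (lam + \<gamma>) * (\<phi> * ?d)" by (simp add: algebra_simps)
 also have "... <= rate * (\<phi> * ?d)" using r_pos de phi_gt_1 unfolding rate_def by (intro mult_right_mono) auto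
 finally have "(lam * a + \<gamma> * b) / rate <= \<phi> * ?d" using rate_pos by (simp add: divide_le_eq mult.commute)
 moreover have "\<phi> * ?d <= \<phi> * ?e" using de phi_gt_1 by (intro mult_left_mono) auto
 ultimately show "gain W y p <= gain W x p + \<phi> * (y - x)" using diff by (simp add: algebra_simps)
qed

lemma stage_tame:
 assumes W: "tame \<phi> W" shows "tame \<phi> (stage W)"
proof (rule tameI)
 fix x y :: real assume xy: "0 <= x" "x <= y"
 note int = gain_integrable[OF W]
 show "stage W x <= stage W y" unfolding stage_def by (intro integral_mono int gain_incr W xy(2))
 have "stage W y <= (LINT p|\<mu>. gain W x p + \<phi> * (y - x))" unfolding stage_def by (intro integral_mono int gain_incr W xy(2) Bochner_Integration.integrable_add) simp
 also have "... = stage W x + \<phi> * (y - x)" unfolding stage_def using int by (simp add: prob_space)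
 finally show "stage W y <= stage W x + \<phi> * (y - x)" .
qed

lemma stage_mono:
 assumes W: "tame L W" "tame L' W'" and le: "!!u. 0 <= u ==> W u <= W' u"
 shows "stage W x <= stage W' x" unfolding stage_def
proof (rule integral_mono[OF gain_integrable[OF W(1)] gain_integrable[OF W(2)]])
 fix p show "gain W x p <= gain W' x p" unfolding gain_def using le[of "reflected x p"] gamma_pos rate_pos by (intro diff_right_mono divide_right_mono add_left_mono mult_left_mono) auto
qed

lemma stage_diff:
 assumes W: "tame L W" and W': "tame L' W'"
 shows "stage W x - stage W' x = \<gamma> / rate * (LINT p|\<mu>. W (reflected x p) - W' (reflected x p))"
proof -
 have "stage W x - stage W' x = (LINT p|\<mu>. gain W x p - gain W' x p)" unfolding stage_def by (rule Bochner_Integration.integral_diff[symmetric, OF gain_integrable[OF W] gain_integrable[OF W']])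
 also have "... = (LINT p|\<mu>. \<gamma> / rate * (W (reflected x p) - W' (reflected x p)))" using rate_pos by (intro Bochner_Integration.integral_cong refl) (simp add: gain_def field_simps)
 finally show ?thesis by simp
qed

lemma tame_reflected_integrable:
 assumes W: "tame L W"
 shows "integrable \<mu> (%p. W (reflected x p))"
proof (rule Bochner_Integration.integrable_bound)
 show "integrable \<mu> (%p. abs (W 0) + L * (abs x + abs (fst p) + abs (snd p)))" using integrable_fst integrable_snd by simp
 note [measurable] = tame_measurable[OF W]
 show "(%p. W (reflected x p)) \<in> Bor \<mu>" unfolding reflected_def by measurable
 show "AE p in \<mu>. norm (W (reflected x p)) <= norm (abs (W 0) + L * (abs x + abs (fst p) + abs (snd p)))"
 proof (rule AE_I2)
  fix p
  have "abs (W (reflected x p) - W 0) <= L * abs (reflected x p - 0)" using W by (rule tame_lipschitz) auto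
  also have "... <= L * (abs x + abs (fst p) + abs (snd p))" using reflected_le[of x p] tame_const_nonneg[OF W] by (intro mult_left_mono) auto
  finally show "norm (W (reflected x p)) <= norm (abs (W 0) + L * (abs x + abs (fst p) + abs (snd p)))" by simp
 qed
qed

text \<open>Since \<open>max _ i\<close> is convex, mixing the starting points takes less injection
  than mixing the outcomes; the saving is \<open>e\<close>. The lower end level loses at most
  \<open>\<phi> * e\<close> by the Lipschitz bound, scaled by a factor at most 1, while the saving
  is worth exactly \<open>\<phi> * e\<close>. The rest is concavity of \<open>\<Psi>\<close> and
  \<open>W\<close> in the level.\<close>

lemma stage_concave:
 assumes W: "tame \<phi> W" "concave_on {0..} W"
 shows "concave_on {0..} (stage W)" unfolding concave_on_iff
proof (intro conjI ballI allI impI)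
 fix x y a b :: real assume *: "x \<in> {0..}" "y \<in> {0..}" "0 <= a" "0 <= b" "a + b = 1"
 let ?z = "a *\<^sub>R x + b *\<^sub>R y"
 have z: "0 <= ?z" using * by auto
 have "a * stage W x + b * stage W y = (LINT p|\<mu>. a * gain W x p + b * gain W y p)" unfolding stage_def using gain_integrable[OF W(1)] * by simp
 also have "... <= stage W ?z" unfolding stage_def
 proof (rule integral_mono_AE)
  show "AE p in \<mu>. a * gain W x p + b * gain W y p <= gain W ?z p" using above_infimum
  proof eventually_elim
   case (elim p)
   define A i where "A = fst p" and "i = snd p"
   have refl: "reflected t p = A + max t i" for t using elim by (auto simp: reflected_def A_def i_def)
   let ?m = "a * max x i + b * max y i"
   have m: "max ?z i <= ?m"
   proof -
    have "a * i + b * i <= ?m" using * by (intro add_mono mult_left_mono) auto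
    hence "i <= ?m" using *(5) by (simp add: distrib_right[symmetric])
    moreover have "?z <= ?m" using * by (auto intro!: add_mono mult_left_mono)
    ultimately show ?thesis by simp
   qed
   have Am: "A + ?m = a * (A + max x i) + b * (A + max y i)"
   proof -
    have "A = a * A + b * A" using *(5) by (simp flip: distrib_right)
    thus ?thesis by (simp add: distrib_left)
   qed
   have nn: "0 <= A + max ?z i" "0 <= A + max x i" "0 <= A + max y i" using elim by (auto simp: A_def i_def)
   have cc: "a * f (A + max x i) + b * f (A + max y i) <= f (A + max ?z i) + \<phi> * (?m - max ?z i)"
    if f: "concave_on {0..} f" "tame \<phi> f" for f
   proof -
    have "a * f (A + max x i) + b * f (A + max y i) <= f (a *\<^sub>R (A + max x i) + b *\<^sub>R (A + max y i))" using f(1) nn * unfolding concave_on_iff by blast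
    also have "... = f (A + ?m)" unfolding Am by simp
    also have "... <= f (A + max ?z i) + \<phi> * ((A + ?m) - (A + max ?z i))" using m nn by (intro tameD[OF f(2)]) auto
    finally show ?thesis by simp
   qed
   define P where "P = a * \<Psi> (A + max x i) + b * \<Psi> (A + max y i)"
   define Q where "Q = a * W (A + max x i) + b * W (A + max y i)"
   define e where "e = ?m - max ?z i"
   have e: "0 <= e" using m by (simp add: e_def)
   have "a * gain W x p + b * gain W y p = (lam * P + \<gamma> * Q) / rate - \<phi> * (?m - ?z)" using rate_pos unfolding gain_def refl P_def Q_def i_def[symmetric] by (simp add: field_simps)
   also have "... <= (lam * (\<Psi> (A + max ?z i) + \<phi> * e) + \<gamma> * (W (A + max ?z i) + \<phi> * e)) / rate - \<phi> * (?m - ?z)"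
   proof -
    have "P <= \<Psi> (A + max ?z i) + \<phi> * e" "Q <= W (A + max ?z i) + \<phi> * e" using cc[OF payoff_concave payoff_tame] cc[OF W(2,1)] unfolding P_def Q_def e_def by auto
    thus ?thesis using lam_pos gamma_pos rate_pos by (intro diff_right_mono divide_right_mono add_mono[OF mult_left_mono mult_left_mono]) auto
   qed
   also have "... = gain W ?z p + (lam + \<gamma>) / rate * (\<phi> * e) - \<phi> * e" using rate_pos unfolding gain_def refl i_def[symmetric] e_def by (simp add: field_simps)
   also have "(lam + \<gamma>) / rate * (\<phi> * e) <= 1 * (\<phi> * e)" using rate_pos r_pos phi_gt_1 e by (intro mult_right_mono) (auto simp: rate_def)
   finally show ?case by simp
  qed
 qed (use gain_integrable[OF W(1)] * z in auto)
 finally show "a * stage W x + b * stage W y <= stage W ?z" .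
qed simp

lemma stage_limit:
 assumes Wn: "!!n. tame \<phi> (Wn n)" and lim: "!!u. 0 <= u ==> (%n. Wn n u) ----> W u"
  and W: "tame \<phi> W" and le: "!!n u. 0 <= u ==> Wn n u <= W u" and ge: "!!n u. 0 <= u ==> Wn 0 u <= Wn n u"
 shows "(%n. stage (Wn n) x) ----> stage W x" unfolding stage_def
proof (rule integral_dominated_convergence)
 show "integrable \<mu> (%p. abs (gain (Wn 0) x p) + abs (gain W x p))" by (intro Bochner_Integration.integrable_add integrable_abs gain_integrable[OF Wn] gain_integrable[OF W])
 show "gain W x \<in> Bor \<mu>" "!!n. gain (Wn n) x \<in> Bor \<mu>" using Wn W by (auto intro: gain_measurable)
 show "AE p in \<mu>. (%n. gain (Wn n) x p) ----> gain W x p" unfolding gain_def using rate_pos by (intro AE_I2 tendsto_intros lim) auto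
 show "AE p in \<mu>. norm (gain (Wn n) x p) <= abs (gain (Wn 0) x p) + abs (gain W x p)" for n
 proof (rule AE_I2)
  fix p
  have mono: "gain V x p <= gain V' x p" if "V (reflected x p) <= V' (reflected x p)" for V V' unfolding gain_def using that gamma_pos rate_pos
   by (intro diff_right_mono divide_right_mono add_left_mono mult_left_mono) auto
  have "gain (Wn 0) x p <= gain (Wn n) x p" "gain (Wn n) x p <= gain W x p" by (intro mono ge le; simp)+
  thus "norm (gain (Wn n) x p) <= abs (gain (Wn 0) x p) + abs (gain W x p)" by auto
 qed
qed

end

text \<open>Approximation from below lets the supremum pass to the limit: a payment nearly optimal
  for \<open>v\<close> becomes nearly optimal for \<open>vn n\<close>.\<close>

lemma impulse_op_limit:
 assumes vn: "!!n. tame L (vn n)" and v: "tame L v"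
  and le: "!!n u. 0 <= u ==> vn n u <= v u" and lim: "!!u. 0 <= u ==> (%n. vn n u) ----> v u"
  and u: "0 <= u"
 shows "(%n. impulse_op (vn n) u) ----> impulse_op v u"
proof (rule increasing_tendsto)
 show "\<forall>\<^sub>F n in sequentially. impulse_op (vn n) u <= impulse_op v u"
 proof (intro always_eventually allI impulse_le[OF u])
  fix n y assume y: "0 <= y" "y <= u"
  show "vn n y + (u - y) <= impulse_op v u" using le[OF y(1), of n] impulse_ge[OF v y] by linarith
 qed
 fix x assume x: "x < impulse_op v u"
 obtain y where y: "0 <= y" "y <= u" "x < v y + (u - y)" using impulse_le[OF u, of v x] x by (meson linorder_not_less)
 have "(%n. vn n y + (u - y)) ----> v y + (u - y)" by (intro tendsto_intros lim y)
 hence "\<forall>\<^sub>F n in sequentially. x < vn n y + (u - y)" using y(3) by (rule order_tendstoD)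
 thus "\<forall>\<^sub>F n in sequentially. x < impulse_op (vn n) u" by eventually_elim (rule less_le_trans[OF _ impulse_ge[OF vn y(1,2)]])
qed

text \<open>\<open>R\<close> is the right derivative, written as a supremum of forward slopes so
  that no limit has to be shown to exist. It is monotone, hence continuous off a countable set, and
  where it is continuous the slopes are squeezed between \<open>R (u + h)\<close> and
  \<open>R u\<close>.\<close>

lemma countable_kinks:
 fixes f :: "real => real"
 assumes f: "tame L f" and cc: "concave_on {0..} f"
 shows "countable {u. 0 < u & ~ (EX d. (f has_real_derivative d) (at u))}"
proof -
 define sl where "sl u h = (f (u + h) - f u) / h" for u h
 define R where "R u = (SUP h\<in>{0<..}. sl u h)" for u
 have sl_le: "sl u h <= L" if "0 <= u" "0 < h" for u h using tameD(2)[OF f, of u "u + h"] that by (simp add: sl_def divide_le_eq)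
 have bdd: "bdd_above (sl u ` {0<..})" if "0 <= u" for u using sl_le[OF that] by (intro bdd_aboveI[of _ L]) auto
 have upper: "sl u h <= R u" if "0 <= u" "0 < h" for u h unfolding R_def using that by (intro cSUP_upper bdd) auto
 have lower: "R (u + h) <= sl u h" if "0 <= u" "0 < h" for u h unfolding R_def
 proof (rule cSUP_least)
  fix k :: real assume "k \<in> {0<..}"
  thus "sl (u + h) k <= sl u h" using concave_slope_antimono[OF cc, of u "u + h" "u + h" "u + h + k"] that by (simp add: sl_def)
 qed (auto intro: exI[of _ 1])
 have mono: "mono_on {0<..} (%u. - R u)"
 proof (rule mono_onI)
  fix u w :: real assume *: "u \<in> {0<..}" "w \<in> {0<..}" "u <= w"
  show "- R u <= - R w"
  proof (cases "u = w")
   case False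
   thus ?thesis using lower[of u "w - u"] upper[of u "w - u"] * by auto
  qed simp
 qed
 have deriv: "(f has_real_derivative R u) (at u)" if u: "0 < u" and cont: "isCont R u" for u
 proof -
  have "(%h. sl u h - R u) \<midarrow>0\<rightarrow> 0"
  proof (rule Lim_null_comparison)
   have "(%h. R (u + h)) \<midarrow>0\<rightarrow> R u" using cont by (simp add: isCont_iff)
   hence "(%h. abs (R (u + h) - R u)) \<midarrow>0\<rightarrow> (abs (R u - R u))" by (intro tendsto_intros)
   thus "(%h. abs (R (u + h) - R u)) \<midarrow>0\<rightarrow> 0" by simp
   show "\<forall>\<^sub>F h in at 0. norm (sl u h - R u) <= abs (R (u + h) - R u)" unfolding eventually_at
   proof (intro exI[of _ u] conjI ballI impI u)
    fix h :: real assume h: "h ~= 0 & dist h 0 < u"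
    show "norm (sl u h - R u) <= abs (R (u + h) - R u)"
    proof (cases "h > 0")
     case True
     thus ?thesis using upper[of u h] lower[of u h] u by auto
    next
     case False
     hence h: "h < 0" "0 < u + h" using h by (auto simp: dist_real_def)
     \<comment> \<open>A backward slope at \<open>u\<close> is a forward slope at
       \<open>u + h\<close>, so the same squeeze applies.\<close>
     have "sl u h = sl (u + h) (- h)" using h(1) by (simp add: sl_def field_simps)
     thus ?thesis using upper[of "u + h" "- h"] lower[of "u + h" "- h"] h by auto
    qed
   qed
  qed
  hence "(%h. sl u h) \<midarrow>0\<rightarrow> R u" by (rule LIM_zero_cancel)
  thus ?thesis unfolding DERIV_def sl_def .
 qed
 have "{u. 0 < u & ~ (EX d. (f has_real_derivative d) (at u))}
   <= {a \<in> {0<..}. ~ continuous (at a within {0<..}) (%u. - R u)}"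
 proof (safe, goal_cases)
  case (1 u)
  hence "isCont (%u. - R u) u" by (simp add: at_within_open[of u "{0<..}"])
  hence "isCont (%u. - (- R u)) u" by (rule isCont_minus)
  thus ?case using 1 deriv by auto
 qed
 thus ?thesis using mono_on_ctble_discont[OF mono] by (rule countable_subset)
qed

section \<open>Fixed points of stage equations by monotone iteration\<close>

context stage_problem
begin

lemma stage_cong: "(!!u. 0 <= u ==> W u = W' u) ==> stage W x = stage W' x" unfolding stage_def gain_def by simp

text \<open>Stated for an abstract operator \<open>OP\<close>, so that it serves both the barrier
  operator and the impulse operator. \<open>P\<close> is a property carried along the iteration and
  preserved by limits: concavity for the impulse operator, \<open>True\<close> for the barrier
  operator.\<close>

lemma fixed_point_exists:
 assumes mono: "!!v v' u. tame \<phi> v ==> tame \<phi> v' ==> (!!u. 0 <= u ==> v u <= v' u) ==> 0 <= u ==> OP v u <= OP v' u"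
  and tame: "!!v. tame \<phi> v ==> tame \<phi> (OP v)"
  and cont: "!!vn v u. (!!n. tame \<phi> (vn n)) ==> tame \<phi> v ==> (!!n u. 0 <= u ==> vn n u <= v u) ==>
    (!!u. 0 <= u ==> (%n. vn n u) ----> v u) ==> 0 <= u ==> (%n. OP (vn n) u) ----> OP v u"
  and lower: "!!C u. 0 <= u ==> - C <= OP (%_. - C) u"
  and upper: "!!\<alpha> \<beta> u. 0 <= \<alpha> ==> \<alpha> <= 1 ==> 0 <= u ==> OP (%u. \<alpha> * u + \<beta>) u <= u + \<beta>"
  and P_const: "!!C. P (%_. C)" and P_stage: "!!v. tame \<phi> v ==> P v ==> P (stage (OP v))"
  and P_limit: "!!vn v. (!!n. P (vn n)) ==> (!!u. 0 <= u ==> (%n. vn n u) ----> v u) ==> P v"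
 obtains v \<alpha> \<beta> where "tame \<phi> v" "P v" "!!x. 0 <= x ==> v x = stage (OP v) x"
  "0 <= \<alpha>" "\<alpha> < 1" "!!x. 0 <= x ==> v x <= \<alpha> * x + \<beta>"
proof -
 define E where "E = (LINT p|\<mu>. abs (fst p)) + (LINT p|\<mu>. abs (snd p))"
 have E: "0 <= E" unfolding E_def by simp
 have intE: "integrable \<mu> (%p. abs (fst p) + abs (snd p))" using integrable_fst integrable_snd by simp
 have E_eq: "(LINT p|\<mu>. abs (fst p) + abs (snd p)) = E" unfolding E_def using integrable_fst integrable_snd by simp
 obtain C0 where C0: "!!u. 0 <= u ==> \<Psi> u <= (1 + r / (2 * lam)) * u + C0" using payoff_growth by auto
 define C1 where "C1 = abs C0"
 have C1: "\<Psi> u <= (1 + r / (2 * lam)) * u + C1" "0 <= C1" if "0 <= u" for u using C0[OF that] by (auto simp: C1_def)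
 \<comment> \<open>\<open>C\<close> solves \<open>C = \<gamma> * C / rate + \<phi> * E\<close>. The
   injections of one stage cost at most \<open>\<phi> * E\<close> on average, so the constant
   \<open>- C\<close> is a subsolution.\<close>
 define C where "C = \<phi> * E * rate / (lam + r)"
 \<comment> \<open>The slope after one stage: \<open>\<Psi>\<close> contributes
   \<open>lam + r / 2\<close>, and the continuation value contributes \<gamma> because by
   \<open>upper\<close> the operator turns slopes up to 1 into at most 1. The intercept \<beta>
   solves \<open>\<beta> = E + (lam * C1 + \<gamma> * \<beta>) / rate\<close>.\<close>
 define \<alpha> where "\<alpha> = (lam + r / 2 + \<gamma>) / rate"
 define \<beta> where "\<beta> = rate / (lam + r) * (E + lam * C1 / rate)"
 have \<alpha>: "0 <= \<alpha>" "\<alpha> < 1" using lam_pos r_pos gamma_pos by (auto simp: \<alpha>_def rate_def)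
 have C: "0 <= C" using E phi_gt_1 rate_pos lam_pos r_pos by (simp add: C_def)
 have \<beta>: "0 <= \<beta>" using E rate_pos lam_pos r_pos C1 by (auto simp: \<beta>_def)
 have tame_const: "tame \<phi> (%_. c)" for c using phi_gt_1 by (intro tameI) auto
 have tame_lin: "tame \<phi> (%u. \<alpha> * u + \<beta>)"
 proof (rule tameI)
  fix x y :: real assume "0 <= x" "x <= y"
  thus "\<alpha> * x + \<beta> <= \<alpha> * y + \<beta>" using \<alpha> by (simp add: mult_left_mono)
  have "\<alpha> * (y - x) <= \<phi> * (y - x)" using \<alpha> phi_gt_1 \<open>x <= y\<close> by (intro mult_right_mono) auto
  thus "\<alpha> * y + \<beta> <= \<alpha> * x + \<beta> + \<phi> * (y - x)" by (simp add: algebra_simps)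
 qed
 have sub: "- C <= stage (OP (%_. - C)) x" if x: "0 <= x" for x
 proof -
  have "- C = \<gamma> * (- C) / rate - \<phi> * E"
  proof -
   have "C * (lam + r) = \<phi> * E * rate" using lam_pos r_pos by (simp add: C_def)
   hence "\<phi> * E = C * (lam + r) / rate" using rate_pos by simp
   also have "... = C * (rate - \<gamma>) / rate" by (simp add: rate_def)
   also have "... = C - \<gamma> * C / rate" using rate_pos by (simp add: diff_divide_distrib right_diff_distrib)
   finally show ?thesis by simp
  qed
  also have "... = (LINT p|\<mu>. \<gamma> * (- C) / rate - \<phi> * (abs (fst p) + abs (snd p)))" using E_eq intE by (simp add: prob_space)
  also have "... <= stage (OP (%_. - C)) x" unfolding stage_def
  proof (rule integral_mono)
   show "integrable \<mu> (%p. \<gamma> * (- C) / rate - \<phi> * (abs (fst p) + abs (snd p)))" using intE by simp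
   show "integrable \<mu> (gain (OP (%_. - C)) x)" by (rule gain_integrable[OF tame[OF tame_const]])
   fix p
   have "\<gamma> * (- C) <= lam * \<Psi> (reflected x p) + \<gamma> * OP (%_. - C) (reflected x p)" using lower[of "reflected x p" C] payoff_nonneg[of "reflected x p"] lam_pos gamma_pos
    by (smt (verit) mult_left_mono mult_nonneg_nonneg reflected_nonneg)
   hence "\<gamma> * (- C) / rate <= (lam * \<Psi> (reflected x p) + \<gamma> * OP (%_. - C) (reflected x p)) / rate" using rate_pos by (intro divide_right_mono) auto
   moreover have "\<phi> * (max x (snd p) - x) <= \<phi> * (abs (fst p) + abs (snd p))" using x phi_gt_1 by (intro mult_left_mono) auto
   ultimately show "\<gamma> * (- C) / rate - \<phi> * (abs (fst p) + abs (snd p)) <= gain (OP (%_. - C)) x p" unfolding gain_def by linarith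
  qed
  finally show ?thesis .
 qed
 have super: "stage (OP (%u. \<alpha> * u + \<beta>)) x <= \<alpha> * x + \<beta>" if x: "0 <= x" for x
 proof -
  have "stage (OP (%u. \<alpha> * u + \<beta>)) x
   <= (LINT p|\<mu>. \<alpha> * (x + (abs (fst p) + abs (snd p))) + (lam * C1 + \<gamma> * \<beta>) / rate)" unfolding stage_def
  proof (rule integral_mono)
   show "integrable \<mu> (gain (OP (%u. \<alpha> * u + \<beta>)) x)" by (rule gain_integrable[OF tame[OF tame_lin]])
   show "integrable \<mu> (%p. \<alpha> * (x + (abs (fst p) + abs (snd p))) + (lam * C1 + \<gamma> * \<beta>) / rate)" using intE by simp
   fix p
   define u where "u = reflected x p"
   have u: "0 <= u" "u <= x + (abs (fst p) + abs (snd p))" using reflected_le[of x p] x by (auto simp: u_def)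
   have "lam * \<Psi> u + \<gamma> * OP (%u. \<alpha> * u + \<beta>) u
     <= lam * ((1 + r / (2 * lam)) * u + C1) + \<gamma> * (u + \<beta>)" using C1(1)[OF u(1)] upper[of \<alpha> u \<beta>] u \<alpha> lam_pos gamma_pos by (intro add_mono mult_left_mono) auto
   also have "... = (lam + r / 2 + \<gamma>) * u + (lam * C1 + \<gamma> * \<beta>)" using lam_pos by (simp add: field_simps)
   finally have "(lam * \<Psi> u + \<gamma> * OP (%u. \<alpha> * u + \<beta>) u) / rate
     <= ((lam + r / 2 + \<gamma>) * u + (lam * C1 + \<gamma> * \<beta>)) / rate" using rate_pos by (intro divide_right_mono) auto
   also have "... = \<alpha> * u + (lam * C1 + \<gamma> * \<beta>) / rate" unfolding \<alpha>_def by (subst add_divide_distrib) simp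
   also have "\<alpha> * u <= \<alpha> * (x + (abs (fst p) + abs (snd p)))" using \<alpha> u by (intro mult_left_mono) auto
   finally have "(lam * \<Psi> u + \<gamma> * OP (%u. \<alpha> * u + \<beta>) u) / rate
     <= \<alpha> * (x + (abs (fst p) + abs (snd p))) + (lam * C1 + \<gamma> * \<beta>) / rate" by simp
   moreover have "0 <= \<phi> * (max x (snd p) - x)" using phi_gt_1 by simp
   ultimately show "gain (OP (%u. \<alpha> * u + \<beta>)) x p
     <= \<alpha> * (x + (abs (fst p) + abs (snd p))) + (lam * C1 + \<gamma> * \<beta>) / rate" unfolding gain_def u_def by linarith
  qed
  also have "... = \<alpha> * x + \<alpha> * E + (lam * C1 + \<gamma> * \<beta>) / rate"
  proof -
   have "(LINT p|\<mu>. \<alpha> * (x + (abs (fst p) + abs (snd p))) + (lam * C1 + \<gamma> * \<beta>) / rate)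
    = (LINT p|\<mu>. (\<alpha> * x + (lam * C1 + \<gamma> * \<beta>) / rate) + \<alpha> * (abs (fst p) + abs (snd p)))" by (intro Bochner_Integration.integral_cong refl) (simp add: distrib_left)
   also have "... = (\<alpha> * x + (lam * C1 + \<gamma> * \<beta>) / rate) + \<alpha> * E" using intE by (subst Bochner_Integration.integral_add) (auto simp: prob_space E_eq[symmetric])
   finally show ?thesis by simp
  qed
  also have "\<alpha> * E <= E" using \<alpha> E mult_right_mono[of \<alpha> 1 E] by simp
  also have "\<alpha> * x + E + (lam * C1 + \<gamma> * \<beta>) / rate = \<alpha> * x + \<beta>"
  proof -
   define Y where "Y = E + lam * C1 / rate"
   have "(lam + r) * \<beta> = rate * Y" using lam_pos r_pos by (simp add: \<beta>_def Y_def)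
   also have "... = rate * E + lam * C1" using rate_pos by (simp add: Y_def distrib_left)
   finally have "rate * E + lam * C1 + \<gamma> * \<beta> = rate * \<beta>" by (simp add: rate_def algebra_simps)
   hence "(rate * E + lam * C1 + \<gamma> * \<beta>) / rate = \<beta>" using rate_pos by simp
   hence "E + (lam * C1 + \<gamma> * \<beta>) / rate = \<beta>" using rate_pos by (simp add: add_divide_distrib)
   thus ?thesis by simp
  qed
  finally show ?thesis by simp
 qed
 define vn where "vn n = ((%v. stage (OP v)) ^^ n) (%_. - C)" for n
 have vn_0: "vn 0 = (%_. - C)" and vn_Suc: "vn (Suc n) = stage (OP (vn n))" for n by (simp_all add: vn_def)
 have vn_tame: "tame \<phi> (vn n)" for n by (induction n) (auto simp: vn_0 vn_Suc intro: tame_const stage_tame tame)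
 have vn_P: "P (vn n)" for n by (induction n) (auto simp: vn_0 vn_Suc intro: P_const P_stage vn_tame)
 have vn_step: "vn n u <= vn (Suc n) u" if "0 <= u" for n u using that
 proof (induction n arbitrary: u)
  case 0 thus ?case using sub by (simp add: vn_0 vn_Suc)
 next
  case (Suc n)
  show ?case unfolding vn_Suc[of "Suc n"] vn_Suc[of n]
  proof (rule stage_mono)
   fix u :: real assume "0 <= u"
   thus "OP (vn n) u <= OP (stage (OP (vn n))) u" using Suc.IH by (intro mono) (auto simp: vn_Suc[symmetric] vn_tame)
  qed (auto simp: vn_Suc[symmetric] intro: tame vn_tame)
 qed
 have vn_le: "vn n u <= \<alpha> * u + \<beta>" if "0 <= u" for n u using that
 proof (induction n arbitrary: u)
  case 0
  have "0 <= \<alpha> * u" using \<alpha> 0 by simp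
  thus ?case using C \<beta> by (simp add: vn_0)
 next
  case (Suc n)
  have "stage (OP (vn n)) u <= stage (OP (%u. \<alpha> * u + \<beta>)) u" by (rule stage_mono) (auto intro: tame vn_tame tame_lin mono Suc.IH)
  thus ?case using super[OF Suc.prems] by (simp add: vn_Suc)
 qed
 define v where "v u = lim (%n. vn n u)" for u
 have lim: "(%n. vn n u) ----> v u" if u: "0 <= u" for u
 proof -
  have "incseq (%n. vn n u)" using vn_step[OF u] by (rule incseq_SucI)
  then obtain l where "(%n. vn n u) ----> l" using incseq_convergent[of "%n. vn n u" "\<alpha> * u + \<beta>"] vn_le[OF u] by blast
  thus ?thesis unfolding v_def using limI by blast
 qed
 have inc: "incseq (%n. vn n u)" if "0 <= u" for u using vn_step[OF that] by (rule incseq_SucI)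
 have vn_v: "vn n u <= v u" if "0 <= u" for n u using incseq_le[OF inc[OF that] lim[OF that]] .
 have v_tame: "tame \<phi> v"
 proof (rule tameI)
  fix x y :: real assume xy: "0 <= x" "x <= y"
  hence y: "0 <= y" by simp
  show "v x <= v y" by (rule LIMSEQ_le[OF lim[OF xy(1)] lim[OF y]]) (use tameD(1)[OF vn_tame xy] in auto)
  have "(%n. vn n x + \<phi> * (y - x)) ----> v x + \<phi> * (y - x)" by (intro tendsto_intros lim xy)
  thus "v y <= v x + \<phi> * (y - x)" by (rule LIMSEQ_le[OF lim[OF y]]) (use tameD(2)[OF vn_tame xy] in auto)
 qed
 have vn_0_le: "vn 0 u <= vn n u" if "0 <= u" for n u using inc[OF that] by (simp add: incseq_def)
 have "v x = stage (OP v) x" if x: "0 <= x" for x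
 proof -
  have "(%n. stage (OP (vn n)) x) ----> stage (OP v) x"
  proof (rule stage_limit)
   show "OP (vn n) u <= OP v u" if "0 <= u" for n u using vn_v that by (intro mono vn_tame v_tame)
   show "OP (vn 0) u <= OP (vn n) u" if "0 <= u" for n u using vn_0_le that by (intro mono vn_tame)
   show "(%n. OP (vn n) u) ----> OP v u" if "0 <= u" for u by (rule cont[OF vn_tame v_tame vn_v lim that])
  qed (intro tame vn_tame v_tame)+
  moreover have "(%n. stage (OP (vn n)) x) ----> v x" using LIMSEQ_Suc[OF lim[OF x]] by (simp add: vn_Suc)
  ultimately show ?thesis using LIMSEQ_unique by blast
 qed
 moreover have "v x <= \<alpha> * x + \<beta>" if "0 <= x" for x using LIMSEQ_le_const2[OF lim[OF that]] vn_le[OF that] by blast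
 moreover have "P v" using vn_P lim by (rule P_limit)
 ultimately show ?thesis using v_tame \<alpha> that by blast
qed

lemma barrier_fixed_point:
 assumes b: "0 <= b"
 obtains v where "tame \<phi> v" "!!x. 0 <= x ==> v x = stage (barrier_op b v) x"
proof (rule fixed_point_exists[of "barrier_op b" "%_. True"])
 show "barrier_op b v u <= barrier_op b v' u"
  if "!!u. 0 <= u ==> v u <= v' u" "0 <= u" for v v' u using that(1)[of "min u b"] that(2) b by (simp add: barrier_op_def)
 show "tame \<phi> (barrier_op b v)" if "tame \<phi> v" for v using that phi_gt_1 b by (intro tame_barrier_op) auto
 show "(%n. barrier_op b (vn n) u) ----> barrier_op b v u"
  if "!!u. 0 <= u ==> (%n. vn n u) ----> v u" "0 <= u" for vn v u unfolding barrier_op_def using b that(2) by (intro tendsto_intros that(1)) auto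
 show "barrier_op b (%u. \<alpha> * u + \<beta>) u <= u + \<beta>" if "0 <= \<alpha>" "\<alpha> <= 1" "0 <= u" for \<alpha> \<beta> u
 proof -
  have "\<alpha> * min u b <= min u b" using that b mult_right_mono[of \<alpha> 1 "min u b"] by auto
  thus ?thesis by (auto simp: barrier_op_def)
 qed
 show "- C <= barrier_op b (%_. - C) u" for C u :: real by (simp add: barrier_op_def)
qed (rule TrueI | (rule that, assumption, blast))+

lemma impulse_fixed_point:
 obtains V \<alpha> \<beta> where "tame \<phi> V" "concave_on {0..} V" "!!x. 0 <= x ==> V x = stage (impulse_op V) x"
  "0 <= \<alpha>" "\<alpha> < 1" "!!x. 0 <= x ==> V x <= \<alpha> * x + \<beta>"
proof (rule fixed_point_exists[of impulse_op "concave_on {0..}"])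
 show "impulse_op v u <= impulse_op v' u"
  if "tame \<phi> v'" "!!u. 0 <= u ==> v u <= v' u" "0 <= u" for v v' u
 proof (rule impulse_le[OF that(3)])
  fix y assume y: "0 <= y" "y <= u"
  show "v y + (u - y) <= impulse_op v' u" using impulse_ge[OF that(1) y] that(2)[OF y(1)] by linarith
 qed
 show "tame \<phi> (impulse_op v)" if "tame \<phi> v" for v using that phi_gt_1 by (intro tame_impulse_op) auto
 show "(%n. impulse_op (vn n) u) ----> impulse_op v u"
  if "!!n. tame \<phi> (vn n)" "tame \<phi> v" "!!n u. 0 <= u ==> vn n u <= v u"
   "!!u. 0 <= u ==> (%n. vn n u) ----> v u" "0 <= u" for vn v u using that by (rule impulse_op_limit)
 show "- C <= impulse_op (%_. - C) u" if "0 <= u" for C u :: real using impulse_ge[of \<phi> "%_. - C" u u] that phi_gt_1 by (auto simp: tame_def)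
 show "impulse_op (%u. \<alpha> * u + \<beta>) u <= u + \<beta>" if "0 <= \<alpha>" "\<alpha> <= 1" "0 <= u" for \<alpha> \<beta> u :: real
 proof (rule impulse_le[OF that(3)])
  fix y assume "0 <= y" "y <= u"
  hence "\<alpha> * y <= y" using that mult_right_mono[of \<alpha> 1 y] by auto
  thus "\<alpha> * y + \<beta> + (u - y) <= u + \<beta>" by simp
 qed
 show "concave_on {0..} (stage (impulse_op v))" if "tame \<phi> v" "concave_on {0..} v" for v using that phi_gt_1 by (intro stage_concave tame_impulse_op concave_impulse_op) auto
 show "concave_on {0..} v" if "!!n. concave_on {0..} (vn n)" "!!u. 0 <= u ==> (%n. vn n u) ----> v u"
  for vn :: "nat => real => real" and v by (rule concave_on_limit[of "{0..}" vn v]) (use that in auto)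
 show "concave_on {0..} (%_::real. C)" for C :: real unfolding concave_on_const by (rule convex_real_interval)
qed (rule that)

text \<open>A reserve \<open>x\<close> below the running maximum saves an injection of exactly
  \<open>x\<close>, worth \<open>\<phi> * x > x\<close>. As that maximum is almost surely positive,
  this is the typical case for small \<open>x\<close>. One steep chord is enough to exclude 0 as a
  maximiser of \<open>V u - u\<close>.\<close>

lemma derivative_at_zero:
 assumes W: "tame \<phi> W"
 obtains x where "0 < x" "stage W x - stage W 0 > x"
proof -
 \<comment> \<open>\<open>g n\<close> is the fraction of the reserve \<open>1 / Suc n\<close> that
   replaces injections. It tends to 1 almost surely, so its mean eventually exceeds
   \<open>1 / \<phi>\<close>.\<close>
 define g where "g n p = 1 - (max (1 / real (Suc n)) (snd p) - max 0 (snd p)) * real (Suc n)" for n and p :: "real \<times> real"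
 have g_bound: "0 <= g n p" "g n p <= 1" for n p
 proof -
  define e where "e = 1 / real (Suc n)"
  have "0 < e" by (simp add: e_def)
  hence "0 <= max e (snd p) - max 0 (snd p)" "max e (snd p) - max 0 (snd p) <= e" by auto
  hence "0 <= max (1 / real (Suc n)) (snd p) - max 0 (snd p)"
   "max (1 / real (Suc n)) (snd p) - max 0 (snd p) <= 1 / real (Suc n)" unfolding e_def by blast+
  thus "0 <= g n p" "g n p <= 1" unfolding g_def by (auto simp: pos_le_divide_eq simp del: of_nat_Suc)
 qed
 have g_meas[measurable]: "g n \<in> Bor \<mu>" for n unfolding g_def by measurable
 have "(%n. LINT p|\<mu>. g n p) ----> (LINT p|\<mu>. 1)"
 proof (rule integral_dominated_convergence[where w="%_. 1"])
  show "AE p in \<mu>. (%n. g n p) ----> 1" using snd_positive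
  proof eventually_elim
   case (elim p)
   have "\<forall>\<^sub>F n in sequentially. 1 / real (Suc n) < snd p" using elim LIMSEQ_inverse_real_of_nat order_tendstoD(2)[of "%n. inverse (real (Suc n))" 0 sequentially "snd p"]
    by (simp add: inverse_eq_divide)
   hence "\<forall>\<^sub>F n in sequentially. g n p = 1" by eventually_elim (use elim in \<open>auto simp: g_def\<close>)
   thus ?case by (rule tendsto_eventually)
  qed
 qed (use g_bound in auto)
 hence "(%n. LINT p|\<mu>. g n p) ----> 1" by (simp add: prob_space)
 hence "\<forall>\<^sub>F n in sequentially. 1 / \<phi> < (LINT p|\<mu>. g n p)" using phi_gt_1 by (intro order_tendstoD) auto
 then obtain n where n: "1 / \<phi> < (LINT p|\<mu>. g n p)" by (auto simp: eventually_sequentially)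
 define x where "x = 1 / real (Suc n)"
 have x: "0 < x" by (simp add: x_def)
 have "x < \<phi> * x * (LINT p|\<mu>. g n p)" using n x phi_gt_1 by (simp add: field_simps)
 also have "... = (LINT p|\<mu>. \<phi> * x * g n p)" by simp
 also have "... <= (LINT p|\<mu>. gain W x p - gain W 0 p)"
 proof (rule integral_mono)
  show "integrable \<mu> (%p. \<phi> * x * g n p)" by (rule integrable_const_bound[of _ "\<phi> * x"]) (use g_bound x phi_gt_1 in \<open>auto simp: abs_mult mult_left_le\<close>)
  show "integrable \<mu> (%p. gain W x p - gain W 0 p)" using gain_integrable[OF W] by auto
  fix p
  have "\<Psi> (reflected 0 p) <= \<Psi> (reflected x p)" "W (reflected 0 p) <= W (reflected x p)" using x by (auto intro!: tameD(1)[OF payoff_tame] tameD(1)[OF W] reflected_mono)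
  hence "(lam * \<Psi> (reflected 0 p) + \<gamma> * W (reflected 0 p)) / rate
    <= (lam * \<Psi> (reflected x p) + \<gamma> * W (reflected x p)) / rate" using lam_pos gamma_pos rate_pos by (intro divide_right_mono add_mono mult_left_mono) auto
  moreover have "x * g n p = x - (max x (snd p) - max 0 (snd p))"
  proof -
   define k where "k = real (Suc n)"
   have "x * k = 1" by (simp add: x_def k_def)
   moreover have "g n p = 1 - (max x (snd p) - max 0 (snd p)) * k" by (simp add: g_def x_def k_def)
   ultimately show ?thesis by algebra
  qed
  hence "\<phi> * x * g n p = \<phi> * (x - (max x (snd p) - max 0 (snd p)))" by (simp add: mult.assoc)
  ultimately show "\<phi> * x * g n p <= gain W x p - gain W 0 p" unfolding gain_def by (simp add: algebra_simps)
 qed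
 also have "... = stage W x - stage W 0" unfolding stage_def using gain_integrable[OF W] by simp
 finally show ?thesis using that x by blast
qed

end

section \<open>Smoothness and the optimal barrier\<close>

lemma has_real_derivative_transfer:
 assumes "(f has_real_derivative d) (at x)" "\<forall>\<^sub>F y in nhds x. f y = g y"
 shows "(g has_real_derivative d) (at x)" using DERIV_cong_ev[OF refl assms(2) refl] assms(1) by simp

context stage_problem
begin

text \<open>For starts below the running maximum \<open>snd p\<close> the gain is affine with slope
  \<phi>; for starts above it, it is built from translates of \<open>\<Psi>\<close> and
  \<open>W\<close>. Trouble arises only if \<open>x = snd p\<close> or if \<open>x + fst p\<close>
  hits one of countably many kinks, both null events by \<open>no_atom_snd\<close> and
  \<open>no_atom_fst\<close>.\<close>

lemma gain_differentiable:
 assumes W: "tame \<phi> W" "concave_on {0..} W" and x: "0 < x"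
 shows "AE p in \<mu>. EX d. ((%x. gain W x p) has_real_derivative d) (at x)"
proof -
 define K where "K = insert 0 ({u. 0 < u & ~ (EX d. (\<Psi> has_real_derivative d) (at u))}
   \<union> {u. 0 < u & ~ (EX d. (W has_real_derivative d) (at u))})"
 have K: "countable K" unfolding K_def using countable_kinks[OF payoff_tame payoff_concave] countable_kinks[OF W] by simp
 have "AE p in \<mu>. \<forall>y\<in>K. fst p ~= y - x" unfolding AE_ball_countable[OF K] using no_atom_fst by blast
 thus ?thesis using above_infimum no_atom_snd[OF x]
 proof eventually_elim
  case (elim p)
  show ?case
  proof (cases "snd p < x")
   case True
   have pos: "0 < fst p + x" using elim True by linarith
   have "fst p + x \<notin> K" using elim(1) by force
   then obtain d e where "(\<Psi> has_real_derivative d) (at (x + fst p))" "(W has_real_derivative e) (at (x + fst p))" using pos unfolding K_def by (auto simp: add.commute)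
   hence "((%y. \<Psi> (y + fst p)) has_real_derivative d) (at x)" "((%y. W (y + fst p)) has_real_derivative e) (at x)" by (simp_all add: DERIV_shift)
   hence "((%y. (lam * \<Psi> (y + fst p) + \<gamma> * W (y + fst p)) / rate) has_real_derivative (lam * d + \<gamma> * e) / rate) (at x)" by (intro DERIV_cdivide DERIV_add DERIV_cmult)
   moreover have "\<forall>\<^sub>F y in nhds x. (lam * \<Psi> (y + fst p) + \<gamma> * W (y + fst p)) / rate = gain W y p"
   proof -
    have "\<forall>\<^sub>F y in nhds x. y \<in> {snd p<..} Int {- fst p<..}" using True pos by (intro eventually_nhds_in_open) auto
    thus ?thesis by eventually_elim (auto simp: gain_def reflected_def max_def add.commute)
   qed
   ultimately show ?thesis by (intro exI) (rule has_real_derivative_transfer)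
  next
   case False
   hence sx: "x < snd p" using elim(3) by linarith
   have "((%y. (lam * \<Psi> (fst p + snd p) + \<gamma> * W (fst p + snd p)) / rate - \<phi> * (snd p - y)) has_real_derivative \<phi>) (at x)" by (auto intro!: derivative_eq_intros)
   moreover have "\<forall>\<^sub>F y in nhds x. (lam * \<Psi> (fst p + snd p) + \<gamma> * W (fst p + snd p)) / rate - \<phi> * (snd p - y) = gain W y p"
   proof -
    have "\<forall>\<^sub>F y in nhds x. y \<in> {..<snd p}" using sx by (intro eventually_nhds_in_open) auto
    thus ?thesis by eventually_elim (use elim in \<open>auto simp: gain_def reflected_def max_def\<close>)
   qed
   ultimately show ?thesis by (intro exI) (rule has_real_derivative_transfer)
  qed
 qed
qed

text \<open>The difference quotients of the gain are bounded by \<phi>, so differentiation passes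
  under the integral.\<close>

lemma stage_differentiable:
 assumes W: "tame \<phi> W" "concave_on {0..} W" and x: "0 < x"
 obtains d where "(stage W has_real_derivative d) (at x)"
proof -
 define Q where "Q h p = (gain W (x + h) p - gain W x p) / h" for h p
 \<comment> \<open>The limit is taken along one explicit sequence; this makes \<open>D\<close>
   measurable even at the points where the derivative fails to exist.\<close>
 define D where "D p = lim (%n. Q (1 / real (Suc n)) p)" for p
 have Q_meas[measurable]: "Q h \<in> Bor \<mu>" for h using gain_measurable[OF W(1)] unfolding Q_def by measurable
 have D_meas[measurable]: "D \<in> Bor \<mu>" unfolding D_def by measurable
 have Q_lim: "AE p in \<mu>. (%h. Q h p) \<midarrow>0\<rightarrow> D p" using gain_differentiable[OF W x]
 proof eventually_elim
  case (elim p)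
  then obtain d where d: "(%h. Q h p) \<midarrow>0\<rightarrow> d" unfolding DERIV_def Q_def by blast
  have "(%n. Q (1 / real (Suc n)) p) ----> d"
  proof (rule filterlim_compose[OF d])
   have "(%n. 1 / real (Suc n)) ----> 0" using LIMSEQ_inverse_real_of_nat by (simp add: inverse_eq_divide)
   thus "filterlim (%n. 1 / real (Suc n)) (at 0) sequentially" by (auto simp: filterlim_at)
  qed
  hence "D p = d" unfolding D_def by (rule limI)
  thus ?case using d by simp
 qed
 have Q_bound: "abs (Q h p) <= \<phi>" for h p
 proof (cases "h = 0")
  case False
  thus ?thesis using gain_incr[OF W(1), of x "x + h" p] gain_incr[OF W(1), of "x + h" x p] unfolding Q_def by (cases "h > 0") (auto simp: abs_le_iff divide_le_eq le_divide_eq field_simps)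
 qed (use phi_gt_1 in \<open>simp add: Q_def\<close>)
 have "(%h. LINT p|\<mu>. Q h p) \<midarrow>0\<rightarrow> (LINT p|\<mu>. D p)" unfolding tendsto_at_iff_sequentially comp_def
 proof safe
  fix X :: "nat => real" assume X: "ALL i. X i \<in> UNIV - {0}" "X ----> 0"
  show "(%n. LINT p|\<mu>. Q (X n) p) ----> (LINT p|\<mu>. D p)"
  proof (rule integral_dominated_convergence[where w="%_. \<phi>"])
   show "AE p in \<mu>. (%n. Q (X n) p) ----> D p" using Q_lim
   proof eventually_elim
    case (elim p)
    show ?case by (rule filterlim_compose[OF elim]) (use X in \<open>auto simp: filterlim_at\<close>)
   qed
  qed (use Q_bound in auto)
 qed
 moreover have "(LINT p|\<mu>. Q h p) = (stage W (x + h) - stage W x) / h" for h unfolding Q_def stage_def using gain_integrable[OF W(1)] by simp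
 ultimately have "(stage W has_real_derivative (LINT p|\<mu>. D p)) (at x)" unfolding DERIV_def by simp
 thus ?thesis using that by blast
qed

text \<open>This is why no level below \<open>b\<close> meets the slope condition. The equation for
  \<open>V - v\<close> contracts slopes by \<theta>, and \<open>V\<close> is steeper than 1 left of
  \<open>b\<close>, so \<open>v\<close> inherits at least the share \<open>1 - \<theta>\<close> of
  the excess slope. The margin \<open>(1 - \<theta>) * (s0 - 1)\<close> does not depend on
  \<open>x\<close>, which keeps the inequality strict as \<open>x\<close> tends to
  \<open>b'\<close>.\<close>

lemma barrier_slope_gt_1:
 assumes V: "tame \<phi> V" "!!x. 0 <= x ==> V x = stage (barrier_op b V) x"
  and cc: "concave_on {0..} (barrier_op b V)"
  and max: "!!x. 0 <= x ==> x < b ==> b - x < V b - V x"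
  and b': "0 < b'" "b' < b"
  and v: "tame \<phi> v" "!!x. 0 <= x ==> v x = stage (barrier_op b' v) x"
  and d: "(v has_real_derivative d) (at b')"
 shows "1 < d"
proof -
 define \<theta> where "\<theta> = \<gamma> / rate"
 have \<theta>: "0 < \<theta>" "\<theta> < 1" using lam_pos r_pos gamma_pos by (auto simp: \<theta>_def rate_def)
 define s0 where "s0 = (V b - V b') / (b - b')"
 have s0: "1 < s0" using max[of b'] b' by (simp add: s0_def less_divide_eq)
 define k where "k u = barrier_op b V u - barrier_op b' v u" for u
 define w where "w u = V u - v u" for u
 have tV: "tame \<phi> (barrier_op b V)" and tv: "tame \<phi> (barrier_op b' v)" using V(1) v(1) b' phi_gt_1 by (auto intro!: tame_barrier_op)
 have main: "(1 + (1 - \<theta>) * (s0 - 1)) * (b' - x) <= v b' - v x" if x: "0 <= x" "x < b'" for x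
 proof -
  define s where "s = (V b' - V x) / (b' - x)"
  have eqV: "barrier_op b V u = V u" if "u <= b" for u using that by (simp add: barrier_op_def)
  have s: "s0 <= s" using concave_slope_antimono[OF cc, of x b' b' b] x b' by (simp add: s0_def s_def eqV)
  have right: "barrier_op b V q - barrier_op b V p <= s * (q - p)" if "b' <= p" "p <= q" for p q
  proof (cases "p = q")
   case False
   thus ?thesis using concave_slope_antimono[OF cc, of x b' p q] x b' that by (simp add: s_def eqV divide_le_eq)
  qed simp
  \<comment> \<open>One application of the equation. On \<open>[0, b']\<close> the slopes of
    \<open>k\<close> are those of \<open>w\<close>; beyond \<open>b'\<close> the concave term has
    slope at most \<open>s\<close> and the other term slope 1. So any \<open>K >= s - 1\<close> that
    bounds the slopes of \<open>w\<close> on \<open>[0, b']\<close> bounds those of \<open>k\<close>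
    everywhere, and averaging multiplies the bound by \<theta>.\<close>
  have step: "w q - w p <= \<theta> * K * (q - p)"
   if K: "s - 1 <= K" "!!p q. 0 <= p ==> p <= q ==> q <= b' ==> w q - w p <= K * (q - p)"
    and pq: "0 <= p" "p <= q" for K p q
  proof -
   have K0: "0 <= K" using K s s0 by linarith
   have low: "k q - k p <= K * (q - p)" if "0 <= p" "p <= q" "q <= b'" for p q using K(2)[OF that] that b' by (simp add: k_def w_def barrier_op_def min_def)
   have high: "k q - k p <= K * (q - p)" if "b' <= p" "p <= q" for p q
   proof -
    have "k q - k p = barrier_op b V q - barrier_op b V p - (q - p)" using that by (simp add: k_def barrier_op_def[of b'])
    also have "... <= (s - 1) * (q - p)" using right[OF that] by (simp add: algebra_simps)
    also have "... <= K * (q - p)" using K(1) that by (intro mult_right_mono) auto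
    finally show ?thesis .
   qed
   have k: "k q - k p <= K * (q - p)" if "0 <= p" "p <= q" for p q
   proof (cases "q <= b' | b' <= p")
    case True thus ?thesis using low high that by blast
   next
    case False
    hence "k b' - k p <= K * (b' - p)" "k q - k b' <= K * (q - b')" using low[of p b'] high[of b' q] that b' by auto
    thus ?thesis by (simp add: algebra_simps)
   qed
   have int: "integrable \<mu> (%p. k (reflected y p))" for y unfolding k_def using tame_reflected_integrable[OF tV] tame_reflected_integrable[OF tv] by auto
   have w: "w y = \<theta> * (LINT p|\<mu>. k (reflected y p))" if "0 <= y" for y unfolding w_def k_def using V(2)[OF that] v(2)[OF that] stage_diff[OF tV tv] by (simp add: \<theta>_def)
   have "w q - w p = \<theta> * (LINT z|\<mu>. k (reflected q z) - k (reflected p z))" using w[of p] w[of q] pq int by (simp add: right_diff_distrib)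
   also have "... <= \<theta> * (LINT z|\<mu>. K * (q - p))"
   proof (intro mult_left_mono integral_mono)
    fix z
    have "k (reflected q z) - k (reflected p z) <= K * (reflected q z - reflected p z)" using pq by (intro k reflected_mono) auto
    also have "... <= K * (q - p)" using reflected_diff[OF pq(2), of z] K0 pq by (intro mult_left_mono) auto
    finally show "k (reflected q z) - k (reflected p z) <= K * (q - p)" .
   qed (use int \<theta> in auto)
   finally show ?thesis by (simp add: prob_space)
  qed
  \<comment> \<open>Starting from the Lipschitz constant, the bound shrinks geometrically until it
    meets the floor \<open>s - 1\<close>; one further step then gives
    \<open>\<theta> * (s - 1)\<close>.\<close>
  have iter: "w q - w p <= max (\<theta> ^ n * \<phi>) (s - 1) * (q - p)" if "0 <= p" "p <= q" for n p q using that
  proof (induction n arbitrary: p q)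
   case 0
   have "w q - w p <= V q - V p" using tameD(1)[OF v(1) 0] by (simp add: w_def)
   also have "... <= \<phi> * (q - p)" using tameD(2)[OF V(1) 0] by simp
   also have "... <= max (\<theta> ^ 0 * \<phi>) (s - 1) * (q - p)" using 0 by (intro mult_right_mono) auto
   finally show ?case .
  next
   case (Suc n)
   let ?K = "max (\<theta> ^ n * \<phi>) (s - 1)"
   have "w q - w p <= \<theta> * ?K * (q - p)" using Suc by (intro step) auto
   also have "\<theta> * ?K <= max (\<theta> ^ Suc n * \<phi>) (s - 1)"
   proof (cases "s - 1 <= \<theta> ^ n * \<phi>")
    case False
    hence "\<theta> * ?K = \<theta> * (s - 1)" by simp
    also have "... <= 1 * (s - 1)" using \<theta> s s0 by (intro mult_right_mono) auto
    finally show ?thesis by simp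
   qed (simp add: mult.assoc)
   hence "\<theta> * ?K * (q - p) <= max (\<theta> ^ Suc n * \<phi>) (s - 1) * (q - p)" using Suc.prems by (intro mult_right_mono) auto
   finally show ?case .
  qed
  have "(%n. \<theta> ^ n * \<phi>) ----> 0 * \<phi>" using \<theta> by (intro tendsto_intros LIMSEQ_power_zero) auto
  hence "\<forall>\<^sub>F n in sequentially. \<theta> ^ n * \<phi> < s - 1" using s s0 by (intro order_tendstoD) auto
  then obtain n where n: "\<theta> ^ n * \<phi> < s - 1" by (auto simp: eventually_sequentially)
  have "w b' - w x <= \<theta> * (s - 1) * (b' - x)" using iter[of _ _ n] n x by (intro step) (auto simp: max_def split: if_splits)
  hence "V b' - V x - \<theta> * (s - 1) * (b' - x) <= v b' - v x" by (simp add: w_def)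
  moreover have "V b' - V x = s * (b' - x)" using x by (simp add: s_def)
  moreover have "(1 + (1 - \<theta>) * (s0 - 1)) * (b' - x) <= (1 + (1 - \<theta>) * (s - 1)) * (b' - x)" using s \<theta> x by (intro mult_right_mono add_left_mono mult_left_mono) auto
  ultimately show ?thesis by (simp add: algebra_simps)
 qed
 have "1 + (1 - \<theta>) * (s0 - 1) <= d"
 proof (rule tendsto_lowerbound)
  show "((%h. (v (b' + h) - v b') / h) ---> d) (at_left 0)" using d unfolding DERIV_def by (rule tendsto_mono[rotated]) (simp add: at_le)
  have "\<forall>\<^sub>F h in at_left 0. - b' < h & h < 0" unfolding eventually_at_left_field using b' by (intro exI[of _ "- b'"]) auto
  thus "\<forall>\<^sub>F h in at_left 0. 1 + (1 - \<theta>) * (s0 - 1) <= (v (b' + h) - v b') / h"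
  proof eventually_elim
   case (elim h)
   thus ?case using main[of "b' + h"] by (simp add: le_divide_eq)
  qed
 qed simp
 moreover have "0 < (1 - \<theta>) * (s0 - 1)" using \<theta> s0 by simp
 ultimately show ?thesis by linarith
qed

theorem optimal_barrier:
 obtains b V where "0 < b" "tame \<phi> V" "!!x. 0 <= x ==> V x = stage (barrier_op b V) x"
  "!!u d. 0 <= u ==> 0 <= d ==> d + V u <= barrier_op b V (u + d)"
  "EX d<=1. (V has_real_derivative d) (at b)"
  "!!b' v d. 0 < b' ==> b' < b ==> tame \<phi> v ==> (!!x. 0 <= x ==> v x = stage (barrier_op b' v) x) ==>
    (v has_real_derivative d) (at b') ==> 1 < d"
proof -
 obtain V \<alpha> \<beta> where V: "tame \<phi> V" "concave_on {0..} V" "!!x. 0 <= x ==> V x = stage (impulse_op V) x"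
  and \<alpha>: "0 <= \<alpha>" "\<alpha> < 1" "!!x. 0 <= x ==> V x <= \<alpha> * x + \<beta>" using impulse_fixed_point by blast
 have impulse_tame: "tame \<phi> (impulse_op V)" using V(1) phi_gt_1 by (intro tame_impulse_op) auto
 define f where "f u = V u - u" for u
 have f_cont: "continuous_on {0..} f" unfolding f_def by (intro continuous_intros tame_continuous_on[OF V(1)])
 \<comment> \<open>From \<open>K\<close> on, the bound \<open>\<alpha> * u + \<beta>\<close> with
   \<open>\<alpha> < 1\<close> keeps \<open>V u - u\<close> at or below its value at 0, so the
   maximisation over the half-line reduces to a compact interval.\<close>
 define K where "K = max 0 ((\<beta> - V 0) / (1 - \<alpha>))"
 have K: "0 <= K" by (simp add: K_def)
 have beyond: "f u <= f 0" if "K <= u" for u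
 proof -
  have "(\<beta> - V 0) / (1 - \<alpha>) <= u" "0 <= u" using that by (auto simp: K_def)
  hence "\<beta> - V 0 <= (1 - \<alpha>) * u" using \<alpha> by (simp add: divide_le_eq mult.commute)
  thus ?thesis using \<alpha>(3)[OF \<open>0 <= u\<close>] by (simp add: f_def algebra_simps)
 qed
 obtain m where m: "m \<in> {0..K}" "!!u. u \<in> {0..K} ==> f u <= f m" using continuous_attains_sup[of "{0..K}" f] K continuous_on_subset[OF f_cont, of "{0..K}"] by auto
 have m_max: "f u <= f m" if "0 <= u" for u using m(2)[of u] m(2)[of 0] beyond[of u] that K by (cases "u <= K") auto
 \<comment> \<open>The maximisers form a compact set. Taking the smallest makes
   \<open>V u - u\<close> strictly smaller to its left, and this strictness is what excludes lower
   barriers.\<close>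
 define A where "A = {u \<in> {0..K}. f u = f m}"
 have "closed A" unfolding A_def by (intro continuous_closed_preimage_constant continuous_on_subset[OF f_cont]) auto
 moreover have "A = {0..K} Int A" by (auto simp: A_def)
 ultimately have "compact A" using compact_Int_closed[of "{0..K}" A] by simp
 then obtain b where b: "b \<in> A" "!!u. u \<in> A ==> b <= u" using compact_attains_inf[of A] m by (auto simp: A_def)
 have b0: "0 <= b" and fb: "f b = f m" using b(1) by (auto simp: A_def)
 have le_b: "f u <= f b" if "0 <= u" for u using m_max[OF that] fb by simp
 have lt_b: "f u < f b" if "0 <= u" "u < b" for u using le_b[OF that(1)] b(2)[of u] that b(1) fb by (force simp: A_def)
 have "b ~= 0"
 proof
  assume "b = 0"
  obtain x where "0 < x" "x < stage (impulse_op V) x - stage (impulse_op V) 0" using derivative_at_zero[OF impulse_tame] .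
  thus False using le_b[of x] V(3)[of x] V(3)[of 0] \<open>b = 0\<close> by (simp add: f_def)
 qed
 with b0 have b_pos: "0 < b" by simp
 have f_mono: "f y <= f u" if "0 <= y" "y <= u" "u <= b" for y u
 proof (cases "y < u & u < b")
  case True
  have "1 <= (V b - V u) / (b - u)" using True lt_b[of u] that by (simp add: f_def le_divide_eq)
  also have "... <= (V u - V y) / (u - y)" using concave_slopes(3)[OF V(2)] True that by auto
  finally show ?thesis using True by (simp add: f_def le_divide_eq)
 next
  case False
  hence "y = u | u = b" using that by auto
  thus ?thesis using le_b[OF that(1)] by auto
 qed
 \<comment> \<open>By concavity \<open>V u - u\<close> is non-decreasing up to \<open>b\<close>:
   below \<open>b\<close> it is best to pay nothing, above \<open>b\<close> to pay down to
   \<open>b\<close>.\<close>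
 have op_eq: "impulse_op V u = barrier_op b V u" if u: "0 <= u" for u
 proof (rule antisym)
  show "impulse_op V u <= barrier_op b V u"
  proof (rule impulse_le[OF u])
   fix y assume y: "0 <= y" "y <= u"
   show "V y + (u - y) <= barrier_op b V u" using f_mono[OF y] le_b[OF y(1)] by (cases "u <= b") (auto simp: barrier_op_def f_def min_def)
  qed
  show "barrier_op b V u <= impulse_op V u" using impulse_ge[OF V(1), of "min u b" u] u b0 by (auto simp: barrier_op_def min_def max_def split: if_splits)
 qed
 have fix_b: "V x = stage (barrier_op b V) x" if "0 <= x" for x using V(3)[OF that] stage_cong[of "impulse_op V" "barrier_op b V"] op_eq by simp
 have cc: "concave_on {0..} (barrier_op b V)" using concave_impulse_op[OF V(1,2)] op_eq unfolding concave_on_iff by (auto simp: convexD)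
 have super: "d + V u <= barrier_op b V (u + d)" if "0 <= u" "0 <= d" for u d using impulse_ge[OF V(1), of u "u + d"] op_eq[of "u + d"] that by simp
 have deriv: "EX d<=1. (V has_real_derivative d) (at b)"
 proof -
  obtain d where "(stage (barrier_op b V) has_real_derivative d) (at b)" using stage_differentiable[OF _ cc b_pos] tame_barrier_op[OF V(1) _ b0] phi_gt_1 by auto
  moreover have "\<forall>\<^sub>F x in nhds b. stage (barrier_op b V) x = V x"
  proof -
   have "\<forall>\<^sub>F x in nhds b. x \<in> {0<..}" using b_pos by (intro eventually_nhds_in_open) auto
   thus ?thesis by eventually_elim (use fix_b in auto)
  qed
  ultimately have d: "(V has_real_derivative d) (at b)" using has_real_derivative_transfer by blast
  have "d <= 1"
  proof (rule tendsto_upperbound)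
   show "((%h. (V (b + h) - V b) / h) ---> d) (at_right 0)" using d unfolding DERIV_def by (rule tendsto_mono[rotated]) (simp add: at_le)
   show "\<forall>\<^sub>F h in at_right 0. (V (b + h) - V b) / h <= 1" using eventually_at_right_less[of 0]
   proof eventually_elim
    case (elim h)
    thus ?case using le_b[of "b + h"] b0 by (simp add: f_def divide_le_eq)
   qed
  qed simp
  with d show ?thesis by blast
 qed
 show ?thesis
 proof (rule that[OF b_pos V(1) fix_b super deriv])
  fix b' v d
  assume *: "0 < b'" "b' < b" "tame \<phi> v" "!!x. 0 <= x ==> v x = stage (barrier_op b' v) x"
   "(v has_real_derivative d) (at b')"
  show "1 < d"
  proof (rule barrier_slope_gt_1[OF V(1) fix_b cc _ *])
   fix x assume "0 <= x" "x < b"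
   thus "b - x < V b - V x" using lt_b[of x] by (simp add: f_def)
  qed
 qed
qed

end

section \<open>Running suprema of cadlag paths\<close>

definition wsup :: "(real => real) => real => real => real" where
 "wsup f s t = (SUP r\<in>{s..t}. f r)"

lemma cadlag_right: "cadlag f ==> 0 <= t ==> (f ---> f t) (at_right t)" by (simp add: cadlag_def continuous_within)

lemma cadlag_left: "cadlag f ==> 0 < t ==> EX l. (f ---> l) (at_left t)" by (simp add: cadlag_def)

lemma cadlag_compose:
 assumes "cadlag f" "continuous_on UNIV g"
 shows "cadlag (%t. g (f t))" unfolding cadlag_def
proof (intro conjI allI impI)
 fix t :: real assume "0 <= t"
 thus "continuous (at_right t) (%t. g (f t))" unfolding continuous_within using continuous_on_tendsto_compose[OF assms(2) cadlag_right[OF assms(1)]] by simp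
next
 fix t :: real assume "0 < t"
 then obtain l where "(f ---> l) (at_left t)" using cadlag_left[OF assms(1)] by blast
 thus "EX l. ((%t. g (f t)) ---> l) (at_left t)" using continuous_on_tendsto_compose[OF assms(2), of f l] by auto
qed

lemma cadlag_add:
 assumes "cadlag f" "cadlag g" shows "cadlag (%t. f t + g t)" unfolding cadlag_def
proof (intro conjI allI impI)
 fix t :: real assume "0 <= t"
 thus "continuous (at_right t) (%t. f t + g t)" using assms unfolding cadlag_def by (intro continuous_intros) auto
next
 fix t :: real assume "0 < t"
 then obtain l m where "(f ---> l) (at_left t)" "(g ---> m) (at_left t)" using cadlag_left[OF assms(1)] cadlag_left[OF assms(2)] by blast
 thus "EX l. ((%t. f t + g t) ---> l) (at_left t)" using tendsto_add by blast
qed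

lemma cadlag_diff:
 assumes "cadlag f" "cadlag g" shows "cadlag (%t. f t - g t)" unfolding cadlag_def
proof (intro conjI allI impI)
 fix t :: real assume "0 <= t"
 thus "continuous (at_right t) (%t. f t - g t)" using assms unfolding cadlag_def by (intro continuous_intros) auto
next
 fix t :: real assume "0 < t"
 then obtain l m where "(f ---> l) (at_left t)" "(g ---> m) (at_left t)" using cadlag_left[OF assms(1)] cadlag_left[OF assms(2)] by blast
 thus "EX l. ((%t. f t - g t) ---> l) (at_left t)" using tendsto_diff by blast
qed

lemma cadlag_const: "cadlag (%_. a)" by (auto simp: cadlag_def)

lemma cadlag_uminus: "cadlag f ==> cadlag (%t. - f t)" using cadlag_diff[OF cadlag_const[of 0]] by fastforce

text \<open>Compactness by bisection: right continuity and the left limit bound the path on a small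
  interval around each point. The guard \<open>0 <= s\<close> makes the condition vacuous at
  negative times, where a cadlag path is unconstrained.\<close>

lemma cadlag_bounded:
 assumes f: "cadlag f"
 obtains B where "0 <= B" "!!s. 0 <= s ==> s <= T ==> abs (f s) <= B"
proof (cases "0 <= T")
 case True
 hence "EX B. \<forall>s\<in>{0..T}. 0 <= s --> abs (f s) <= B"
 proof (rule Bolzano[where P="%a b. EX B. \<forall>s\<in>{a..b}. 0 <= s --> abs (f s) <= B"])
  fix a b c :: real
  assume "EX B. \<forall>s\<in>{a..b}. 0 <= s --> abs (f s) <= B" "EX B. \<forall>s\<in>{b..c}. 0 <= s --> abs (f s) <= B"
  then obtain B1 B2 where B: "!!s. s \<in> {a..b} ==> 0 <= s ==> abs (f s) <= B1"
   "!!s. s \<in> {b..c} ==> 0 <= s ==> abs (f s) <= B2" by blast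
  show "EX B. \<forall>s\<in>{a..c}. 0 <= s --> abs (f s) <= B"
  proof (intro exI[of _ "max B1 B2"] ballI impI)
   fix s assume "s \<in> {a..c}" "0 <= s"
   thus "abs (f s) <= max B1 B2" using B(1)[of s] B(2)[of s] by (cases "s <= b") auto
  qed
 next
  fix x :: real assume x: "0 <= x" "x <= T"
  have "\<forall>\<^sub>F s in at_right x. abs (f s) < abs (f x) + 1" using tendsto_rabs[OF cadlag_right[OF f x(1)]] by (rule order_tendstoD) simp
  then obtain e where e: "x < e" "!!s. x < s ==> s < e ==> abs (f s) < abs (f x) + 1" unfolding eventually_at_right_field by auto
  obtain d B where d: "0 < d" "!!s. 0 <= s ==> x - d < s ==> s < x ==> abs (f s) <= B"
  proof (cases "x = 0")
   case True
   thus ?thesis using that[of 1] by auto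
  next
   case False
   then obtain l where "(f ---> l) (at_left x)" using cadlag_left[OF f, of x] x by force
   hence "((%s. abs (f s)) ---> abs l) (at_left x)" by (rule tendsto_rabs)
   hence "\<forall>\<^sub>F s in at_left x. abs (f s) < abs l + 1" by (rule order_tendstoD) simp
   then obtain b where "b < x" "!!s. b < s ==> s < x ==> abs (f s) < abs l + 1" unfolding eventually_at_left_field by auto
   thus ?thesis using that[of "x - b" "abs l + 1"] by force
  qed
  show "EX d>0. ALL a b. a <= x & x <= b & b - a < d --> (EX B. \<forall>s\<in>{a..b}. 0 <= s --> abs (f s) <= B)"
  proof (rule exI[of _ "min d (e - x)"], intro conjI allI impI)
   fix a b assume ab: "a <= x & x <= b & b - a < min d (e - x)"
   show "EX B. \<forall>s\<in>{a..b}. 0 <= s --> abs (f s) <= B"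
   proof (intro exI[of _ "max B (abs (f x) + 1)"] ballI impI)
    fix s assume "s \<in> {a..b}" "0 <= s"
    thus "abs (f s) <= max B (abs (f x) + 1)" using d(2)[of s] e(2)[of s] ab by (cases s x rule: linorder_cases) auto
   qed
  qed (use d e in auto)
 qed
 then obtain B where B: "\<forall>s\<in>{0..T}. 0 <= s --> abs (f s) <= B" by blast
 show ?thesis
 proof (rule that[of "max 0 B"])
  fix s assume "0 <= s" "s <= T"
  thus "abs (f s) <= max 0 B" using B by (auto intro: max.coboundedI2)
 qed simp
qed (use that[of 0] in auto)

lemma wsup_bdd:
 assumes "cadlag f" "0 <= s" shows "bdd_above (f ` {s..t})"
proof -
 obtain B where "!!r. 0 <= r ==> r <= t ==> abs (f r) <= B" using cadlag_bounded[OF assms(1), of t] by auto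
 thus ?thesis using assms(2) by (intro bdd_aboveI[of _ B]) (force simp: abs_le_iff)
qed

lemma wsup_upper: "cadlag f ==> 0 <= s ==> s <= r ==> r <= t ==> f r <= wsup f s t" unfolding wsup_def by (intro cSUP_upper wsup_bdd) auto

lemma wsup_least: "s <= t ==> (!!r. s <= r ==> r <= t ==> f r <= B) ==> wsup f s t <= B" unfolding wsup_def by (intro cSUP_least) auto

lemma wsup_refl [simp]: "wsup f s s = f s" by (simp add: wsup_def)

lemma wsup_less:
 assumes "s <= t" "x < wsup f s t"
 obtains r where "s <= r" "r <= t" "x < f r" using wsup_least[OF assms(1), of f x] assms(2) by (meson linorder_not_less)

lemma wsup_split:
 assumes f: "cadlag f" and "0 <= s" "s <= t" "t <= u"
 shows "wsup f s u = max (wsup f s t) (wsup f t u)"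
proof (rule antisym)
 show "wsup f s u <= max (wsup f s t) (wsup f t u)"
 proof (rule wsup_least)
  fix r assume "s <= r" "r <= u"
  thus "f r <= max (wsup f s t) (wsup f t u)" using wsup_upper[OF f, of s r t] wsup_upper[OF f, of t r u] assms by (cases "r <= t") auto
 qed (use assms in auto)
 show "max (wsup f s t) (wsup f t u) <= wsup f s u" using assms by (auto intro!: max.boundedI wsup_least wsup_upper[OF f])
qed

lemma wsup_mono: "cadlag f ==> 0 <= s ==> s <= t ==> t <= u ==> wsup f s t <= wsup f s u" using wsup_split[of f s t u] by simp

lemma wsup_right_limit:
 assumes f: "cadlag f" and st: "0 <= s" "s <= t"
 shows "(wsup f s ---> wsup f s t) (at_right t)"
proof (rule decreasing_tendsto)
 show "\<forall>\<^sub>F u in at_right t. wsup f s t <= wsup f s u" using eventually_at_right_less[of t] by eventually_elim (use st wsup_mono[OF f] in auto)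
 fix x assume x: "wsup f s t < x"
 hence "f t < x" using wsup_upper[OF f st(1) st(2), of t] by simp
 then obtain y where y: "f t < y" "y < x" using dense by blast
 have "\<forall>\<^sub>F u in at_right t. f u < y" using cadlag_right[OF f] st y(1) by (intro order_tendstoD) auto
 then obtain e where e: "t < e" "!!u. t < u ==> u < e ==> f u < y" unfolding eventually_at_right_field by auto
 have "\<forall>\<^sub>F u in at_right t. t < u & u < e" unfolding eventually_at_right_field using e(1) by auto
 thus "\<forall>\<^sub>F u in at_right t. wsup f s u < x"
 proof eventually_elim
  case (elim u)
  have "wsup f t u <= y"
  proof (rule wsup_least)
   fix r assume "t <= r" "r <= u"
   thus "f r <= y" using e(2)[of r] y elim by (cases "r = t") auto
  qed (use elim in simp)
  thus ?case using wsup_split[OF f st, of u] elim x y by simp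
 qed
qed

text \<open>Cutting \<open>[s, u]\<close> off the window matters only if the supremum there exceeds
  everything later, in particular \<open>f u\<close>. The error is controlled by a quantity that
  vanishes as \<open>u\<close> decreases to \<open>s\<close>, whatever the right end
  \<open>t\<close> is.\<close>

lemma wsup_window_error:
 assumes f: "cadlag f" and "0 <= s" "s <= u" "u <= t"
 shows "abs (wsup f u t - wsup f s t) <= abs (wsup f s u - f u)" using wsup_split[OF assms] wsup_upper[OF f, of u u t] wsup_upper[OF f, of s u u] assms by auto

text \<open>\<open>f t <= l\<close> excludes an upward jump at \<open>t\<close>, the only way in
  which the supremum could miss its left limit. The shortfall of a surplus without downward jumps
  satisfies it.\<close>

lemma wsup_left_limit:
 assumes f: "cadlag f" and st: "0 <= s" "s < t" and l: "(f ---> l) (at_left t)" "f t <= l"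
 shows "(wsup f s ---> wsup f s t) (at_left t)"
proof (rule increasing_tendsto)
 have ev: "\<forall>\<^sub>F u in at_left t. s < u & u < t" unfolding eventually_at_left_field using st by auto
 thus "\<forall>\<^sub>F u in at_left t. wsup f s u <= wsup f s t" by eventually_elim (use st wsup_mono[OF f] in auto)
 fix x assume "x < wsup f s t"
 then obtain r where r: "s <= r" "r <= t" "x < f r" using wsup_less[of s t x f] st by auto
 show "\<forall>\<^sub>F u in at_left t. x < wsup f s u"
 proof (cases "r = t")
  case True
  hence "x < l" using l(2) r(3) by simp
  hence "\<forall>\<^sub>F u in at_left t. x < f u" by (rule order_tendstoD(1)[OF l(1)])
  with ev show ?thesis by eventually_elim (use wsup_upper[OF f st(1)] in \<open>force intro: less_le_trans\<close>)
 next
  case False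
  hence "\<forall>\<^sub>F u in at_left t. r < u & u < t" unfolding eventually_at_left_field using r by (intro exI[of _ r]) auto
  thus ?thesis by eventually_elim (use wsup_upper[OF f st(1) r(1)] r(3) in \<open>force intro: less_le_trans\<close>)
 qed
qed

lemma mono_cadlag:
 assumes mono: "mono_on {0..} f" and right: "!!t. 0 <= t ==> (f ---> f t) (at_right t)"
 shows "cadlag f" unfolding cadlag_def
proof (intro conjI allI impI)
 fix t :: real assume "0 <= t"
 thus "continuous (at_right t) f" using right by (simp add: continuous_within)
next
 fix t :: real assume t: "0 < t"
 have bdd: "bdd_above (f ` {0..<t})" using mono t by (intro bdd_aboveI[of _ "f t"]) (auto simp: mono_on_def)
 have "(f ---> (SUP r\<in>{0..<t}. f r)) (at_left t)"
 proof (rule increasing_tendsto)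
  have ev: "\<forall>\<^sub>F u in at_left t. 0 < u & u < t" unfolding eventually_at_left_field using t by auto
  thus "\<forall>\<^sub>F u in at_left t. f u <= (SUP r\<in>{0..<t}. f r)" by eventually_elim (use bdd in \<open>auto intro: cSUP_upper\<close>)
  fix x assume "x < (SUP r\<in>{0..<t}. f r)"
  then obtain r where r: "0 <= r" "r < t" "x < f r" using less_cSUP_iff[OF _ bdd] t by auto
  have "\<forall>\<^sub>F u in at_left t. r < u & u < t" unfolding eventually_at_left_field using r by auto
  thus "\<forall>\<^sub>F u in at_left t. x < f u" by eventually_elim (use mono r in \<open>force simp: mono_on_def intro: less_le_trans\<close>)
 qed
 thus "EX l. (f ---> l) (at_left t)" by blast
qed

lemma cadlag_wsup:
 assumes "cadlag f" shows "cadlag (wsup f 0)" "mono_on {0..} (wsup f 0)"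
proof -
 show "mono_on {0..} (wsup f 0)" by (auto intro!: mono_onI wsup_mono assms)
 thus "cadlag (wsup f 0)" by (rule mono_cadlag) (rule wsup_right_limit[OF assms order_refl])
qed

definition dyadic_max :: "(real => real) => real => real => nat => real" where
 "dyadic_max f s t n = Max ((%j. f (s + real j * (t / 2 ^ n))) ` {..2 ^ n})"

lemma dyadic_max_le:
 assumes f: "cadlag f" and "0 <= s" "0 <= t"
 shows "dyadic_max f s t n <= wsup f s (s + t)"
proof -
 have "f (s + real j * (t / 2 ^ n)) <= wsup f s (s + t)" if j: "j <= 2 ^ n" for j
 proof -
  have "real j <= 2 ^ n" using j by (metis of_nat_le_iff of_nat_numeral of_nat_power)
  hence "real j * (t / 2 ^ n) <= 2 ^ n * (t / 2 ^ n)" using assms by (intro mult_right_mono) auto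
  thus ?thesis using assms by (intro wsup_upper) auto
 qed
 thus ?thesis unfolding dyadic_max_def by (auto simp: Max_le_iff)
qed

lemma dyadic_max_incseq: "incseq (dyadic_max f s t)"
proof (rule incseq_SucI)
 fix n
 show "dyadic_max f s t n <= dyadic_max f s t (Suc n)" unfolding dyadic_max_def
 proof (rule Max_mono)
  show "(%j. f (s + real j * (t / 2 ^ n))) ` {..2 ^ n} <= (%j. f (s + real j * (t / 2 ^ Suc n))) ` {..2 ^ Suc n}"
  proof safe
   fix j :: nat assume "j <= 2 ^ n"
   thus "f (s + real j * (t / 2 ^ n)) \<in> (%j. f (s + real j * (t / 2 ^ Suc n))) ` {..2 ^ Suc n}" by (intro image_eqI[of _ _ "2 * j"]) auto
  qed
 qed auto
qed

text \<open>The supremum is nearly attained at some \<open>r\<close> and, by right continuity, on a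
  small interval to the right of \<open>r\<close>, which every fine grid meets. The right end of the
  window has no room to its right, but it belongs to every grid.\<close>

lemma dyadic_max_limit:
 assumes f: "cadlag f" and st: "0 <= s" "0 <= t"
 shows "dyadic_max f s t ----> wsup f s (s + t)"
proof (rule increasing_tendsto)
 show "\<forall>\<^sub>F n in sequentially. dyadic_max f s t n <= wsup f s (s + t)" using dyadic_max_le[OF assms] by simp
 fix x assume x: "x < wsup f s (s + t)"
 obtain r where r: "s <= r" "r <= s + t" "x < f r" using wsup_less[OF _ x] st by auto
 have upper: "f (s + real j * (t / 2 ^ n)) <= dyadic_max f s t n" if "j <= 2 ^ n" for j n unfolding dyadic_max_def using that by (intro Max_ge) auto
 show "\<forall>\<^sub>F n in sequentially. x < dyadic_max f s t n"
 proof (cases "r = s + t")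
  case True
  hence "x < dyadic_max f s t n" for n using upper[of "2 ^ n" n] r(3) by simp
  thus ?thesis by simp
 next
  case False
  hence t: "0 < t" "r < s + t" using r by auto
  have "\<forall>\<^sub>F u in at_right r. x < f u" using cadlag_right[OF f] r st by (intro order_tendstoD) auto
  then obtain e where e: "r < e" "!!u. r < u ==> u < e ==> x < f u" unfolding eventually_at_right_field by auto
  have "(%n. t * (1 / 2) ^ n) ----> t * 0" by (intro tendsto_intros LIMSEQ_power_zero) auto
  hence "(%n. t * (1 / 2) ^ n) ----> 0" by simp
  hence "\<forall>\<^sub>F n in sequentially. t * (1 / 2) ^ n < min (e - r) (s + t - r)" by (rule order_tendstoD) (use e t in auto)
  thus ?thesis
  proof eventually_elim
   case (elim n)
   define h where "h = t / 2 ^ n"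
   have h: "0 < h" "h < e - r" "h < s + t - r" using elim t by (auto simp: h_def power_divide)
   define j where "j = nat \<lceil>(r - s) / h\<rceil>"
   have jr: "real j = of_int \<lceil>(r - s) / h\<rceil>" using r h by (simp add: j_def)
   have j: "(r - s) / h <= real j" "real j < (r - s) / h + 1" unfolding jr by linarith+
   hence j': "r <= s + real j * h" "s + real j * h < r + h" using h by (auto simp: field_simps)
   hence "real j * h < t" using h by simp
   hence "real j < 2 ^ n" using t by (simp add: h_def field_simps)
   hence "j <= 2 ^ n" by (metis less_imp_le of_nat_less_iff of_nat_numeral of_nat_power)
   hence "f (s + real j * h) <= dyadic_max f s t n" unfolding h_def by (rule upper)
   moreover have "x < f (s + real j * h)" using e(2)[of "s + real j * h"] r(3) j' h by (cases "r = s + real j * h") auto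
   ultimately show ?case by simp
  qed
 qed
qed

lemma wsup_measurable:
 assumes cad: "!!w. w \<in> space G ==> cadlag (%t. Z t w)"
  and meas: "!!t. s <= t ==> t <= u ==> Z t \<in> Bor G" and st: "0 <= s" "s <= u"
 shows "(%w. wsup (%t. Z t w) s u) \<in> Bor G"
proof (rule borel_measurable_LIMSEQ_real)
 fix w assume "w \<in> space G"
 thus "(%n. dyadic_max (%t. Z t w) s (u - s) n) ----> wsup (%t. Z t w) s u" using dyadic_max_limit[OF cad, of w s "u - s"] st by simp
next
 fix n
 have "Z (s + real j * ((u - s) / 2 ^ n)) \<in> Bor G" if "j \<in> {..2 ^ n}" for j
 proof (rule meas)
  have "real j <= 2 ^ n" using that by (metis atMost_iff of_nat_le_iff of_nat_numeral of_nat_power)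
  hence "real j * ((u - s) / 2 ^ n) <= 2 ^ n * ((u - s) / 2 ^ n)" using st by (intro mult_right_mono) auto
  thus "s + real j * ((u - s) / 2 ^ n) <= u" by simp
 qed (use st in auto)
 thus "(%w. dyadic_max (%t. Z t w) s (u - s) n) \<in> Bor G" unfolding dyadic_max_def by (intro borel_measurable_Max) auto
qed

section \<open>Independence and exponential times\<close>

context prob_space
begin

text \<open>Pairing \<open>Y\<close> with the identity into the sub-algebra \<open>B\<close> turns
  independence from a \<sigma>-algebra into a product law. A functional that depends on the path
  only through \<open>B\<close> can then be integrated by Fubini with \<open>Y\<close>
  frozen.\<close>

lemma indep_product_distr:
 assumes Y: "Y \<in> measurable M S" and B: "subalgebra M B"
  and ind: "indep_set {Y -` A Int space M | A. A \<in> sets S} (sets B)"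
 shows "distr M (S \<Otimes>\<^sub>M B) (%w. (Y w, w)) = distr M S Y \<Otimes>\<^sub>M distr M B (%w. w)"
proof -
 have id: "(%w. w) \<in> measurable M B" using B by (auto simp: subalgebra_def measurable_def)
 interpret B: prob_space "distr M B (%w. w)" by (rule prob_space_distr[OF id])
 interpret Y: prob_space "distr M S Y" by (rule prob_space_distr[OF Y])
 show ?thesis
 proof (rule pair_measure_eqI[symmetric])
  show "sigma_finite_measure (distr M S Y)" "sigma_finite_measure (distr M B (%w. w))" ..
  show "sets (distr M S Y \<Otimes>\<^sub>M distr M B (%w. w)) = sets (distr M (S \<Otimes>\<^sub>M B) (%w. (Y w, w)))" by (simp cong: sets_pair_measure_cong)
  fix A C assume "A \<in> sets (distr M S Y)" "C \<in> sets (distr M B (%w. w))"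
  hence A: "A \<in> sets S" and C: "C \<in> sets B" by auto
  have CM: "C \<in> sets M" "C <= space M" using C B sets.sets_into_space[OF C] by (auto simp: subalgebra_def)
  have "emeasure (distr M (S \<Otimes>\<^sub>M B) (%w. (Y w, w))) (A \<times> C)
    = emeasure M ((%w. (Y w, w)) -` (A \<times> C) Int space M)" using A C Y id by (intro emeasure_distr) auto
  also have "(%w. (Y w, w)) -` (A \<times> C) Int space M = (Y -` A Int space M) Int C" using CM by auto
  also have "emeasure M ... = emeasure M (Y -` A Int space M) * emeasure M C"
  proof -
   have "prob ((Y -` A Int space M) Int C) = prob (Y -` A Int space M) * prob C" by (rule indep_setD[OF ind]) (use A C in auto)
   thus ?thesis by (simp add: emeasure_eq_measure ennreal_mult')
  qed
  also have "... = emeasure (distr M S Y) A * emeasure (distr M B (%w. w)) C" using A C Y id CM by (simp add: emeasure_distr Int_absorb2)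
  finally show "emeasure (distr M S Y) A * emeasure (distr M B (%w. w)) C
   = emeasure (distr M (S \<Otimes>\<^sub>M B) (%w. (Y w, w))) (A \<times> C)" by simp
 qed
qed

lemma indep_nn_integral:
 assumes Y: "Y \<in> measurable M S" and B: "subalgebra M B"
  and ind: "indep_set {Y -` A Int space M | A. A \<in> sets S} (sets B)"
  and g: "g \<in> Bor (S \<Otimes>\<^sub>M B)"
 shows "(\<integral>\<^sup>+w. g (Y w, w) \<partial>M) = (\<integral>\<^sup>+y. (\<integral>\<^sup>+w. g (y, w) \<partial>M) \<partial>distr M S Y)"
proof -
 have id: "(%w. w) \<in> measurable M B" using B by (auto simp: subalgebra_def measurable_def)
 interpret B: prob_space "distr M B (%w. w)" by (rule prob_space_distr[OF id])
 have "(\<integral>\<^sup>+w. g (Y w, w) \<partial>M) = (\<integral>\<^sup>+z. g z \<partial>distr M (S \<Otimes>\<^sub>M B) (%w. (Y w, w)))" using Y id g by (subst nn_integral_distr) auto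
 also have "... = (\<integral>\<^sup>+z. g z \<partial>(distr M S Y \<Otimes>\<^sub>M distr M B (%w. w)))" unfolding indep_product_distr[OF Y B ind] ..
 also have "... = (\<integral>\<^sup>+y. (\<integral>\<^sup>+w. g (y, w) \<partial>distr M B (%w. w)) \<partial>distr M S Y)"
  using g by (intro B.nn_integral_fst[symmetric]) (simp cong: measurable_cong_sets sets_pair_measure_cong)
 also have "... = (\<integral>\<^sup>+y. (\<integral>\<^sup>+w. g (y, w) \<partial>M) \<partial>distr M S Y)" using g id by (intro nn_integral_cong nn_integral_distr) auto
 finally show ?thesis .
qed

lemma indep_integral:
 fixes g :: "_ => real"
 assumes Y: "Y \<in> measurable M S" and B: "subalgebra M B"
  and ind: "indep_set {Y -` A Int space M | A. A \<in> sets S} (sets B)"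
  and g: "g \<in> Bor (S \<Otimes>\<^sub>M B)"
  and int: "integrable M (%w. g (Y w, w))"
 shows "(LINT w|M. g (Y w, w)) = (LINT y|distr M S Y. (LINT w|M. g (y, w)))"
proof -
 have id: "(%w. w) \<in> measurable M B" using B by (auto simp: subalgebra_def measurable_def)
 interpret B: prob_space "distr M B (%w. w)" by (rule prob_space_distr[OF id])
 interpret Y: prob_space "distr M S Y" by (rule prob_space_distr[OF Y])
 interpret P: pair_prob_space "distr M S Y" "distr M B (%w. w)" ..
 have "(LINT w|M. g (Y w, w)) = (LINT z|distr M (S \<Otimes>\<^sub>M B) (%w. (Y w, w)). g z)" using Y id g by (subst integral_distr) auto
 also have "... = (LINT z|(distr M S Y \<Otimes>\<^sub>M distr M B (%w. w)). g z)" unfolding indep_product_distr[OF Y B ind] ..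
 also have "... = (LINT y|distr M S Y. (LINT w|distr M B (%w. w). g (y, w)))"
 proof (rule P.integral_fst'[symmetric])
  have "integrable (distr M (S \<Otimes>\<^sub>M B) (%w. (Y w, w))) g" using Y id g int by (subst integrable_distr_eq) auto
  thus "integrable (distr M S Y \<Otimes>\<^sub>M distr M B (%w. w)) g" unfolding indep_product_distr[OF Y B ind] .
 qed
 also have "... = (LINT y|distr M S Y. (LINT w|M. g (y, w)))" using g id by (intro Bochner_Integration.integral_cong refl integral_distr) auto
 finally show ?thesis .
qed

end

text \<open>A dyadic time strictly after \<open>t\<close>, even if \<open>t\<close> is dyadic
  itself. Strictness gives convergence along \<open>at_right t\<close> and suits random times known
  through the events \<open>S < t\<close>.\<close>

definition dyadic_above :: "nat => real => real" where
 "dyadic_above k t = (of_int \<lfloor>2 ^ k * t\<rfloor> + 1) / 2 ^ k"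

lemma dyadic_above: "t < dyadic_above k t" "dyadic_above k t <= t + 1 / 2 ^ k"
proof -
 have "of_int \<lfloor>2 ^ k * t\<rfloor> <= 2 ^ k * t" "2 ^ k * t < of_int \<lfloor>2 ^ k * t\<rfloor> + 1" by linarith+
 thus "t < dyadic_above k t" "dyadic_above k t <= t + 1 / 2 ^ k" unfolding dyadic_above_def by (auto simp: field_simps)
qed

lemma dyadic_above_tendsto: "filterlim (%k. dyadic_above k t) (at_right t) sequentially" unfolding filterlim_at
proof
 have "(%k. (1 / 2 :: real) ^ k) ----> 0" by (rule LIMSEQ_power_zero) simp
 hence "(%k. t + (1 / 2 :: real) ^ k) ----> t + 0" by (intro tendsto_add tendsto_const)
 hence lim: "(%k. t + 1 / 2 ^ k) ----> t" by (simp add: power_divide)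
 show "(%k. dyadic_above k t) ----> t" using dyadic_above(1)[of t] dyadic_above(2)[where t=t] by (intro tendsto_sandwich[OF _ _ tendsto_const lim] always_eventually allI) (auto intro: less_imp_le)
 show "\<forall>\<^sub>F k in sequentially. dyadic_above k t \<in> {t<..} & dyadic_above k t ~= t" using dyadic_above(1)[of t] by (auto simp: less_imp_neq[symmetric])
qed

text \<open>A right-continuous path is the limit of its values at \<open>dyadic_above k t\<close>, a
  time with countably many values. Negative times are folded to 0, since nothing is assumed about
  the process there.\<close>

lemma joint_measurable:
 fixes Z :: "real => 'a => real"
 assumes Z: "!!t. 0 <= t ==> Z t \<in> Bor G"
  and right: "!!w t. w \<in> space G ==> 0 <= t ==> ((%t. Z t w) ---> Z t w) (at_right t)"
 shows "(%(t, w). Z (max 0 t) w) \<in> Bor (borel \<Otimes>\<^sub>M G)"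
proof (rule borel_measurable_LIMSEQ_real)
 fix z :: "real \<times> 'a" assume "z \<in> space (borel \<Otimes>\<^sub>M G)"
 hence "snd z \<in> space G" by (auto simp: space_pair_measure)
 from filterlim_compose[OF right[OF this, of "max 0 (fst z)"] dyadic_above_tendsto]
 show "(%k. Z (dyadic_above k (max 0 (fst z))) (snd z)) ----> (case z of (t, w) => Z (max 0 t) w)" by (simp add: split_beta)
next
 fix k
 have 1: "(%z::real \<times> 'a. \<lfloor>2 ^ k * max 0 (fst z)\<rfloor>) \<in> measurable (borel \<Otimes>\<^sub>M G) (count_space UNIV)" by measurable
 \<comment> \<open>Composition over a countable index asks for measurability at every integer, hence
   \<open>max 0 i\<close>; at the indices that occur it changes nothing.\<close>
 have "(%z. Z ((of_int (max 0 i) + 1) / 2 ^ k) (snd z)) \<in> Bor (borel \<Otimes>\<^sub>M G)" for i :: int by (rule measurable_compose[OF measurable_snd Z]) auto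
 from measurable_compose_countable[of "%i z. Z ((of_int (max 0 i) + 1) / 2 ^ k) (snd z)", OF this 1]
 have "(%z. Z ((of_int (max 0 \<lfloor>2 ^ k * max 0 (fst z :: real)\<rfloor>) + 1) / 2 ^ k) (snd z)) \<in> Bor (borel \<Otimes>\<^sub>M G)" .
 moreover have "max 0 \<lfloor>2 ^ k * max 0 x\<rfloor> = \<lfloor>2 ^ k * max 0 (x::real)\<rfloor>" for x by (rule max_absorb2) simp
 ultimately show "(%z. Z (dyadic_above k (max 0 (fst z))) (snd z)) \<in> Bor (borel \<Otimes>\<^sub>M G)" unfolding dyadic_above_def by simp
qed

section \<open>Exponential distributions\<close>

definition expo :: "real => real measure" where
 "expo l = density lborel (%t. ennreal (exponential_density l t))"

lemma sets_expo [simp, measurable_cong]: "sets (expo l) = sets borel"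
 and space_expo [simp]: "space (expo l) = UNIV" by (simp_all add: expo_def)

lemma prob_space_expo: "0 < l ==> prob_space (expo l)" unfolding expo_def by (rule prob_space_exponential_density)

lemma expo_pos: "AE t in expo l. 0 < t"
proof -
 have "AE t in lborel. t ~= (0::real)" by (rule AE_lborel_singleton)
 hence "AE t in lborel. 0 < ennreal (exponential_density l t) --> 0 < t" by eventually_elim (auto simp: exponential_density_def ennreal_zero_less_top)
 thus ?thesis unfolding expo_def by (subst AE_density) auto
qed

lemma expo_no_atom: "AE t in expo l. t ~= a" unfolding expo_def by (subst AE_density) (use AE_lborel_singleton[of a] in auto)

lemma integral_expo:
 fixes f :: "real => real"
 assumes "0 < l" "f \<in> Bor borel"
 shows "(LINT t|expo l. f t) = (LINT t|lborel. exponential_density l t * f t)" unfolding expo_def using assms by (subst integral_density) (auto simp: exponential_density_nonneg)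

lemma nn_integral_expo:
 assumes "f \<in> Bor borel"
 shows "(\<integral>\<^sup>+t. f t \<partial>expo l) = (\<integral>\<^sup>+t. ennreal (exponential_density l t) * f t \<partial>lborel)"
 unfolding expo_def using assms by (subst nn_integral_density) auto

text \<open>Discounting as killing: the factor \<open>exp (- r * t)\<close> merges into the density,
  which becomes that of rate \<open>l + r\<close> up to the mass \<open>l / (l + r)\<close>.\<close>

lemma expo_discount:
 fixes f :: "real => real"
 assumes "0 < l" "0 < r" "f \<in> Bor borel"
 shows "(LINT t|expo l. exp (- r * t) * f t) = l / (l + r) * (LINT t|expo (l + r). f t)"
proof -
 have "exponential_density l t * (exp (- r * t) * f t) = l / (l + r) * (exponential_density (l + r) t * f t)" for t
 proof -
  have "exp (- (t * l)) * exp (- (r * t)) = exp (- (t * (l + r)))" by (simp add: mult_exp_exp algebra_simps)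
  thus ?thesis using assms by (auto simp: exponential_density_def)
 qed
 thus ?thesis using assms by (subst (1 2) integral_expo) auto
qed

lemma expo_discount_nn:
 assumes "0 < l" "0 < r" "f \<in> Bor borel"
 shows "(\<integral>\<^sup>+t. ennreal (exp (- r * t)) * f t \<partial>expo l) = ennreal (l / (l + r)) * (\<integral>\<^sup>+t. f t \<partial>expo (l + r))"
proof -
 have "ennreal (exponential_density l t) * (ennreal (exp (- r * t)) * f t)
   = ennreal (l / (l + r)) * (ennreal (exponential_density (l + r) t) * f t)" for t
 proof -
  have e: "exp (- (t * l)) * exp (- (r * t)) = exp (- (t * (l + r)))" by (simp add: mult_exp_exp algebra_simps)
  have "exponential_density l t * exp (- r * t) = l / (l + r) * exponential_density (l + r) t" using assms e by (auto simp: exponential_density_def)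
  hence "ennreal (exponential_density l t) * ennreal (exp (- r * t)) = ennreal (l / (l + r)) * ennreal (exponential_density (l + r) t)"
   using assms by (simp add: ennreal_mult'[symmetric] exponential_density_nonneg)
  thus ?thesis by (simp add: mult.assoc[symmetric])
 qed
 thus ?thesis using assms by (subst (1 2) nn_integral_expo) (auto intro!: nn_integral_cmult)
qed

text \<open>Memorylessness in integrated form: beyond \<open>s\<close> the law restarts, weighted by
  the probability of getting there.\<close>

lemma expo_shift:
 fixes f :: "real => real"
 assumes l: "0 < l" and s: "0 <= s" and f: "f \<in> Bor borel"
 shows "(LINT t|expo l. indicator {s..} t * f t) = exp (- l * s) * (LINT t|expo l. f (s + t))"
proof -
 have "(LINT t|expo l. indicator {s..} t * f t) = (LINT t|lborel. exponential_density l t * (indicator {s..} t * f t))" using f l by (intro integral_expo) auto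
 also have "... = (LINT t|lborel. exponential_density l (s + t) * (indicator {s..} (s + t) * f (s + t)))"
  using lborel_integral_real_affine[of 1 "%t. exponential_density l t * (indicator {s..} t * f t)" s] by simp
 also have "... = (LINT t|lborel. exp (- l * s) * (exponential_density l t * f (s + t)))"
 proof (intro Bochner_Integration.integral_cong refl)
  fix t
  have "exp (- (s + t) * l) = exp (- l * s) * exp (- t * l)" by (simp add: mult_exp_exp algebra_simps)
  thus "exponential_density l (s + t) * (indicator {s..} (s + t) * f (s + t)) = exp (- l * s) * (exponential_density l t * f (s + t))" using s by (simp add: exponential_density_def indicator_def)
 qed
 also have "... = exp (- l * s) * (LINT t|expo l. f (s + t))" using f l by (subst integral_expo) auto
 finally show ?thesis .
qed

lemma expo_less:
 assumes l: "0 < l" and a: "0 <= a"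
 shows "(LINT t|expo l. indicator {..<a} t) = 1 - exp (- l * a)"
proof -
 interpret prob_space "expo l" by (rule prob_space_expo[OF l])
 have "(LINT t|expo l. indicator {a..} t) = exp (- l * a)" using expo_shift[OF l a, of "%_. 1"] prob_space by simp
 moreover have "(LINT t|expo l. indicator {..<a} t) = (LINT t|expo l. 1 - (indicator {a..} t :: real))" by (intro Bochner_Integration.integral_cong) (auto simp: indicator_def)
 moreover have "... = 1 - (LINT t|expo l. indicator {a..} t)"
 proof -
  have int: "integrable (expo l) (indicator {a..} :: real => real)" by (rule integrable_real_indicator) (auto simp: emeasure_eq_measure)
  show ?thesis using Bochner_Integration.integral_diff[OF integrable_const int, of 1] prob_space by simp
 qed
 ultimately show ?thesis by simp
qed

lemma expo_exp_integrable:
 assumes "0 <= ep" "ep < l"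
 shows "integrable (expo l) (%t. exp (ep * t))" "(LINT t|expo l. exp (ep * t)) = l / (l - ep)"
proof -
 have l: "0 < l" "0 < l - ep" using assms by auto
 have eq: "ennreal (exponential_density l t) * ennreal (exp (ep * t)) = ennreal (l / (l - ep)) * ennreal (exponential_density (l - ep) t)" for t
 proof -
  have e: "exp (- (t * l)) * exp (ep * t) = exp (- (t * (l - ep)))" by (simp add: mult_exp_exp algebra_simps)
  have "exponential_density l t * exp (ep * t) = l / (l - ep) * exponential_density (l - ep) t" using l e by (auto simp: exponential_density_def)
  thus ?thesis using l by (simp add: ennreal_mult'[symmetric] exponential_density_nonneg)
 qed
 interpret E: prob_space "expo (l - ep)" by (rule prob_space_expo[OF l(2)])
 have "(\<integral>\<^sup>+t. ennreal (exp (ep * t)) \<partial>expo l) = (\<integral>\<^sup>+t. ennreal (l / (l - ep)) * ennreal (exponential_density (l - ep) t) \<partial>lborel)"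
  by (subst nn_integral_expo) (auto simp: eq)
 also have "... = ennreal (l / (l - ep)) * (\<integral>\<^sup>+t. 1 \<partial>expo (l - ep))" by (subst nn_integral_expo) (auto simp: nn_integral_cmult)
 also have "... = ennreal (l / (l - ep))" using E.emeasure_space_1 by simp
 finally have "has_bochner_integral (expo l) (%t. exp (ep * t)) (l / (l - ep))" using l by (intro has_bochner_integral_nn_integral) auto
 thus "integrable (expo l) (%t. exp (ep * t))" "(LINT t|expo l. exp (ep * t)) = l / (l - ep)" by (auto simp: has_bochner_integral_iff)
qed

lemma expo_min:
 assumes "0 < l" "0 < r"
 shows "distr (expo l \<Otimes>\<^sub>M expo r) borel (%(s, t). min s t) = expo (l + r)"
proof -
 interpret L: prob_space "expo l" by (rule prob_space_expo) fact
 interpret R: prob_space "expo r" by (rule prob_space_expo) fact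
 interpret P: pair_prob_space "expo l" "expo r" ..
 have gt: "measure (expo u) {a<..} = exp (- u * a)" if "0 < u" "0 <= a" for a u
 proof -
  interpret U: prob_space "expo u" by (rule prob_space_expo[OF that(1)])
  have "measure (expo u) {a<..} = measure (expo u) {a..}" using expo_no_atom[where l=u and a=a] by (intro U.finite_measure_eq_AE) auto
  also have "... = exp (- u * a)" using expo_shift[OF that, of "%_. 1"] U.prob_space by simp
  finally show ?thesis .
 qed
 have "distributed (expo l \<Otimes>\<^sub>M expo r) lborel (%z. min (fst z) (snd z)) (exponential_density (l + r))"
 proof (subst P.exponential_distributed_iff, safe)
  fix a :: real assume a: "0 <= a"
  have sp: "space (expo l \<Otimes>\<^sub>M expo r) = UNIV" by (simp add: space_pair_measure)
  have "P.prob {x \<in> space (expo l \<Otimes>\<^sub>M expo r). min (fst x) (snd x) <= a} = P.prob (space (expo l \<Otimes>\<^sub>M expo r) - {a<..} \<times> {a<..})"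
   by (intro arg_cong[where f=P.prob]) (auto simp: sp min_def)
  also have "... = 1 - P.prob ({a<..} \<times> {a<..})" by (intro P.prob_compl) simp
  also have "P.prob ({a<..} \<times> {a<..}) = exp (- l * a) * exp (- r * a)"
  proof -
   have "emeasure (expo l \<Otimes>\<^sub>M expo r) ({a<..} \<times> {a<..}) = emeasure (expo l) {a<..} * emeasure (expo r) {a<..}" by (rule R.emeasure_pair_measure_Times) auto
   thus ?thesis unfolding L.emeasure_eq_measure R.emeasure_eq_measure P.emeasure_eq_measure gt[OF assms(1) a] gt[OF assms(2) a] by (simp add: ennreal_mult'[symmetric] del: ennreal_mult'')
  qed
  also have "... = exp (- a * (l + r))" by (simp add: mult_exp_exp algebra_simps)
  finally show "P.prob {x \<in> space (expo l \<Otimes>\<^sub>M expo r). min (fst x) (snd x) <= a} = 1 - exp (- a * (l + r))" .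
 qed (use assms in auto)
 from distributed_distr_eq_density[OF this] show ?thesis unfolding expo_def by (simp add: split_beta cong: distr_cong)
qed

section \<open>Models with regular paths\<close>

lemma cadlag_shift:
 assumes f: "cadlag f" and s: "0 <= s" shows "cadlag (%t. f (s + t))" unfolding cadlag_def
proof (intro conjI allI impI)
 fix t :: real assume t: "0 <= t"
 have "(f ---> f (s + t)) (at_right (s + t))" using cadlag_right[OF f, of "s + t"] t s by simp
 hence "((%t. f (s + t)) ---> f (s + t)) (at_right t)" by (subst (asm) at_right_to_0) (subst at_right_to_0, simp add: filterlim_filtermap add_ac)
 thus "continuous (at_right t) (%t. f (s + t))" by (simp add: continuous_within)
next
 fix t :: real assume t: "0 < t"
 then obtain l where "(f ---> l) (at_left (s + t))" using cadlag_left[OF f, of "s + t"] s by auto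
 hence "((%t. f (s + t)) ---> l) (at_left t)" by (subst (asm) at_left_to_0) (subst at_left_to_0, simp add: filterlim_filtermap add_ac)
 thus "EX l. ((%t. f (s + t)) ---> l) (at_left t)" by blast
qed

lemma left_lim_eq:
 assumes "0 < t" "(f ---> l) (at_left t)" shows "left_lim f t = l" unfolding left_lim_def using eventually_at_left_real[OF assms(1)]
 by (intro tendsto_Lim Lim_transform_eventually[OF assms(2)]) (auto elim!: eventually_mono simp: zero_ext_def)

lemma (in prob_space) indep_set_mono:
 assumes "indep_set A B" "A' <= A" "B' <= B" shows "indep_set A' B'"
proof (rule indep_setI)
 show "A' <= events" "B' <= events" using assms indep_setD_ev1[OF assms(1)] indep_setD_ev2[OF assms(1)] by auto
 show "prob (a Int b) = prob a * prob b" if "a \<in> A'" "b \<in> B'" for a b using indep_setD[OF assms(1)] that assms by blast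
qed

text \<open>Path properties are required at every \<open>w\<close> of the space, so that path
  arguments run without exceptional sets. \<open>N_simple\<close> says that arrivals come one at a
  time. The Laplace exponent survives only as \<open>X_exp_moment\<close>, which controls downward
  excursions and, with \<open>X_integrable_1\<close>, gives absolute moments.\<close>

locale regular_model = prob_space M for M :: "'a measure" +
 fixes F :: "real => 'a measure" and X :: "real => 'a => real" and N :: "real => 'a => nat" and \<gamma> :: real
 assumes F_sub: "!!t. 0 <= t ==> subalgebra M (F t)"
  and F_mono: "!!s t. 0 <= s ==> s <= t ==> sets (F s) <= sets (F t)"
  and X_F: "!!t. 0 <= t ==> X t \<in> Bor (F t)"
  and N_F: "!!t. 0 <= t ==> (%w. real (N t w)) \<in> Bor (F t)"
  and X_cadlag: "!!w. w \<in> space M ==> cadlag (%t. X t w)"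
  and X_0: "!!w. w \<in> space M ==> X 0 w = 0"
  and X_jump: "!!w t. w \<in> space M ==> 0 < t ==> 0 <= jump (%s. X s w) t"
  and N_mono: "!!w. w \<in> space M ==> mono_on {0..} (%t. N t w)"
  and N_cadlag: "!!w. w \<in> space M ==> cadlag (%t. real (N t w))"
  and N_0: "!!w. w \<in> space M ==> N 0 w = 0"
  and N_unbounded: "!!w n. w \<in> space M ==> EX t>=0. n <= N t w"
  and N_simple: "!!w n. w \<in> space M ==> N (arrival_time (%t. N t w) n) w = n"
  and increments_indep: "!!t. t >= 0 ==>
     indep_set (sets (F t))
      (sigma_sets (space M)
       (events_of M (%s w. X s w - X t w) {t..} \<union>
        events_of M (%s w. real (N s w) - real (N t w)) {t..}))"
  and XN_indep: "indep_set (events_of M X {0..}) (events_of M (%t w. real (N t w)) {0..})"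
  and X_stationary: "!!s t. 0 <= s ==> 0 <= t ==> distr M borel (%w. X (s + t) w - X s w) = distr M borel (X t)"
  and N_no_arrival: "!!s t. 0 <= s ==> 0 <= t ==> prob {w \<in> space M. N (s + t) w = N s w} = exp (- \<gamma> * t)"
  and X_integrable_1: "integrable M (X 1)"
  and X_exp_moment: "EX C. \<forall>t\<in>{0..1}. integrable M (%w. exp (- X t w)) & expectation (%w. exp (- X t w)) <= C"
  and X_not_mono: "~ (AE w in M. mono_on {0..} (%t. X t w))"
  and intensity_pos: "0 < \<gamma>"
begin

text \<open>The information in the increments after \<open>s\<close>, independent of
  \<open>F s\<close>. Its two parts, from \<open>X\<close> and from \<open>N\<close>, are also
  independent of each other.\<close>

definition future :: "real => 'a measure" where
 "future s = sigma (space M) (events_of M (%r w. X r w - X s w) {s..} \<union>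
   events_of M (%r w. real (N r w) - real (N s w)) {s..})"

definition X_future :: "real => 'a measure" where
 "X_future s = sigma (space M) (events_of M (%r w. X r w - X s w) {s..})"

definition N_future :: "real => 'a measure" where
 "N_future s = sigma (space M) (events_of M (%r w. real (N r w) - real (N s w)) {s..})"

definition Xi :: "real => real => 'a => real" where
 "Xi s t w = X (s + t) w - X s w"

definition Ii :: "real => real => 'a => real" where
 "Ii s t w = wsup (%r. - Xi s r w) 0 t"

abbreviation "XI s t w == (Xi s t w, Ii s t w)"

lemma space_F: "0 <= t ==> space (F t) = space M" using F_sub[of t] by (simp add: subalgebra_def)

lemma F_le_M: "0 <= t ==> Z \<in> Bor (F t) ==> Z \<in> Bor M" using measurable_from_subalg[OF F_sub] .

lemma F_le_F:
 assumes "0 <= s" "s <= t" "Z \<in> measurable (F s) S" shows "Z \<in> measurable (F t) S"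
proof (rule measurable_from_subalg[OF _ assms(3)])
 show "subalgebra (F t) (F s)" using F_mono[OF assms(1,2)] space_F assms by (simp add: subalgebra_def)
qed

lemma X_meas: "0 <= t ==> X t \<in> Bor M" using F_le_M X_F by blast

lemma N_meas: "0 <= t ==> (%w. real (N t w)) \<in> Bor M" using F_le_M N_F by blast

lemma events_Pow: "events_of M Y I <= Pow (space M)" unfolding events_of_def by (rule subsetI, rule PowI, erule sigma_sets_into_sp[rotated]) auto

lemma space_future [simp]: "space (future s) = space M" "space (X_future s) = space M" "space (N_future s) = space M" by (simp_all add: future_def X_future_def N_future_def space_measure_of_conv)

lemma sets_future:
 "sets (future s) = sigma_sets (space M) (events_of M (%r w. X r w - X s w) {s..} \<union>
   events_of M (%r w. real (N r w) - real (N s w)) {s..})"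
 "sets (X_future s) = sigma_sets (space M) (events_of M (%r w. X r w - X s w) {s..})"
 "sets (N_future s) = sigma_sets (space M) (events_of M (%r w. real (N r w) - real (N s w)) {s..})" using events_Pow by (simp_all add: future_def X_future_def N_future_def)

lemma events_sub:
 assumes "!!t. t \<in> I ==> Y t \<in> Bor G" "space G = space M"
 shows "events_of M Y I <= sets G" unfolding events_of_def assms(2)[symmetric] by (rule sets.sigma_sets_subset) (auto intro: measurable_sets[OF assms(1)])

lemma events_measurable:
 assumes "t \<in> I" "events_of M Y I <= sets G" "space G = space M"
 shows "Y t \<in> Bor G"
proof (rule measurableI)
 fix A :: "real set" assume "A \<in> sets borel"
 hence "Y t -` A Int space M \<in> events_of M Y I" using assms(1) unfolding events_of_def by (intro sigma_sets.Basic) blast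
 thus "Y t -` A Int space G \<in> sets G" using assms by auto
qed simp

lemma future_sub:
 assumes "0 <= s"
 shows "subalgebra M (future s)" "subalgebra (future s) (X_future s)" "subalgebra (future s) (N_future s)"
  "subalgebra M (X_future s)" "subalgebra M (N_future s)"
proof -
 have 1: "events_of M (%r w. X r w - X s w) {s..} <= sets M"
  "events_of M (%r w. real (N r w) - real (N s w)) {s..} <= sets M" by (rule events_sub; use assms in \<open>auto intro!: borel_measurable_diff X_meas N_meas\<close>)+
 show "subalgebra M (future s)" using 1 by (simp add: subalgebra_def sets_future sets.sigma_sets_subset)
 show 2: "subalgebra (future s) (X_future s)" "subalgebra (future s) (N_future s)" by (simp_all add: subalgebra_def sets_future sigma_sets_subseteq)
 show "subalgebra M (X_future s)" "subalgebra M (N_future s)" using 2 \<open>subalgebra M (future s)\<close> unfolding subalgebra_def by auto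
qed

lemma Xi_measurable:
 assumes "0 <= s" "0 <= t"
 shows "Xi s t \<in> Bor (X_future s)"
proof -
 have "(%w. X (s + t) w - X s w) \<in> Bor (X_future s)" by (rule events_measurable[of _ "{s..}" "%r w. X r w - X s w"])
    (use assms in \<open>auto simp: sets_future\<close>)
 thus ?thesis unfolding Xi_def[abs_def] .
qed

lemma N_incr_measurable:
 assumes "0 <= s" "0 <= t"
 shows "(%w. real (N (s + t) w) - real (N s w)) \<in> Bor (N_future s)" by (rule events_measurable[of _ "{s..}" "%r w. real (N r w) - real (N s w)"])
   (use assms in \<open>auto simp: sets_future\<close>)

lemma XN_future_indep:
 assumes "0 <= s" shows "indep_set (sets (X_future s)) (sets (N_future s))"
proof (rule indep_set_mono[OF XN_indep])
 have *: "sigma_sets (space M) (events_of M (%r w. Y r w - Y s w) {s..}) <= events_of M Y {0..}" for Y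
 proof -
  define G where "G = sigma (space M) (events_of M Y {0..})"
  have G: "space G = space M" "sets G = events_of M Y {0..}" unfolding G_def using events_Pow[of Y "{0..}"] by (simp_all add: sets_measure_of events_of_def sigma_sets_sigma_sets_eq)
    (subst sigma_sets_sigma_sets_eq, auto)
  have "events_of M (%r w. Y r w - Y s w) {s..} <= sets G" by (rule events_sub) (use assms G in \<open>auto intro!: borel_measurable_diff events_measurable[of _ "{0..}"]\<close>)
  thus ?thesis using sets.sigma_sets_subset[of _ G] unfolding G(1) G(2)[symmetric] by blast
 qed
 show "sets (X_future s) <= events_of M X {0..}" unfolding sets_future by (rule *)
 show "sets (N_future s) <= events_of M (%t w. real (N t w)) {0..}" unfolding sets_future by (rule *)
qed

lemma indep_future:
 assumes "0 <= s" "Y \<in> measurable (F s) S"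
 shows "indep_set {Y -` A Int space M | A. A \<in> sets S} (sets (future s))"
proof (rule indep_set_mono[OF increments_indep[OF assms(1)]])
 show "{Y -` A Int space M | A. A \<in> sets S} <= sets (F s)" using measurable_sets[OF assms(2)] space_F[OF assms(1)] by auto
qed (simp add: sets_future)

lemma Xi_cadlag: "w \<in> space M ==> 0 <= s ==> cadlag (%t. Xi s t w)" unfolding Xi_def by (rule cadlag_diff[OF cadlag_shift[OF X_cadlag] cadlag_const])

lemma Ii_measurable:
 assumes "0 <= s" "0 <= t"
 shows "Ii s t \<in> Bor (X_future s)"
proof -
 have "(%w. wsup (%r. - Xi s r w) 0 t) \<in> Bor (X_future s)" by (rule wsup_measurable) (use assms in \<open>auto intro!: cadlag_uminus Xi_cadlag borel_measurable_uminus Xi_measurable\<close>)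
 thus ?thesis unfolding Ii_def[abs_def] .
qed

lemma Ii_cadlag:
 assumes "w \<in> space M" "0 <= s" shows "cadlag (%t. Ii s t w)" "mono_on {0..} (%t. Ii s t w)" unfolding Ii_def using cadlag_wsup[OF cadlag_uminus[OF Xi_cadlag[OF assms]]] .

lemma Xi_0 [simp]: "Xi s 0 w = 0" by (simp add: Xi_def)

lemma Ii_upper:
 assumes "w \<in> space M" "0 <= s" "0 <= r" "r <= t" shows "- Xi s r w <= Ii s t w" unfolding Ii_def using wsup_upper[OF cadlag_uminus[OF Xi_cadlag[OF assms(1,2)]], of 0 r t] assms by simp

lemma Ii_nonneg:
 assumes "w \<in> space M" "0 <= s" "0 <= t" shows "0 <= Ii s t w" using Ii_upper[OF assms(1,2), of 0 t] assms by simp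

lemma Ii_eq:
 assumes "0 <= s" "0 <= t" "w \<in> space M"
 shows "Ii s t w = X s w + wsup (%r. - X r w) s (s + t)"
proof -
 have cad: "cadlag (%r. - X r w)" by (rule cadlag_uminus[OF X_cadlag[OF assms(3)]])
 show ?thesis
 proof (rule antisym)
  show "Ii s t w <= X s w + wsup (%r. - X r w) s (s + t)" unfolding Ii_def
  proof (rule wsup_least[OF assms(2)])
   fix r assume "0 <= r" "r <= t"
   thus "- Xi s r w <= X s w + wsup (%r. - X r w) s (s + t)" using wsup_upper[OF cad assms(1), of "s + r" "s + t"] by (simp add: Xi_def)
  qed
  have "wsup (%r. - X r w) s (s + t) <= Ii s t w - X s w"
  proof (rule wsup_least)
   fix r assume "s <= r" "r <= s + t"
   thus "- X r w <= Ii s t w - X s w" using Ii_upper[OF assms(3,1), of "r - s" t] by (simp add: Xi_def)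
  qed (use assms in simp)
  thus "X s w + wsup (%r. - X r w) s (s + t) <= Ii s t w" by simp
 qed
qed

text \<open>On a grid, the pair of increment and running maximum is a Markov chain driven by
  independent increments with the law of \<open>X h\<close>. Its transition \<open>K\<close> does
  not involve the starting time, and induction on the number of steps removes that time from the
  law.\<close>

lemma skeleton_law:
 fixes f :: "real \<times> real => ennreal"
 assumes s: "0 <= s" and h: "0 <= h" and f: "f \<in> Bor borel2"
 shows "(\<integral>\<^sup>+w. f (Xi s (real j * h) w, Max ((%i. - Xi s (real i * h) w) ` {..j})) \<partial>M)
  = (\<integral>\<^sup>+w. f (Xi 0 (real j * h) w, Max ((%i. - Xi 0 (real i * h) w) ` {..j})) \<partial>M)" using f
proof (induction j arbitrary: f)
 case 0 thus ?case by simp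
next
 case (Suc j)
 define K where "K p = (\<integral>\<^sup>+y. f (fst p + y, max (snd p) (- (fst p + y))) \<partial>distr M borel (X h))" for p
 interpret D: prob_space "distr M borel (X h)" by (rule prob_space_distr[OF X_meas[OF h]])
 note [measurable] = Suc.prems
 have K: "K \<in> Bor borel2" unfolding K_def by measurable
 have step: "(\<integral>\<^sup>+w. f (Xi s (real (Suc j) * h) w, Max ((%i. - Xi s (real i * h) w) ` {..Suc j})) \<partial>M)
  = (\<integral>\<^sup>+w. K (Xi s (real j * h) w, Max ((%i. - Xi s (real i * h) w) ` {..j})) \<partial>M)" if s: "0 <= s" for s
 proof -
  define u where "u = s + real j * h"
  have u: "0 <= u" using s h by (simp add: u_def)
  define Y where "Y w = (Xi s (real j * h) w, Max ((%i. - Xi s (real i * h) w) ` {..j}))" for w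
  have XiF: "Xi s (real i * h) \<in> Bor (F u)" if "i <= j" for i
  proof -
   have le: "s + real i * h <= u" using that h by (simp add: u_def mult_right_mono)
   show ?thesis unfolding Xi_def by (intro borel_measurable_diff F_le_F[OF _ le X_F] F_le_F[OF s _ X_F]) (use s h in \<open>auto simp: u_def\<close>)
  qed
  have Y: "Y \<in> measurable (F u) borel2" unfolding Y_def by (intro measurable_Pair borel_measurable_Max borel_measurable_uminus XiF) auto
  have YM: "Y \<in> measurable M borel2" by (rule measurable_from_subalg[OF F_sub[OF u] Y])
  define g where "g z = f (fst (fst z) + Xi u h (snd z), max (snd (fst z)) (- (fst (fst z) + Xi u h (snd z))))" for z
  have [measurable]: "Xi u h \<in> Bor (future u)" by (rule measurable_from_subalg[OF future_sub(2)[OF u] Xi_measurable[OF u h]])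
  have g: "g \<in> Bor (borel2 \<Otimes>\<^sub>M future u)" unfolding g_def by measurable
  have "f (Xi s (real (Suc j) * h) w, Max ((%i. - Xi s (real i * h) w) ` {..Suc j})) = g (Y w, w)" for w
  proof -
   have "Xi s (real (Suc j) * h) w = Xi s (real j * h) w + Xi u h w" by (simp add: Xi_def u_def algebra_simps)
   thus ?thesis unfolding g_def Y_def by (simp add: atMost_Suc max.commute)
  qed
  hence "(\<integral>\<^sup>+w. f (Xi s (real (Suc j) * h) w, Max ((%i. - Xi s (real i * h) w) ` {..Suc j})) \<partial>M)
   = (\<integral>\<^sup>+w. g (Y w, w) \<partial>M)" by simp
  also have "... = (\<integral>\<^sup>+y. (\<integral>\<^sup>+w. g (y, w) \<partial>M) \<partial>distr M borel2 Y)" by (rule indep_nn_integral[OF YM future_sub(1)[OF u] indep_future[OF u Y] g])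
  also have "... = (\<integral>\<^sup>+y. K y \<partial>distr M borel2 Y)"
  proof (rule nn_integral_cong)
   fix y :: "real \<times> real"
   have "K y = (\<integral>\<^sup>+x. f (fst y + x, max (snd y) (- (fst y + x))) \<partial>distr M borel (Xi u h))" unfolding K_def Xi_def[abs_def] X_stationary[OF u h] ..
   also have "... = (\<integral>\<^sup>+w. g (y, w) \<partial>M)" unfolding g_def by (subst nn_integral_distr)
     (auto intro: measurable_from_subalg[OF future_sub(4)[OF u] Xi_measurable[OF u h]])
   finally show "(\<integral>\<^sup>+w. g (y, w) \<partial>M) = K y" by simp
  qed
  also have "... = (\<integral>\<^sup>+w. K (Y w) \<partial>M)" by (rule nn_integral_distr[OF YM]) (simp add: K)
  finally show ?thesis by (simp add: Y_def)
 qed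
 show ?case using step[OF s] step[of 0] Suc.IH[OF K] by simp
qed

lemma XI_pair_measurable:
 assumes "0 <= s" "0 <= t"
 shows "(%w. (XI s t w)) \<in> measurable M borel2" by (intro measurable_Pair measurable_from_subalg[OF future_sub(4)[OF assms(1)]]
   Xi_measurable[OF assms] Ii_measurable[OF assms])

text \<open>Grid maxima have the law given by the skeleton and increase to \<open>Ii\<close>;
  dominated convergence lifts the equality. The bound is demanded for all \<open>i\<close> between 0
  and \<open>Ii u t w\<close> because the grid maxima lie there.\<close>

lemma XI_expectation:
 fixes f :: "real \<times> real => real"
 assumes s: "0 <= s" and t: "0 <= t" and f: "continuous_on UNIV f" and B: "!!u. u \<in> {0, s} ==> integrable M (B u)"
  and bd: "!!u. u \<in> {0, s} ==> AE w in M. \<forall>i\<in>{0..Ii u t w}. abs (f (Xi u t w, i)) <= B u w"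
 shows "(LINT w|M. f (XI s t w)) = (LINT w|M. f (XI 0 t w))"
proof -
 define D where "D u n w = dyadic_max (%r. - Xi u r w) 0 t n" for u n w
 have fm: "f \<in> Bor borel2" using borel_measurable_continuous_onI[OF f] by (simp add: borel_prod)
 have Dm: "(%w. (Xi u t w, D u n w)) \<in> measurable M borel2" if "0 <= u" for u n unfolding D_def dyadic_max_def using that t
  by (intro measurable_Pair borel_measurable_Max borel_measurable_uminus measurable_from_subalg[OF future_sub(4) Xi_measurable]) auto
 have law: "distr M borel2 (%w. (Xi s t w, D s n w)) = distr M borel2 (%w. (Xi 0 t w, D 0 n w))" for n
 proof (rule measure_eqI)
  fix A assume "A \<in> sets (distr M borel2 (%w. (Xi s t w, D s n w)))"
  hence A: "A \<in> sets borel2" by simp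
  have "emeasure (distr M borel2 (%w. (Xi u t w, D u n w))) A
    = (\<integral>\<^sup>+w. indicator A (Xi u (real (2 ^ n) * (t / 2 ^ n)) w, Max ((%j. - Xi u (real j * (t / 2 ^ n)) w) ` {..2 ^ n})) \<partial>M)" if "0 <= u" for u
   using nn_integral_distr[OF Dm[OF that], of "indicator A"] A by (simp add: D_def dyadic_max_def)
  thus "emeasure (distr M borel2 (%w. (Xi s t w, D s n w))) A = emeasure (distr M borel2 (%w. (Xi 0 t w, D 0 n w))) A" using skeleton_law[OF s, of "t / 2 ^ n" "indicator A" "2 ^ n"] s t A by simp
 qed simp
 have lim: "(%n. LINT w|M. f (Xi u t w, D u n w)) ----> (LINT w|M. f (XI u t w))" if u: "u \<in> {0, s}" for u
 proof (rule integral_dominated_convergence[OF _ _ B[OF u]])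
  have u0: "0 <= u" using u s by auto
  note c = cadlag_uminus[OF Xi_cadlag[OF _ u0]]
  show "(%w. f (XI u t w)) \<in> Bor M" by (rule measurable_compose[OF XI_pair_measurable[OF u0 t] fm])
  show "(%w. f (Xi u t w, D u n w)) \<in> Bor M" for n by (rule measurable_compose[OF Dm[OF u0] fm])
  show "AE w in M. (%n. f (Xi u t w, D u n w)) ----> f (XI u t w)"
  proof (rule AE_I2)
   fix w assume w: "w \<in> space M"
   have "(%n. D u n w) ----> Ii u t w" using dyadic_max_limit[OF c[OF w] order_refl t] by (simp add: D_def[abs_def] Ii_def)
   thus "(%n. f (Xi u t w, D u n w)) ----> f (XI u t w)" by (intro continuous_on_tendsto_compose[OF f] tendsto_Pair tendsto_const) auto
  qed
  show "AE w in M. norm (f (Xi u t w, D u n w)) <= B u w" for n using bd[OF u] AE_space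
  proof eventually_elim
   case (elim w)
   have "D u n w <= Ii u t w" using dyadic_max_le[OF c[OF elim(2)] order_refl t, of n] by (simp add: D_def Ii_def)
   moreover have "0 <= D u n w" unfolding D_def dyadic_max_def by (rule Max_ge) (auto intro!: image_eqI[of _ _ 0])
   ultimately show ?case using elim(1) by simp
  qed
 qed
 have "(LINT w|M. f (Xi u t w, D u n w)) = (LINT p|distr M borel2 (%w. (Xi u t w, D u n w)). f p)" if "0 <= u" for u n using Dm[OF that] fm by (intro integral_distr[symmetric]) auto
 hence "(LINT w|M. f (Xi s t w, D s n w)) = (LINT w|M. f (Xi 0 t w, D 0 n w))" for n using law[of n] s by simp
 thus ?thesis using LIMSEQ_unique[OF lim[of s]] lim[of 0] by simp
qed

end

section \<open>An exponential envelope of the paths\<close>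

lemma (in prob_space) tail_eq:
 fixes Z :: "'a => real"
 assumes [measurable]: "Z \<in> Bor M"
 shows "emeasure M {w \<in> space M. y < Z w} = (\<integral>\<^sup>+w. (if y < Z w then 1 else 0) \<partial>M)"
proof -
 have "(\<integral>\<^sup>+w. (if y < Z w then 1 else 0) \<partial>M) = (\<integral>\<^sup>+w. indicator {w \<in> space M. y < Z w} w \<partial>M)" by (intro nn_integral_cong) auto
 thus ?thesis by simp
qed

lemma (in prob_space) tail_measurable:
 fixes Z :: "'a => real"
 assumes [measurable]: "Z \<in> Bor M"
 shows "(%y. emeasure M {w \<in> space M. y < Z w}) \<in> Bor borel" unfolding tail_eq[OF assms] by measurable

lemma (in prob_space) layer_cake:
 assumes Z[measurable]: "Z \<in> Bor M" and nn: "!!w. w \<in> space M ==> 0 <= Z w"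
 shows "(\<integral>\<^sup>+w. ennreal (Z w) \<partial>M) = (\<integral>\<^sup>+y. indicator {0..} y * emeasure M {w \<in> space M. y < Z w} \<partial>lborel)"
proof -
 interpret P: pair_sigma_finite M lborel ..
 define g :: "'a => real => ennreal" where "g w y = indicator {0..} y * (if y < Z w then 1 else 0)" for w y
 have "(\<integral>\<^sup>+w. ennreal (Z w) \<partial>M) = (\<integral>\<^sup>+w. (\<integral>\<^sup>+y. g w y \<partial>lborel) \<partial>M)"
 proof (rule nn_integral_cong)
  fix w assume "w \<in> space M"
  have "(\<integral>\<^sup>+y. g w y \<partial>lborel) = (\<integral>\<^sup>+y. indicator {0..<Z w} y \<partial>lborel)" by (intro nn_integral_cong) (auto simp: g_def indicator_def)
  thus "ennreal (Z w) = (\<integral>\<^sup>+y. g w y \<partial>lborel)" using nn[OF \<open>w \<in> space M\<close>] by simp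
 qed
 also have "... = (\<integral>\<^sup>+y. (\<integral>\<^sup>+w. g w y \<partial>M) \<partial>lborel)" by (rule P.Fubini'[symmetric]) (unfold g_def, measurable)
 also have "... = (\<integral>\<^sup>+y. indicator {0..} y * emeasure M {w \<in> space M. y < Z w} \<partial>lborel)"
  unfolding g_def tail_eq[OF Z] by (intro nn_integral_cong nn_integral_cmult) measurable
 finally show ?thesis .
qed

context regular_model
begin

lemma Xi_meas: "0 <= s ==> 0 <= t ==> Xi s t \<in> Bor M" by (rule measurable_from_subalg[OF future_sub(4) Xi_measurable])

lemma Xi_distr: "0 <= s ==> 0 <= t ==> distr M borel (Xi s t) = distr M borel (X t)" using X_stationary by (simp add: Xi_def[abs_def])

text \<open>\<open>X t\<close> is bounded below by \<open>- exp (- X t)\<close>, and above through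
  \<open>X t = X 1 - (X 1 - X t)\<close>, where the negative of the later increment has an
  exponential moment by stationarity. Hence one bound serves all of \<open>[0, 1]\<close>.\<close>

lemma X_absolute_moment:
 obtains C where "!!t. 0 <= t ==> t <= 1 ==> integrable M (X t)"
  "!!t. 0 <= t ==> t <= 1 ==> expectation (%w. abs (X t w)) <= C"
proof -
 obtain C where C: "!!t. 0 <= t ==> t <= 1 ==> integrable M (%w. exp (- X t w))"
  "!!t. 0 <= t ==> t <= 1 ==> expectation (%w. exp (- X t w)) <= C" using X_exp_moment unfolding Ball_def atLeastAtMost_iff by blast
 have *: "integrable M (X t) & expectation (%w. abs (X t w)) <= C + expectation (%w. abs (X 1 w)) + C"
  if t: "0 <= t" "t <= 1" for t
 proof -
  have t': "0 <= 1 - t" "1 - t <= 1" using t by auto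
  have m: "Xi t (1 - t) \<in> Bor M" "X (1 - t) \<in> Bor M" using Xi_meas X_meas t by auto
  have int: "integrable M (%w. exp (- Xi t (1 - t) w))"
  proof -
   have "integrable (distr M borel (Xi t (1 - t))) (%x. exp (- x))" unfolding Xi_distr[OF t(1) t'(1)] using C(1)[OF t'] m(2) by (subst integrable_distr_eq) auto
   thus ?thesis using m(1) by (subst (asm) integrable_distr_eq) auto
  qed
  have "expectation (%w. exp (- Xi t (1 - t) w)) = (LINT x|distr M borel (Xi t (1 - t)). exp (- x))" using m by (subst integral_distr) auto
  also have "... = expectation (%w. exp (- X (1 - t) w))" unfolding Xi_distr[OF t(1) t'(1)] using m by (subst integral_distr) auto
  also have "... <= C" by (rule C(2)[OF t'])
  finally have E: "expectation (%w. exp (- Xi t (1 - t) w)) <= C" .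
  have bound: "abs (X t w) <= exp (- X t w) + abs (X 1 w) + exp (- Xi t (1 - t) w)" for w
  proof -
   have "- X t w <= exp (- X t w)" "- Xi t (1 - t) w <= exp (- Xi t (1 - t) w)" using exp_ge_add_one_self[of "- X t w"] exp_ge_add_one_self[of "- Xi t (1 - t) w"] by linarith+
   moreover have "0 <= exp (- X t w)" "0 <= exp (- Xi t (1 - t) w)" by simp_all
   moreover have "Xi t (1 - t) w = X 1 w - X t w" by (simp add: Xi_def)
   ultimately show ?thesis by linarith
  qed
  have int3: "integrable M (%w. exp (- X t w) + abs (X 1 w) + exp (- Xi t (1 - t) w))" using C(1)[OF t] X_integrable_1 int by auto
  have "integrable M (X t)" by (rule Bochner_Integration.integrable_bound[OF int3]) (use X_meas t bound in \<open>auto intro!: AE_I2 order_trans[OF _ abs_ge_self]\<close>)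
  moreover have "expectation (%w. abs (X t w)) <= expectation (%w. exp (- X t w) + abs (X 1 w) + exp (- Xi t (1 - t) w))" using calculation int3 bound by (intro integral_mono) auto
  moreover have "... = expectation (%w. exp (- X t w)) + expectation (%w. abs (X 1 w)) + expectation (%w. exp (- Xi t (1 - t) w))" using C(1)[OF t] X_integrable_1 int by simp
  ultimately show ?thesis using C(2)[OF t] E by linarith
 qed
 thus ?thesis using that by blast
qed

text \<open>Ottaviani's inequality. \<open>A j\<close> is the event that the value first exceeds
  \<open>2 * x\<close> at step \<open>j\<close>; independently of it, the remaining increment is at
  most \<open>x\<close> with probability at least 1/2, and then the final value still exceeds
  \<open>x\<close>.\<close>

lemma ottaviani:
 assumes s: "0 <= s" and h: "0 <= h" and K: "real K * h <= 1"
  and half: "!!t. 0 <= t ==> t <= 1 ==> prob {w \<in> space M. x < abs (X t w)} <= 1 / 2"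
 shows "prob {w \<in> space M. EX j<=K. 2 * x < abs (Xi s (real j * h) w)} <= 2 * prob {w \<in> space M. x < abs (X (real K * h) w)}"
proof -
 define S where "S j w = Xi s (real j * h) w" for j w
 have Sm[measurable]: "S j \<in> Bor M" for j unfolding S_def using Xi_meas[OF s, of "real j * h"] h by simp
 define A where "A j = {w \<in> space M. (ALL i<j. abs (S i w) <= 2 * x) & 2 * x < abs (S j w)}" for j
 define B where "B j = {w \<in> space M. abs (S K w - S j w) <= x}" for j
 have Am: "A j \<in> sets M" and Bm: "B j \<in> sets M" for j unfolding A_def B_def by measurable
 have jh: "0 <= real j * h" for j using h by simp
 have law: "prob {w \<in> space M. x < abs (Xi u t w)} = prob {w \<in> space M. x < abs (X t w)}" if "0 <= u" "0 <= t" for u t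
 proof -
  have "prob {w \<in> space M. x < abs (Xi u t w)} = measure (distr M borel (Xi u t)) {y. x < abs y}" using Xi_meas[OF that] by (subst measure_distr) (auto intro!: arg_cong[where f=prob])
  also have "... = prob {w \<in> space M. x < abs (X t w)}" unfolding Xi_distr[OF that] using X_meas[OF that(2)] by (subst measure_distr) (auto intro!: arg_cong[where f=prob])
  finally show ?thesis .
 qed
 have key: "prob (A j) <= 2 * prob (A j Int B j)" if j: "j <= K" for j
 proof -
  define u where "u = s + real j * h"
  define t where "t = real (K - j) * h"
  have u: "0 <= u" and t: "0 <= t" using s h by (auto simp: u_def t_def)
  have "real (K - j) * h <= real K * h" using h by (intro mult_right_mono) auto
  hence t1: "t <= 1" using K by (simp add: t_def)
  have diff: "S K w - S j w = Xi u t w" for w using j by (simp add: S_def Xi_def u_def t_def of_nat_diff algebra_simps)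
  have SF: "S i \<in> Bor (F u)" if "i <= j" for i
  proof -
   have le: "s + real i * h <= u" using that h by (simp add: u_def mult_right_mono)
   show ?thesis unfolding S_def Xi_def by (intro borel_measurable_diff F_le_F[OF _ le X_F] F_le_F[OF s _ X_F]) (use s h in \<open>auto simp: u_def\<close>)
  qed
  have "A j \<in> sets (F u)"
  proof -
   have "A j = {w \<in> space (F u). (\<forall>i\<in>{..<j}. abs (S i w) <= 2 * x) & 2 * x < abs (S j w)}" unfolding A_def space_F[OF u] by auto
   also have "... \<in> sets (F u)"
   proof (intro sets.sets_Collect_conj sets.sets_Collect_finite_All)
    show "{w \<in> space (F u). abs (S i w) <= 2 * x} \<in> sets (F u)" if "i \<in> {..<j}" for i
    proof -
     have [measurable]: "S i \<in> Bor (F u)" using SF that by simp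
     show ?thesis by measurable
    qed
    have [measurable]: "S j \<in> Bor (F u)" using SF by simp
    show "{w \<in> space (F u). 2 * x < abs (S j w)} \<in> sets (F u)" by measurable
   qed auto
   finally show ?thesis .
  qed
  moreover have "B j \<in> sets (future u)"
  proof -
   have [measurable]: "Xi u t \<in> Bor (future u)" by (rule measurable_from_subalg[OF future_sub(2)[OF u] Xi_measurable[OF u t]])
   have "B j = {w \<in> space (future u). abs (Xi u t w) <= x}" unfolding B_def diff by simp
   also have "... \<in> sets (future u)" by measurable
   finally show ?thesis .
  qed
  ultimately have "prob (A j Int B j) = prob (A j) * prob (B j)" using indep_setD[OF increments_indep[OF u]] by (simp add: sets_future)
  moreover have "1 / 2 <= prob (B j)"
  proof -
   have "prob (B j) = prob (space M - {w \<in> space M. x < abs (Xi u t w)})" by (intro arg_cong[where f=prob]) (auto simp: B_def diff)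
   also have "... = 1 - prob {w \<in> space M. x < abs (Xi u t w)}" using Xi_meas[OF u t] by (intro prob_compl) simp
   finally show ?thesis using half[OF t t1] law[OF u t] by simp
  qed
  hence "prob (A j) * (1 / 2) <= prob (A j) * prob (B j)" by (intro mult_left_mono) auto
  ultimately show ?thesis by simp
 qed
 have disj: "disjoint_family_on A {..K}"
 proof (unfold disjoint_family_on_def, intro ballI impI)
  fix i j :: nat assume "i ~= j"
  thus "A i Int A j = {}" unfolding A_def by (cases i j rule: linorder_cases) force+
 qed
 have "{w \<in> space M. EX j<=K. 2 * x < abs (S j w)} = (\<Union>j\<in>{..K}. A j)"
 proof (intro set_eqI iffI)
  fix w assume "w \<in> {w \<in> space M. EX j<=K. 2 * x < abs (S j w)}"
  then obtain j where j: "w \<in> space M" "j <= K" "2 * x < abs (S j w)" by auto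
  define l where "l = (LEAST j. 2 * x < abs (S j w))"
  have "2 * x < abs (S l w)" unfolding l_def by (rule LeastI[of _ j]) (rule j(3))
  moreover have "l <= j" unfolding l_def by (rule Least_le) (rule j(3))
  moreover have "abs (S i w) <= 2 * x" if "i < l" for i using not_less_Least[OF that[unfolded l_def]] by simp
  ultimately show "w \<in> (\<Union>j\<in>{..K}. A j)" using j by (auto simp: A_def intro!: bexI[of _ l])
 qed (auto simp: A_def)
 hence "prob {w \<in> space M. EX j<=K. 2 * x < abs (S j w)} = (\<Sum>j\<le>K. prob (A j))" using finite_measure_finite_Union[OF _ _ disj] Am by auto
 also have "... <= (\<Sum>j\<le>K. 2 * prob (A j Int B j))" by (intro sum_mono key) simp
 also have "... = 2 * prob (\<Union>j\<in>{..K}. A j Int B j)"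
 proof -
  have "disjoint_family_on (%j. A j Int B j) {..K}" using disj unfolding disjoint_family_on_def by blast
  hence "prob (\<Union>j\<in>{..K}. A j Int B j) = (\<Sum>j\<le>K. prob (A j Int B j))" using Am Bm by (intro finite_measure_finite_Union) auto
  thus ?thesis by (simp only: sum_distrib_left)
 qed
 also have "prob (\<Union>j\<in>{..K}. A j Int B j) <= prob {w \<in> space M. x < abs (S K w)}" by (rule finite_measure_mono) (auto simp: A_def B_def)
 also have "... = prob {w \<in> space M. x < abs (X (real K * h) w)}" unfolding S_def by (rule law[OF s jh])
 finally show ?thesis by (simp add: S_def)
qed

definition osc :: "real => 'a => real" where
 "osc s w = wsup (%r. abs (Xi s r w)) 0 1"

lemma abs_Xi_cadlag: "w \<in> space M ==> 0 <= s ==> cadlag (%r. abs (Xi s r w))" using cadlag_compose[OF Xi_cadlag, of w s abs] continuous_on_rabs[OF continuous_on_id] by simp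

lemma osc_upper:
 assumes "w \<in> space M" "0 <= s" "0 <= r" "r <= 1" shows "abs (Xi s r w) <= osc s w" unfolding osc_def by (rule wsup_upper[OF abs_Xi_cadlag]) (use assms in auto)

lemma osc_measurable: "0 <= s ==> osc s \<in> Bor M" unfolding osc_def[abs_def] by (rule wsup_measurable) (auto intro: abs_Xi_cadlag borel_measurable_abs Xi_meas)

text \<open>Dyadic maxima increase to the supremum, so the grid events increase to the event for the
  whole interval and the maximal inequality passes to the limit.\<close>

lemma osc_tail:
 assumes s: "0 <= s"
  and half: "!!t. 0 <= t ==> t <= 1 ==> prob {w \<in> space M. x < abs (X t w)} <= 1 / 2"
 shows "prob {w \<in> space M. 2 * x < osc s w} <= 2 * prob {w \<in> space M. x < abs (X 1 w)}"
proof -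
 define D where "D n w = dyadic_max (%r. abs (Xi s r w)) 0 1 n" for n w
 have Dm[measurable]: "D n \<in> Bor M" for n unfolding D_def dyadic_max_def using s by (intro borel_measurable_Max borel_measurable_abs Xi_meas) auto
 have bound: "prob {w \<in> space M. 2 * x < D n w} <= 2 * prob {w \<in> space M. x < abs (X 1 w)}" for n
 proof -
  have "{w \<in> space M. 2 * x < D n w} = {w \<in> space M. EX j<=2 ^ n. 2 * x < abs (Xi s (real j * (1 / 2 ^ n)) w)}" unfolding D_def dyadic_max_def by (subst Max_gr_iff) auto
  thus ?thesis using ottaviani[OF s, of "1 / 2 ^ n" "2 ^ n" x] half by simp
 qed
 have "incseq (%n. {w \<in> space M. 2 * x < D n w})" using dyadic_max_incseq unfolding D_def incseq_def by (fastforce intro: less_le_trans)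
 hence "(%n. prob {w \<in> space M. 2 * x < D n w}) ----> prob (\<Union>n. {w \<in> space M. 2 * x < D n w})" by (intro finite_Lim_measure_incseq) auto
 moreover have "(\<Union>n. {w \<in> space M. 2 * x < D n w}) = {w \<in> space M. 2 * x < osc s w}"
 proof (intro set_eqI iffI)
  fix w assume "w \<in> (\<Union>n. {w \<in> space M. 2 * x < D n w})"
  then obtain n where n: "w \<in> space M" "2 * x < D n w" by auto
  thus "w \<in> {w \<in> space M. 2 * x < osc s w}" using dyadic_max_le[OF abs_Xi_cadlag[OF n(1) s] order_refl, of 1 n] by (auto simp: D_def osc_def)
 next
  fix w assume w: "w \<in> {w \<in> space M. 2 * x < osc s w}"
  hence "(%n. D n w) ----> osc s w" using dyadic_max_limit[OF abs_Xi_cadlag[OF _ s] order_refl, of w 1] by (simp add: D_def osc_def)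
  hence "\<forall>\<^sub>F n in sequentially. 2 * x < D n w" using w by (intro order_tendstoD) auto
  thus "w \<in> (\<Union>n. {w \<in> space M. 2 * x < D n w})" using w by (auto simp: eventually_sequentially)
 qed
 ultimately show ?thesis using bound by (intro LIMSEQ_le_const2) auto
qed

text \<open>By Markov's inequality the hypothesis of the maximal inequality holds from level
  \<open>2 * C1\<close> on, uniformly in time. Beyond \<open>4 * C1\<close> the tail of the
  oscillation is thus integrated against that of \<open>2 * abs (X 1)\<close>, which does not
  involve \<open>s\<close>.\<close>

lemma osc_integral_bound:
 obtains C where "0 <= C" "!!s. 0 <= s ==> (\<integral>\<^sup>+w. ennreal (osc s w) \<partial>M) <= ennreal C"
proof -
 obtain C0 where C0: "!!t. 0 <= t ==> t <= 1 ==> integrable M (X t)"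
  "!!t. 0 <= t ==> t <= 1 ==> expectation (%w. abs (X t w)) <= C0" using X_absolute_moment by blast
 define C1 where "C1 = max 1 C0"
 have half: "prob {w \<in> space M. x < abs (X t w)} <= 1 / 2" if x: "2 * C1 <= x" and t: "0 <= t" "t <= 1" for x t
 proof -
  have x0: "0 < x" using x by (simp add: C1_def)
  have "prob {w \<in> space M. x < abs (X t w)} <= prob {w \<in> space M. x <= abs (X t w)}" using X_meas[OF t(1)] by (intro finite_measure_mono) auto
  also have "... <= expectation (%w. abs (X t w)) / x" using C0(1)[OF t] x0 by (intro integral_Markov_inequality_measure[where A="{}"]) auto
  also have "... <= 1 / 2" using C0(2)[OF t] x x0 by (simp add: divide_le_eq C1_def)
  finally show ?thesis .
 qed
 let ?C = "4 * C1 + 4 * expectation (%w. abs (X 1 w))"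
 have "(\<integral>\<^sup>+w. ennreal (osc s w) \<partial>M) <= ennreal ?C" if s: "0 <= s" for s
 proof -
  have nn: "0 <= osc s w" if "w \<in> space M" for w using osc_upper[OF that s, of 0] by simp
  have "(\<integral>\<^sup>+w. ennreal (osc s w) \<partial>M) = (\<integral>\<^sup>+y. indicator {0..} y * emeasure M {w \<in> space M. y < osc s w} \<partial>lborel)"
   by (rule layer_cake[OF osc_measurable[OF s] nn])
  also have "... <= (\<integral>\<^sup>+y. indicator {0..4 * C1} y + 2 * (indicator {0..} y * emeasure M {w \<in> space M. y < 2 * abs (X 1 w)}) \<partial>lborel)"
  proof (rule nn_integral_mono)
   fix y :: real
   show "indicator {0..} y * emeasure M {w \<in> space M. y < osc s w}
    <= indicator {0..4 * C1} y + 2 * (indicator {0..} y * emeasure M {w \<in> space M. y < 2 * abs (X 1 w)})"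
   proof (cases "0 <= y & 4 * C1 < y")
    case True
    hence "prob {w \<in> space M. 2 * (y / 2) < osc s w} <= 2 * prob {w \<in> space M. y / 2 < abs (X 1 w)}" by (intro osc_tail[OF s] half) auto
    also have "{w \<in> space M. y / 2 < abs (X 1 w)} = {w \<in> space M. y < 2 * abs (X 1 w)}" by auto
    finally have "ennreal (prob {w \<in> space M. y < osc s w}) <= ennreal (2 * prob {w \<in> space M. y < 2 * abs (X 1 w)})" by (intro ennreal_leI) simp
    thus ?thesis using True by (simp add: emeasure_eq_measure ennreal_mult')
   next
    case False
    have "emeasure M {w \<in> space M. y < osc s w} <= 1" by (simp add: emeasure_eq_measure)
    thus ?thesis using False by (auto simp: indicator_def intro: order_trans)
   qed
  qed
  also have "... = (\<integral>\<^sup>+y. indicator {0..4 * C1} y \<partial>lborel) + 2 * (\<integral>\<^sup>+y. indicator {0..} y * emeasure M {w \<in> space M. y < 2 * abs (X 1 w)} \<partial>lborel)"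
  proof -
   have "(%y. emeasure M {w \<in> space M. y < 2 * abs (X 1 w)}) \<in> Bor borel" by (rule tail_measurable) (use X_meas[of 1] in auto)
   thus ?thesis by (simp add: nn_integral_add nn_integral_cmult)
  qed
  also have "(\<integral>\<^sup>+y. indicator {0..} y * emeasure M {w \<in> space M. y < 2 * abs (X 1 w)} \<partial>lborel) = (\<integral>\<^sup>+w. ennreal (2 * abs (X 1 w)) \<partial>M)"
   using X_meas[of 1] by (intro layer_cake[symmetric]) auto
  also have "... = ennreal (2 * expectation (%w. abs (X 1 w)))" using X_integrable_1 by (subst nn_integral_eq_integral) auto
  also have "(\<integral>\<^sup>+y. indicator {0..4 * C1} y \<partial>lborel) = ennreal (4 * C1)" by (simp add: C1_def)
  also have "2 * ennreal (2 * expectation (%w. abs (X 1 w))) = ennreal (4 * expectation (%w. abs (X 1 w)))"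
  proof -
   have "2 * ennreal (2 * expectation (%w. abs (X 1 w))) = ennreal 2 * ennreal (2 * expectation (%w. abs (X 1 w)))" by simp
   also have "... = ennreal (2 * (2 * expectation (%w. abs (X 1 w))))" by (rule ennreal_mult'[symmetric]) simp
   finally show ?thesis by simp
  qed
  finally show ?thesis by (simp add: ennreal_plus[symmetric] C1_def del: ennreal_plus)
 qed
 thus ?thesis using that[of ?C] by (simp add: C1_def)
qed

text \<open>A series of oscillations over unit intervals with weights \<open>exp (- ep * k)\<close>
  has finite mean, since their means have a common bound. In the unit interval after time
  \<open>n\<close> the path is at most the sum of the first \<open>n + 1\<close> oscillations, whose
  weights are all at least \<open>exp (- ep * n)\<close>.\<close>

lemma exponential_domination:
 assumes e: "0 < ep"
 obtains Z where "integrable M Z" "AE w in M. ALL t>=0. abs (X t w) <= exp (ep * t) * Z w"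
proof -
 obtain C where C: "0 <= C" "!!s. 0 <= s ==> (\<integral>\<^sup>+w. ennreal (osc s w) \<partial>M) <= ennreal C" using osc_integral_bound by blast
 have om[measurable]: "osc (real k) \<in> Bor M" for k by (rule osc_measurable) simp
 define q where "q = exp (- ep)"
 have q: "0 < q" "q < 1" using e by (auto simp: q_def)
 define Y where "Y w = (\<Sum>k. ennreal (q ^ k * osc (real k) w))" for w
 have Ym[measurable]: "Y \<in> Bor M" unfolding Y_def by measurable
 have "(\<integral>\<^sup>+w. Y w \<partial>M) = (\<Sum>k. \<integral>\<^sup>+w. ennreal (q ^ k * osc (real k) w) \<partial>M)" unfolding Y_def by (intro nn_integral_suminf) measurable
 also have "... <= (\<Sum>k. ennreal (q ^ k * C))"
 proof (intro suminf_le)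
  fix k
  have "(\<integral>\<^sup>+w. ennreal (q ^ k * osc (real k) w) \<partial>M) = ennreal (q ^ k) * (\<integral>\<^sup>+w. ennreal (osc (real k) w) \<partial>M)"
   using q by (subst nn_integral_cmult[symmetric]) (auto simp: ennreal_mult')
  also have "... <= ennreal (q ^ k) * ennreal C" by (intro mult_left_mono C) auto
  finally show "(\<integral>\<^sup>+w. ennreal (q ^ k * osc (real k) w) \<partial>M) <= ennreal (q ^ k * C)" using q C by (simp add: ennreal_mult')
 qed auto
 also have "... < \<infinity>"
 proof -
  have "summable (%k. q ^ k * C)" using q by (intro summable_mult2 summable_geometric) simp
  thus ?thesis using q C by (subst suminf_ennreal2) auto
 qed
 finally have fin: "(\<integral>\<^sup>+w. Y w \<partial>M) < \<infinity>" .
 have AE_fin: "AE w in M. Y w ~= \<infinity>" by (rule nn_integral_noteq_infinite) (use fin in auto)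
 have int: "integrable M (%w. enn2real (Y w))"
 proof (rule integrableI_bounded)
  have "(\<integral>\<^sup>+w. ennreal (norm (enn2real (Y w))) \<partial>M) = (\<integral>\<^sup>+w. Y w \<partial>M)" using AE_fin by (intro nn_integral_cong_AE) (auto simp: less_top)
  thus "(\<integral>\<^sup>+w. ennreal (norm (enn2real (Y w))) \<partial>M) < \<infinity>" using fin by simp
 qed simp
 have "AE w in M. ALL t>=0. abs (X t w) <= exp (ep * t) * enn2real (Y w)" using AE_fin AE_space
 proof eventually_elim
  case (elim w)
  have osc_nn: "0 <= osc (real k) w" for k using osc_upper[OF elim(2), of "real k" 0] by simp
  have Xn: "abs (X (real n) w) <= (\<Sum>k<n. osc (real k) w)" for n
  proof (induction n)
   case 0 thus ?case using X_0[OF elim(2)] by simp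
  next
   case (Suc n)
   have "abs (X (real (Suc n)) w) <= abs (X (real n) w) + abs (Xi (real n) 1 w)" by (simp add: Xi_def add.commute)
   thus ?case using Suc osc_upper[OF elim(2), of "real n" 1] by simp
  qed
  show ?case
  proof (intro allI impI)
   fix t :: real assume t: "0 <= t"
   define n where "n = nat \<lfloor>t\<rfloor>"
   have n: "real n <= t" "t <= real n + 1" using t unfolding n_def by linarith+
   have "abs (X t w) <= abs (X (real n) w) + abs (Xi (real n) (t - real n) w)" by (simp add: Xi_def)
   also have "... <= (\<Sum>k<Suc n. osc (real k) w)" using Xn[of n] osc_upper[OF elim(2), of "real n" "t - real n"] n by simp
   finally have X: "abs (X t w) <= (\<Sum>k<Suc n. osc (real k) w)" .
   have "q ^ n * (\<Sum>k<Suc n. osc (real k) w) <= (\<Sum>k<Suc n. q ^ k * osc (real k) w)" unfolding sum_distrib_left using q osc_nn by (intro sum_mono mult_right_mono power_decreasing) auto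
   also have "... <= enn2real (Y w)"
   proof -
    have "ennreal (\<Sum>k<Suc n. q ^ k * osc (real k) w) = (\<Sum>k<Suc n. ennreal (q ^ k * osc (real k) w))" using q osc_nn by (intro sum_ennreal[symmetric]) auto
    also have "... <= Y w" unfolding Y_def by (rule sum_le_suminf) auto
    finally have "ennreal (\<Sum>k<Suc n. q ^ k * osc (real k) w) <= ennreal (enn2real (Y w))" using elim(1) by (simp add: less_top)
    thus ?thesis by (subst (asm) ennreal_le_iff) auto
   qed
   finally have le: "q ^ n * (\<Sum>k<Suc n. osc (real k) w) <= enn2real (Y w)" .
   have qn: "q ^ n = exp (- ep * real n)" by (simp add: q_def exp_of_nat_mult[symmetric] mult.commute)
   have "abs (X t w) <= exp (ep * real n) * (q ^ n * (\<Sum>k<Suc n. osc (real k) w))" using X unfolding qn by (simp add: mult.assoc[symmetric] mult_exp_exp)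
   also have "... <= exp (ep * real n) * enn2real (Y w)" using le by (intro mult_left_mono) auto
   also have "... <= exp (ep * t) * enn2real (Y w)" using e n by (intro mult_right_mono) auto
   finally show "abs (X t w) <= exp (ep * t) * enn2real (Y w)" .
  qed
 qed
 thus ?thesis using that[OF int] by blast
qed

end

section \<open>The strong Markov property\<close>

context regular_model
begin

text \<open>Event and state are known at \<open>s\<close>, while \<open>H u\<close> depends on later
  increments only; so the state can be frozen and \<open>H\<close> averaged.\<close>

lemma markov_at_time:
 fixes \<xi> :: "'a => real" and H :: "real => 'a => real"
 assumes s: "0 <= s" and A: "A \<in> sets (F s)" and \<xi>: "\<xi> \<in> Bor (F s)"
  and \<xi>_nonneg: "!!w. w \<in> space M ==> 0 <= \<xi> w"
  and H: "(%(u, w). H u w) \<in> Bor (borel \<Otimes>\<^sub>M future s)"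
  and h: "!!u. 0 <= u ==> (LINT w|M. H u w) = h u"
  and int: "integrable M (%w. indicator A w * H (\<xi> w) w)"
 shows "(LINT w|M. indicator A w * H (\<xi> w) w) = (LINT w|M. indicator A w * h (\<xi> w))"
proof -
 define Y :: "'a => real \<times> real" where "Y w = (indicator A w, \<xi> w)" for w
 have Y: "Y \<in> measurable (F s) borel2" unfolding Y_def by (intro measurable_Pair borel_measurable_indicator A \<xi>)
 have YM: "Y \<in> measurable M borel2" by (rule measurable_from_subalg[OF F_sub[OF s] Y])
 define g where "g z = fst (fst z) * (%(u, w). H u w) (snd (fst z), snd z)" for z :: "(real \<times> real) \<times> 'a"
 have g: "g \<in> Bor (borel2 \<Otimes>\<^sub>M future s)" unfolding g_def by (intro borel_measurable_times measurable_compose[OF _ H]) measurable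
 have HM: "(%(u, w). H u w) \<in> Bor (borel \<Otimes>\<^sub>M M)" using H by (rule measurable_from_subalg[rotated])
   (use future_sub(1)[OF s] in \<open>auto simp: subalgebra_def space_pair_measure sets_pair_measure intro!: sigma_sets_mono' \<close>)
 have "(LINT w|M. indicator A w * H (\<xi> w) w) = (LINT w|M. g (Y w, w))" by (simp add: g_def Y_def)
 also have "... = (LINT y|distr M borel2 Y. (LINT w|M. g (y, w)))" by (rule indep_integral[OF YM future_sub(1)[OF s] indep_future[OF s Y] g])
    (use int in \<open>simp add: g_def Y_def\<close>)
 also have "... = (LINT w'|M. (LINT w|M. g (Y w', w)))"
 proof (rule integral_distr[OF YM])
  have "g \<in> Bor (borel2 \<Otimes>\<^sub>M M)" unfolding g_def by (intro borel_measurable_times measurable_compose[OF _ HM]) measurable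
  hence "(%(y, w). g (y, w)) \<in> Bor (borel2 \<Otimes>\<^sub>M M)" by simp
  thus "(%y. LINT w|M. g (y, w)) \<in> Bor borel2" by (rule borel_measurable_lebesgue_integral)
 qed
 also have "... = (LINT w|M. indicator A w * h (\<xi> w))" by (intro Bochner_Integration.integral_cong refl) (simp add: g_def Y_def h \<xi>_nonneg)
 finally show ?thesis .
qed

text \<open>\<open>S\<close> is replaced by the next dyadic time strictly after it. On each of
  countably many pieces this time is constant and the piece is known by then, so
  \<open>markov_at_time\<close> applies. Right continuity, together with a bound uniform over
  deterministic times, takes the limit back to \<open>S\<close>.\<close>

lemma strong_markov:
 fixes S :: "'a => real" and \<xi> :: "real => 'a => real" and H :: "real => real => 'a => real"
 assumes A_sub: "A <= space M" and S_nonneg: "!!w. w \<in> A ==> 0 <= S w"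
  and S: "!!t. 0 <= t ==> {w \<in> A. S w < t} \<in> sets (F t)"
  and \<xi>: "!!t. 0 <= t ==> \<xi> t \<in> Bor (F t)"
  and \<xi>_nonneg: "!!t w. 0 <= t ==> w \<in> space M ==> 0 <= \<xi> t w"
  and H: "!!s. 0 <= s ==> (%(u, w). H s u w) \<in> Bor (borel \<Otimes>\<^sub>M future s)"
  and h: "!!s u. 0 <= s ==> 0 <= u ==> (LINT w|M. H s u w) = h u"
  and H_lim: "!!w. w \<in> A ==> ((%s. H s (\<xi> s w) w) ---> H (S w) (\<xi> (S w) w) w) (at_right (S w))"
  and h_lim: "!!w. w \<in> A ==> ((%s. h (\<xi> s w)) ---> h (\<xi> (S w) w)) (at_right (S w))"
  and B: "integrable M B"
  and H_bound: "AE w in M. ALL s>=0. exp (- \<beta> * s) * abs (H s (\<xi> s w) w) <= B w"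
  and h_bound: "AE w in M. ALL s>=0. exp (- \<beta> * s) * abs (h (\<xi> s w)) <= B w"
 shows "(LINT w|M. indicator A w * (exp (- \<beta> * S w) * H (S w) (\<xi> (S w) w) w))
   = (LINT w|M. indicator A w * (exp (- \<beta> * S w) * h (\<xi> (S w) w)))" (is "?lhs = ?rhs")
  and "integrable M (%w. indicator A w * (exp (- \<beta> * S w) * H (S w) (\<xi> (S w) w) w))"
  and "integrable M (%w. indicator A w * (exp (- \<beta> * S w) * h (\<xi> (S w) w)))"
proof -
 define a where "a k i = real (Suc i) / 2 ^ k" for k i :: nat
 have a_pos: "0 <= a k i" for k i by (simp add: a_def)
 define C where "C k i = {w \<in> A. real i / 2 ^ k <= S w & S w < a k i}" for k i
 have C_F: "C k i \<in> sets (F (a k i))" for k i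
 proof -
  have "{w \<in> A. S w < real i / 2 ^ k} \<in> sets (F (a k i))" using S[of "real i / 2 ^ k"] F_mono[of "real i / 2 ^ k" "a k i"] by (auto simp: a_def divide_right_mono)
  hence "{w \<in> A. S w < a k i} - {w \<in> A. S w < real i / 2 ^ k} \<in> sets (F (a k i))" using S[OF a_pos] by auto
  also have "{w \<in> A. S w < a k i} - {w \<in> A. S w < real i / 2 ^ k} = C k i" by (auto simp: C_def)
  finally show ?thesis .
 qed
 have C_M: "C k i \<in> sets M" for k i using C_F[of k i] F_sub[OF a_pos[of k i]] by (auto simp: subalgebra_def)
 have C_dyadic: "dyadic_above k (S w) = a k i" if "w \<in> C k i" for w k i
 proof -
  have "\<lfloor>2 ^ k * S w\<rfloor> = int i" using that by (intro floor_unique) (auto simp: C_def a_def field_simps)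
  thus ?thesis by (simp add: dyadic_above_def a_def add.commute)
 qed
 have C_UN: "(\<Union>i. C k i) = A" for k
 proof (intro set_eqI iffI)
  fix w assume w: "w \<in> A"
  define i where "i = nat \<lfloor>2 ^ k * S w\<rfloor>"
  have "real i = of_int \<lfloor>2 ^ k * S w\<rfloor>" using S_nonneg[OF w] by (simp add: i_def)
  hence "real i <= 2 ^ k * S w" "2 ^ k * S w < real i + 1" by linarith+
  hence "w \<in> C k i" using w by (simp add: C_def a_def field_simps)
  thus "w \<in> (\<Union>i. C k i)" by blast
 qed (auto simp: C_def)
 have C_disj: "disjoint_family (C k)" for k
 proof -
  have "i = j" if "w \<in> C k i" "w \<in> C k j" for w i j using C_dyadic[OF that(1)] C_dyadic[OF that(2)] by (simp add: a_def)
  thus ?thesis by (auto simp: disjoint_family_on_def)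
 qed
 have "(\<Union>i. C 0 i) \<in> sets M" using C_M by auto
 hence A_M: "A \<in> sets M" unfolding C_UN .
 have Hm: "(%w. H s (\<xi> s w) w) \<in> Bor M" if s: "0 <= s" for s
 proof -
  have "(%w. (\<xi> s w, w)) \<in> measurable M (borel \<Otimes>\<^sub>M future s)" using measurable_from_subalg[OF F_sub[OF s] \<xi>[OF s]] future_sub(1)[OF s]
   by (intro measurable_Pair) (auto simp: measurable_def subalgebra_def)
  from measurable_compose[OF this H[OF s]] show ?thesis by simp
 qed
 have hm: "(%w. h (\<xi> s w)) \<in> Bor M" if s: "0 <= s" for s
 proof -
  have "(%(u, w). H s u w) \<in> Bor (borel \<Otimes>\<^sub>M M)" using H[OF s] by (rule measurable_from_subalg[rotated])
    (use future_sub(1)[OF s] in \<open>auto simp: subalgebra_def space_pair_measure sets_pair_measure intro!: sigma_sets_mono' \<close>)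
  hence "(%u. LINT w|M. H s u w) \<in> Bor borel" by (rule borel_measurable_lebesgue_integral)
  from measurable_compose[OF measurable_from_subalg[OF F_sub[OF s] \<xi>[OF s]] this]
  show ?thesis by (rule measurable_cong[THEN iffD1, rotated]) (simp add: h s \<xi>_nonneg)
 qed
 define G where "G k w = indicator A w * (exp (- \<beta> * dyadic_above k (S w)) * H (dyadic_above k (S w)) (\<xi> (dyadic_above k (S w)) w) w)" for k w
 define g where "g k w = indicator A w * (exp (- \<beta> * dyadic_above k (S w)) * h (\<xi> (dyadic_above k (S w)) w))" for k w
 have ind: "EX i. indicator A w * f (dyadic_above k (S w)) = indicator (C k i) w * f (a k i) & (ALL j. j ~= i --> w \<notin> C k j)" for k w and f :: "real => real"
 proof (cases "w \<in> A")
  case True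
  then obtain i where i: "w \<in> C k i" using C_UN[of k] by blast
  thus ?thesis using C_dyadic[OF i] True C_disj[of k] unfolding disjoint_family_on_def by (intro exI[of _ i]) auto
 next
  case False
  thus ?thesis using C_UN[of k] by (auto simp: indicator_def)
 qed
 have piece: "indicator A w * f (dyadic_above k (S w)) = (\<Sum>i. indicator (C k i) w * f (a k i))" for k w and f :: "real => real"
 proof -
  obtain i where i: "indicator A w * f (dyadic_above k (S w)) = indicator (C k i) w * f (a k i)" "ALL j. j ~= i --> w \<notin> C k j" using ind by blast
  define c :: "nat => real" where "c j = indicator (C k j) w * f (a k j)" for j
  have "(\<Sum>j. c j) = (\<Sum>j\<in>{i}. c j)" by (rule suminf_finite) (use i(2) in \<open>auto simp: c_def\<close>)
  also have "... = c i" by simp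
  finally show ?thesis unfolding i(1) c_def by (rule sym)
 qed
 have G_m: "G k \<in> Bor M" and g_m: "g k \<in> Bor M" for k
 proof -
  have eq: "G k = (%w. \<Sum>i. indicator (C k i) w * (exp (- \<beta> * a k i) * H (a k i) (\<xi> (a k i) w) w))" unfolding G_def by (intro ext) (rule piece)
  show "G k \<in> Bor M" unfolding eq by (intro borel_measurable_suminf borel_measurable_times borel_measurable_const borel_measurable_indicator C_M Hm[OF a_pos])
  have eq: "g k = (%w. \<Sum>i. indicator (C k i) w * (exp (- \<beta> * a k i) * h (\<xi> (a k i) w)))" unfolding g_def by (intro ext) (rule piece)
  show "g k \<in> Bor M" unfolding eq by (intro borel_measurable_suminf borel_measurable_times borel_measurable_const borel_measurable_indicator C_M hm[OF a_pos])
 qed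
 have dy: "0 <= dyadic_above k (S w)" if "w \<in> A" for k w using dyadic_above(1)[of "S w" k] S_nonneg[OF that] by linarith
 have B_nonneg: "AE w in M. 0 <= B w" using h_bound by eventually_elim (force intro: order_trans[OF mult_nonneg_nonneg])
 have G_bd: "AE w in M. norm (G k w) <= B w" for k using H_bound B_nonneg by eventually_elim (use dy in \<open>auto simp: G_def indicator_def abs_mult\<close>)
 have g_bd: "AE w in M. norm (g k w) <= B w" for k using h_bound B_nonneg by eventually_elim (use dy in \<open>auto simp: g_def indicator_def abs_mult\<close>)
 have G_int: "integrable M (G k)" for k by (rule Bochner_Integration.integrable_bound[OF B G_m]) (use G_bd[of k] in \<open>eventually_elim, auto\<close>)
 have g_int: "integrable M (g k)" for k by (rule Bochner_Integration.integrable_bound[OF B g_m]) (use g_bd[of k] in \<open>eventually_elim, auto\<close>)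
 have eq: "(LINT w|M. G k w) = (LINT w|M. g k w)" for k
 proof -
  have sp: "(LINT w|M. f w) = (\<Sum>i. LINT w|M. indicator (C k i) w * f w)"
   if f: "integrable M f" "!!w. w \<notin> A ==> f w = 0" for f :: "'a => real"
  proof -
   have "(LINT w:(\<Union>i. C k i)|M. f w) = (\<Sum>i. (LINT w:(C k i)|M. f w))"
   proof (rule lebesgue_integral_countable_add)
    show "set_integrable M (\<Union>i. C k i) f" unfolding C_UN set_integrable_def using f(1) A_M by (intro integrable_mult_indicator) auto
    show "C k i Int C k j = {}" if "i ~= j" for i j using C_disj[of k] that by (auto simp: disjoint_family_on_def)
   qed (rule C_M)
   moreover have "(LINT w:(\<Union>i. C k i)|M. f w) = (LINT w|M. f w)" unfolding C_UN set_lebesgue_integral_def using f(2) by (intro Bochner_Integration.integral_cong refl) (auto simp: indicator_def)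
   ultimately show ?thesis by (simp add: set_lebesgue_integral_def)
  qed
  have "(LINT w|M. indicator (C k i) w * G k w) = (LINT w|M. indicator (C k i) w * g k w)" for i
  proof -
   let ?s = "a k i"
   have CA: "C k i <= A" by (auto simp: C_def)
   have 1: "indicator (C k i) w * G k w = exp (- \<beta> * ?s) * (indicator (C k i) w * H ?s (\<xi> ?s w) w)" for w using C_dyadic[of w k i] CA by (auto simp: G_def indicator_def)
   have 2: "indicator (C k i) w * g k w = exp (- \<beta> * ?s) * (indicator (C k i) w * h (\<xi> ?s w))" for w using C_dyadic[of w k i] CA by (auto simp: g_def indicator_def)
   have "integrable M (%w. indicator (C k i) w * G k w)" using integrable_mult_indicator[OF C_M G_int, of k i k] by simp
   hence int: "integrable M (%w. indicator (C k i) w * H ?s (\<xi> ?s w) w)" unfolding 1 by simp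
   have "(LINT w|M. indicator (C k i) w * H ?s (\<xi> ?s w) w) = (LINT w|M. indicator (C k i) w * h (\<xi> ?s w))"
    by (rule markov_at_time[OF a_pos C_F \<xi>[OF a_pos] \<xi>_nonneg[OF a_pos] H[OF a_pos] h[OF a_pos] int])
   thus ?thesis unfolding 1 2 by simp
  qed
  thus ?thesis using sp[OF G_int] sp[OF g_int] by (simp add: G_def g_def)
 qed
 have G_lim: "(%k. G k w) ----> indicator A w * (exp (- \<beta> * S w) * H (S w) (\<xi> (S w) w) w)"
  and g_lim: "(%k. g k w) ----> indicator A w * (exp (- \<beta> * S w) * h (\<xi> (S w) w))" for w
 proof -
  have "((%s. exp (- \<beta> * s)) ---> exp (- \<beta> * S w)) (at_right (S w))" by (intro tendsto_intros)
  from tendsto_mult[OF this H_lim] tendsto_mult[OF this h_lim]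
  have "((%s. exp (- \<beta> * s) * H s (\<xi> s w) w) ---> exp (- \<beta> * S w) * H (S w) (\<xi> (S w) w) w) (at_right (S w))"
   "((%s. exp (- \<beta> * s) * h (\<xi> s w)) ---> exp (- \<beta> * S w) * h (\<xi> (S w) w)) (at_right (S w))" if "w \<in> A" using that by auto
  thus "(%k. G k w) ----> indicator A w * (exp (- \<beta> * S w) * H (S w) (\<xi> (S w) w) w)"
   "(%k. g k w) ----> indicator A w * (exp (- \<beta> * S w) * h (\<xi> (S w) w))" unfolding G_def g_def by (cases "w \<in> A"; auto intro!: filterlim_compose[OF _ dyadic_above_tendsto])+
 qed
 have lm: "(%w. indicator A w * (exp (- \<beta> * S w) * H (S w) (\<xi> (S w) w) w)) \<in> Bor M"
  "(%w. indicator A w * (exp (- \<beta> * S w) * h (\<xi> (S w) w))) \<in> Bor M" by (rule borel_measurable_LIMSEQ_real[OF G_lim G_m], rule borel_measurable_LIMSEQ_real[OF g_lim g_m])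
 show "integrable M (%w. indicator A w * (exp (- \<beta> * S w) * H (S w) (\<xi> (S w) w) w))" by (rule integrable_dominated_convergence[where s=G and w=B, OF lm(1) G_m B AE_I2[OF G_lim] G_bd])
 show "integrable M (%w. indicator A w * (exp (- \<beta> * S w) * h (\<xi> (S w) w)))" by (rule integrable_dominated_convergence[where s=g and w=B, OF lm(2) g_m B AE_I2[OF g_lim] g_bd])
 have "(%k. LINT w|M. G k w) ----> ?lhs" by (rule integral_dominated_convergence[where s=G and w=B, OF lm(1) G_m B AE_I2[OF G_lim] G_bd])
 moreover have "(%k. LINT w|M. g k w) ----> ?rhs" by (rule integral_dominated_convergence[where s=g and w=B, OF lm(2) g_m B AE_I2[OF g_lim] g_bd])
 ultimately show "?lhs = ?rhs" unfolding eq by (rule LIMSEQ_unique)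
qed

end

section \<open>The law at an independent exponential time\<close>

context regular_model
begin

lemma pair_measure_sub:
 assumes "subalgebra M' G" "f \<in> measurable (S \<Otimes>\<^sub>M G) T" shows "f \<in> measurable (S \<Otimes>\<^sub>M M') T" using _ assms(2) by (rule measurable_from_subalg)
   (use assms(1) in \<open>auto simp: subalgebra_def space_pair_measure sets_pair_measure intro!: sigma_sets_mono'\<close>)

lemma pair_joint_measurable:
 assumes "0 <= s"
 shows "(%z. (Xi s (max 0 (fst z)) (snd z), Ii s (max 0 (fst z)) (snd z))) \<in> measurable (borel \<Otimes>\<^sub>M X_future s) borel2"
proof (rule measurable_Pair)
 show "(%z. Xi s (max 0 (fst z)) (snd z)) \<in> Bor (borel \<Otimes>\<^sub>M X_future s)"
  using joint_measurable[of "Xi s" "X_future s"] assms by (auto simp: case_prod_unfold intro: Xi_measurable cadlag_right[OF Xi_cadlag])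
 show "(%z. Ii s (max 0 (fst z)) (snd z)) \<in> Bor (borel \<Otimes>\<^sub>M X_future s)"
  using joint_measurable[of "Ii s" "X_future s"] assms by (auto simp: case_prod_unfold intro: Ii_measurable cadlag_right[OF Ii_cadlag(1)])
qed

lemma path_pair_measurable:
 assumes "w \<in> space M" "0 <= s"
 shows "(%t. (XI s (max 0 t) w)) \<in> measurable borel borel2" using measurable_compose[OF measurable_Pair2' pair_joint_measurable[OF assms(2)], of w] assms by simp

lemma above_set [measurable]: "{p::real \<times> real. x < snd p} \<in> sets borel2" using measurable_sets[OF measurable_snd, of "{x<..}" "borel :: real measure" "borel :: real measure"]
 by (simp add: space_pair_measure vimage_def)

lemma Xi_right_limit:
 assumes w: "w \<in> space M" and s: "0 <= s" "0 <= t"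
 shows "((%u. Xi u t w) ---> Xi s t w) (at_right s)" unfolding Xi_def
proof (intro tendsto_diff)
 show "((%u. X u w) ---> X s w) (at_right s)" using cadlag_right[OF X_cadlag[OF w] s(1)] .
 have "((%u. X u w) ---> X (s + t) w) (at_right (s + t))" using cadlag_right[OF X_cadlag[OF w], of "s + t"] s by simp
 thus "((%u. X (u + t) w) ---> X (s + t) w) (at_right s)" by (subst (asm) at_right_to_0) (subst at_right_to_0, simp add: filterlim_filtermap add_ac)
qed

text \<open>Both ends of the window move: the right end is covered by
  \<open>wsup_right_limit\<close>, and the left end costs at most the error of
  \<open>wsup_window_error\<close>.\<close>

lemma wsup_right_shift:
 assumes f: "cadlag f" and s: "0 <= s" "0 <= t"
 shows "((%u. wsup f u (u + t)) ---> wsup f s (s + t)) (at_right s)"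
proof -
 have "((%u. wsup f s (u + t)) ---> wsup f s (s + t)) (at_right s)"
 proof -
  have "(wsup f s ---> wsup f s (s + t)) (at_right (s + t))" using wsup_right_limit[OF f s(1), of "s + t"] s by simp
  thus ?thesis by (subst (asm) at_right_to_0) (subst at_right_to_0, simp add: filterlim_filtermap add_ac)
 qed
 moreover have "((%u. wsup f u (u + t) - wsup f s (u + t)) ---> 0) (at_right s)"
 proof (rule Lim_null_comparison)
  have "((%u. wsup f s u - f u) ---> wsup f s s - f s) (at_right s)" by (intro tendsto_diff wsup_right_limit[OF f s(1) order_refl] cadlag_right[OF f s(1)])
  thus "((%u. abs (wsup f s u - f u)) ---> 0) (at_right s)" by (intro tendsto_rabs_zero) simp
  show "\<forall>\<^sub>F u in at_right s. norm (wsup f u (u + t) - wsup f s (u + t)) <= abs (wsup f s u - f u)" using eventually_at_right_less[of s]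
   by eventually_elim (use wsup_window_error[OF f s(1)] s in auto)
 qed
 ultimately show ?thesis using tendsto_add by fastforce
qed

lemma Ii_right_limit:
 assumes w: "w \<in> space M" and s: "0 <= s" "0 <= t"
 shows "((%u. Ii u t w) ---> Ii s t w) (at_right s)"
proof (rule tendsto_cong[THEN iffD1])
 show "\<forall>\<^sub>F u in at_right s. X u w + wsup (%r. - X r w) u (u + t) = Ii u t w" using eventually_at_right_less[of s] by eventually_elim (use Ii_eq s w in auto)
 show "((%u. X u w + wsup (%r. - X r w) u (u + t)) ---> Ii s t w) (at_right s)" unfolding Ii_eq[OF s w]
  by (intro tendsto_add cadlag_right[OF X_cadlag[OF w] s(1)] wsup_right_shift[OF cadlag_uminus[OF X_cadlag[OF w]]] s)
qed

text \<open>The exponential time is a coordinate of a product space, which builds in its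
  independence from the path.\<close>

definition law :: "real => (real \<times> real) measure" where
 "law kp = distr (expo kp \<Otimes>\<^sub>M M) borel2 (%(t, w). (XI 0 (max 0 t) w))"

lemma law_map_measurable:
 "(%(t, w). (XI 0 (max 0 t) w)) \<in> measurable (expo kp \<Otimes>\<^sub>M M) borel2"
 using pair_measure_sub[OF future_sub(4)[OF order_refl] pair_joint_measurable[OF order_refl]] by (simp add: split_beta)

lemma prob_space_law: "0 < kp ==> prob_space (law kp)"
proof -
 assume k: "0 < kp"
 interpret E: prob_space "expo kp" by (rule prob_space_expo[OF k])
 interpret P: pair_prob_space "expo kp" M ..
 show ?thesis unfolding law_def by (rule P.prob_space_distr[OF law_map_measurable])
qed

lemma sets_law [simp, measurable_cong]: "sets (law kp) = sets borel2" and space_law [simp]: "space (law kp) = UNIV" by (simp_all add: law_def space_pair_measure)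

lemma integral_law:
 fixes f :: "real \<times> real => real"
 assumes k: "0 < kp" and f: "integrable (law kp) f"
 shows "(LINT p|law kp. f p) = (LINT w|M. (LINT t|expo kp. f (XI 0 (max 0 t) w)))"
  and "(LINT p|law kp. f p) = (LINT t|expo kp. (LINT w|M. f (XI 0 (max 0 t) w)))"
proof -
 interpret E: prob_space "expo kp" by (rule prob_space_expo[OF k])
 interpret P: pair_prob_space "expo kp" M ..
 let ?g = "%(t, w). f (XI 0 (max 0 t) w)"
 have fm: "f \<in> Bor borel2" using borel_measurable_integrable[OF f] by simp
 have int: "integrable (expo kp \<Otimes>\<^sub>M M) ?g" using f unfolding law_def by (subst (asm) integrable_distr_eq[OF law_map_measurable fm]) (simp add: case_prod_unfold)
 have "(LINT p|law kp. f p) = (LINT z|(expo kp \<Otimes>\<^sub>M M). ?g z)" unfolding law_def using fm law_map_measurable by (subst integral_distr) (auto simp: case_prod_unfold)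
 thus "(LINT p|law kp. f p) = (LINT w|M. (LINT t|expo kp. f (XI 0 (max 0 t) w)))"
  "(LINT p|law kp. f p) = (LINT t|expo kp. (LINT w|M. f (XI 0 (max 0 t) w)))" using P.integral_snd[OF int] P.integral_fst[OF int] by simp_all
qed

lemma AE_law:
 assumes k: "0 < kp" and P: "!!w t. w \<in> space M ==> 0 <= t ==> P (XI 0 t w)"
  and meas: "{p. P p} \<in> sets borel2"
 shows "AE p in law kp. P p" unfolding law_def using meas by (subst AE_distr_iff[OF law_map_measurable]) (auto simp: space_pair_measure intro!: AE_I2 P)

text \<open>The path creeps downwards. Right continuity gives \<open>X S w <= - x\<close>; the path
  is at or above \<open>- x\<close> before \<open>S\<close> and has no downward jump, so it cannot
  overshoot. The level at passage is thereby deterministic.\<close>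

lemma down_crossing_level:
 assumes w: "w \<in> space M" and x: "0 < x" and ex: "EX t>=0. X t w < - x"
 defines "S \<equiv> Inf {t. 0 <= t & X t w < - x}"
 shows "0 <= S" "X S w = - x" "!!t. 0 <= t ==> t < S ==> - x <= X t w" "!!t. S < t ==> EX s>=0. s < t & X s w < - x"
proof -
 let ?D = "{t. 0 <= t & X t w < - x}"
 have ne: "?D ~= {}" and bdd: "bdd_below ?D" using ex by (auto intro: bdd_belowI[of _ 0])
 show S0: "0 <= S" unfolding S_def using ne by (intro cInf_greatest) auto
 show before: "- x <= X t w" if "0 <= t" "t < S" for t using cInf_lower[OF _ bdd, of t] that unfolding S_def by force
 show after: "EX s>=0. s < t & X s w < - x" if "S < t" for t using that cInf_less_iff[OF ne bdd, of t] unfolding S_def by auto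
 have right: "((%u. X u w) ---> X S w) (at_right S)" using cadlag_right[OF X_cadlag[OF w] S0] .
 have "X S w <= - x"
 proof (rule ccontr)
  assume "~ X S w <= - x"
  hence "\<forall>\<^sub>F u in at_right S. - x < X u w" using right by (intro order_tendstoD) auto
  then obtain e where e: "S < e" "!!u. S < u ==> u < e ==> - x < X u w" unfolding eventually_at_right_field by auto
  obtain s where s: "0 <= s" "s < e" "X s w < - x" using after[OF e(1)] by auto
  hence "S <= s" using cInf_lower[OF _ bdd, of s] by (simp add: S_def)
  thus False using e(2)[of s] s \<open>~ X S w <= - x\<close> by (cases "s = S") auto
 qed
 moreover have "- x <= X S w"
 proof (cases "S = 0")
  case True thus ?thesis using X_0[OF w] x by simp
 next
  case False
  hence S: "0 < S" using S0 by simp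
  obtain l where l: "((%u. X u w) ---> l) (at_left S)" using cadlag_left[OF X_cadlag[OF w] S] by auto
  have "left_lim (%u. X u w) S = l" by (rule left_lim_eq[OF S l])
  hence "l <= X S w" using X_jump[OF w S] by (simp add: jump_def)
  moreover have "- x <= l"
  proof (rule tendsto_lowerbound[OF l])
   show "\<forall>\<^sub>F u in at_left S. - x <= X u w" unfolding eventually_at_left_field using S before by (intro exI[of _ 0]) auto
  qed simp
  ultimately show ?thesis by simp
 qed
 ultimately show "X S w = - x" by simp
qed

text \<open>If the running maximum exceeds \<open>x\<close>, the path restarts from level
  \<open>- x\<close> at the passage time \<open>S\<close>, and by memorylessness the remaining
  lifetime is again exponential. So the shifted pair has the original law, up to the mean of
  \<open>exp (- kp * S)\<close> on \<open>A\<close>. Continuity of \<open>f\<close> provides the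
  right limits that the strong Markov property asks for.\<close>

lemma first_passage:
 assumes k: "0 < kp" and x: "0 < x"
 shows "EX C. \<forall>f :: real \<times> real => real. ALL B. continuous_on UNIV f --> (ALL p. abs (f p) <= B) -->
   (LINT p|law kp. indicator {p. x < snd p} p * f (fst p + x, snd p - x)) = C * (LINT p|law kp. f p)"
proof -
 interpret E: prob_space "expo kp" by (rule prob_space_expo[OF k])
 interpret L: prob_space "law kp" by (rule prob_space_law[OF k])
 define A where "A = {w \<in> space M. EX t>=0. X t w < - x}"
 define S where "S w = Inf {t. 0 <= t & X t w < - x}" for w
 have level: "0 <= S w" "X (S w) w = - x" "!!t. 0 <= t ==> t < S w ==> - x <= X t w"
  "!!t. S w < t ==> EX s>=0. s < t & X s w < - x" if "w \<in> A" for w using down_crossing_level[of w x] that x unfolding A_def S_def by auto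
 have S_F: "{w \<in> A. S w < t} \<in> sets (F t)" if t: "0 <= t" for t
 proof -
  \<comment> \<open>By right continuity, a strict crossing before \<open>t\<close> is also seen at
    some rational time before \<open>t\<close>.\<close>
  have "{w \<in> A. S w < t} = (\<Union>s\<in>\<rat> Int {0..<t}. {w \<in> space M. X s w < - x})"
  proof (intro set_eqI iffI)
   fix w assume w: "w \<in> {w \<in> A. S w < t}"
   hence wM: "w \<in> space M" by (simp add: A_def)
   obtain s where s: "0 <= s" "s < t" "X s w < - x" using level(4)[of w t] w by auto
   have "\<forall>\<^sub>F u in at_right s. X u w < - x" using cadlag_right[OF X_cadlag[OF wM] s(1)] s(3) by (rule order_tendstoD)
   then obtain e where e: "s < e" "!!u. s < u ==> u < e ==> X u w < - x" unfolding eventually_at_right_field by auto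
   obtain u where u: "u \<in> \<rat>" "s < u" "u < min e t" using Rats_dense_in_real[of s "min e t"] s e by auto
   show "w \<in> (\<Union>s\<in>\<rat> Int {0..<t}. {w \<in> space M. X s w < - x})" using u e(2)[of u] s wM by (intro UN_I[of u]) auto
  next
   fix w assume "w \<in> (\<Union>s\<in>\<rat> Int {0..<t}. {w \<in> space M. X s w < - x})"
   then obtain s where s: "0 <= s" "s < t" "w \<in> space M" "X s w < - x" by auto
   hence "S w <= s" unfolding S_def by (intro cInf_lower) (auto intro: bdd_belowI[of _ 0])
   thus "w \<in> {w \<in> A. S w < t}" using s by (auto simp: A_def)
  qed
  also have "... \<in> sets (F t)"
  proof (rule sets.countable_UN'')
   show "countable (\<rat> Int {0..<t})" using countable_rat by (rule countable_subset[rotated]) auto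
   fix s assume s: "s \<in> \<rat> Int {0..<t}"
   have [measurable]: "X s \<in> Bor (F t)" using s by (intro F_le_F[OF _ _ X_F]) auto
   show "{w \<in> space M. X s w < - x} \<in> sets (F t)" unfolding space_F[OF t, symmetric] by measurable
  qed
  finally show ?thesis .
 qed
 define C where "C = (LINT w|M. indicator A w * exp (- kp * S w))"
 have main: "(LINT p|law kp. indicator {p. x < snd p} p * f (fst p + x, snd p - x)) = C * (LINT p|law kp. f p)"
  if f: "continuous_on UNIV f" and bounded: "!!p. abs (f p) <= B" for f :: "real \<times> real => real" and B
 proof -
  have fm[measurable]: "f \<in> Bor borel2" using borel_measurable_continuous_onI[OF f] by (simp add: borel_prod)
  define H where "H s u w = (LINT t|expo kp. f (XI s (max 0 t) w))" for s and u :: real and w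
  have Hm: "(%(u, w). H s u w) \<in> Bor (borel \<Otimes>\<^sub>M future s)" if s: "0 <= s" for s
  proof -
   have "(%(w, t). f (XI s (max 0 t) w)) \<in> Bor (future s \<Otimes>\<^sub>M expo kp)"
    using measurable_compose[OF measurable_compose[OF measurable_pair_swap' pair_measure_sub[OF future_sub(2)[OF s] pair_joint_measurable[OF s]]] fm] by (simp add: case_prod_unfold)
   from E.borel_measurable_lebesgue_integral[OF this] show ?thesis unfolding H_def by (simp add: split_beta)
  qed
  have Hh: "(LINT w|M. H s u w) = (LINT p|law kp. f p)" if s: "0 <= s" for s u
  proof -
   interpret P: pair_prob_space "expo kp" M ..
   let ?g = "%(t, w). f (XI s (max 0 t) w)"
   have m: "?g \<in> Bor (expo kp \<Otimes>\<^sub>M M)" using measurable_compose[OF pair_measure_sub[OF future_sub(4)[OF s] pair_joint_measurable[OF s]] fm] by (simp add: case_prod_unfold)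
   have int: "integrable (expo kp \<Otimes>\<^sub>M M) ?g" by (rule P.integrable_const_bound[of _ B, OF _ m]) (use bounded in auto)
   have "(LINT w|M. H s u w) = (LINT t|expo kp. (LINT w|M. f (XI s (max 0 t) w)))" unfolding H_def using P.integral_snd[OF int] P.integral_fst[OF int] by simp
   also have "... = (LINT t|expo kp. (LINT w|M. f (XI 0 (max 0 t) w)))" by (intro Bochner_Integration.integral_cong refl XI_expectation[OF s _ f, of _ "%_ _. B"]) (use bounded in auto)
   also have "... = (LINT p|law kp. f p)" by (rule integral_law(2)[OF k, symmetric]) (rule L.integrable_const_bound[of _ B], use bounded fm in auto)
   finally show ?thesis .
  qed
  have H_bd: "abs (H s u w) <= B" if w: "w \<in> space M" and s: "0 <= s" for s u w
  proof -
   have "abs (H s u w) <= (LINT t|expo kp. abs (f (XI s (max 0 t) w)))" unfolding H_def by (rule integral_abs_bound)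
   also have "... <= (LINT t|expo kp. B)" using bounded order_trans[OF abs_ge_zero bounded] by (intro integral_mono_AE') auto
   finally show ?thesis using E.prob_space by simp
  qed
  have H_lim: "((%s. H s u w) ---> H s0 u w) (at_right s0)" if w: "w \<in> space M" and s0: "0 <= s0" for s0 u w unfolding tendsto_at_iff_sequentially comp_def
  proof safe
   fix Z :: "nat => real" assume Z: "ALL i. Z i \<in> {s0<..} - {s0}" "Z ----> s0"
   have "Z i ~= s0 & s0 < Z i" for i using Z(1)[rule_format, of i] by auto
   hence Zr: "filterlim Z (at_right s0) sequentially" unfolding filterlim_at using Z(2) by simp
   have Z0: "0 <= Z n" for n using Z(1)[rule_format, of n] s0 by auto
   have pm: "(%t. f (XI s (max 0 t) w)) \<in> Bor (expo kp)" if s: "0 <= s" for s using measurable_compose[OF path_pair_measurable[OF w s] fm] by simp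
   show "(%n. H (Z n) u w) ----> H s0 u w" unfolding H_def
   proof (rule integral_dominated_convergence[where w="%_. B"])
    show "AE t in expo kp. (%n. f (XI (Z n) (max 0 t) w)) ----> f (XI s0 (max 0 t) w)"
    proof (rule AE_I2, rule continuous_on_tendsto_compose[OF f])
     fix t
     show "(%n. (XI (Z n) (max 0 t) w)) ----> (XI s0 (max 0 t) w)" by (intro tendsto_Pair filterlim_compose[OF Xi_right_limit[OF w s0] Zr] filterlim_compose[OF Ii_right_limit[OF w s0] Zr]) auto
    qed auto
   qed (use pm[OF s0] pm[OF Z0] bounded in auto)
  qed
  have sm: "(LINT w|M. indicator A w * (exp (- kp * S w) * H (S w) 0 w))
   = (LINT w|M. indicator A w * (exp (- kp * S w) * (LINT p|law kp. f p)))"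
  proof (rule strong_markov(1)[where \<xi>="%_ _. 0" and h="%_. LINT p|law kp. f p" and B="%_. B + abs (LINT p|law kp. f p)"])
   have B0: "0 <= B" using order_trans[OF abs_ge_zero bounded] .
   show "AE w in M. ALL s>=0. exp (- kp * s) * abs (H s 0 w) <= B + abs (LINT p|law kp. f p)"
   proof (intro AE_I2 allI impI)
    fix w s assume "w \<in> space M" "0 <= (s::real)"
    hence "exp (- kp * s) * abs (H s 0 w) <= 1 * B" using k by (intro mult_mono H_bd) auto
    thus "exp (- kp * s) * abs (H s 0 w) <= B + abs (LINT p|law kp. f p)" by simp
   qed
   show "AE w in M. ALL s>=0. exp (- kp * s) * abs (LINT p|law kp. f p) <= B + abs (LINT p|law kp. f p)"
   proof (intro AE_I2 allI impI)
    fix s assume "0 <= (s::real)"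
    hence "exp (- kp * s) * abs (LINT p|law kp. f p) <= 1 * abs (LINT p|law kp. f p)" using k by (intro mult_right_mono) auto
    thus "exp (- kp * s) * abs (LINT p|law kp. f p) <= B + abs (LINT p|law kp. f p)" using B0 by simp
   qed
  qed (use S_F Hm Hh level(1) H_lim in \<open>auto simp: A_def\<close>)
  \<comment> \<open>For a fixed path only the exponential time is integrated. Up to the null event
    \<open>t = S w\<close>, the maximum exceeds \<open>x\<close> exactly after \<open>S w\<close>,
    and what follows \<open>S w\<close> is a shifted copy of the problem.\<close>
  have path: "(LINT t|expo kp. indicator {p. x < snd p} (XI 0 (max 0 t) w) * f (Xi 0 (max 0 t) w + x, Ii 0 (max 0 t) w - x))
   = indicator A w * (exp (- kp * S w) * H (S w) 0 w)" if w: "w \<in> space M" for w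
  proof (cases "w \<in> A")
   case False
   have "Ii 0 (max 0 t) w <= x" for t unfolding Ii_def
   proof (rule wsup_least)
    fix r assume "0 <= r" "r <= max 0 t"
    hence "- x <= X r w" using False w by (auto simp: A_def not_less)
    thus "- Xi 0 r w <= x" using X_0[OF w] by (simp add: Xi_def)
   qed simp
   thus ?thesis using False by (simp add: not_less[symmetric])
  next
   case True
   note lv = level[OF True]
   define g where "g t = f (Xi 0 (max 0 t) w + x, Ii 0 (max 0 t) w - x)" for t
   have [measurable]: "(%t. Xi 0 (max 0 t) w) \<in> Bor borel" "(%t. Ii 0 (max 0 t) w) \<in> Bor borel"
    using path_pair_measurable[OF w order_refl, THEN measurable_compose, OF measurable_fst] path_pair_measurable[OF w order_refl, THEN measurable_compose, OF measurable_snd] by simp_all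
   have gm: "g \<in> Bor borel" unfolding g_def by measurable
   have cad: "cadlag (%r. - X r w)" by (rule cadlag_uminus[OF X_cadlag[OF w]])
   have I0: "Ii 0 t w = wsup (%r. - X r w) 0 t" if "0 <= t" for t using Ii_eq[OF order_refl that w] X_0[OF w] by simp
   have pre: "wsup (%r. - X r w) 0 (S w) <= x"
   proof (rule wsup_least[OF lv(1)])
    fix r assume "0 <= r" "r <= S w"
    thus "- X r w <= x" using lv(2) lv(3)[of r] by (cases "r = S w") auto
   qed
   have "(LINT t|expo kp. indicator {p. x < snd p} (XI 0 (max 0 t) w) * f (Xi 0 (max 0 t) w + x, Ii 0 (max 0 t) w - x))
    = (LINT t|expo kp. indicator {S w..} t * g t)"
   proof (rule integral_cong_AE)
    show "(%t. indicator {p. x < snd p} (XI 0 (max 0 t) w) * f (Xi 0 (max 0 t) w + x, Ii 0 (max 0 t) w - x)) \<in> Bor (expo kp)" by measurable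
    show "(%t. indicator {S w..} t * g t) \<in> Bor (expo kp)" using gm by measurable
    show "AE t in expo kp. indicator {p. x < snd p} (XI 0 (max 0 t) w) * f (Xi 0 (max 0 t) w + x, Ii 0 (max 0 t) w - x) = indicator {S w..} t * g t"
     using expo_pos[of kp] expo_no_atom[where l=kp and a="S w"]
    proof eventually_elim
     case (elim t)
     show ?case
     proof (cases "S w < t")
      case True
      then obtain s where s: "0 <= s" "s < t" "X s w < - x" using lv(4) by blast
      hence "x < Ii 0 t w" using wsup_upper[OF cad order_refl s(1), of t] I0[of t] elim by auto
      thus ?thesis using True elim by (simp add: g_def)
     next
      case False
      hence "t < S w" using elim by simp
      hence "Ii 0 t w <= x" using I0[of t] pre wsup_mono[OF cad order_refl, of t "S w"] elim by auto
      thus ?thesis using False elim \<open>t < S w\<close> by simp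
     qed
    qed
   qed
   also have "... = exp (- kp * S w) * (LINT t|expo kp. g (S w + t))" by (rule expo_shift[OF k lv(1) gm])
   also have "(LINT t|expo kp. g (S w + t)) = H (S w) 0 w" unfolding H_def
   proof (rule integral_cong_AE)
    show "(%t. g (S w + t)) \<in> Bor (expo kp)" using gm by measurable
    show "(%t. f (XI (S w) (max 0 t) w)) \<in> Bor (expo kp)" using measurable_compose[OF path_pair_measurable[OF w lv(1)] fm] by simp
    show "AE t in expo kp. g (S w + t) = f (XI (S w) (max 0 t) w)" using expo_pos[of kp]
    proof eventually_elim
     case (elim t)
     have "wsup (%r. - X r w) (S w) (S w + t) = Ii (S w) t w + x" using Ii_eq[OF lv(1), of t w] elim w lv(2) by simp
     moreover have "0 <= Ii (S w) t w" using Ii_nonneg[OF w lv(1)] elim by simp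
     ultimately have "Ii 0 (S w + t) w = Ii (S w) t w + x" using I0[of "S w + t"] wsup_split[OF cad order_refl lv(1), of "S w + t"] pre elim lv(1) by simp
     moreover have "Xi 0 (S w + t) w + x = Xi (S w) t w" using X_0[OF w] lv(2) by (simp add: Xi_def)
     ultimately show ?case using elim lv(1) by (simp add: g_def)
    qed
   qed
   finally show ?thesis using True by simp
  qed
  define fx where "fx p = indicator {p. x < snd p} p * f (fst p + x, snd p - x)" for p :: "real \<times> real"
  have fxm: "fx \<in> Bor borel2" unfolding fx_def by measurable
  have "(LINT p|law kp. fx p) = (LINT w|M. (LINT t|expo kp. fx (XI 0 (max 0 t) w)))"
   by (rule integral_law(1)[OF k]) (rule L.integrable_const_bound[of _ B], use fxm bounded order_trans[OF abs_ge_zero bounded] in \<open>auto simp: fx_def indicator_def\<close>)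
  also have "... = (LINT w|M. indicator A w * (exp (- kp * S w) * H (S w) 0 w))" by (intro Bochner_Integration.integral_cong refl) (use path in \<open>simp add: fx_def\<close>)
  also have "... = (LINT w|M. (indicator A w * exp (- kp * S w)) * (LINT p|law kp. f p))" unfolding sm by (simp add: mult.assoc)
  also have "... = C * (LINT p|law kp. f p)" unfolding C_def by simp
  finally show ?thesis by (simp add: fx_def)
 qed
 thus ?thesis by blast
qed

end

lemma AE_pair_fst:
 assumes "sigma_finite_measure B" "AE x in A. P x"
 shows "AE z in A \<Otimes>\<^sub>M B. P (fst z)"
proof -
 interpret B: sigma_finite_measure B by fact
 obtain N where N: "!!x. x \<in> space A - N ==> P x" "N \<in> null_sets A" using AE_E3[OF assms(2)] by blast
 have "N \<times> space B \<in> null_sets (A \<Otimes>\<^sub>M B)" using N(2) by (simp add: null_sets_def B.emeasure_pair_measure_Times)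
 from AE_not_in[OF this] show ?thesis using AE_space by eventually_elim (use N(1) in \<open>force simp: space_pair_measure\<close>)
qed

lemma AE_pair_snd:
 assumes "sigma_finite_measure B" "AE y in B. P y"
 shows "AE z in A \<Otimes>\<^sub>M B. P (snd z)"
proof -
 interpret B: sigma_finite_measure B by fact
 obtain N where N: "!!x. x \<in> space B - N ==> P x" "N \<in> null_sets B" using AE_E3[OF assms(2)] by blast
 have "space A \<times> N \<in> null_sets (A \<Otimes>\<^sub>M B)" using N(2) by (simp add: null_sets_def B.emeasure_pair_measure_Times)
 from AE_not_in[OF this] show ?thesis using AE_space by eventually_elim (use N(1) in \<open>force simp: space_pair_measure\<close>)
qed

context regular_model
begin

lemma exp_product_integrable:
 assumes e: "0 <= ep" "ep < l" and Z: "integrable M Z"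
 shows "integrable (expo l \<Otimes>\<^sub>M M) (%(t, w). exp (ep * t) * Z w :: real)"
proof -
 have l: "0 < l" using e by simp
 interpret E: prob_space "expo l" by (rule prob_space_expo[OF l])
 interpret P: pair_prob_space "expo l" M ..
 note [measurable] = borel_measurable_integrable[OF Z]
 show ?thesis
 proof (rule P.Fubini_integrable)
  show "integrable (expo l) (%t. LINT w|M. norm (case (t, w) of (t, w) => exp (ep * t) * Z w))" using expo_exp_integrable(1)[OF e] by (simp add: abs_mult)
  show "AE t in expo l. integrable M (%w. case (t, w) of (t, w) => exp (ep * t) * Z w)" using Z by simp
 qed measurable
qed

lemma domination:
 assumes e: "0 < ep"
 obtains Z where "integrable M Z" "AE w in M. 0 <= Z w"
  "AE w in M. ALL t>=0. abs (X t w) <= exp (ep * t) * Z w"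
  "AE w in M. ALL s>=0. ALL t>=0. abs (Xi s t w) <= exp (ep * (s + t)) * Z w & abs (Ii s t w) <= exp (ep * (s + t)) * Z w"
proof -
 obtain Z where Z: "integrable M Z" "AE w in M. ALL t>=0. abs (X t w) <= exp (ep * t) * Z w" using exponential_domination[OF e] by blast
 show ?thesis
 \<comment> \<open>An increment is the difference of two values of \<open>X\<close>, hence the
   factor 2.\<close>
 proof (rule that[of "%w. 2 * Z w"])
  show "integrable M (%w. 2 * Z w)" using Z(1) by simp
  have nn: "AE w in M. 0 <= Z w" using Z(2) by eventually_elim (auto dest: spec[of _ 0])
  thus "AE w in M. 0 <= 2 * Z w" by simp
  show "AE w in M. ALL t>=0. abs (X t w) <= exp (ep * t) * (2 * Z w)" using Z(2) nn
  proof eventually_elim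
   case (elim w)
   show ?case
   proof (intro allI impI)
    fix t :: real assume "0 <= t"
    hence "abs (X t w) <= exp (ep * t) * Z w" using elim by blast
    also have "... <= exp (ep * t) * (2 * Z w)" using elim by simp
    finally show "abs (X t w) <= exp (ep * t) * (2 * Z w)" .
   qed
  qed
  show "AE w in M. ALL s>=0. ALL t>=0. abs (Xi s t w) <= exp (ep * (s + t)) * (2 * Z w) & abs (Ii s t w) <= exp (ep * (s + t)) * (2 * Z w)" using Z(2) nn AE_space
  proof eventually_elim
   case (elim w)
   have *: "abs (Xi s r w) <= exp (ep * (s + t)) * (2 * Z w)" if "0 <= s" "0 <= r" "r <= t" for s r t
   proof -
    have "abs (X u w) <= exp (ep * (s + t)) * Z w" if "0 <= u" "u <= s + t" for u
    proof -
     have "abs (X u w) <= exp (ep * u) * Z w" using elim that by blast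
     also have "... <= exp (ep * (s + t)) * Z w" using e elim that by (intro mult_right_mono) auto
     finally show ?thesis .
    qed
    from this[of s] this[of "s + r"] show ?thesis using that by (simp add: Xi_def abs_le_iff)
   qed
   have "abs (Ii s t w) <= exp (ep * (s + t)) * (2 * Z w)" if "0 <= s" "0 <= t" for s t
   proof -
    have "Ii s t w <= exp (ep * (s + t)) * (2 * Z w)" unfolding Ii_def
    proof (rule wsup_least[OF that(2)])
     fix r assume "0 <= r" "r <= t"
     thus "- Xi s r w <= exp (ep * (s + t)) * (2 * Z w)" using *[OF that(1), of r t] by (simp add: abs_le_iff)
    qed
    thus ?thesis using Ii_nonneg[OF elim(3) that] by simp
   qed
   thus ?case using * by blast
  qed
 qed
qed

lemma Xi_Ii_integrable:
 assumes s: "0 <= s" and t: "0 <= t"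
 shows "integrable M (Xi s t)" "integrable M (Ii s t)"
proof -
 obtain Z where Z: "integrable M Z" "AE w in M. 0 <= Z w"
  and b: "AE w in M. ALL s>=0. ALL t>=0. abs (Xi s t w) <= exp (1 * (s + t)) * Z w & abs (Ii s t w) <= exp (1 * (s + t)) * Z w" by (rule domination[OF zero_less_one])
 have i: "integrable M (%w. exp (1 * (s + t)) * Z w)" using Z by simp
 note m = measurable_compose[OF XI_pair_measurable[OF s t]]
 show "integrable M (Xi s t)" by (rule Bochner_Integration.integrable_bound[OF i]) (use m[OF measurable_fst] b Z(2) s t in \<open>auto elim!: AE_mp\<close>)
 show "integrable M (Ii s t)" by (rule Bochner_Integration.integrable_bound[OF i]) (use m[OF measurable_snd] b Z(2) s t in \<open>auto elim!: AE_mp\<close>)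
qed

lemma law_integrable:
 assumes k: "0 < kp"
 shows "integrable (law kp) fst" "integrable (law kp) snd"
proof -
 \<comment> \<open>Half the killing rate: the envelope \<open>exp (kp / 2 * t)\<close> stays
   integrable under \<open>expo kp\<close>.\<close>
 have e: "0 < kp / 2" "0 <= kp / 2" "kp / 2 < kp" using k by auto
 interpret E: prob_space "expo kp" by (rule prob_space_expo[OF k])
 interpret P: pair_prob_space "expo kp" M ..
 obtain Z where Z: "integrable M Z"
  "AE w in M. ALL s>=0. ALL t>=0. abs (Xi s t w) <= exp (kp / 2 * (s + t)) * Z w & abs (Ii s t w) <= exp (kp / 2 * (s + t)) * Z w" using domination[OF e(1)] by blast
 note int = exp_product_integrable[OF e(2,3) Z(1)]
 have AE: "AE z in expo kp \<Otimes>\<^sub>M M. 0 < fst z & (ALL s>=0. ALL t>=0. abs (Xi s t (snd z)) <= exp (kp / 2 * (s + t)) * Z (snd z) & abs (Ii s t (snd z)) <= exp (kp / 2 * (s + t)) * Z (snd z))"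
  by (rule AE_conjI[OF AE_pair_fst[OF sigma_finite_measure_axioms expo_pos] AE_pair_snd[OF sigma_finite_measure_axioms Z(2)]])
 have "integrable (expo kp \<Otimes>\<^sub>M M) (%z. fst ((%(t, w). (XI 0 (max 0 t) w)) z))"
 proof (rule Bochner_Integration.integrable_bound[OF int])
  show "(%z. fst ((%(t, w). (XI 0 (max 0 t) w)) z)) \<in> Bor (expo kp \<Otimes>\<^sub>M M)" using measurable_compose[OF law_map_measurable measurable_fst] .
  show "AE z in expo kp \<Otimes>\<^sub>M M. norm (fst ((%(t, w). (XI 0 (max 0 t) w)) z)) <= norm (case z of (t, w) => exp (kp / 2 * t) * Z w)" using AE
  proof eventually_elim
   case (elim z)
   hence "abs (Xi 0 (fst z) (snd z)) <= exp (kp / 2 * (0 + fst z)) * Z (snd z)" "abs (Ii 0 (fst z) (snd z)) <= exp (kp / 2 * (0 + fst z)) * Z (snd z)" by auto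
   thus ?case using elim by (simp add: case_prod_unfold)
  qed
 qed
 thus "integrable (law kp) fst" unfolding law_def by (subst integrable_distr_eq[OF law_map_measurable]) auto
 have "integrable (expo kp \<Otimes>\<^sub>M M) (%z. snd ((%(t, w). (XI 0 (max 0 t) w)) z))"
 proof (rule Bochner_Integration.integrable_bound[OF int])
  show "(%z. snd ((%(t, w). (XI 0 (max 0 t) w)) z)) \<in> Bor (expo kp \<Otimes>\<^sub>M M)" using measurable_compose[OF law_map_measurable measurable_snd] .
  show "AE z in expo kp \<Otimes>\<^sub>M M. norm (snd ((%(t, w). (XI 0 (max 0 t) w)) z)) <= norm (case z of (t, w) => exp (kp / 2 * t) * Z w)" using AE
  proof eventually_elim
   case (elim z)
   hence "abs (Xi 0 (fst z) (snd z)) <= exp (kp / 2 * (0 + fst z)) * Z (snd z)" "abs (Ii 0 (fst z) (snd z)) <= exp (kp / 2 * (0 + fst z)) * Z (snd z)" by auto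
   thus ?case using elim by (simp add: case_prod_unfold)
  qed
 qed
 thus "integrable (law kp) snd" unfolding law_def by (subst integrable_distr_eq[OF law_map_measurable]) auto
qed

text \<open>The indicators of \<open>y < snd p\<close> and of \<open>fst p = z\<close> are pointwise
  limits of bounded continuous functions, so the factorisation extends to them. The first identity
  makes the tail of the running maximum multiplicative; the second transports atoms of the end
  position.\<close>

lemma first_passage_tail:
 assumes k: "0 < kp" and x: "0 < x" and y: "0 < y"
 shows "measure (law kp) {p. x + y < snd p} = measure (law kp) {p. x < snd p} * measure (law kp) {p. y < snd p}"
  and "measure (law kp) {p. x < snd p & fst p + x = z} = measure (law kp) {p. x < snd p} * measure (law kp) {p. fst p = z}"
proof -
 interpret L: prob_space "law kp" by (rule prob_space_law[OF k])
 obtain C where C: "!!f :: real \<times> real => real. !!B. continuous_on UNIV f ==> (!!p. abs (f p) <= B) ==>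
   (LINT p|law kp. indicator {p. x < snd p} p * f (fst p + x, snd p - x)) = C * (LINT p|law kp. f p)" using first_passage[OF k x] by blast
 \<comment> \<open>Testing with the constant 1 identifies the constant as a tail
   probability.\<close>
 have Cx: "C = measure (law kp) {p. x < snd p}" using C[of "%_. 1" 1] L.prob_space by simp
 have zset[measurable]: "{p::real \<times> real. fst p = z} \<in> sets borel2" for z using measurable_sets[OF measurable_fst, of "{z}" "borel :: real measure" "borel :: real measure"]
  by (simp add: space_pair_measure vimage_def)
 have lim: "(LINT p|law kp. indicator {p. x < snd p} p * g (fst p + x, snd p - x)) = C * (LINT p|law kp. g p)"
  if f: "!!k. continuous_on UNIV (f k)" "!!k p. abs (f k p) <= 1" and fg: "!!p. (%k. f k p) ----> g p"
  for f :: "nat => real \<times> real => real" and g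
 proof -
  have fm[measurable]: "f k \<in> Bor borel2" for k using borel_measurable_continuous_onI[OF f(1)] by (simp add: borel_prod)
  have gm[measurable]: "g \<in> Bor borel2" using fg by (rule borel_measurable_LIMSEQ_real) simp
  have "(%k. LINT p|law kp. indicator {p. x < snd p} p * f k (fst p + x, snd p - x)) ----> (LINT p|law kp. indicator {p. x < snd p} p * g (fst p + x, snd p - x))"
  proof (rule integral_dominated_convergence[where w="%_. 1"])
   show "AE p in law kp. (%k. indicator {p. x < snd p} p * f k (fst p + x, snd p - x)) ----> indicator {p. x < snd p} p * g (fst p + x, snd p - x)" by (intro AE_I2 tendsto_intros fg)
   show "AE p in law kp. norm (indicator {p. x < snd p} p * f k (fst p + x, snd p - x)) <= 1" for k using f(2) by (auto simp: indicator_def)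
  qed auto
  moreover have "(%k. C * (LINT p|law kp. f k p)) ----> C * (LINT p|law kp. g p)"
   by (intro tendsto_mult tendsto_const integral_dominated_convergence[where w="%_. 1"]) (use fg f(2) in auto)
  ultimately show ?thesis unfolding C[OF f] by (rule LIMSEQ_unique)
 qed
 have "(LINT p|law kp. indicator {p. x < snd p} p * (%p. indicator {p. y < snd p} p) (fst p + x, snd p - x)) = C * (LINT p|law kp. indicator {p. y < snd p} p)"
 proof (rule lim[of "%k p. min 1 (max 0 (real k * (snd p - y)))"])
  fix p :: "real \<times> real"
  show "(%k. min 1 (max 0 (real k * (snd p - y)))) ----> indicator {p. y < snd p} p"
  proof (cases "y < snd p")
   case True
   have "\<forall>\<^sub>F k in sequentially. min 1 (max 0 (real k * (snd p - y))) = 1"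
   proof -
    obtain n where "1 / (snd p - y) < real n" using reals_Archimedean2 by blast
    hence n: "1 < real n * (snd p - y)" using True by (simp add: divide_less_eq)
    have "min 1 (max 0 (real k * (snd p - y))) = 1" if "n <= k" for k
    proof -
     have "real n * (snd p - y) <= real k * (snd p - y)" using True that by (intro mult_right_mono) auto
     thus ?thesis using n by linarith
    qed
    thus ?thesis unfolding eventually_sequentially by blast
   qed
   thus ?thesis using True by (auto intro: tendsto_eventually)
  next
   case False
   hence "real k * (snd p - y) <= 0" for k by (simp add: mult_nonneg_nonpos)
   hence "min 1 (max 0 (real k * (snd p - y))) = 0" for k by (metis max_absorb1 min_absorb2 zero_le_one)
   thus ?thesis using False by simp
  qed
 qed (auto intro!: continuous_intros)
 moreover have "indicator {p. x < snd p} p * (%p. indicator {p. y < snd p} p) (fst p + x, snd p - x) = (indicator {p. x + y < snd p} p :: real)" for p using y by (auto simp: indicator_def)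
 ultimately show "measure (law kp) {p. x + y < snd p} = measure (law kp) {p. x < snd p} * measure (law kp) {p. y < snd p}" by (simp add: Cx)
 have "(LINT p|law kp. indicator {p. x < snd p} p * (%p. indicator {p. fst p = z} p) (fst p + x, snd p - x)) = C * (LINT p|law kp. indicator {p. fst p = z} p)"
 proof (rule lim[of "%k p. max 0 (1 - real k * abs (fst p - z))"])
  fix p :: "real \<times> real"
  show "(%k. max 0 (1 - real k * abs (fst p - z))) ----> indicator {p. fst p = z} p"
  proof (cases "fst p = z")
   case False
   have "\<forall>\<^sub>F k in sequentially. max 0 (1 - real k * abs (fst p - z)) = 0"
   proof -
    obtain n where "1 / abs (fst p - z) < real n" using reals_Archimedean2 by blast
    hence n: "1 < real n * abs (fst p - z)" using False by (simp add: divide_less_eq)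
    have "max 0 (1 - real k * abs (fst p - z)) = 0" if "n <= k" for k
    proof -
     have "real n * abs (fst p - z) <= real k * abs (fst p - z)" using that by (intro mult_right_mono) auto
     thus ?thesis using n by linarith
    qed
    thus ?thesis unfolding eventually_sequentially by blast
   qed
   thus ?thesis using False by (auto intro: tendsto_eventually)
  qed simp
 qed (auto intro!: continuous_intros)
 moreover have "indicator {p. x < snd p} p * (%p. indicator {p. fst p = z} p) (fst p + x, snd p - x) = (indicator {p. x < snd p & fst p + x = z} p :: real)" for p by (auto simp: indicator_def)
 ultimately show "measure (law kp) {p. x < snd p & fst p + x = z} = measure (law kp) {p. x < snd p} * measure (law kp) {p. fst p = z}" by (simp add: Cx)
qed

text \<open>If the maximum of \<open>- X\<close> were 0 at the exponential time, it would be 0 at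
  arbitrarily large fixed times, so \<open>X\<close> would never be negative. By stationarity no
  increment would be negative, and \<open>X\<close> would be non-decreasing.\<close>

lemma infimum_moves:
 assumes k: "0 < kp"
 shows "EX x>0. 0 < measure (law kp) {p. x < snd p}"
proof (rule ccontr)
 assume neg: "~ (EX x>0. 0 < measure (law kp) {p. x < snd p})"
 interpret L: prob_space "law kp" by (rule prob_space_law[OF k])
 interpret E: prob_space "expo kp" by (rule prob_space_expo[OF k])
 interpret P: pair_prob_space "expo kp" M ..
 have "AE p in law kp. ~ (1 / real (Suc n) < snd p)" for n
 proof -
  have "measure (law kp) {p. 1 / real (Suc n) < snd p} = 0" using neg[simplified, rule_format, of "1 / real (Suc n)"] measure_nonneg[of "law kp"] by (simp add: not_less antisym)
  hence "{p. 1 / real (Suc n) < snd p} \<in> null_sets (law kp)" by (simp add: null_sets_def L.emeasure_eq_measure)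
  from AE_not_in[OF this] show ?thesis by simp
 qed
 hence "AE p in law kp. ALL n. ~ (1 / real (Suc n) < snd p)" by (simp add: AE_all_countable)
 hence "AE p in law kp. snd p <= 0"
 proof eventually_elim
  case (elim p)
  show ?case
  proof (rule ccontr)
   assume "~ snd p <= 0"
   then obtain n where "inverse (real (Suc n)) < snd p" using reals_Archimedean[of "snd p"] by auto
   thus False using elim by (simp add: inverse_eq_divide)
  qed
 qed
 hence "AE z in expo kp \<Otimes>\<^sub>M M. Ii 0 (max 0 (fst z)) (snd z) <= 0" unfolding law_def by (subst (asm) AE_distr_iff[OF law_map_measurable]) (auto simp: case_prod_unfold)
 hence AEt: "AE t in expo kp. AE w in M. Ii 0 (max 0 t) w <= 0" using P.AE_pair by fastforce
 \<comment> \<open>The exponential law charges every half-line, so a property of almost all times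
   holds at some time beyond any bound.\<close>
 have "EX t>=real n. AE w in M. Ii 0 (max 0 t) w <= 0" for n
 proof (rule ccontr)
  assume *: "~ ?thesis"
  from AEt have "AE t in expo kp. t < real n" by eventually_elim (use * in \<open>meson not_less\<close>)
  hence "AE t in expo kp. indicator {..<real n} t = (1::real)" by eventually_elim simp
  hence "(LINT t|expo kp. indicator {..<real n} t) = (LINT t|expo kp. (1::real))" by (intro integral_cong_AE) auto
  thus False using expo_less[OF k, of "real n"] E.prob_space by simp
 qed
 then obtain t where t: "!!n. real n <= t n" "!!n. AE w in M. Ii 0 (max 0 (t n)) w <= 0" by metis
 have "AE w in M. ALL n. Ii 0 (max 0 (t n)) w <= 0" using t(2) by (simp add: AE_all_countable)
 hence nn: "AE w in M. ALL u>=0. 0 <= X u w" using AE_space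
 proof eventually_elim
  case (elim w)
  show ?case
  proof (intro allI impI)
   fix u :: real assume u: "0 <= u"
   obtain n where "u <= real n" using real_arch_simple by blast
   hence "- Xi 0 u w <= Ii 0 (max 0 (t n)) w" using u t(1)[of n] by (intro Ii_upper elim) auto
   thus "0 <= X u w" using elim(1)[rule_format, of n] X_0[OF elim(2)] by (simp add: Xi_def)
  qed
 qed
 have incr: "AE w in M. 0 <= Xi s u w" if s: "0 <= s" "0 <= u" for s u
 proof -
  have "AE w in M. 0 <= X u w" using nn by eventually_elim (use s in simp)
  hence "AE y in distr M borel (X u). 0 <= y" using X_meas[OF s(2)] by (subst AE_distr_iff) auto
  thus ?thesis unfolding Xi_distr[OF s, symmetric] using Xi_meas[OF s] by (subst (asm) AE_distr_iff) auto
 qed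
 have "AE w in M. \<forall>s\<in>\<rat>. \<forall>u\<in>\<rat>. 0 <= s --> 0 <= u --> 0 <= Xi s u w" using incr by (simp add: AE_ball_countable[OF countable_rat])
 hence "AE w in M. mono_on {0..} (%t. X t w)" using AE_space
 proof eventually_elim
  case (elim w)
  show ?case
  proof (rule mono_onI)
   fix a b :: real assume ab: "a \<in> {0..}" "b \<in> {0..}" "a <= b"
   have rat: "dyadic_above k c \<in> \<rat>" for k c by (simp add: dyadic_above_def)
   have lim: "(%k. X (dyadic_above k c) w) ----> X c w" if "0 <= c" for c by (rule filterlim_compose[OF cadlag_right[OF X_cadlag[OF elim(2)] that] dyadic_above_tendsto])
   show "X a w <= X b w"
   proof (rule LIMSEQ_le[OF lim lim])
    have "X (dyadic_above k a) w <= X (dyadic_above k b) w" for k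
    proof -
     have "\<lfloor>2 ^ k * a\<rfloor> <= \<lfloor>2 ^ k * b\<rfloor>" using ab by (intro floor_mono mult_left_mono) auto
     hence le: "dyadic_above k a <= dyadic_above k b" by (simp add: dyadic_above_def divide_right_mono)
     moreover have "0 <= dyadic_above k a" using dyadic_above(1)[of a k] ab by auto
     ultimately have "0 <= Xi (dyadic_above k a) (dyadic_above k b - dyadic_above k a) w" using elim(1) rat by (intro elim(1)[rule_format]) auto
     thus ?thesis by (simp add: Xi_def)
    qed
    thus "EX N. ALL n>=N. X (dyadic_above n a) w <= X (dyadic_above n b) w" by blast
   qed (use ab in auto)
  qed
 qed
 thus False using X_not_mono by simp
qed

text \<open>Halving \<open>x0\<close> gives \<open>P (e n) = P (e (Suc n)) * P (e (Suc n))\<close>;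
  the limit solves \<open>l = l * l\<close> and is positive, hence 1. An atom of the maximum at
  \<open>x\<close> has mass at most \<open>P (x - e n) - P x\<close>, hence at most
  \<open>1 - P (e n)\<close>, which tends to 0.\<close>

lemma law_regular:
 assumes k: "0 < kp"
 shows "AE p in law kp. 0 < snd p" and "!!x. 0 < x ==> AE p in law kp. snd p ~= x" and "!!y. AE p in law kp. fst p ~= y"
proof -
 interpret L: prob_space "law kp" by (rule prob_space_law[OF k])
 define P where "P x = measure (law kp) {p. x < snd p}" for x
 obtain x0 where x0: "0 < x0" "0 < P x0" using infimum_moves[OF k] by (auto simp: P_def)
 define e where "e n = x0 / 2 ^ n" for n :: nat
 have e: "0 < e n" "e n = e (Suc n) + e (Suc n)" for n using x0 by (auto simp: e_def)
 have "(%n. x0 * (1 / 2) ^ n) ----> x0 * 0" by (intro tendsto_mult tendsto_const LIMSEQ_power_zero) simp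
 hence e_lim: "e ----> 0" by (simp add: e_def[abs_def] power_divide)
 have Pe: "P (e n) = P (e (Suc n)) * P (e (Suc n))" for n using first_passage_tail(1)[OF k e(1)[of "Suc n"] e(1)[of "Suc n"]] e(2)[of n] by (simp add: P_def)
 have UN: "(\<Union>n. {p::real \<times> real. e n < snd p}) = {p. 0 < snd p}"
 proof (intro set_eqI iffI)
  fix p :: "real \<times> real" assume "p \<in> {p. 0 < snd p}"
  hence "\<forall>\<^sub>F n in sequentially. e n < snd p" using e_lim by (intro order_tendstoD) auto
  thus "p \<in> (\<Union>n. {p. e n < snd p})" by (auto simp: eventually_sequentially)
 qed (use e(1) in \<open>auto intro: less_trans\<close>)
 have "incseq (%n. {p::real \<times> real. e n < snd p})"
 proof (rule incseq_SucI)
  fix n show "{p::real \<times> real. e n < snd p} <= {p. e (Suc n) < snd p}" using e(1)[of "Suc n"] e(2)[of n] by auto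
 qed
 hence P_lim: "(%n. P (e n)) ----> measure (law kp) {p. 0 < snd p}" using L.finite_Lim_measure_incseq[of "%n. {p::real \<times> real. e n < snd p}"] unfolding UN P_def
  by (simp add: above_set image_subset_iff)
 define l where "l = measure (law kp) {p. 0 < snd p}"
 have "(%n. P (e (Suc n)) * P (e (Suc n))) ----> l * l" unfolding l_def by (intro tendsto_mult LIMSEQ_Suc[OF P_lim])
 hence "l = l * l" unfolding Pe[symmetric] using LIMSEQ_unique P_lim l_def by blast
 moreover have "0 < l"
 proof -
  have "P x0 <= l" unfolding P_def l_def using x0 by (intro L.finite_measure_mono) (auto intro: above_set)
  thus ?thesis using x0 by simp
 qed
 ultimately have l: "l = 1" by simp
 thus pos: "AE p in law kp. 0 < snd p" using L.prob_eq_1[of "{p. 0 < snd p}"] by (simp add: l_def above_set)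
 show "AE p in law kp. snd p ~= x" if x: "0 < x" for x
 proof -
  have set: "{p::real \<times> real. snd p = x} \<in> sets borel2" using measurable_sets[OF measurable_snd, of "{x}" "borel :: real measure" "borel :: real measure"]
   by (simp add: space_pair_measure vimage_def)
  have "measure (law kp) {p. snd p = x} <= 0"
  proof (rule LIMSEQ_le_const)
   have "(%n. 1 - P (e n)) ----> 1 - l" unfolding l_def by (intro tendsto_intros P_lim)
   thus "(%n. 1 - P (e n)) ----> 0" using l by simp
   have "\<forall>\<^sub>F n in sequentially. e n < x" using e_lim x by (rule order_tendstoD)
   then obtain N where N: "!!n. N <= n ==> e n < x" by (auto simp: eventually_sequentially)
   show "EX N. ALL n>=N. measure (law kp) {p. snd p = x} <= 1 - P (e n)"
   proof (intro exI allI impI)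
    fix n assume n: "N <= n"
    have "measure (law kp) {p. snd p = x} + P x = measure (law kp) ({p. snd p = x} \<union> {p. x < snd p})" unfolding P_def by (subst L.finite_measure_Union) (use set above_set in auto)
    also have "... <= P (x - e n)" unfolding P_def using e(1)[of n] by (intro L.finite_measure_mono) (auto intro: above_set)
    finally have "measure (law kp) {p. snd p = x} <= P (x - e n) - P x" by simp
    also have "P x = P (x - e n) * P (e n)" using first_passage_tail(1)[OF k _ e(1)[of n], of "x - e n"] N[OF n] by (simp add: P_def)
    also have "P (x - e n) - P (x - e n) * P (e n) = P (x - e n) * (1 - P (e n))" by (simp add: algebra_simps)
    also have "... <= 1 * (1 - P (e n))" unfolding P_def by (intro mult_right_mono) auto
    finally show "measure (law kp) {p. snd p = x} <= 1 - P (e n)" by simp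
   qed
  qed
  hence "measure (law kp) {p. snd p = x} = 0" using measure_nonneg[of "law kp"] by (intro antisym) auto
  hence "{p. snd p = x} \<in> null_sets (law kp)" using set by (simp add: null_sets_def L.emeasure_eq_measure)
  from AE_not_in[OF this] show ?thesis by simp
 qed
 show "AE p in law kp. fst p ~= y" for y
 proof -
  have set: "{p::real \<times> real. fst p = z} \<in> sets borel2" for z using measurable_sets[OF measurable_fst, of "{z}" "borel :: real measure" "borel :: real measure"]
   by (simp add: space_pair_measure vimage_def)
  interpret D: prob_space "distr (law kp) borel fst" by (rule L.prob_space_distr) simp
  have D: "measure (distr (law kp) borel fst) {z} = measure (law kp) {p. fst p = z}" for z by (subst measure_distr) (auto intro!: arg_cong[where f="measure (law kp)"])
  \<comment> \<open>An atom at \<open>y\<close> charged together with a maximum above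
    \<open>x n\<close> would make \<open>y + x n\<close> an atom too. Atoms are countable, so
    arbitrarily small \<open>x n\<close> exist for which \<open>y + x n\<close> is none; positivity
    of the maximum then covers the whole event.\<close>
  define Q where "Q = (%z. z - y) ` {z. measure (law kp) {p. fst p = z} ~= 0}"
  have Q: "countable Q" unfolding Q_def using D.countable_support by (simp add: D)
  have "EX x. 0 < x & x < 1 / real (Suc n) & x \<notin> Q" for n
  proof -
   have "uncountable {0<..<1 / real (Suc n)}" by (simp add: uncountable_open_interval)
   hence "~ {0<..<1 / real (Suc n)} <= Q" using Q countable_subset by blast
   thus ?thesis by auto
  qed
  then obtain x where x: "!!n. 0 < x n" "!!n. x n < 1 / real (Suc n)" "!!n. x n \<notin> Q" by metis
  have "AE p in law kp. ~ (x n < snd p & fst p = y)" for n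
  proof -
   have "measure (law kp) {p. fst p = y + x n} = 0" using x(3)[of n] unfolding Q_def by (auto simp: image_iff)
   hence "measure (law kp) {p. x n < snd p & fst p + x n = y + x n} = 0" using first_passage_tail(2)[OF k x(1)[of n] zero_less_one, of "y + x n"] by simp
   hence "measure (law kp) ({p. x n < snd p} Int {p. fst p = y}) = 0" by (simp add: Collect_conj_eq)
   moreover have "{p. x n < snd p} Int {p. fst p = y} \<in> sets (law kp)" using set above_set by auto
   ultimately have "{p. x n < snd p} Int {p. fst p = y} \<in> null_sets (law kp)" by (simp add: null_sets_def L.emeasure_eq_measure)
   from AE_not_in[OF this] show ?thesis by simp
  qed
  hence "AE p in law kp. ALL n. ~ (x n < snd p & fst p = y)" unfolding AE_all_countable by blast
  thus ?thesis using pos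
  proof eventually_elim
   case (elim p)
   obtain n where "inverse (real (Suc n)) < snd p" using reals_Archimedean[of "snd p"] elim by auto
   hence "x n < snd p" using x(2)[of n] by (simp add: inverse_eq_divide)
   thus ?case using elim by blast
  qed
 qed
qed

lemma stage_problem_law:
 assumes "0 < lam" "0 < r" "1 < \<phi>" and "!!u. 0 <= u ==> 0 <= \<Psi> u" "tame \<phi> \<Psi>" "concave_on {0..} \<Psi>"
  "EX C. ALL u>=0. \<Psi> u <= (1 + r / (2 * lam)) * u + C"
 shows "stage_problem (law (lam + \<gamma> + r)) lam \<gamma> r \<phi> \<Psi>"
proof -
 have k: "0 < lam + \<gamma> + r" using assms intensity_pos by simp
 interpret L: prob_space "law (lam + \<gamma> + r)" by (rule prob_space_law[OF k])
 show ?thesis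
 proof
  show "AE p in law (lam + \<gamma> + r). 0 <= fst p + snd p"
  proof (rule AE_law[OF k])
   have "{p::real \<times> real. 0 <= fst p + snd p} = {p \<in> space borel2. 0 <= fst p + snd p}" by (simp add: space_pair_measure)
   also have "... \<in> sets borel2" by measurable
   finally show "{p::real \<times> real. 0 <= fst p + snd p} \<in> sets borel2" .
  next
   fix w and t :: real assume "w \<in> space M" "0 <= t"
   thus "0 <= fst (XI 0 t w) + snd (XI 0 t w)" using Ii_upper[of w 0 t t] by simp
  qed
 qed (use assms intensity_pos law_integrable[OF k] law_regular[OF k] in auto)
qed

end

section \<open>Waiting for the next arrival\<close>

context regular_model
begin

lemma arrival_le_iff:
 assumes "w \<in> space M" "0 <= t"
 shows "arrival_time (%t. N t w) n <= t <-> n <= N t w" by (rule arrival_time_le_iff) (use assms N_mono N_cadlag N_unbounded in auto)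

definition wait :: "real => 'a => real" where
 "wait s w = arrival_time (%t. N t w) (Suc (N s w)) - s"

lemma wait_le_iff:
 assumes "w \<in> space M" "0 <= s" "0 <= t"
 shows "wait s w <= t <-> N (s + t) w ~= N s w"
proof -
 have "N s w <= N (s + t) w" using N_mono[OF assms(1)] assms by (auto simp: mono_on_def)
 moreover have "wait s w <= t <-> Suc (N s w) <= N (s + t) w" using arrival_le_iff[OF assms(1), of "s + t" "Suc (N s w)"] assms by (simp add: wait_def algebra_simps)
 ultimately show ?thesis by auto
qed

lemma wait_pos: "w \<in> space M ==> 0 <= s ==> 0 < wait s w" using wait_le_iff[of w s 0] by auto

lemma wait_measurable:
 assumes s: "0 <= s" shows "wait s \<in> Bor (N_future s)"
proof (rule borel_measurableI_le)
 fix a :: real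
 show "{w \<in> space (N_future s). wait s w <= a} \<in> sets (N_future s)"
 proof (cases "0 <= a")
  case True
  have [measurable]: "(%w. real (N (s + a) w) - real (N s w)) \<in> Bor (N_future s)" by (rule N_incr_measurable[OF s True])
  have "{w \<in> space (N_future s). wait s w <= a} = {w \<in> space (N_future s). real (N (s + a) w) - real (N s w) ~= 0}" using wait_le_iff[OF _ s True] by auto
  also have "... \<in> sets (N_future s)" by measurable
  finally show ?thesis .
 next
  case False
  hence eq: "{w \<in> space (N_future s). wait s w <= a} = {}" using wait_pos[OF _ s] by force
  show ?thesis unfolding eq by simp
 qed
qed

lemma wait_distr:
 assumes s: "0 <= s" shows "distr M borel (wait s) = expo \<gamma>"
proof -
 have m: "wait s \<in> Bor M" by (rule measurable_from_subalg[OF future_sub(5)[OF s] wait_measurable[OF s]])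
 have "distributed M lborel (wait s) (exponential_density \<gamma>)" unfolding exponential_distributed_iff[OF intensity_pos]
 proof (intro conjI allI impI m)
  fix a :: real assume a: "0 <= a"
  have [measurable]: "(%w. real (N u w)) \<in> Bor M" if "u \<in> {s, s + a}" for u using that s a N_meas by auto
  have "{w \<in> space M. N (s + a) w = N s w} = {w \<in> space M. real (N (s + a) w) = real (N s w)}" by simp
  also have "... \<in> sets M" using N_meas[of s] N_meas[of "s + a"] s a by measurable
  finally have set: "{w \<in> space M. N (s + a) w = N s w} \<in> sets M" .
  have "prob {w \<in> space M. wait s w <= a} = prob (space M - {w \<in> space M. N (s + a) w = N s w})" by (intro arg_cong[where f=prob]) (use wait_le_iff[OF _ s a] in auto)
  also have "... = 1 - exp (- a * \<gamma>)" using prob_compl[OF set] N_no_arrival[OF s a] by (simp add: mult.commute)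
  finally show "prob {w \<in> space M. wait s w <= a} = 1 - exp (- a * \<gamma>)" .
 qed
 from distributed_distr_eq_density[OF this] have "distr M lborel (wait s) = expo \<gamma>" by (simp add: expo_def)
 thus ?thesis by (metis distr_cong sets_lborel)
qed

text \<open>Two clocks race: one of rate \<open>q\<close>, carrying \<open>f1\<close>, and the next
  arrival, carrying \<open>f2\<close>. Given the path of \<open>X\<close>, the first to ring is
  exponential of rate \<open>q + \<gamma>\<close>, and independently of that time the winner has
  probability \<open>q / (q + \<gamma>)\<close> or \<open>\<gamma> / (q + \<gamma>)\<close>.\<close>

lemma killed_expectation:
 fixes f1 f2 :: "real => 'a => real"
 assumes s: "0 <= s" and q: "0 <= ep" "ep < q" and Y: "integrable M Y" "AE w in M. 0 <= Y w"
  and m: "(%(t, w). f1 t w) \<in> Bor (borel \<Otimes>\<^sub>M X_future s)" "(%(t, w). f2 t w) \<in> Bor (borel \<Otimes>\<^sub>M X_future s)"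
  and dom: "AE w in M. ALL t>=0. abs (f1 t w) <= exp (ep * t) * Y w & abs (f2 t w) <= exp (ep * t) * Y w"
 shows "(LINT w|M. (LINT t|expo q. indicator {..<wait s w} t * f1 t w) + exp (- q * wait s w) * f2 (wait s w) w)
  = (LINT t|expo (q + \<gamma>). q / (q + \<gamma>) * (LINT w|M. f1 t w) + \<gamma> / (q + \<gamma>) * (LINT w|M. f2 t w))"
proof -
 have q0: "0 < q" and k: "0 < q + \<gamma>" "ep < q + \<gamma>" using q intensity_pos by auto
 interpret Eq: prob_space "expo q" by (rule prob_space_expo[OF q0])
 interpret Eg: prob_space "expo \<gamma>" by (rule prob_space_expo[OF intensity_pos])
 interpret Ek: prob_space "expo (q + \<gamma>)" by (rule prob_space_expo[OF k(1)])
 interpret PM: pair_prob_space "expo q" M ..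
 interpret PK: pair_prob_space "expo (q + \<gamma>)" M ..
 note mM = pair_measure_sub[OF future_sub(4)[OF s] m(1)] pair_measure_sub[OF future_sub(4)[OF s] m(2)]
 have mX: "f1 t \<in> Bor (X_future s)" for t using measurable_compose[OF measurable_Pair1' m(1), of t] by simp
 have om_m: "f1 t \<in> Bor M" "f2 t \<in> Bor M" for t using measurable_compose[OF measurable_Pair1' mM(1), of t] measurable_compose[OF measurable_Pair1' mM(2), of t] by simp_all
 have wm: "wait s \<in> Bor M" by (rule measurable_from_subalg[OF future_sub(5)[OF s] wait_measurable[OF s]])
 have "indep_set (sets (N_future s)) (sets (X_future s))"
 proof (rule indep_setI)
  show "sets (N_future s) <= events" "sets (X_future s) <= events" using future_sub[OF s] by (auto simp: subalgebra_def)
  show "prob (a Int b) = prob a * prob b" if "a \<in> sets (N_future s)" "b \<in> sets (X_future s)" for a b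
   using indep_setD[OF XN_future_indep[OF s] that(2,1)] by (simp add: Int_commute mult.commute)
 qed
 hence ind: "indep_set {wait s -` A Int space M | A. A \<in> sets borel} (sets (X_future s))" by (rule indep_set_mono) (use measurable_sets[OF wait_measurable[OF s]] in auto)
 note indep = indep_integral[OF wm future_sub(4)[OF s] ind, unfolded wait_distr[OF s]]
 define F1 where "F1 t = (LINT w|M. f1 t w)" for t
 define F2 where "F2 t = (LINT w|M. f2 t w)" for t
 have F_m: "F1 \<in> Bor borel" "F2 \<in> Bor borel" unfolding F1_def F2_def using mM by (auto intro!: borel_measurable_lebesgue_integral)
 have prod: "integrable (expo l \<Otimes>\<^sub>M M) (%(t, w). f t w)" if l: "ep < l" and f: "(%(t, w). f t w) \<in> Bor (borel \<Otimes>\<^sub>M M)"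
  and d: "AE w in M. ALL t>=0. abs (f t w) <= exp (ep * t) * Y w" for l and f :: "real => 'a => real"
 proof (rule Bochner_Integration.integrable_bound[OF exp_product_integrable[OF q(1) l Y(1)]])
  show "(%(t, w). f t w) \<in> Bor (expo l \<Otimes>\<^sub>M M)" using f by (simp cong: measurable_cong_sets sets_pair_measure_cong)
  show "AE z in expo l \<Otimes>\<^sub>M M. norm (case z of (t, w) => f t w) <= norm (case z of (t, w) => exp (ep * t) * Y w)"
   using AE_pair_fst[OF sigma_finite_measure_axioms expo_pos[of l]] AE_pair_snd[OF sigma_finite_measure_axioms d, of "expo l"]
   by eventually_elim (auto simp: case_prod_unfold intro: order_trans[OF _ abs_ge_self])
 qed
 have "AE w in M. ALL t>=0. abs (f1 t w) <= exp (ep * t) * Y w" "AE w in M. ALL t>=0. abs (f2 t w) <= exp (ep * t) * Y w" using dom by (auto elim!: eventually_mono)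
 note d = this
 have F_int: "integrable (expo (q + \<gamma>)) F1" "integrable (expo (q + \<gamma>)) F2"
  unfolding F1_def F2_def using PK.integrable_fst[OF prod[OF k(2) mM(1) d(1)]] PK.integrable_fst[OF prod[OF k(2) mM(2) d(2)]] by simp_all
 have int2: "integrable (expo q \<Otimes>\<^sub>M M) (%(t, w). indicator {..<wait s w} t * f1 t w)"
 proof (rule prod[OF q(2)])
  have "(%z. (if fst z < wait s (snd z) then 1 else 0) * (%(t, w). f1 t w) z) \<in> Bor (borel \<Otimes>\<^sub>M M)" by (intro borel_measurable_times mM(1)) (use wm in measurable)
  also have "(%z. (if fst z < wait s (snd z) then 1 else 0) * (%(t, w). f1 t w) z) = (%(t, w). indicator {..<wait s w} t * f1 t w)" by (auto simp: indicator_def)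
  finally show "(%(t, w). indicator {..<wait s w} t * f1 t w) \<in> Bor (borel \<Otimes>\<^sub>M M)" .
  show "AE w in M. ALL t>=0. abs (indicator {..<wait s w} t * f1 t w) <= exp (ep * t) * Y w" using d(1) Y(2) by eventually_elim (auto simp: indicator_def)
 qed
 have "(LINT w|M. (LINT t|expo q. indicator {..<wait s w} t * f1 t w)) = (LINT t|expo q. (LINT w|M. indicator {..<wait s w} t * f1 t w))"
  using PM.integral_snd[OF int2] PM.integral_fst[OF int2] by simp
 also have "... = (LINT t|expo q. exp (- \<gamma> * t) * F1 t)"
 proof (rule integral_cong_AE)
  show "(%t. LINT w|M. indicator {..<wait s w} t * f1 t w) \<in> Bor (expo q)" using borel_measurable_integrable[OF PM.integrable_fst[OF int2]] by simp
  show "AE t in expo q. (LINT w|M. indicator {..<wait s w} t * f1 t w) = exp (- \<gamma> * t) * F1 t" using expo_pos[of q]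
  proof eventually_elim
   case (elim t)
   let ?g = "%z. (if t < fst z then 1 else 0) * f1 t (snd z)"
   have "integrable M (f1 t)"
   proof (rule Bochner_Integration.integrable_bound[of M "%w. exp (ep * t) * Y w"])
    show "AE w in M. norm (f1 t w) <= norm (exp (ep * t) * Y w)" using d(1) by eventually_elim (use elim in \<open>auto intro: order_trans[OF _ abs_ge_self]\<close>)
   qed (use Y om_m in auto)
   hence "integrable M (%w. ?g (wait s w, w))" by (rule Bochner_Integration.integrable_bound) (use om_m wm in auto)
   moreover have "?g \<in> Bor (borel \<Otimes>\<^sub>M X_future s)" by (intro borel_measurable_times measurable_compose[OF measurable_snd mX]) measurable
   moreover have "(LINT y|expo \<gamma>. (if t < y then 1 else 0 :: real)) = (LINT y|expo \<gamma>. indicator {t..} y * (1 :: real))"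
    by (rule integral_cong_AE) (use expo_no_atom[where l=\<gamma> and a=t] in \<open>auto elim!: eventually_mono\<close>)
   moreover have "indicator {..<a} t = (if t < a then 1 else 0 :: real)" for a by (simp add: indicator_def)
   ultimately show ?case using indep[of ?g] expo_shift[OF intensity_pos, of t "%_. 1"] elim Eg.prob_space by (simp add: F1_def)
  qed
 qed (use F_m in simp)
 also have "... = q / (q + \<gamma>) * (LINT t|expo (q + \<gamma>). F1 t)" by (rule expo_discount[OF q0 intensity_pos F_m(1)])
 finally have 1: "(LINT w|M. (LINT t|expo q. indicator {..<wait s w} t * f1 t w)) = q / (q + \<gamma>) * (LINT t|expo (q + \<gamma>). F1 t)" .
 let ?g = "%z. exp (- q * fst z) * (%(t, w). f2 t w) z"
 have g: "?g \<in> Bor (borel \<Otimes>\<^sub>M X_future s)" by (intro borel_measurable_times m(2)) measurable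
 have i: "integrable M (%w. ?g (wait s w, w))"
 proof (rule Bochner_Integration.integrable_bound[OF Y(1)])
  have "(%w. (wait s w, w)) \<in> measurable M (borel \<Otimes>\<^sub>M X_future s)" using wm future_sub(4)[OF s] by (intro measurable_Pair) (auto simp: measurable_def subalgebra_def)
  from measurable_compose[OF this g] show "(%w. ?g (wait s w, w)) \<in> Bor M" .
  show "AE w in M. norm (?g (wait s w, w)) <= norm (Y w)" using d(2) Y(2) AE_space
  proof eventually_elim
   case (elim w)
   have w: "0 < wait s w" by (rule wait_pos[OF elim(3) s])
   have "exp (- q * wait s w) * abs (f2 (wait s w) w) <= exp (- q * wait s w) * (exp (ep * wait s w) * Y w)" using elim w by simp
   also have "... = exp ((ep - q) * wait s w) * Y w" unfolding mult.assoc[symmetric] mult_exp_exp by (simp add: left_diff_distrib)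
   also have "... <= 1 * Y w" using elim w q by (intro mult_right_mono) (auto simp: mult_nonpos_nonneg)
   finally show ?case using elim by (simp add: abs_mult)
  qed
 qed
 have 2: "(LINT w|M. exp (- q * wait s w) * f2 (wait s w) w) = \<gamma> / (q + \<gamma>) * (LINT t|expo (q + \<gamma>). F2 t)"
  using indep[OF g i] expo_discount[OF intensity_pos q0 F_m(2)] by (simp add: add.commute F2_def)
 have "integrable M (%w. LINT t|expo q. indicator {..<wait s w} t * f1 t w)" using PM.integrable_snd[OF int2] by simp
 thus ?thesis using 1 2 i F_int by (simp add: F1_def[symmetric] F2_def[symmetric])
qed

end

section \<open>Dynamic programming between arrivals\<close>

locale control_model = regular_model M F X N \<gamma>
 for M :: "'a measure" and F :: "real => 'a measure" and X :: "real => 'a => real" and N :: "real => 'a => nat" and \<gamma> :: real +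
 fixes lam r \<phi> :: real and \<Psi> :: "real => real"
 assumes killing_pos: "0 < lam" and discount_pos: "0 < r" and cost_gt_1: "1 < \<phi>"
  and terminal_nonneg: "!!u. 0 <= u ==> 0 <= \<Psi> u" and terminal_tame: "tame \<phi> \<Psi>"
  and terminal_concave: "concave_on {0..} \<Psi>" and terminal_growth: "EX C. ALL u>=0. \<Psi> u <= (1 + r / (2 * lam)) * u + C"
begin

sublocale st: stage_problem "law (lam + \<gamma> + r)" lam \<gamma> r \<phi> \<Psi>
 by (rule stage_problem_law[OF killing_pos discount_pos cost_gt_1 terminal_nonneg terminal_tame terminal_concave terminal_growth])

definition q where "q = r + lam"

lemma q_pos: "0 < q" "0 <= q / 2" "q / 2 < q" "0 < q / 2" using killing_pos discount_pos by (auto simp: q_def)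

definition lump :: "(real => real) => real => real \<times> real => real" where
 "lump W u p = W (reflected u p) - \<phi> * (max u (snd p) - u)"

text \<open>\<open>lam / q\<close> is the probability that a clock of rate
  \<open>q = r + lam\<close> rings on account of \<tau> rather than of discounting. Only then is
  \<open>\<Psi>\<close> paid, whereas injections are charged in either case.\<close>

abbreviation flow :: "real => real \<times> real => real" where
 "flow \<equiv> lump (%u. lam / q * \<Psi> u)"

lemma flow_tame: "tame \<phi> (%u. lam / q * \<Psi> u)" unfolding tame_def
proof (intro allI impI conjI)
 fix x y :: real assume "0 <= x & x <= y"
 hence d: "0 <= \<Psi> y - \<Psi> x" "\<Psi> y - \<Psi> x <= \<phi> * (y - x)" using terminal_tame by (auto simp: tame_def)
 have c: "0 <= lam / q" "lam / q <= 1" using killing_pos discount_pos by (auto simp: q_def)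
 show "0 <= lam / q * \<Psi> y - lam / q * \<Psi> x" "lam / q * \<Psi> y - lam / q * \<Psi> x <= \<phi> * (y - x)"
  using mult_nonneg_nonneg[OF c(1) d(1)] mult_right_mono[OF c(2) d(1)] d(2) unfolding right_diff_distrib by linarith+
qed

text \<open>Value of one stage begun at time \<open>s\<close> with surplus \<open>u\<close>, for a
  fixed path and with the clock of rate \<open>q\<close> integrated out: it rings before the next
  arrival, or survives until then with probability \<open>exp (- q * wait s w)\<close>.\<close>

definition H :: "(real => real) => real => real => 'a => real" where
 "H W s u w = (LINT t|expo q. indicator {..<wait s w} t * flow u (XI s (max 0 t) w))
   + exp (- q * wait s w) * lump W u (XI s (wait s w) w)"

lemma lump_measurable:
 assumes "tame \<phi> W"
 shows "(%z. lump W (fst z) (snd z)) \<in> Bor (borel \<Otimes>\<^sub>M borel2)"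
  "lump W u \<in> Bor borel2"
proof -
 note [measurable] = tame_measurable[OF assms]
 show *: "(%z. lump W (fst z) (snd z)) \<in> Bor (borel \<Otimes>\<^sub>M borel2)" unfolding lump_def reflected_def by measurable
 show "lump W u \<in> Bor borel2" using measurable_compose[OF measurable_Pair1' *, of u] by simp
qed

lemma lump_continuous:
 assumes W: "tame \<phi> W" and u: "(u ---> u0) Fl" and p: "(p ---> p0) Fl"
 shows "((%n. lump W (u n) (p n)) ---> lump W u0 p0) Fl" unfolding lump_def reflected_def by (intro tendsto_intros u p continuous_on_tendsto_compose[OF tame_continuous[OF W]]) auto

lemma lump_bound:
 assumes W: "tame \<phi> W" and u: "0 <= u"
 shows "abs (lump W u p) <= (abs (W 0) + 2 * \<phi>) * (1 + u + abs (fst p) + abs (snd p))"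
proof -
 let ?A = "1 + u + abs (fst p) + abs (snd p)"
 have "abs (W (reflected u p) - W 0) <= \<phi> * abs (reflected u p - 0)" by (rule tame_lipschitz[OF W]) auto
 also have "... <= \<phi> * ?A" using st.reflected_le[of u p] u cost_gt_1 by (intro mult_left_mono) auto
 finally have 1: "abs (W (reflected u p) - W 0) <= \<phi> * ?A" .
 have 2: "0 <= \<phi> * (max u (snd p) - u)" "\<phi> * (max u (snd p) - u) <= \<phi> * ?A" using u cost_gt_1 by (auto intro!: mult_left_mono)
 have "abs (W 0) <= abs (W 0) * ?A" using u mult_left_mono[of 1 ?A "abs (W 0)"] by simp
 hence "abs (lump W u p) <= abs (W 0) * ?A + \<phi> * ?A + \<phi> * ?A" using 1 2 unfolding lump_def by linarith
 also have "... = (abs (W 0) + 2 * \<phi>) * ?A" by (simp add: algebra_simps)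
 finally show ?thesis .
qed

text \<open>The path envelope is taken at rate \<open>q / 2\<close>: it is integrable under
  \<open>expo q\<close> and beaten by the discount \<open>exp (- q * s)\<close>. One constant serves
  both \<open>W\<close> and the flow.\<close>

lemma lump_domination:
 assumes W: "tame \<phi> W"
 obtains C Z where "0 <= C" "integrable M Z" "AE w in M. 0 <= Z w"
  "AE w in M. ALL t>=0. abs (X t w) <= exp (q / 2 * t) * Z w"
  "AE w in M. \<forall>v\<in>{W, %u. lam / q * \<Psi> u}. ALL s>=0. ALL u>=0. ALL t>=0. abs (lump v u (XI s t w)) <= exp (q / 2 * t) * (C * (1 + u + exp (q / 2 * s) * Z w))"
proof -
 define C where "C = abs (W 0) + abs (lam / q * \<Psi> 0) + 2 * \<phi>"
 have C: "0 <= C" using cost_gt_1 by (simp add: C_def)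
 obtain Z where Z: "integrable M Z" "AE w in M. 0 <= Z w" "AE w in M. ALL t>=0. abs (X t w) <= exp (q / 2 * t) * Z w"
  "AE w in M. ALL s>=0. ALL t>=0. abs (Xi s t w) <= exp (q / 2 * (s + t)) * Z w & abs (Ii s t w) <= exp (q / 2 * (s + t)) * Z w" using domination[OF q_pos(4)] by blast
 show ?thesis
 proof (rule that[of C "%w. 2 * Z w"])
  show "AE w in M. ALL t>=0. abs (X t w) <= exp (q / 2 * t) * (2 * Z w)" using Z(2,3) by eventually_elim (force intro: order_trans)
  show "AE w in M. \<forall>v\<in>{W, %u. lam / q * \<Psi> u}. ALL s>=0. ALL u>=0. ALL t>=0. abs (lump v u (XI s t w)) <= exp (q / 2 * t) * (C * (1 + u + exp (q / 2 * s) * (2 * Z w)))" using Z(2,4)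
  proof eventually_elim
   case (elim w)
   show ?case
   proof (intro allI impI ballI)
    fix v and s u t :: real assume v: "v \<in> {W, %u. lam / q * \<Psi> u}" and *: "0 <= s" "0 <= u" "0 <= t"
    have vC: "tame \<phi> v" "abs (v 0) + 2 * \<phi> <= C" using v W flow_tame by (auto simp: C_def)
    have "1 * (1 + u) <= exp (q / 2 * t) * (1 + u)" using * q_pos by (intro mult_right_mono) auto
    moreover have "exp (q / 2 * (s + t)) = exp (q / 2 * t) * exp (q / 2 * s)" by (simp add: exp_add[symmetric] algebra_simps)
    hence "abs (Xi s t w) + abs (Ii s t w) <= exp (q / 2 * t) * (exp (q / 2 * s) * (2 * Z w))" using elim(2)[rule_format, OF *(1,3)] by simp
    ultimately have "1 + u + abs (Xi s t w) + abs (Ii s t w) <= exp (q / 2 * t) * (1 + u + exp (q / 2 * s) * (2 * Z w))" by (simp add: distrib_left)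
    hence "(abs (v 0) + 2 * \<phi>) * (1 + u + abs (Xi s t w) + abs (Ii s t w)) <= C * (exp (q / 2 * t) * (1 + u + exp (q / 2 * s) * (2 * Z w)))" using vC * C by (intro mult_mono) auto
    thus "abs (lump v u (XI s t w)) <= exp (q / 2 * t) * (C * (1 + u + exp (q / 2 * s) * (2 * Z w)))"
     using lump_bound[OF vC(1) *(2), of "(XI s t w)"] by (simp only: mult.left_commute fst_conv snd_conv)
   qed
  qed
 qed (use C Z in auto)
qed

text \<open>\<open>killed_expectation\<close> turns the stage into an integral over a single clock
  of rate \<open>q + \<gamma>\<close>, which is \<open>st.rate\<close>. \<open>st.gain\<close> is
  the mixture of \<open>flow\<close> and \<open>lump\<close> with the two winning probabilities, and
  stationarity moves the start from \<open>s\<close> to 0.\<close>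

lemma H_expectation:
 assumes W: "tame \<phi> W" and s: "0 <= s" and u: "0 <= u"
 shows "(LINT w|M. H W s u w) = st.stage W u"
proof -
 obtain C Z where C: "0 <= C" "integrable M Z" "AE w in M. 0 <= Z w"
  and X: "AE w in M. ALL t>=0. abs (X t w) <= exp (q / 2 * t) * Z w"
  and bd: "AE w in M. \<forall>v\<in>{W, %u. lam / q * \<Psi> u}. ALL s>=0. ALL u>=0. ALL t>=0. abs (lump v u (XI s t w)) <= exp (q / 2 * t) * (C * (1 + u + exp (q / 2 * s) * Z w))"
  by (rule lump_domination[OF W])
 define f1 where "f1 t w = flow u (XI s (max 0 t) w)" for t w
 define f2 where "f2 t w = lump W u (XI s (max 0 t) w)" for t w
 let ?Y = "%w. C * (1 + u + exp (q / 2 * s) * Z w)"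
 have Hf: "H W s u w = (LINT t|expo q. indicator {..<wait s w} t * f1 t w) + exp (- q * wait s w) * f2 (wait s w) w"
  if "w \<in> space M" for w using wait_pos[OF that s] unfolding H_def f1_def f2_def by simp
 have "(LINT w|M. H W s u w) = (LINT w|M. (LINT t|expo q. indicator {..<wait s w} t * f1 t w) + exp (- q * wait s w) * f2 (wait s w) w)" by (intro Bochner_Integration.integral_cong refl Hf)
 also have "... = (LINT t|expo (q + \<gamma>). q / (q + \<gamma>) * (LINT w|M. f1 t w) + \<gamma> / (q + \<gamma>) * (LINT w|M. f2 t w))"
 proof (rule killed_expectation[OF s q_pos(2,3), of ?Y])
  show "integrable M ?Y" using C by simp
  show "AE w in M. 0 <= ?Y w" using C(3) by eventually_elim (use C u in auto)
  show "(%(t, w). f1 t w) \<in> Bor (borel \<Otimes>\<^sub>M X_future s)" "(%(t, w). f2 t w) \<in> Bor (borel \<Otimes>\<^sub>M X_future s)"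
   using measurable_compose[OF pair_joint_measurable[OF s] lump_measurable(2)[OF flow_tame]]
    measurable_compose[OF pair_joint_measurable[OF s] lump_measurable(2)[OF W]] by (simp_all add: f1_def f2_def case_prod_unfold)
  show "AE w in M. ALL t>=0. abs (f1 t w) <= exp (q / 2 * t) * ?Y w & abs (f2 t w) <= exp (q / 2 * t) * ?Y w" using bd by eventually_elim (use s u in \<open>simp add: f1_def f2_def\<close>)
 qed
 also have "... = (LINT t|expo (q + \<gamma>). (LINT w|M. st.gain W u (XI 0 (max 0 t) w)))"
 proof (rule Bochner_Integration.integral_cong[OF refl])
  fix t :: real
  have law: "(LINT w|M. lump v u (XI s (max 0 t) w)) = (LINT w|M. lump v u (XI 0 (max 0 t) w))"
   and int: "integrable M (%w. lump v u (XI 0 (max 0 t) w))" if v: "tame \<phi> v" for v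
  proof -
   define B where "B a w = (abs (v 0) + 2 * \<phi>) * (1 + u + abs (Xi a (max 0 t) w) + abs (Ii a (max 0 t) w))" for a w
   have Bi: "integrable M (B a)" if "0 <= a" for a unfolding B_def using Xi_Ii_integrable[OF that, of "max 0 t"] by auto
   have Bb: "abs (lump v u (Xi a (max 0 t) w, i)) <= B a w" if "i \<in> {0..Ii a (max 0 t) w}" for a i w
    unfolding B_def using that cost_gt_1 by (intro order_trans[OF lump_bound[OF v u]] mult_left_mono) auto
   show "(LINT w|M. lump v u (XI s (max 0 t) w)) = (LINT w|M. lump v u (XI 0 (max 0 t) w))" by (rule XI_expectation[OF s, where B=B])
     (use s Bi Bb lump_continuous[OF v tendsto_const tendsto_ident_at] in \<open>auto simp: continuous_on_def\<close>)
   show "integrable M (%w. lump v u (XI 0 (max 0 t) w))"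
   proof (rule Bochner_Integration.integrable_bound[OF Bi[OF order_refl] measurable_compose[OF XI_pair_measurable lump_measurable(2)[OF v]]])
    show "AE w in M. norm (lump v u (XI 0 (max 0 t) w)) <= norm (B 0 w)" using Bb[of "Ii 0 (max 0 t) _" 0] Ii_nonneg[OF _ order_refl] by (intro AE_I2) (force intro: order_trans[OF _ abs_ge_self])
   qed auto
  qed
  have gain: "st.gain W u p = q / (q + \<gamma>) * flow u p + \<gamma> / (q + \<gamma>) * lump W u p" for p
  proof -
   have k: "st.rate = q + \<gamma>" "q + \<gamma> ~= 0" "q ~= 0" using q_pos intensity_pos by (auto simp: st.rate_def q_def)
   define h where "h = \<phi> * (max u (snd p) - u)"
   define P where "P = \<Psi> (reflected u p)"
   define Q where "Q = W (reflected u p)"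
   have "q / (q + \<gamma>) * (lam / q * P - h) + \<gamma> / (q + \<gamma>) * (Q - h) = (q * (lam / q * P - h) + \<gamma> * (Q - h)) / (q + \<gamma>)" by (simp add: add_divide_distrib)
   also have "q * (lam / q * P - h) + \<gamma> * (Q - h) = lam * P + \<gamma> * Q - (q + \<gamma>) * h" using k(3) by (simp add: right_diff_distrib distrib_right)
   also have "... / (q + \<gamma>) = (lam * P + \<gamma> * Q) / (q + \<gamma>) - h" using k(2) by (simp add: diff_divide_distrib)
   finally show ?thesis unfolding st.gain_def lump_def k(1) h_def[symmetric] P_def[symmetric] Q_def[symmetric] by simp
  qed
  show "q / (q + \<gamma>) * (LINT w|M. f1 t w) + \<gamma> / (q + \<gamma>) * (LINT w|M. f2 t w) = (LINT w|M. st.gain W u (XI 0 (max 0 t) w))" unfolding f1_def f2_def law[OF flow_tame] law[OF W] gain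
   using int[OF flow_tame] int[OF W] by simp
 qed
 also have "... = (LINT p|law (lam + \<gamma> + r). st.gain W u p)" using integral_law(2)[OF _ st.gain_integrable[OF W, of u]] killing_pos intensity_pos discount_pos by (simp add: q_def add_ac)
 finally show ?thesis by (simp add: st.stage_def)
qed

lemma H_measurable:
 assumes W: "tame \<phi> W" and s: "0 <= s"
 shows "(%(u, w). H W s u w) \<in> Bor (borel \<Otimes>\<^sub>M future s)"
proof -
 interpret Eq: prob_space "expo q" by (rule prob_space_expo[OF q_pos(1)])
 have wm[measurable]: "wait s \<in> Bor (future s)" by (rule measurable_from_subalg[OF future_sub(3)[OF s] wait_measurable[OF s]])
 have pj[measurable]: "(%z. (Xi s (max 0 (fst z)) (snd z), Ii s (max 0 (fst z)) (snd z))) \<in> measurable (borel \<Otimes>\<^sub>M future s) borel2"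
  by (rule pair_measure_sub[OF future_sub(2)[OF s] pair_joint_measurable[OF s]])
 have p1: "(%y. (Xi s (max 0 (snd y)) (snd (fst y)), Ii s (max 0 (snd y)) (snd (fst y)))) \<in> measurable ((borel \<Otimes>\<^sub>M future s) \<Otimes>\<^sub>M expo q) borel2"
  using measurable_compose[OF _ pj, of "%y. (snd y, snd (fst y))" "(borel \<Otimes>\<^sub>M future s) \<Otimes>\<^sub>M expo q"] by simp
 have "(%y. flow (fst (fst y)) (Xi s (max 0 (snd y)) (snd (fst y)), Ii s (max 0 (snd y)) (snd (fst y)))) \<in> Bor ((borel \<Otimes>\<^sub>M future s) \<Otimes>\<^sub>M expo q)"
  using measurable_compose[OF measurable_Pair[OF _ p1] lump_measurable(1)[OF flow_tame], of "%y. fst (fst y)"] by simp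
 hence "(%(z, t). (if t < wait s (snd z) then 1 else 0) * flow (fst z) (Xi s (max 0 t) (snd z), Ii s (max 0 t) (snd z))) \<in> Bor ((borel \<Otimes>\<^sub>M future s) \<Otimes>\<^sub>M expo q)"
  unfolding case_prod_unfold by (rule borel_measurable_times[rotated]) measurable
 hence "(%z. LINT t|expo q. (if t < wait s (snd z) then 1 else 0) * flow (fst z) (Xi s (max 0 t) (snd z), Ii s (max 0 t) (snd z))) \<in> Bor (borel \<Otimes>\<^sub>M future s)"
  by (rule Eq.borel_measurable_lebesgue_integral)
 moreover have "(LINT t|expo q. (if t < wait s (snd z) then 1 else 0) * flow (fst z) (Xi s (max 0 t) (snd z), Ii s (max 0 t) (snd z)))
   = (LINT t|expo q. indicator {..<wait s (snd z)} t * flow (fst z) (Xi s (max 0 t) (snd z), Ii s (max 0 t) (snd z)))" for z :: "real \<times> 'a"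
  by (intro Bochner_Integration.integral_cong refl) (auto simp: indicator_def)
 moreover have "(%z. exp (- q * wait s (snd z)) * lump W (fst z) (Xi s (wait s (snd z)) (snd z), Ii s (wait s (snd z)) (snd z))) \<in> Bor (borel \<Otimes>\<^sub>M future s)"
 proof -
  have p2: "(%y. (Xi s (max 0 (wait s (snd y))) (snd y), Ii s (max 0 (wait s (snd y))) (snd y))) \<in> measurable (borel \<Otimes>\<^sub>M future s) borel2"
   using measurable_compose[OF _ pj, of "%y. (wait s (snd y), snd y)" "borel \<Otimes>\<^sub>M future s"] by simp
  have "(%z. lump W (fst z) (Xi s (max 0 (wait s (snd z))) (snd z), Ii s (max 0 (wait s (snd z))) (snd z))) \<in> Bor (borel \<Otimes>\<^sub>M future s)"
   using measurable_compose[OF measurable_Pair[OF measurable_fst p2] lump_measurable(1)[OF W]] by simp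
  hence "(%z. exp (- q * wait s (snd z)) * lump W (fst z) (Xi s (max 0 (wait s (snd z))) (snd z), Ii s (max 0 (wait s (snd z))) (snd z))) \<in> Bor (borel \<Otimes>\<^sub>M future s)"
   by (rule borel_measurable_times[rotated]) measurable
  thus ?thesis by (rule measurable_cong[THEN iffD1, rotated]) (use wait_pos[OF _ s, THEN less_imp_le] in \<open>auto simp: space_pair_measure max_def\<close>)
 qed
 ultimately show ?thesis unfolding H_def case_prod_unfold by simp
qed

lemma H_bound:
 assumes W: "tame \<phi> W"
 obtains C Z where "0 <= C" "integrable M Z" "AE w in M. 0 <= Z w"
  "AE w in M. ALL t>=0. abs (X t w) <= exp (q / 2 * t) * Z w"
  "AE w in M. ALL s>=0. ALL u>=0. exp (- q * s) * abs (H W s u w) <= C * (1 + exp (- q * s) * u + Z w)"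
proof -
 obtain C Z where C: "0 <= C" "integrable M Z" "AE w in M. 0 <= Z w"
  and X: "AE w in M. ALL t>=0. abs (X t w) <= exp (q / 2 * t) * Z w"
  and bd: "AE w in M. \<forall>v\<in>{W, %u. lam / q * \<Psi> u}. ALL s>=0. ALL u>=0. ALL t>=0. abs (lump v u (XI s t w)) <= exp (q / 2 * t) * (C * (1 + u + exp (q / 2 * s) * Z w))"
  by (rule lump_domination[OF W])
 show ?thesis
 proof (rule that[of "3 * C" Z])
  show "AE w in M. ALL s>=0. ALL u>=0. exp (- q * s) * abs (H W s u w) <= 3 * C * (1 + exp (- q * s) * u + Z w)" using bd C(3) AE_space
  proof eventually_elim
   case (elim w)
   show ?case
   proof (intro allI impI)
    fix s u :: real assume su: "0 <= s" "0 <= u"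
    define Y where "Y = C * (1 + u + exp (q / 2 * s) * Z w)"
    have Y0: "0 <= Y" using C elim su by (simp add: Y_def)
    have w: "0 < wait s w" using wait_pos[OF elim(3) su(1)] .
    have fl: "abs (flow u (XI s t w)) <= exp (q / 2 * t) * Y" if "0 <= t" for t using elim(1) su that unfolding Y_def by blast
    have "abs (LINT t|expo q. indicator {..<wait s w} t * flow u (XI s (max 0 t) w))
      <= (LINT t|expo q. abs (indicator {..<wait s w} t * flow u (XI s (max 0 t) w)))" by (rule integral_abs_bound)
    also have "... <= (LINT t|expo q. exp (q / 2 * t) * Y)"
    proof (rule integral_mono_AE')
     show "integrable (expo q) (%t. exp (q / 2 * t) * Y)" using expo_exp_integrable(1)[OF q_pos(2,3)] by simp
     show "AE t in expo q. abs (indicator {..<wait s w} t * flow u (XI s (max 0 t) w)) <= exp (q / 2 * t) * Y" using expo_pos[of q]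
     proof eventually_elim
      case (elim t)
      hence "abs (flow u (XI s t w)) <= exp (q / 2 * t) * Y" using fl[of t] by simp
      thus ?case using elim Y0 by (auto simp: indicator_def)
     qed
     show "AE t in expo q. 0 <= exp (q / 2 * t) * Y" using Y0 by simp
    qed
    \<comment> \<open>\<open>exp (q / 2 * t)\<close> integrates to 2 under \<open>expo q\<close>;
      with the arrival term this makes the factor 3.\<close>
    also have "... = 2 * Y" using expo_exp_integrable(2)[OF q_pos(2,3)] q_pos by simp
    finally have 1: "abs (LINT t|expo q. indicator {..<wait s w} t * flow u (XI s (max 0 t) w)) <= 2 * Y" .
    have "abs (lump W u (XI s (wait s w) w)) <= exp (q / 2 * wait s w) * Y" using elim(1) su w unfolding Y_def by auto
    hence "abs (exp (- q * wait s w) * lump W u (XI s (wait s w) w)) <= exp (- q * wait s w) * (exp (q / 2 * wait s w) * Y)" unfolding abs_mult by simp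
    also have "... <= Y"
    proof -
     have "exp (- q * wait s w) * exp (q / 2 * wait s w) = exp (- (q / 2 * wait s w))" by (simp add: mult_exp_exp)
     also have "... <= 1" using q_pos w by simp
     finally show ?thesis using mult_right_mono[OF _ Y0, of "exp (- q * wait s w) * exp (q / 2 * wait s w)" 1] by (simp add: mult.assoc)
    qed
    finally have "abs (H W s u w) <= 3 * Y" using 1 unfolding H_def by linarith
    hence "exp (- q * s) * abs (H W s u w) <= exp (- q * s) * (3 * Y)" by simp
    also have "... = 3 * C * (exp (- q * s) + exp (- q * s) * u + exp (- q * s) * exp (q / 2 * s) * Z w)" by (simp add: Y_def algebra_simps)
    also have "... <= 3 * C * (1 + exp (- q * s) * u + 1 * Z w)"
    proof -
     have "exp (- q * s) * exp (q / 2 * s) = exp (- (q / 2 * s))" by (simp add: mult_exp_exp)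
     also have "... <= 1" using q_pos su by simp
     finally have "exp (- q * s) * exp (q / 2 * s) * Z w <= 1 * Z w" using elim by (intro mult_right_mono) auto
     moreover have "exp (- q * s) <= 1" using q_pos su by simp
     ultimately show ?thesis using C by (intro mult_left_mono add_mono) auto
    qed
    finally show "exp (- q * s) * abs (H W s u w) <= 3 * C * (1 + exp (- q * s) * u + Z w)" by simp
   qed
  qed
 qed (use C X in auto)
qed

end

context control_model
begin

text \<open>On the interval up to the next arrival the arrival time itself is constant, so only the
 starting point of the window moves.\<close>

lemma H_right_limit:
 assumes W: "tame \<phi> W" and w: "w \<in> space M" and S: "0 <= S" and \<xi>: "cadlag \<xi>" "!!t. 0 <= t ==> 0 <= \<xi> t"
 shows "((%s. H W s (\<xi> s) w) ---> H W S (\<xi> S) w) (at_right S)"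
proof -
 define T where "T = S + wait S w"
 have T: "S < T" using wait_pos[OF w S] by (simp add: T_def)
 have wait: "wait s w = T - s" if "S <= s" "s < T" for s using wait_le_iff[OF w S, of "s - S"] that by (auto simp: T_def wait_def)
 define C where "C = abs (lam / q * \<Psi> 0) + 2 * \<phi>"
 have C: "0 <= C" using cost_gt_1 by (simp add: C_def)
 obtain B1 where B1: "0 <= B1" "!!s. 0 <= s ==> s <= T ==> abs (X s w) <= B1" using cadlag_bounded[OF X_cadlag[OF w], of T] by metis
 obtain B2 where B2: "0 <= B2" "!!s. 0 <= s ==> s <= T ==> abs (\<xi> s) <= B2" using cadlag_bounded[OF \<xi>(1), of T] by metis
 define K where "K = C * (1 + B2 + 4 * B1)"
 have bound: "abs (flow (\<xi> s) (XI s t w)) <= K" if st: "0 <= s" "0 <= t" "s + t <= T" for s t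
 proof -
  have *: "abs (Xi s r w) <= 2 * B1" if "0 <= r" "r <= t" for r using B1(2)[of "s + r"] B1(2)[of s] st that by (simp add: Xi_def)
  moreover have "abs (Ii s t w) <= 2 * B1"
  proof -
   have "Ii s t w <= 2 * B1" unfolding Ii_def
   proof (rule wsup_least[OF st(2)])
    fix r assume "0 <= r" "r <= t"
    from *[OF this] show "- Xi s r w <= 2 * B1" by linarith
   qed
   thus ?thesis using Ii_nonneg[OF w st(1,2)] by simp
  qed
  moreover have "abs (\<xi> s) <= B2" using B2 st by simp
  ultimately have "C * (1 + \<xi> s + abs (Xi s t w) + abs (Ii s t w)) <= K" unfolding K_def using *[OF st(2) order_refl] by (intro mult_left_mono C) linarith
  thus ?thesis using lump_bound[OF flow_tame \<xi>(2)[OF st(1)], of "(XI s t w)"] by (simp add: C_def)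
 qed
 have K: "0 <= K" using C B1 B2 by (simp add: K_def)
 have lim\<xi>: "(\<xi> ---> \<xi> S) (at_right S)" by (rule cadlag_right[OF \<xi>(1) S])
 define g where "g s t = indicator {..<T - s} t * flow (\<xi> s) (XI s (max 0 t) w)" for s t
 have gm: "g s \<in> Bor (expo q)" if "0 <= s" for s
 proof -
  have [measurable]: "(%t. flow (\<xi> s) (XI s (max 0 t) w)) \<in> Bor borel" using measurable_compose[OF path_pair_measurable[OF w that] lump_measurable(2)[OF flow_tame, of "\<xi> s"]] by simp
  show ?thesis unfolding g_def by measurable
 qed
 have glim: "((%s. g s t) ---> g S t) (at_right S)" for t
 proof (cases "t < T - S")
  case True
  have "((%s. flow (\<xi> s) (XI s (max 0 t) w)) ---> flow (\<xi> S) (XI S (max 0 t) w)) (at_right S)"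
   by (rule lump_continuous[OF flow_tame]) (intro lim\<xi> tendsto_Pair Xi_right_limit[OF w S] Ii_right_limit[OF w S] max.cobounded1)+
  moreover have "eventually (%s. flow (\<xi> s) (XI s (max 0 t) w) = g s t) (at_right S)" using eventually_at_right_real[of S "T - t"] True unfolding g_def by (auto elim!: eventually_mono)
  ultimately show ?thesis using True by (auto simp: g_def intro: Lim_transform_eventually)
 next
  case False
  have "eventually (%s. g s t = 0) (at_right S)" using eventually_at_right_less[of S] by eventually_elim (use False in \<open>auto simp: g_def\<close>)
  thus ?thesis using False by (auto simp: g_def tendsto_eventually)
 qed
 have "((%s. LINT t|expo q. g s t) ---> (LINT t|expo q. g S t)) (at_right S)" unfolding tendsto_at_iff_sequentially comp_def
 proof (intro allI impI)
  fix x :: "nat => real" assume x: "ALL i. x i \<in> {S<..} - {S}" "x ----> S"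
  interpret Eq: prob_space "expo q" by (rule prob_space_expo[OF q_pos(1)])
  show "(%i. LINT t|expo q. g (x i) t) ----> (LINT t|expo q. g S t)"
  proof (rule integral_dominated_convergence[where w = "%_. K"])
   show "AE t in expo q. (%i. g (x i) t) ----> g S t" using x glim unfolding tendsto_at_iff_sequentially comp_def by simp
   fix i
   have xi: "0 <= x i" using x(1)[rule_format, of i] S by auto
   show "AE t in expo q. norm (g (x i) t) <= K" using expo_pos[of q] by eventually_elim (use bound[OF xi] K in \<open>auto simp: g_def indicator_def\<close>)
   show "g (x i) \<in> Bor (expo q)" by (rule gm[OF xi])
  qed (use gm[OF S] in auto)
 qed
 moreover have "((%s. exp (- q * (T - s)) * lump W (\<xi> s) (XI s (T - s) w))
   ---> exp (- q * (T - S)) * lump W (\<xi> S) (XI S (T - S) w)) (at_right S)"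
 proof -
  have Xlim: "((%s. X s w) ---> X S w) (at_right S)" by (rule cadlag_right[OF X_cadlag[OF w] S])
  have c: "cadlag (%r. - X r w)" by (rule cadlag_uminus[OF X_cadlag[OF w]])
  have "((%s. wsup (%r. - X r w) S s - - X s w) ---> wsup (%r. - X r w) S S - - X S w) (at_right S)" by (intro tendsto_intros Xlim wsup_right_limit[OF c S order_refl])
  hence "((%s. abs (wsup (%r. - X r w) S s - - X s w)) ---> 0) (at_right S)" by (intro tendsto_rabs_zero) simp
  moreover have "eventually (%s. norm (wsup (%r. - X r w) s T - wsup (%r. - X r w) S T) <= abs (wsup (%r. - X r w) S s - - X s w)) (at_right S)"
   using eventually_at_right_real[OF T] by eventually_elim (use wsup_window_error[OF c S] in auto)
  ultimately have "((%s. wsup (%r. - X r w) s T - wsup (%r. - X r w) S T) ---> 0) (at_right S)" by (rule Lim_null_comparison[rotated])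
  hence "((%s. X s w + wsup (%r. - X r w) s T) ---> X S w + wsup (%r. - X r w) S T) (at_right S)" by (intro tendsto_intros Xlim) (simp add: LIM_zero_iff)
  moreover have "eventually (%s. X s w + wsup (%r. - X r w) s T = Ii s (T - s) w) (at_right S)" using eventually_at_right_real[OF T] by eventually_elim (use S in \<open>simp add: Ii_eq w\<close>)
  ultimately have I: "((%s. Ii s (T - s) w) ---> Ii S (T - S) w) (at_right S)" using Ii_eq[OF S _ w, of "T - S"] T by (auto intro: Lim_transform_eventually)
  have XT: "((%s. Xi s (T - s) w) ---> Xi S (T - S) w) (at_right S)" unfolding Xi_def by (simp, intro tendsto_intros Xlim)
  show ?thesis by (intro tendsto_mult tendsto_intros lump_continuous[OF W] lim\<xi> tendsto_Pair I XT)
 qed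
 ultimately have "((%s. (LINT t|expo q. g s t) + exp (- q * (T - s)) * lump W (\<xi> s) (XI s (T - s) w)) ---> H W S (\<xi> S) w) (at_right S)"
  unfolding H_def g_def using wait[OF order_refl T] by (auto intro!: tendsto_add)
 thus ?thesis by (rule Lim_transform_eventually)
   (use eventually_at_right_real[OF T] wait in \<open>auto elim!: eventually_mono simp: H_def g_def\<close>)
qed

end

section \<open>Arrival times along a path\<close>

lemma cadlag_measurable:
 assumes f: "cadlag f" shows "(%t. f (max 0 t)) \<in> Bor borel"
proof -
 have "(%(t, w). f (max 0 t)) \<in> Bor (borel \<Otimes>\<^sub>M (count_space UNIV :: unit measure))" using cadlag_right[OF f] by (intro joint_measurable) auto
 from measurable_compose[OF measurable_Pair2' this, of "()"] show ?thesis by simp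
qed

lemma window_integrable:
 assumes l: "0 < l" and f: "cadlag f"
 shows "integrable (expo l) (%t. indicator {..<a} t * f (max 0 t))"
proof -
 interpret prob_space "expo l" by (rule prob_space_expo[OF l])
 obtain B where B: "0 <= B" "!!s. 0 <= s ==> s <= a ==> abs (f s) <= B" using cadlag_bounded[OF f, of a] by metis
 have [measurable]: "(%t. f (max 0 t)) \<in> Bor borel" by (rule cadlag_measurable[OF f])
 show ?thesis
 proof (rule integrable_const_bound[of _ B])
  show "AE t in expo l. norm (indicator {..<a} t * f (max 0 t)) <= B" using expo_pos[of l] by eventually_elim (use B in \<open>auto simp: indicator_def\<close>)
 qed measurable
qed

context regular_model
begin

definition arr :: "nat => 'a => real" where "arr n w = arrival_time (%t. N t w) n"

lemma arr_le_iff: "w \<in> space M ==> 0 <= t ==> arr n w <= t <-> n <= N t w" unfolding arr_def by (rule arrival_le_iff)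

lemma arr_nonneg: "w \<in> space M ==> 0 <= arr n w" unfolding arr_def arrival_time_def using N_unbounded[of w n] by (intro cInf_greatest) auto

lemma arr_0: "w \<in> space M ==> arr 0 w = 0" using arr_le_iff[of w 0 0] arr_nonneg[of w 0] by simp

lemma N_arr: "w \<in> space M ==> N (arr n w) w = n" unfolding arr_def by (rule N_simple)

lemma arr_Suc: "w \<in> space M ==> arr (Suc n) w = arr n w + wait (arr n w) w" using N_arr[of w n] by (simp add: wait_def arr_def)

lemma N_idle:
 assumes "w \<in> space M" "arr n w <= t" "t < arr (Suc n) w" shows "N t w = n" using arr_le_iff[OF assms(1), of t n] arr_le_iff[OF assms(1), of t "Suc n"] arr_nonneg[OF assms(1), of n] assms by auto

lemma arr_at_top:
 assumes "w \<in> space M" shows "filterlim (%n. arr n w) at_top sequentially" unfolding filterlim_at_top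
proof
 fix Z :: real
 have *: "Z <= arr n w" if "N (max 0 Z) w < n" for n using arr_le_iff[OF assms, of "max 0 Z" n] that by linarith
 show "\<forall>\<^sub>F n in sequentially. Z <= arr n w" using eventually_gt_at_top[of "N (max 0 Z) w"] by (rule eventually_mono) (rule *)
qed

lemma arr_less:
 assumes t: "0 <= t" shows "{w \<in> space M. arr n w < t} \<in> sets (F t)"
proof -
 have "{w \<in> space M. arr n w < t} = (\<Union>u\<in>\<rat> Int {0..<t}. {w \<in> space M. real n <= real (N u w)})" (is "?l = ?r")
 proof (intro equalityI subsetI)
  fix w assume "w \<in> ?l"
  hence w: "w \<in> space M" "arr n w < t" by auto
  obtain u where u: "u \<in> \<rat>" "arr n w < u" "u < t" using Rats_dense_in_real[OF w(2)] by blast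
  have u0: "0 <= u" using arr_nonneg[OF w(1), of n] u(2) by linarith
  have "n <= N u w" using arr_le_iff[OF w(1) u0, of n] u(2) by simp
  thus "w \<in> ?r" using u u0 w(1) by (intro UN_I[of u]) auto
 next
  fix w assume "w \<in> ?r"
  then obtain u where "u \<in> {0..<t}" "w \<in> space M" "n <= N u w" unfolding UN_iff by auto
  thus "w \<in> ?l" using arr_le_iff[of w u n] by auto
 qed
 moreover have "{w \<in> space M. real n <= real (N u w)} \<in> sets (F t)" if "u \<in> {0..<t}" for u
 proof -
  have [measurable]: "(%w. real (N u w)) \<in> Bor (F u)" using N_F[of u] that by simp
  have "{w \<in> space (F u). real n <= real (N u w)} \<in> sets (F u)" by measurable
  thus ?thesis using F_mono[of u t] space_F[of u] that by auto
 qed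
 ultimately show ?thesis using countable_rat by (auto intro!: sets.countable_UN' countable_Int1)
qed

lemma arr_measurable [measurable]: "arr n \<in> Bor M"
proof (rule borel_measurableI_less)
 fix t :: real
 show "{w \<in> space M. arr n w < t} \<in> sets M"
 proof (cases "0 <= t")
  case True
  thus ?thesis using arr_less[OF True, of n] F_sub[OF True] by (auto simp: subalgebra_def)
 next
  case False
  hence e: "{w \<in> space M. arr n w < t} = {}" using arr_nonneg[of _ n] by force
  show ?thesis unfolding e by simp
 qed
qed

end

text \<open>\<open>D_0\<close> and \<open>D_idle\<close> are the pathwise form of being an integral
  against \<open>dN\<close>: dividends change only at arrivals. \<open>R_finite\<close> is the
  integrability of the discounted injections, written as the mean of \<open>R\<close> at an
  exponential time of rate \<open>q\<close>.\<close>

locale strategy = control_model M F X N \<gamma> lam r \<phi> \<Psi>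
 for M :: "'a measure" and F X N \<gamma> lam r \<phi> \<Psi> +
 fixes x :: real and D R :: "real => 'a => real"
 assumes x_nonneg: "0 <= x"
  and D_F: "!!t. 0 <= t ==> D t \<in> Bor (F t)"
  and R_F: "!!t. 0 <= t ==> R t \<in> Bor (F t)"
  and D_mono: "!!w. w \<in> space M ==> mono_on {0..} (%t. D t w)"
  and R_mono: "!!w. w \<in> space M ==> mono_on {0..} (%t. R t w)"
  and D_cadlag: "!!w. w \<in> space M ==> cadlag (%t. D t w)"
  and R_cadlag: "!!w. w \<in> space M ==> cadlag (%t. R t w)"
  and D_0: "!!w. w \<in> space M ==> D 0 w = 0"
  and R_0: "!!w. w \<in> space M ==> 0 <= R 0 w"
  and solvent: "!!w t. w \<in> space M ==> 0 <= t ==> 0 <= x + X t w - D t w + R t w"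
  and D_idle: "!!w s t. w \<in> space M ==> 0 <= s ==> s <= t ==> N s w = N t w ==> D s w = D t w"
  and R_finite: "(\<integral>\<^sup>+w. (\<integral>\<^sup>+t. ennreal (R (max 0 t) w) \<partial>expo q) \<partial>M) < \<infinity>"
begin

definition U :: "real => 'a => real" where "U t w = x + X t w - D t w + R t w"

text \<open>The mean of \<open>G\<close> at an exponential time of rate \<open>q\<close> is the
  objective: the discounted integral of \<open>dD - \<phi> dR\<close> is the mean of
  \<open>D - \<phi> R\<close> at that time, and \<open>lam / q\<close> weighs the terminal
  payoff.\<close>

definition G :: "real => 'a => real" where
 "G t w = D t w - \<phi> * R t w + lam / q * \<Psi> (max 0 (U t w))"

definition Rstar :: "'a => real" where "Rstar w = (LINT t|expo q. R (max 0 t) w)"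

lemma D_nonneg: "w \<in> space M ==> 0 <= t ==> 0 <= D t w" using mono_onD[OF D_mono, of w 0 t] D_0[of w] by simp

lemma R_nonneg: "w \<in> space M ==> 0 <= t ==> 0 <= R t w" using mono_onD[OF R_mono, of w 0 t] R_0[of w] by simp

lemma U_nonneg: "w \<in> space M ==> 0 <= t ==> 0 <= U t w" unfolding U_def by (rule solvent)

lemma U_cadlag: "w \<in> space M ==> cadlag (%t. U t w)" unfolding U_def by (intro cadlag_add cadlag_diff cadlag_const X_cadlag D_cadlag R_cadlag)

lemma G_cadlag: "w \<in> space M ==> cadlag (%t. G t w)"
proof -
 assume w: "w \<in> space M"
 have "continuous_on UNIV (%u. lam / q * \<Psi> (max 0 u))" using tame_continuous[OF terminal_tame] by (intro continuous_intros)
 from cadlag_compose[OF U_cadlag[OF w] this] cadlag_compose[OF R_cadlag[OF w], of "%u. \<phi> * u"]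
 show ?thesis unfolding G_def by (intro cadlag_add cadlag_diff D_cadlag w) (auto intro: continuous_intros)
qed

lemma U_F: "0 <= t ==> U t \<in> Bor (F t)" unfolding U_def using X_F[of t] D_F[of t] R_F[of t] by measurable

lemma joint_measurable_M:
 assumes "!!t. 0 <= t ==> Z t \<in> Bor (F t)" "!!w. w \<in> space M ==> cadlag (%t. Z t w)"
 shows "(%z. Z (max 0 (snd z)) (fst z)) \<in> Bor (M \<Otimes>\<^sub>M borel)"
proof -
 have "(%(t, w). Z (max 0 t) w) \<in> Bor (borel \<Otimes>\<^sub>M M)" using measurable_from_subalg[OF F_sub assms(1)] cadlag_right[OF assms(2)] by (intro joint_measurable) auto
 from measurable_compose[OF measurable_pair_swap' this] show ?thesis by (simp add: case_prod_unfold)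
qed

lemma G_F: "0 <= t ==> G t \<in> Bor (F t)"
proof -
 assume t: "0 <= t"
 note [measurable] = U_F[OF t] D_F[OF t] R_F[OF t] tame_measurable[OF terminal_tame]
 show ?thesis unfolding G_def by measurable
qed

lemma joint [measurable]:
 "(%z. X (max 0 (snd z)) (fst z)) \<in> Bor (M \<Otimes>\<^sub>M borel)"
 "(%z. D (max 0 (snd z)) (fst z)) \<in> Bor (M \<Otimes>\<^sub>M borel)"
 "(%z. R (max 0 (snd z)) (fst z)) \<in> Bor (M \<Otimes>\<^sub>M borel)"
 "(%z. U (max 0 (snd z)) (fst z)) \<in> Bor (M \<Otimes>\<^sub>M borel)"
 "(%z. G (max 0 (snd z)) (fst z)) \<in> Bor (M \<Otimes>\<^sub>M borel)" by (intro joint_measurable_M X_F X_cadlag D_F D_cadlag R_F R_cadlag U_F U_cadlag G_F G_cadlag; assumption)+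

lemma at_arr_measurable [measurable]:
 "(%w. D (arr n w) w) \<in> Bor M" "(%w. R (arr n w) w) \<in> Bor M"
 "(%w. U (arr n w) w) \<in> Bor M"
proof -
 have m: "(%w. (w, arr n w)) \<in> measurable M (M \<Otimes>\<^sub>M borel)" by measurable
 have "(%w. Z (arr n w) w) \<in> Bor M" if "(%z. Z (max 0 (snd z)) (fst z)) \<in> Bor (M \<Otimes>\<^sub>M borel)" for Z :: "real => 'a => real"
  using measurable_compose[OF m that] by (rule measurable_cong[THEN iffD1, rotated]) (simp add: max_absorb2 arr_nonneg)
 from this[OF joint(2)] this[OF joint(3)] this[OF joint(4)] show "(%w. D (arr n w) w) \<in> Bor M" "(%w. R (arr n w) w) \<in> Bor M"
 "(%w. U (arr n w) w) \<in> Bor M" .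
qed

lemma Rstar: "integrable M Rstar" "AE w in M. integrable (expo q) (%t. R (max 0 t) w)"
proof -
 interpret Eq: prob_space "expo q" by (rule prob_space_expo[OF q_pos(1)])
 interpret P: pair_prob_space M "expo q" ..
 have m: "(%z. R (max 0 (snd z)) (fst z)) \<in> Bor (M \<Otimes>\<^sub>M expo q)" using joint(3) by simp
 have "integrable (M \<Otimes>\<^sub>M expo q) (%z. R (max 0 (snd z)) (fst z))"
 proof (rule integrableI_nonneg[OF m])
  show "AE z in M \<Otimes>\<^sub>M expo q. 0 <= R (max 0 (snd z)) (fst z)" by (rule AE_I2) (auto simp: space_pair_measure R_nonneg)
  show "(\<integral>\<^sup>+z. ennreal (R (max 0 (snd z)) (fst z)) \<partial>(M \<Otimes>\<^sub>M expo q)) < \<infinity>" using R_finite m by (subst Eq.nn_integral_fst[symmetric]) auto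
 qed
 hence i: "integrable (M \<Otimes>\<^sub>M expo q) (%(w, t). R (max 0 t) w)" by (simp add: case_prod_unfold)
 show "integrable M Rstar" using P.integrable_fst'[OF i] by (simp add: Rstar_def[abs_def])
 show "AE w in M. integrable (expo q) (%t. R (max 0 t) w)" using P.AE_integrable_fst'[OF i] by simp
qed

text \<open>\<open>R\<close> is non-decreasing and the clock exceeds \<open>s\<close> with
  probability \<open>exp (- q * s)\<close>. The first bound keeps only the tail of the integral,
  which makes the discounted injections vanish along the arrivals.\<close>

lemma Rstar_ge:
 assumes w: "w \<in> space M" and i: "integrable (expo q) (%t. R (max 0 t) w)" and s: "0 <= s"
 shows "exp (- q * s) * R s w <= (LINT t|expo q. indicator {s..} t * R (max 0 t) w)" "exp (- q * s) * R s w <= Rstar w" "0 <= Rstar w"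
proof -
 interpret Eq: prob_space "expo q" by (rule prob_space_expo[OF q_pos(1)])
 have ind: "integrable (expo q) (%t. indicator {s..} t * R (max 0 t) w)" using integrable_mult_indicator[OF _ i, of "{s..}"] by simp
 have "exp (- q * s) * R s w = (LINT t|expo q. indicator {s..} t * R s w)" unfolding expo_shift[OF q_pos(1) s, of "%_. R s w", OF borel_measurable_const] using Eq.prob_space by simp
 also have "... <= (LINT t|expo q. indicator {s..} t * R (max 0 t) w)"
 proof (rule integral_mono[OF _ ind])
  show "integrable (expo q) (%t. indicator {s..} t * R s w)" using integrable_mult_indicator[of "{s..}" "expo q" "%_. R s w"] by simp
  show "indicator {s..} t * R s w <= indicator {s..} t * R (max 0 t) w" for t using mono_onD[OF R_mono[OF w], of s t] s by (auto simp: indicator_def)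
 qed
 finally show 1: "exp (- q * s) * R s w <= (LINT t|expo q. indicator {s..} t * R (max 0 t) w)" .
 also have "... <= Rstar w" unfolding Rstar_def using R_nonneg[OF w] by (intro integral_mono[OF ind i]) (auto simp: indicator_def)
 finally show "exp (- q * s) * R s w <= Rstar w" .
 show "0 <= Rstar w" unfolding Rstar_def using R_nonneg[OF w] by (intro integral_nonneg_AE) auto
qed

end

section \<open>Verification along the arrivals\<close>

context strategy
begin

definition payoff :: "'a => real" where "payoff w = (LINT t|expo q. G (max 0 t) w)"

text \<open>The value collected up to the \<open>n\<close>-th arrival if \<open>v\<close> were
  received there as continuation value. It interpolates between \<open>v\<close> at the initial
  surplus and the full payoff.\<close>

definition progress :: "(real => real) => nat => 'a => real" where
 "progress v n w = (LINT t|expo q. indicator {..<arr n w} t * G (max 0 t) w)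
   + exp (- q * arr n w) * (D (arr n w) w - \<phi> * R (arr n w) w + v (U (arr n w) w))"

text \<open>One stage, counted relative to the totals \<open>D s\<close> and \<open>R s\<close> at
  its start, so that it can be compared with \<open>H\<close>.\<close>

definition increment :: "(real => real) => real => 'a => real" where
 "increment v s w = (LINT t|expo q. indicator {..<wait s w} t * (lam / q * \<Psi> (max 0 (U (s + max 0 t) w)) - \<phi> * (R (s + max 0 t) w - R s w)))
   + exp (- q * wait s w) * (D (s + wait s w) w - D s w - \<phi> * (R (s + wait s w) w - R s w) + v (U (s + wait s w) w))"

lemma flow_cadlag:
 assumes w: "w \<in> space M" and s: "0 <= s"
 shows "cadlag (%t. lam / q * \<Psi> (max 0 (U (s + t) w)) - \<phi> * (R (s + t) w - R s w))"
  "cadlag (%t. flow u (XI s t w))"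
proof -
 have c: "cadlag (%t. lam / q * \<Psi> (max 0 (f t)))" if "cadlag f" for f by (rule cadlag_compose[OF that]) (intro continuous_intros tame_continuous[OF terminal_tame])
 have m: "cadlag (%t. \<phi> * (f t - a))" if "cadlag f" for f a by (rule cadlag_compose[OF that, of "%u. \<phi> * (u - a)"]) (intro continuous_intros)
 have i: "cadlag (%t. max u (Ii s t w))" by (rule cadlag_compose[OF Ii_cadlag(1)[OF w s], of "max u"]) (intro continuous_intros)
 show "cadlag (%t. lam / q * \<Psi> (max 0 (U (s + t) w)) - \<phi> * (R (s + t) w - R s w))" by (intro cadlag_diff c m cadlag_shift U_cadlag R_cadlag w s)
 show "cadlag (%t. flow u (XI s t w))" unfolding lump_def reflected_def fst_conv snd_conv by (intro cadlag_diff c m i cadlag_add Xi_cadlag w s)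
qed

text \<open>Memorylessness moves the part of the integral beyond \<open>arr n w\<close> to time 0.
  The accumulated amount \<open>c\<close> enters with weight \<open>1 - exp (- q * a)\<close> during
  the stage and \<open>exp (- q * a)\<close> at its end, hence once in total, as in
  \<open>progress v n\<close>.\<close>

lemma progress_Suc:
 assumes w: "w \<in> space M"
 shows "progress v (Suc n) w = progress v n w + exp (- q * arr n w) * (increment v (arr n w) w - v (U (arr n w) w))"
proof -
 interpret Eq: prob_space "expo q" by (rule prob_space_expo[OF q_pos(1)])
 define s where "s = arr n w"
 define a where "a = wait s w"
 define c where "c = D s w - \<phi> * R s w"
 define g where "g t = lam / q * \<Psi> (max 0 (U (s + t) w)) - \<phi> * (R (s + t) w - R s w)" for t
 have s: "0 <= s" using arr_nonneg[OF w] by (simp add: s_def)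
 have a: "0 < a" using wait_pos[OF w s] by (simp add: a_def)
 have Suc: "arr (Suc n) w = s + a" using arr_Suc[OF w, of n] by (simp add: s_def a_def)
 have Gm: "(%t. G (max 0 t) w) \<in> Bor borel" by (rule cadlag_measurable[OF G_cadlag[OF w]])
 have Gi: "integrable (expo q) (%t. indicator {..<b} t * G (max 0 t) w)" for b by (rule window_integrable[OF q_pos(1) G_cadlag[OF w]])
 have gi: "integrable (expo q) (%t. indicator {..<a} t * g (max 0 t))" unfolding g_def by (rule window_integrable[OF q_pos(1) flow_cadlag(1)[OF w s]])
 have G: "G (s + t) w = c + g t" if "0 <= t" "t < a" for t
 proof -
  have "N s w = n" "N (s + t) w = n" using N_arr[OF w, of n] N_idle[OF w, of n "s + t"] that Suc by (auto simp: s_def)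
  hence "D (s + t) w = D s w" using D_idle[OF w s, of "s + t"] that by simp
  thus ?thesis by (simp add: G_def c_def g_def algebra_simps)
 qed
 have "(LINT t|expo q. indicator {..<s + a} t * G (max 0 t) w)
   = (LINT t|expo q. indicator {..<s} t * G (max 0 t) w + indicator {s..} t * (indicator {..<s + a} t * G (max 0 t) w))"
  using a by (intro Bochner_Integration.integral_cong refl) (auto simp: indicator_def)
 also have "... = (LINT t|expo q. indicator {..<s} t * G (max 0 t) w) + (LINT t|expo q. indicator {s..} t * (indicator {..<s + a} t * G (max 0 t) w))"
  using Gi integrable_mult_indicator[OF _ Gi[of "s + a"], of "{s..}"] by (intro Bochner_Integration.integral_add) auto
 also have "(LINT t|expo q. indicator {s..} t * (indicator {..<s + a} t * G (max 0 t) w)) = exp (- q * s) * (LINT t|expo q. indicator {..<s + a} (s + t) * G (max 0 (s + t)) w)"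
  by (rule expo_shift[OF q_pos(1) s borel_measurable_times[OF borel_measurable_indicator Gm]]) simp
 also have "(LINT t|expo q. indicator {..<s + a} (s + t) * G (max 0 (s + t)) w) = (LINT t|expo q. c * indicator {..<a} t + indicator {..<a} t * g (max 0 t))"
 proof (rule integral_cong_AE)
  have "(%t. g (max 0 t)) \<in> Bor borel" unfolding g_def by (rule cadlag_measurable[OF flow_cadlag(1)[OF w s]])
  thus "(%t. c * indicator {..<a} t + indicator {..<a} t * g (max 0 t)) \<in> Bor (expo q)" by simp
  have "(%t. G (max 0 (s + t)) w) \<in> Bor borel" using measurable_compose[OF _ Gm, of "%t. s + t"] by simp
  thus "(%t. indicator {..<s + a} (s + t) * G (max 0 (s + t)) w) \<in> Bor (expo q)" by simp
  show "AE t in expo q. indicator {..<s + a} (s + t) * G (max 0 (s + t)) w = c * indicator {..<a} t + indicator {..<a} t * g (max 0 t)"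
   using expo_pos[of q] by eventually_elim (use G s in \<open>auto simp: indicator_def\<close>)
 qed
 also have "... = c * (1 - exp (- q * a)) + (LINT t|expo q. indicator {..<a} t * g (max 0 t))" using gi expo_less[OF q_pos(1) less_imp_le[OF a]] window_integrable[OF q_pos(1) cadlag_const[of 1], of a]
  by (subst Bochner_Integration.integral_add) auto
 finally have 1: "(LINT t|expo q. indicator {..<arr (Suc n) w} t * G (max 0 t) w) = (LINT t|expo q. indicator {..<s} t * G (max 0 t) w)
  + exp (- q * s) * (c * (1 - exp (- q * a)) + (LINT t|expo q. indicator {..<a} t * g (max 0 t)))" by (simp add: Suc)
 have 2: "exp (- q * (s + a)) = exp (- q * s) * exp (- q * a)" by (simp add: mult_exp_exp algebra_simps)
 have 3: "progress v (Suc n) w = (LINT t|expo q. indicator {..<arr (Suc n) w} t * G (max 0 t) w) + exp (- q * (s + a)) * (D (s + a) w - \<phi> * R (s + a) w + v (U (s + a) w))"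
  by (simp add: progress_def Suc)
 have 4: "progress v n w = (LINT t|expo q. indicator {..<s} t * G (max 0 t) w) + exp (- q * s) * (c + v (U s w))" by (simp add: progress_def s_def c_def)
 have 5: "increment v s w = (LINT t|expo q. indicator {..<a} t * g (max 0 t)) + exp (- q * a) * (D (s + a) w - \<phi> * R (s + a) w - c + v (U (s + a) w))"
  by (simp add: increment_def a_def g_def c_def algebra_simps)
 show ?thesis unfolding s_def[symmetric] 3 4 5 1 2 by (simp add: algebra_simps)
qed

text \<open>Solvency at the worst moment of the stage forces this amount, since dividends only lower
  the surplus: no strategy can inject less than reflection does.\<close>

lemma injection_lower_bound:
 assumes w: "w \<in> space M" and s: "0 <= s" and t: "0 <= t"
 shows "max (U s w) (Ii s t w) - U s w <= R (s + t) w - R s w"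
proof -
 have "Ii s t w <= U s w + (R (s + t) w - R s w)" unfolding Ii_def
 proof (rule wsup_least[OF t])
  fix r assume r: "0 <= r" "r <= t"
  have "D s w <= D (s + r) w" "R (s + r) w <= R (s + t) w" using mono_onD[OF D_mono[OF w], of s "s + r"] mono_onD[OF R_mono[OF w], of "s + r" "s + t"] s r by auto
  thus "- Xi s r w <= U s w + (R (s + t) w - R s w)" using solvent[OF w, of "s + r"] s r by (simp add: Xi_def U_def)
 qed
 moreover have "R s w <= R (s + t) w" using mono_onD[OF R_mono[OF w], of s "s + t"] s t by simp
 ultimately show ?thesis by simp
qed

text \<open>Injecting \<open>h\<close> more than the reflection requires costs \<open>\<phi> h\<close> and, all functions being
 \<open>\<phi>\<close>-Lipschitz, gains at most as much.\<close>

lemma increment_le: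
 assumes w: "w \<in> space M" and W: "tame \<phi> W" and v: "!!u d. 0 <= u ==> 0 <= d ==> d + v u <= W (u + d)"
 shows "increment v (arr n w) w <= H W (arr n w) (U (arr n w) w) w"
proof -
 define s where "s = arr n w"
 define a where "a = wait s w"
 have s: "0 <= s" using arr_nonneg[OF w] by (simp add: s_def)
 have a: "0 < a" using wait_pos[OF w s] by (simp add: a_def)
 define z where "z t = reflected (U s w) (XI s t w)" for t
 define h where "h t = R (s + t) w - R s w - (max (U s w) (Ii s t w) - U s w)" for t
 have z: "z t = Xi s t w + max (U s w) (Ii s t w)" "0 <= z t" "0 <= h t" if "0 <= t" for t
  using Ii_upper[OF w s that order_refl] injection_lower_bound[OF w s that] by (auto simp: z_def reflected_def h_def)
 have U: "U (s + t) w + (D (s + t) w - D s w) = z t + h t" if "0 <= t" for t using z(1)[OF that] by (simp add: h_def U_def Xi_def)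
 have flow: "lam / q * \<Psi> (max 0 (U (s + t) w)) - \<phi> * (R (s + t) w - R s w) <= flow (U s w) (XI s t w)" if t: "0 <= t" "t < a" for t
 proof -
  have "N s w = N (s + t) w" using N_arr[OF w, of n] N_idle[OF w, of n "s + t"] t arr_Suc[OF w, of n] by (simp add: s_def a_def)
  hence eq: "U (s + t) w = z t + h t" using U[OF t(1)] D_idle[OF w s, of "s + t"] t by simp
  have "lam / q * \<Psi> (z t + h t) <= lam / q * \<Psi> (z t) + \<phi> * h t" using tameD(2)[OF flow_tame, of "z t" "z t + h t"] z[OF t(1)] by simp
  thus ?thesis using z(2,3)[OF t(1)] by (simp add: eq lump_def z_def[symmetric] h_def algebra_simps)
 qed
 have "(LINT t|expo q. indicator {..<a} t * (lam / q * \<Psi> (max 0 (U (s + max 0 t) w)) - \<phi> * (R (s + max 0 t) w - R s w)))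
   <= (LINT t|expo q. indicator {..<a} t * flow (U s w) (XI s (max 0 t) w))"
  by (intro integral_mono window_integrable[OF q_pos(1)] flow_cadlag w s) (use a flow in \<open>auto simp: indicator_def\<close>)
 moreover have "D (s + a) w - D s w - \<phi> * (R (s + a) w - R s w) + v (U (s + a) w) <= lump W (U s w) (XI s a w)"
 proof -
  have a0: "0 <= a" using a by simp
  have "D (s + a) w - D s w + v (U (s + a) w) <= W (z a + h a)" using v[OF U_nonneg[OF w], of "s + a" "D (s + a) w - D s w"] U[OF a0] mono_onD[OF D_mono[OF w], of s "s + a"] s a by simp
  also have "... <= W (z a) + \<phi> * h a" using tameD(2)[OF W, of "z a" "z a + h a"] z[OF a0] by simp
  finally show ?thesis by (simp add: lump_def z_def[symmetric] h_def algebra_simps)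
 qed
 ultimately show ?thesis unfolding increment_def H_def s_def[symmetric] a_def[symmetric] by (intro add_mono mult_left_mono) auto
qed

end

context strategy
begin

text \<open>One integrable bound for the strong Markov property and for the limit in
  \<open>n\<close>. It rests on \<open>U\<close> and \<open>D\<close> being at most
  \<open>x + abs (X t w) + R t w\<close>, the latter because the surplus stays non-negative.\<close>

lemma envelope:
 assumes v: "tame \<phi> v" and W: "tame \<phi> W"
 obtains B where "integrable M B"
  "AE w in M. (ALL n. abs (progress v n w) <= B w) & (ALL s>=0. exp (- q * s) * abs (H W s (U s w) w) <= B w)
    & (ALL s>=0. exp (- q * s) * abs (v (U s w)) <= B w) & (%n. progress v n w) ----> payoff w"
proof -
 interpret Eq: prob_space "expo q" by (rule prob_space_expo[OF q_pos(1)])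
 obtain C Z where C: "0 <= C" and Z: "integrable M Z" "AE w in M. 0 <= Z w"
  and X: "AE w in M. ALL t>=0. abs (X t w) <= exp (q / 2 * t) * Z w"
  and H: "AE w in M. ALL s>=0. ALL u>=0. exp (- q * s) * abs (H W s u w) <= C * (1 + exp (- q * s) * u + Z w)" by (rule H_bound[OF W])
 \<comment> \<open>\<open>A\<close> collects the weights of \<open>D\<close>, of
   \<open>\<phi> * R\<close> and of a term of slope \<phi>, together with the values of
   \<open>\<Psi>\<close> and \<open>v\<close> at 0.\<close>
 define A where "A = 1 + 2 * \<phi> + abs (\<Psi> 0) + abs (v 0)"
 \<comment> \<open>The factor 2 is the integral of \<open>exp (q / 2 * t)\<close> under
   \<open>expo q\<close>.\<close>
 define E where "E w = 1 + x + 2 * Z w + Rstar w" for w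
 have A: "1 <= A" using cost_gt_1 by (simp add: A_def)
 show ?thesis
 proof (rule that[of "%w. (2 * A + C) * E w"])
  show "integrable M (%w. (2 * A + C) * E w)" unfolding E_def using Z Rstar(1) by simp
  show "AE w in M. (ALL n. abs (progress v n w) <= (2 * A + C) * E w) & (ALL s>=0. exp (- q * s) * abs (H W s (U s w) w) <= (2 * A + C) * E w)
    & (ALL s>=0. exp (- q * s) * abs (v (U s w)) <= (2 * A + C) * E w) & (%n. progress v n w) ----> payoff w" using Z(2) X H Rstar(2) AE_space
  proof eventually_elim
   case (elim w)
   note w = elim(5) and Ri = elim(4)
   define K where "K t = 1 + x + abs (X t w) + R t w" for t
   define e where "e t = exp (- q * t) * K t" for t
   have disc: "exp (- q * t) <= 1" "exp (- (q / 2) * t) <= 1" if "0 <= t" for t using q_pos that by auto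
   have XZ: "exp (- q * t) * abs (X t w) <= exp (- (q / 2) * t) * Z w" if "0 <= t" for t
   proof -
    have "exp (- q * t) * abs (X t w) <= exp (- q * t) * (exp (q / 2 * t) * Z w)" using elim(2) that by simp
    also have "... = exp (- (q / 2) * t) * Z w" unfolding mult.assoc[symmetric] by (simp add: mult_exp_exp)
    finally show ?thesis .
   qed
   note Rs = Rstar_ge[OF w Ri]
   have e_le: "e t <= E w" if "0 <= t" for t
   proof -
    have "e t = exp (- q * t) * (1 + x) + exp (- q * t) * abs (X t w) + exp (- q * t) * R t w" by (simp add: e_def K_def algebra_simps)
    also have "... <= 1 * (1 + x) + 1 * Z w + Rstar w" using disc[OF that] x_nonneg elim(1) Rs(2)[OF that] by (intro add_mono order_trans[OF XZ[OF that]] mult_right_mono) auto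
    finally show ?thesis using elim(1) by (simp add: E_def)
   qed
   have UD: "0 <= U t w" "U t w <= K t - 1" "0 <= D t w" "D t w <= K t - 1" "0 <= R t w" "R t w <= K t - 1" if "0 <= t" for t
    using U_nonneg[OF w that] D_nonneg[OF w that] R_nonneg[OF w that] x_nonneg by (auto simp: U_def K_def)
   have tm: "abs (f (U t w)) <= abs (f 0) + \<phi> * (K t - 1)" if "0 <= t" "tame \<phi> f" for t f
   proof -
    have "abs (f (U t w) - f 0) <= \<phi> * abs (U t w - 0)" by (rule tame_lipschitz[OF that(2)]) (use UD that in auto)
    also have "... <= \<phi> * (K t - 1)" using UD[OF that(1)] cost_gt_1 by (intro mult_left_mono) auto
    finally show ?thesis by linarith
   qed
   have K0: "1 <= K t" if "0 <= t" for t using UD(5)[OF that] x_nonneg by (simp add: K_def)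
   have DR: "abs (D t w - \<phi> * R t w + f) <= A * K t"
    if t: "0 <= t" and f: "abs f <= (abs (\<Psi> 0) + abs (v 0)) + \<phi> * (K t - 1)" for t f
   proof -
    have "\<phi> * R t w <= \<phi> * (K t - 1)" "0 <= \<phi> * R t w" using UD[OF t] cost_gt_1 by (auto intro!: mult_left_mono)
    hence "abs (D t w - \<phi> * R t w + f) <= (K t - 1) + \<phi> * (K t - 1) + ((abs (\<Psi> 0) + abs (v 0)) + \<phi> * (K t - 1))" using UD[OF t] f by linarith
    moreover have "(abs (\<Psi> 0) + abs (v 0)) * 1 <= (abs (\<Psi> 0) + abs (v 0)) * K t" using K0[OF t] by (intro mult_left_mono) auto
    ultimately show ?thesis using cost_gt_1 K0[OF t] by (simp add: A_def algebra_simps)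
   qed
   have term_le: "abs (D t w - \<phi> * R t w + v (U t w)) <= A * K t" if "0 <= t" for t using tm[OF that v] by (intro DR[OF that]) auto
   have "lam / q <= 1" "0 <= lam / q" using killing_pos discount_pos by (auto simp: q_def)
   hence lq: "abs (lam / q * y) <= 1 * abs y" for y unfolding abs_mult by (intro mult_right_mono) auto
   have G_le: "abs (G t w) <= A * K t" if "0 <= t" for t
   proof -
    have "abs (lam / q * \<Psi> (U t w)) <= (abs (\<Psi> 0) + abs (v 0)) + \<phi> * (K t - 1)" using lq[of "\<Psi> (U t w)"] tm[OF that terminal_tame] abs_ge_zero[of "v 0"] by linarith
    from DR[OF that this] show ?thesis unfolding G_def max_absorb2[OF UD(1)[OF that]] .
   qed
   define L where "L t = A * (1 + x + exp (q / 2 * t) * Z w + R (max 0 t) w)" for t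
   have Li: "integrable (expo q) L" unfolding L_def using expo_exp_integrable(1)[OF q_pos(2,3)] Ri by simp
   have "(LINT t|expo q. L t) = A * E w" unfolding L_def E_def Rstar_def using expo_exp_integrable[OF q_pos(2,3)] Ri Eq.prob_space q_pos by simp
   have GL: "AE t in expo q. abs (G (max 0 t) w) <= L t" using expo_pos[of q]
   proof eventually_elim
    case (elim t)
    have "K t <= 1 + x + exp (q / 2 * t) * Z w + R t w" using \<open>ALL t>=0. \<bar>X t w\<bar> <= exp (q / 2 * t) * Z w\<close>[rule_format, of t] elim by (simp add: K_def)
    hence "A * K t <= L t" unfolding L_def using A elim by (intro mult_left_mono) auto
    thus ?case using G_le[of t] elim by simp
   qed
   have Gm: "(%t. G (max 0 t) w) \<in> Bor (expo q)" using cadlag_measurable[OF G_cadlag[OF w]] by simp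
   have flow_le: "abs (LINT t|expo q. indicator {..<a} t * G (max 0 t) w) <= A * E w" for a
   proof -
    have "abs (LINT t|expo q. indicator {..<a} t * G (max 0 t) w) <= (LINT t|expo q. abs (indicator {..<a} t * G (max 0 t) w))" by (rule integral_abs_bound)
    also have "... <= (LINT t|expo q. L t)"
    proof (rule integral_mono_AE'[OF Li])
     show "AE t in expo q. abs (indicator {..<a} t * G (max 0 t) w) <= L t" using GL by eventually_elim (auto simp: indicator_def)
     show "AE t in expo q. 0 <= L t" using GL by eventually_elim linarith
    qed
    finally show ?thesis using \<open>(LINT t|expo q. L t) = A * E w\<close> by simp
   qed
   have E0: "0 <= E w" using elim(1) Rs(3)[of 0] x_nonneg by (simp add: E_def)
   have lump_le: "abs (exp (- q * t) * (D t w - \<phi> * R t w + v (U t w))) <= A * e t" if "0 <= t" for t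
    using mult_left_mono[OF term_le[OF that], of "exp (- q * t)"] by (simp add: abs_mult e_def mult.left_commute)
   have AE: "A * e t <= A * E w" if "0 <= t" for t using e_le[OF that] A by simp
   have CE: "A * E w + A * E w <= (2 * A + C) * E w" "C * E w <= (2 * A + C) * E w" "A * E w <= (2 * A + C) * E w" using E0 A C by (auto simp: algebra_simps)
   have "abs (progress v n w) <= (2 * A + C) * E w" for n using flow_le[of "arr n w"] lump_le[OF arr_nonneg[OF w], of n] AE[OF arr_nonneg[OF w], of n] CE(1) unfolding progress_def by linarith
   moreover have "exp (- q * s) * abs (H W s (U s w) w) <= (2 * A + C) * E w" if s: "0 <= s" for s
   proof -
    have "exp (- q * s) * U s w <= exp (- q * s) * (x + abs (X s w) + R s w)" using UD(2)[OF s] by (simp add: K_def)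
    also have "... = exp (- q * s) * x + exp (- q * s) * abs (X s w) + exp (- q * s) * R s w" by (simp add: algebra_simps)
    also have "... <= 1 * x + 1 * Z w + Rstar w" using disc[OF s] x_nonneg elim(1) Rs(2)[OF s] by (intro add_mono order_trans[OF XZ[OF s]] mult_right_mono) auto
    finally have "C * (1 + exp (- q * s) * U s w + Z w) <= C * E w" unfolding E_def using C by (intro mult_left_mono) auto
    thus ?thesis using elim(3)[rule_format, OF s UD(1)[OF s]] CE(2) by linarith
   qed
   moreover have "exp (- q * s) * abs (v (U s w)) <= (2 * A + C) * E w" if s: "0 <= s" for s
   proof -
    have "abs (v (U s w)) <= A * K s"
    proof -
     have "abs (v 0) * 1 <= abs (v 0) * K s" using K0[OF s] by (intro mult_left_mono) auto
     moreover have "0 <= abs (\<Psi> 0) * K s" "0 <= \<phi> * K s" "\<phi> * (K s - 1) <= \<phi> * K s" using K0[OF s] cost_gt_1 by auto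
     moreover have "A * K s = K s + 2 * (\<phi> * K s) + abs (\<Psi> 0) * K s + abs (v 0) * K s" by (simp add: A_def algebra_simps)
     ultimately show ?thesis using tm[OF s v] K0[OF s] by linarith
    qed
    hence "exp (- q * s) * abs (v (U s w)) <= A * e s" using mult_left_mono[of "abs (v (U s w))" "A * K s" "exp (- q * s)"] by (simp add: e_def mult.left_commute)
    thus ?thesis using AE[OF s] CE(3) by linarith
   qed
   moreover have "(%n. progress v n w) ----> payoff w"
   proof -
    note top = arr_at_top[OF w]
    have dom: "(%n. LINT t|expo q. indicator (S n) t * f t) ----> (LINT t|expo q. l t)"
     if "AE t in expo q. abs (f t) <= g t" "f \<in> Bor (expo q)" "integrable (expo q) g" "!!n. S n \<in> sets borel" "l \<in> Bor (expo q)"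
      "!!t. eventually (%n. indicator (S n) t * f t = l t) sequentially" for S :: "nat => real set" and f g l :: "real => real"
    proof (rule integral_dominated_convergence[where w = g])
     show "AE t in expo q. (%n. indicator (S n) t * f t) ----> l t" using that(6) by (auto intro: tendsto_eventually)
     show "AE t in expo q. norm (indicator (S n) t * f t) <= g t" for n using that(1) by eventually_elim (auto simp: indicator_def)
     show "(%t. indicator (S n) t * f t) \<in> Bor (expo q)" for n using that(2) that(4)[of n] by (intro borel_measurable_times borel_measurable_indicator) auto
    qed (use that in auto)
    have "eventually (%n. indicator {..<arr n w} t * G (max 0 t) w = G (max 0 t) w) sequentially" for t using filterlim_at_top_dense[THEN iffD1, OF top, rule_format, of t] by eventually_elim simp
    hence 1: "(%n. LINT t|expo q. indicator {..<arr n w} t * G (max 0 t) w) ----> payoff w" unfolding payoff_def by (intro dom[OF GL Gm Li _ Gm]) auto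
    \<comment> \<open>The tail integral of \<open>R\<close> beyond \<open>arr n w\<close> dominates
      the discounted injections at that time and vanishes, whereas \<open>Rstar\<close> would merely
      bound them.\<close>
    have "eventually (%n. indicator {arr n w..} t * R (max 0 t) w = 0) sequentially" for t using filterlim_at_top_dense[THEN iffD1, OF top, rule_format, of t] by eventually_elim simp
    hence 2: "(%n. LINT t|expo q. indicator {arr n w..} t * R (max 0 t) w) ----> (LINT t|expo q. 0)" using R_nonneg[OF w] by (intro dom[OF _ borel_measurable_integrable[OF Ri] Ri]) auto
    have 3: "(%n. exp (- c * arr n w)) ----> 0" if "0 < c" for c by (rule filterlim_compose[OF exp_at_bot]) (use filterlim_tendsto_neg_mult_at_bot[OF tendsto_const _ top, of "- c"] that in simp)
    have "(%n. A * (exp (- q * arr n w) * (1 + x) + exp (- (q / 2) * arr n w) * Z w + (LINT t|expo q. indicator {arr n w..} t * R (max 0 t) w))) ----> A * (0 * (1 + x) + 0 * Z w + (LINT t|expo q. 0))"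
     by (intro tendsto_intros 2 3 q_pos)
    hence lim: "(%n. A * (exp (- q * arr n w) * (1 + x) + exp (- (q / 2) * arr n w) * Z w + (LINT t|expo q. indicator {arr n w..} t * R (max 0 t) w))) ----> 0" by simp
    have "norm (exp (- q * arr n w) * (D (arr n w) w - \<phi> * R (arr n w) w + v (U (arr n w) w)))
      <= A * (exp (- q * arr n w) * (1 + x) + exp (- (q / 2) * arr n w) * Z w + (LINT t|expo q. indicator {arr n w..} t * R (max 0 t) w))" for n
    proof -
     define s where "s = arr n w"
     have s: "0 <= s" using arr_nonneg[OF w] by (simp add: s_def)
     have "e s = exp (- q * s) * (1 + x) + exp (- q * s) * abs (X s w) + exp (- q * s) * R s w" by (simp add: e_def K_def algebra_simps)
     also have "... <= exp (- q * s) * (1 + x) + exp (- (q / 2) * s) * Z w + (LINT t|expo q. indicator {s..} t * R (max 0 t) w)" using XZ[OF s] Rs(1)[OF s] by simp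
     finally have "A * e s <= A * (exp (- q * s) * (1 + x) + exp (- (q / 2) * s) * Z w + (LINT t|expo q. indicator {s..} t * R (max 0 t) w))" using A by (intro mult_left_mono) auto
     thus ?thesis using lump_le[OF s] unfolding s_def[symmetric] real_norm_def by linarith
    qed
    hence "(%n. exp (- q * arr n w) * (D (arr n w) w - \<phi> * R (arr n w) w + v (U (arr n w) w))) ----> 0" by (intro Lim_null_comparison[OF always_eventually lim]) auto
    from tendsto_add[OF 1 this] show ?thesis unfolding progress_def by simp
   qed
   ultimately show ?case by blast
  qed
 qed
qed

end

context strategy
begin

lemma G_at_measurable: "progress v n \<in> Bor M" if v: "tame \<phi> v"
proof -
 interpret Eq: prob_space "expo q" by (rule prob_space_expo[OF q_pos(1)])
 have vU: "(%w. v (U (arr n w) w)) \<in> Bor M" using tame_measurable[OF v at_arr_measurable(3)[of n]] by (rule measurable_cong[THEN iffD1, rotated]) (simp add: max_absorb2 U_nonneg arr_nonneg)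
 have m: "(%z. G (max 0 (snd z)) (fst z)) \<in> Bor (M \<Otimes>\<^sub>M expo q)" using joint(5) by simp
 hence "(%(w, t). (if t < arr n w then 1 else 0) * G (max 0 t) w) \<in> Bor (M \<Otimes>\<^sub>M expo q)" unfolding case_prod_unfold by (rule borel_measurable_times[rotated]) measurable
 from Eq.borel_measurable_lebesgue_integral[OF this]
 have "(%w. LINT t|expo q. indicator {..<arr n w} t * G (max 0 t) w) \<in> Bor M" by (rule measurable_cong[THEN iffD1, rotated]) (auto intro!: Bochner_Integration.integral_cong simp: indicator_def)
 thus ?thesis unfolding progress_def[abs_def] using vU by measurable
qed

text \<open>By the strong Markov property the discounted \<open>H\<close> at \<open>arr n w\<close>
  has the same mean as the discounted \<open>v\<close>. So one step of \<open>progress\<close>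
  changes its mean by the discounted mean of \<open>increment\<close> minus \<open>H\<close>, and
  the two conclusions are the cases where this difference is at most zero or zero.\<close>

lemma verification:
 assumes v: "tame \<phi> v" and W: "tame \<phi> W" and fp: "!!u. 0 <= u ==> st.stage W u = v u"
 shows "integrable M payoff"
  and "(!!w n. w \<in> space M ==> increment v (arr n w) w <= H W (arr n w) (U (arr n w) w) w) ==> (LINT w|M. payoff w) <= v x"
  and "(!!w. w \<in> space M ==> R 0 w = 0) ==>
   (!!w n. w \<in> space M ==> increment v (arr n w) w = H W (arr n w) (U (arr n w) w) w) ==> (LINT w|M. payoff w) = v x"
proof -
 obtain B where B: "integrable M B"
  and bd: "AE w in M. (ALL n. abs (progress v n w) <= B w) & (ALL s>=0. exp (- q * s) * abs (H W s (U s w) w) <= B w)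
    & (ALL s>=0. exp (- q * s) * abs (v (U s w)) <= B w) & (%n. progress v n w) ----> payoff w" by (rule envelope[OF v W])
 have m: "progress v n \<in> Bor M" for n by (rule G_at_measurable[OF v])
 have lim: "AE w in M. (%n. progress v n w) ----> payoff w" using bd by eventually_elim blast
 have pm: "payoff \<in> Bor M"
 proof -
  interpret Eq: prob_space "expo q" by (rule prob_space_expo[OF q_pos(1)])
  have "(%(w, t). G (max 0 t) w) \<in> Bor (M \<Otimes>\<^sub>M expo q)" using joint(5) by (simp add: case_prod_unfold)
  from Eq.borel_measurable_lebesgue_integral[OF this] show ?thesis unfolding payoff_def[abs_def] .
 qed
 have bound: "AE w in M. norm (progress v n w) <= B w" for n using bd by eventually_elim auto
 note dc = integral_dominated_convergence[OF pm m B lim bound] integrable_dominated_convergence[OF pm m B lim bound]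
 show "integrable M payoff" by (rule dc(2))
 have pi: "integrable M (progress v n)" for n by (rule Bochner_Integration.integrable_bound[OF B m]) (use bound[of n] in \<open>eventually_elim, auto\<close>)
 have v_lim: "((%s. v (U s w)) ---> v (U s w)) (at_right s)" if w: "w \<in> space M" and s: "0 <= s" for w s
 proof -
  have "((%s. v (max 0 (U s w))) ---> v (max 0 (U s w))) (at_right s)" using continuous_on_tendsto_compose[OF tame_continuous[OF v] cadlag_right[OF U_cadlag[OF w] s]] by simp
  hence "((%s. v (max 0 (U s w))) ---> v (U s w)) (at_right s)" using U_nonneg[OF w s] by simp
  thus ?thesis by (rule Lim_transform_eventually) (use eventually_at_right_less[of s] in eventually_elim, use U_nonneg[OF w] s in simp)
 qed
 have Hb: "AE w in M. ALL s>=0. exp (- q * s) * abs (H W s (U s w) w) <= B w" using bd by eventually_elim blast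
 have vb: "AE w in M. ALL s>=0. exp (- q * s) * abs (v (U s w)) <= B w" using bd by eventually_elim blast
 have sm: "(LINT w|M. exp (- q * arr n w) * H W (arr n w) (U (arr n w) w) w) = (LINT w|M. exp (- q * arr n w) * v (U (arr n w) w))"
  "integrable M (%w. exp (- q * arr n w) * H W (arr n w) (U (arr n w) w) w)" "integrable M (%w. exp (- q * arr n w) * v (U (arr n w) w))" for n
 proof -
  have hyp: "(LINT w|M. H W s u w) = v u" if "0 <= s" "0 <= u" for s u using H_expectation[OF W that] fp[OF that(2)] by simp
  have Hl: "((%s. H W s (U s w) w) ---> H W (arr n w) (U (arr n w) w) w) (at_right (arr n w))" if w: "w \<in> space M" for w
   by (rule H_right_limit[OF W w arr_nonneg[OF w] U_cadlag[OF w] U_nonneg[OF w]])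
  note S = strong_markov[OF order_refl arr_nonneg[where n = n] arr_less[where n = n] U_F U_nonneg H_measurable[OF W] hyp Hl v_lim[OF _ arr_nonneg[where n = n]] B Hb vb]
  have cong: "(LINT w|M. indicator (space M) w * f w) = (LINT w|M. f w)" "integrable M (%w. indicator (space M) w * f w) <-> integrable M f" for f :: "'a => real"
   by (auto intro!: Bochner_Integration.integral_cong Bochner_Integration.integrable_cong)
  show "(LINT w|M. exp (- q * arr n w) * H W (arr n w) (U (arr n w) w) w) = (LINT w|M. exp (- q * arr n w) * v (U (arr n w) w))"
   "integrable M (%w. exp (- q * arr n w) * H W (arr n w) (U (arr n w) w) w)" "integrable M (%w. exp (- q * arr n w) * v (U (arr n w) w))" using S unfolding cong by auto
 qed
 have Suc: "(LINT w|M. progress v (Suc n) w) - (LINT w|M. progress v n w) = (LINT w|M. progress v (Suc n) w - progress v n w)" for n using pi by simp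
 have Hv: "(LINT w|M. exp (- q * arr n w) * H W (arr n w) (U (arr n w) w) w - exp (- q * arr n w) * v (U (arr n w) w)) = 0" for n using sm[of n] by simp
 have p0: "progress v 0 w = - \<phi> * R 0 w + v (x + R 0 w)" if w: "w \<in> space M" for w
 proof -
  have "(LINT t|expo q. indicator {..<0} t * G (max 0 t) w) = (LINT t|expo q. 0)"
   by (rule integral_cong_AE) (use cadlag_measurable[OF G_cadlag[OF w]] expo_pos[of q] in \<open>auto elim!: eventually_mono\<close>)
  thus ?thesis by (simp add: progress_def arr_0[OF w] D_0[OF w] U_def X_0[OF w])
 qed
 {
  assume le: "!!w n. w \<in> space M ==> increment v (arr n w) w <= H W (arr n w) (U (arr n w) w) w"
  have "(LINT w|M. progress v (Suc n) w) <= (LINT w|M. progress v n w)" for n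
  proof -
   have "(LINT w|M. progress v (Suc n) w - progress v n w) <= (LINT w|M. exp (- q * arr n w) * H W (arr n w) (U (arr n w) w) w - exp (- q * arr n w) * v (U (arr n w) w))"
    using le[of _ n] by (intro integral_mono Bochner_Integration.integrable_diff pi sm(2,3)) (simp add: progress_Suc right_diff_distrib[symmetric])
   thus ?thesis using Suc[of n] Hv[of n] by linarith
  qed
  hence "decseq (%n. LINT w|M. progress v n w)" by (rule decseq_SucI)
  hence "(LINT w|M. payoff w) <= (LINT w|M. progress v 0 w)" using decseq_ge[OF _ dc(1)] by blast
  also have "... <= (LINT w|M. v x)"
  proof (rule integral_mono[OF pi])
   fix w assume w: "w \<in> space M"
   \<comment> \<open>An injection at time 0 costs \<phi> per unit and raises \<open>v\<close> by at
     most as much.\<close>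
   show "progress v 0 w <= v x" using p0[OF w] tameD(2)[OF v x_nonneg, of "x + R 0 w"] R_0[OF w] by simp
  qed simp
  finally show "(LINT w|M. payoff w) <= v x" using prob_space by simp
 }
 {
  assume R0: "!!w. w \<in> space M ==> R 0 w = 0"
   and eq: "!!w n. w \<in> space M ==> increment v (arr n w) w = H W (arr n w) (U (arr n w) w) w"
  have step: "(LINT w|M. progress v (Suc n) w) = (LINT w|M. progress v n w)" for n
  proof -
   have "(LINT w|M. progress v (Suc n) w - progress v n w) = (LINT w|M. exp (- q * arr n w) * H W (arr n w) (U (arr n w) w) w - exp (- q * arr n w) * v (U (arr n w) w))"
    using eq[of _ n] by (intro Bochner_Integration.integral_cong refl) (simp add: progress_Suc right_diff_distrib)
   thus ?thesis using Suc[of n] Hv[of n] by linarith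
  qed
  have "(LINT w|M. progress v 0 w) = (LINT w|M. v x)" using p0 R0 by (intro Bochner_Integration.integral_cong refl) simp
  hence "(LINT w|M. progress v n w) = v x" for n by (induction n) (use step prob_space in auto)
  hence "(%n. v x) ----> (LINT w|M. payoff w)" using dc(1) by simp
  thus "(LINT w|M. payoff w) = v x" by (simp add: LIMSEQ_const_iff)
 }
qed

end

section \<open>Double barrier paths\<close>

lemma injections_eq: "injections y d t = wsup (%s. max (d s - y s) 0) 0 t"
proof -
 have "uminus ` (%s. min (y s - d s) 0) ` {0..t} = (%s. max (d s - y s) 0) ` {0..t}" unfolding image_image by (intro image_cong refl) auto
 thus ?thesis by (simp add: injections_def wsup_def Inf_real_def)
qed

locale barrier_path =
 fixes y :: "real => real" and m :: "real => nat" and b :: real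
 assumes y_cadlag: "cadlag y" and y_jump: "!!t. 0 < t ==> 0 <= jump y t" and y_0: "0 <= y 0" and b_nonneg: "0 <= b"
  and T_le: "!!t n. 0 <= t ==> arrival_time m n <= t <-> n <= m t" and m_T: "!!n. m (arrival_time m n) = n"
  and T_nonneg: "!!n. 0 <= arrival_time m n"
begin

abbreviation T where "T \<equiv> arrival_time m"

definition e where "e n = dividends_upto y T b n"

lemma T_less: "T n < T (Suc n)" using T_le[OF T_nonneg, of "Suc n" n] m_T[of n] by auto

lemma e_0: "e 0 t = 0" by (simp add: e_def)

lemma e_step: "EX c>=0. ALL t. e (Suc n) t = e n t + (if T (Suc n) <= t then c else 0)"
 by (intro exI[of _ "max (left_lim (controlled y (e n)) (T (Suc n)) + jump y (T (Suc n)) - b) 0"]) (simp add: e_def)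

lemma e_const: "T n <= s ==> s <= t ==> e n s = e n t"
proof (induction n)
 case (Suc n)
 thus ?case using e_step[of n] T_less[of n] by (smt (verit))
qed (simp add: e_0)

lemma e_mono_cadlag: "mono_on {0..} (e n) & cadlag (e n)"
proof (induction n)
 case 0
 thus ?case by (simp add: e_def monotone_on_def cadlag_const)
next
 case (Suc n)
 obtain c where c: "0 <= c" "!!t. e (Suc n) t = e n t + (if T (Suc n) <= t then c else 0)" using e_step[of n] by auto
 have m: "mono_on {0..} (e (Suc n))"
 proof (rule mono_onI)
  fix s t :: real assume st: "s \<in> {0..}" "t \<in> {0..}" "s <= t"
  have "e n s <= e n t" using mono_onD[OF conjunct1[OF Suc] st] .
  thus "e (Suc n) s <= e (Suc n) t" using st(3) c by simp
 qed
 moreover have "cadlag (e (Suc n))"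
 proof (rule mono_cadlag[OF m])
  fix t :: real assume t: "0 <= t"
  have "eventually (%s. (if T (Suc n) <= t then c else 0) = (if T (Suc n) <= s then c else 0)) (at_right t)"
  proof (cases "T (Suc n) <= t")
   case True
   show ?thesis using eventually_at_right_less[of t] by eventually_elim (use True in auto)
  next
   case False
   hence "t < T (Suc n)" by simp
   from eventually_at_right_real[OF this] show ?thesis by eventually_elim (use False in auto)
  qed
  hence "((%s. if T (Suc n) <= s then c else 0) ---> (if T (Suc n) <= t then c else 0)) (at_right t)" by (rule Lim_transform_eventually[OF tendsto_const])
  thus "(e (Suc n) ---> e (Suc n) t) (at_right t)" unfolding c(2)[abs_def] using cadlag_right[of "e n" t] Suc t by (intro tendsto_add) (auto simp: c(2)[abs_def])
 qed
 ultimately show ?case by blast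
qed

lemma shortfall_cadlag: "cadlag d ==> cadlag (%s. max (d s - y s) 0)" by (rule cadlag_compose[OF cadlag_diff[OF _ y_cadlag], of _ "%u. max u 0"]) (auto intro!: continuous_intros)

lemma injections_bounds:
 assumes "cadlag d" "0 <= t"
 shows "0 <= injections y d t" "0 <= controlled y d t" using wsup_upper[OF shortfall_cadlag[OF assms(1)], of 0 t t] assms by (auto simp: injections_eq controlled_def)

text \<open>Without downward jumps of \<open>y\<close> the injections do not jump at an arrival, so the surplus just before
 the payment is the reflected process itself.\<close>

lemma e_Suc: "e (Suc n) t = e n t + (if T (Suc n) <= t then max (controlled y (e n) (T (Suc n)) - b) 0 else 0)"
proof -
 define s where "s = T (Suc n)"
 have s: "0 < s" "T n < s" using T_less[of n] T_nonneg[of n] by (auto simp: s_def)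
 obtain l where l: "(y ---> l) (at_left s)" using cadlag_left[OF y_cadlag s(1)] by blast
 note ext = left_lim_eq[OF s(1)]
 have ly: "l <= y s" using y_jump[OF s(1)] ext[OF l] by (simp add: jump_def)
 have es: "e n u = e n s" if "T n <= u" "u <= s" for u using e_const[OF that] .
 have ev: "eventually (%u. e n s = e n u) (at_left s)" using eventually_at_left_real[OF s(2)] by (rule eventually_mono) (rule es[symmetric], auto)
 have c: "cadlag (e n)" using e_mono_cadlag by blast
 have "(wsup (%u. max (e n u - y u) 0) 0 ---> wsup (%u. max (e n u - y u) 0) 0 s) (at_left s)"
 proof (rule wsup_left_limit[OF shortfall_cadlag[OF c] order_refl s(1)])
  have "((%u. max (e n s - y u) 0) ---> max (e n s - l) 0) (at_left s)" by (intro tendsto_intros l)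
  thus "((%u. max (e n u - y u) 0) ---> max (e n s - l) 0) (at_left s)" by (rule Lim_transform_eventually) (rule eventually_mono[OF ev], simp)
 qed (use ly in auto)
 moreover have "((%u. y u - e n s) ---> l - e n s) (at_left s)" by (intro tendsto_intros l)
 hence "((%u. y u - e n u) ---> l - e n s) (at_left s)" by (rule Lim_transform_eventually) (rule eventually_mono[OF ev], simp)
 ultimately have "(controlled y (e n) ---> l - e n s + injections y (e n) s) (at_left s)" unfolding controlled_def[abs_def] injections_eq by (intro tendsto_add)
 from ext[OF this] ext[OF l] have "left_lim (controlled y (e n)) s + jump y s = controlled y (e n) s" by (simp add: jump_def controlled_def)
 thus ?thesis unfolding s_def by (simp add: e_def)
qed

text \<open>After \<open>T n\<close> the dividends \<open>e n\<close> are frozen, so only the free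
  path moves. The running supremum stays put until the path restarted from the current surplus would
  become negative, and then grows by that deficit.\<close>

lemma injections_after:
 assumes t: "0 <= t"
 shows "injections y (e n) (T n + t) = injections y (e n) (T n) + max 0 (wsup (%r. y (T n) - y (T n + r)) 0 t - controlled y (e n) (T n))"
proof -
 define s where "s = T n"
 define f where "f r = max (e n r - y r) 0" for r
 define I where "I = injections y (e n)"
 define J where "J = wsup (%r. y s - y (s + r)) 0 t"
 define u where "u = controlled y (e n) s"
 have s: "0 <= s" using T_nonneg by (simp add: s_def)
 have c: "cadlag f" unfolding f_def using e_mono_cadlag by (intro shortfall_cadlag) blast
 have I: "I r = wsup f 0 r" for r unfolding I_def injections_eq f_def ..
 have u: "u = y s - e n s + I s" by (simp add: u_def controlled_def I_def)
 have es: "e n (s + r) = e n s" if "0 <= r" for r using e_const[of n s "s + r"] that by (simp add: s_def)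
 have cJ: "cadlag (%r. y s - y (s + r))" by (intro cadlag_diff cadlag_const cadlag_shift y_cadlag s)
 have I0: "0 <= I r" if "0 <= r" for r using wsup_upper[OF c, of 0 r r] that by (simp add: I f_def)
 have "wsup f s (s + t) <= I s + max 0 (J - u)"
 proof (rule wsup_least)
  fix r assume r: "s <= r" "r <= s + t"
  have "y s - y (s + (r - s)) <= J" unfolding J_def using r by (intro wsup_upper[OF cJ]) auto
  thus "f r <= I s + max 0 (J - u)" using es[of "r - s"] r u I0[OF s] by (simp add: f_def)
 qed (use t in simp)
 hence "I (s + t) <= I s + max 0 (J - u)" using wsup_split[OF c order_refl, of s "s + t"] s t by (simp add: I)
 moreover have "J <= u - I s + I (s + t)" unfolding J_def
 proof (rule wsup_least[OF t])
  fix r assume r: "0 <= r" "r <= t"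
  have "f (s + r) <= I (s + t)" unfolding I using r s by (intro wsup_upper[OF c]) auto
  thus "y s - y (s + r) <= u - I s + I (s + t)" using es[OF r(1)] u by (simp add: f_def)
 qed
 moreover have "I s <= I (s + t)" unfolding I using s t by (intro wsup_mono[OF c]) auto
 ultimately show ?thesis unfolding s_def[symmetric] I_def[symmetric] J_def[symmetric] u_def[symmetric] by simp
qed

text \<open>A positive payment leaves the surplus at \<open>b >= 0\<close>, so it creates no new
  shortfall.\<close>

lemma injections_Suc: "injections y (e (Suc n)) (T (Suc n)) = injections y (e n) (T (Suc n))"
proof -
 define s where "s = T (Suc n)"
 have s: "0 <= s" using T_nonneg by (simp add: s_def)
 have c: "cadlag (%r. max (e k r - y r) 0)" for k using e_mono_cadlag by (intro shortfall_cadlag) blast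
 note nn = injections_bounds[of "e n" s] e_mono_cadlag[of n]
 have "wsup (%r. max (e (Suc n) r - y r) 0) 0 s <= injections y (e n) s"
 proof (rule wsup_least[OF s])
  fix r assume r: "0 <= r" "r <= s"
  have "max (e n r - y r) 0 <= injections y (e n) s" unfolding injections_eq using r by (intro wsup_upper[OF c]) auto
  thus "max (e (Suc n) r - y r) 0 <= injections y (e n) s" using e_Suc[of n r] r nn s b_nonneg by (auto simp: s_def[symmetric] controlled_def split: if_splits)
 qed
 moreover have "injections y (e n) s <= wsup (%r. max (e (Suc n) r - y r) 0) 0 s" unfolding injections_eq[of y "e n"]
 proof (rule wsup_least[OF s])
  fix r assume r: "0 <= r" "r <= s"
  have "max (e (Suc n) r - y r) 0 <= wsup (%r. max (e (Suc n) r - y r) 0) 0 s" using r by (intro wsup_upper[OF c]) auto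
  moreover have "e n r <= e (Suc n) r" by (simp add: e_Suc)
  ultimately show "max (e n r - y r) 0 <= wsup (%r. max (e (Suc n) r - y r) 0) 0 s" by simp
 qed
 ultimately show ?thesis by (simp add: s_def injections_eq[of y "e (Suc n)"])
qed

definition d where "d = barrier_dividends y m b"

lemma d_eq: "0 <= t ==> t < T (Suc n) ==> d t = e n t"
proof -
 assume t: "0 <= t" "t < T (Suc n)"
 have "m t <= n" using T_le[OF t(1), of "Suc n"] t by simp
 hence "e n t = e (m t) t"
 proof (induction n rule: dec_induct)
  case (step k)
  thus ?case using T_le[OF t(1), of "Suc k"] by (simp add: e_Suc)
 qed simp
 thus ?thesis by (simp add: d_def barrier_dividends_def e_def)
qed

lemma d_at: "0 <= t ==> d t = e (m t) t" by (simp add: d_def barrier_dividends_def e_def)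

lemma d_idle: "0 <= s ==> s <= t ==> m s = m t ==> d s = d t" using d_at[of s] d_at[of t] e_const[of "m t" s t] T_le[of s "m t"] by simp

lemma d_mono: "mono_on {0..} d"
proof (rule mono_onI)
 fix s t :: real assume st: "s \<in> {0..}" "t \<in> {0..}" "s <= t"
 have "t < T (Suc (m t))" using T_le[of t "Suc (m t)"] st by simp
 thus "d s <= d t" using d_eq[of s "m t"] d_eq[of t "m t"] mono_onD[OF conjunct1[OF e_mono_cadlag[of "m t"]] st] st by simp
qed

lemma d_0: "d 0 = 0"
proof -
 have "m 0 = 0" using m_T[of 0] T_le[of 0 0] T_nonneg[of 0] by (metis antisym le0 order_refl)
 thus ?thesis using d_at[of 0] by (simp add: e_0)
qed

lemma d_cadlag: "cadlag d"
proof (rule mono_cadlag[OF d_mono])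
 fix t :: real assume t: "0 <= t"
 have less: "t < T (Suc (m t))" using T_le[OF t, of "Suc (m t)"] by simp
 have "(e (m t) ---> d t) (at_right t)" using cadlag_right[OF conjunct2[OF e_mono_cadlag] t] d_at[OF t] by simp
 thus "(d ---> d t) (at_right t)" by (rule Lim_transform_eventually) (use eventually_at_right_real[OF less] in eventually_elim, use d_eq t in auto)
qed

text \<open>The end point \<open>T (Suc n)\<close> is included although \<open>d\<close> already
  contains the payment made there; that payment leaves the injections unchanged by
  \<open>injections_Suc\<close>.\<close>

lemma injections_eq_e:
 assumes t: "0 <= t" "t <= T (Suc n)"
 shows "injections y d t = injections y (e n) t"
proof -
 have cong: "injections y d t = injections y (e k) t" if "t < T (Suc k)" for k unfolding injections_eq wsup_def using that d_eq[of _ k] t by (intro SUP_cong refl) auto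
 show ?thesis
 proof (cases "t < T (Suc n)")
  case False
  hence "t = T (Suc n)" using t by simp
  thus ?thesis using cong[of "Suc n"] T_less[of "Suc n"] injections_Suc[of n] by simp
 qed (rule cong)
qed

text \<open>The recursion in the form matched by \<open>reflected\<close> and
  \<open>barrier_op\<close>: reflection at 0 of the path restarted from the surplus at
  \<open>T n\<close>, then payment of the excess over \<open>b\<close>.\<close>

lemma barrier_cycle:
 assumes t: "0 <= t" "T n + t <= T (Suc n)"
 shows "injections y d (T n + t) = injections y d (T n) + max 0 (wsup (%r. y (T n) - y (T n + r)) 0 t - controlled y d (T n))"
  and "T n + t = T (Suc n) ==> d (T n + t) = d (T n) + max (controlled y d (T n) + (y (T n + t) - y (T n)) + (injections y d (T n + t) - injections y d (T n)) - b) 0"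
proof -
 have u: "controlled y d (T n) = controlled y (e n) (T n)" using injections_eq_e[OF T_nonneg, of n n] d_eq[OF T_nonneg, of n n] T_less[of n] by (simp add: controlled_def)
 show "injections y d (T n + t) = injections y d (T n) + max 0 (wsup (%r. y (T n) - y (T n + r)) 0 t - controlled y d (T n))"
  unfolding u using injections_after[OF t(1), of n] injections_eq_e[of "T n + t" n] injections_eq_e[of "T n" n] T_nonneg[of n] T_less[of n] t by simp
 assume eq: "T n + t = T (Suc n)"
 have "d (T n) = e n (T n)" "d (T (Suc n)) = e (Suc n) (T (Suc n))" using d_at[OF T_nonneg] m_T by auto
 moreover have "e n (T n) = e n (T (Suc n))" using e_const[of n "T n" "T (Suc n)"] T_less[of n] by simp
 ultimately show "d (T n + t) = d (T n) + max (controlled y d (T n) + (y (T n + t) - y (T n)) + (injections y d (T n + t) - injections y d (T n)) - b) 0"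
  unfolding eq u using e_Suc[of n "T (Suc n)"] injections_eq_e[of "T (Suc n)" n] injections_eq_e[of "T n" n] T_nonneg T_less[of n] by (simp add: controlled_def)
qed

end

section \<open>The double barrier strategy\<close>

locale poisson_model = control_model M F X N \<gamma> lam r \<phi> \<Psi>
 for M :: "'a measure" and F X N \<gamma> lam r \<phi> \<Psi> +
 assumes N_mean: "!!t. 0 <= t ==> (\<integral>\<^sup>+w. ennreal (real (N t w)) \<partial>M) = ennreal (\<gamma> * t)"
begin

abbreviation "surplus x w \<equiv> (%s. start_at x X s w)"
abbreviation "arrivals w \<equiv> (%s. N s w)"

definition Db :: "real => real => real => 'a => real" where "Db x b t w = barrier_dividends (surplus x w) (arrivals w) b t"
definition Rb :: "real => real => real => 'a => real" where "Rb x b t w = injections (surplus x w) (barrier_dividends (surplus x w) (arrivals w) b) t"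

lemma surplus_cadlag: "w \<in> space M ==> cadlag (surplus x w)" unfolding start_at_def by (intro cadlag_add cadlag_const X_cadlag)

lemma barrier_path:
 assumes w: "w \<in> space M" and x: "0 <= x" and b: "0 <= b"
 shows "barrier_path (surplus x w) (arrivals w) b"
proof
 fix t :: real assume t: "0 < t"
 obtain l where l: "((%s. X s w) ---> l) (at_left t)" using cadlag_left[OF X_cadlag[OF w] t] by blast
 hence "((%s. x + X s w) ---> x + l) (at_left t)" by (intro tendsto_intros)
 thus "0 <= jump (surplus x w) t" using X_jump[OF w t] left_lim_eq[OF t l] left_lim_eq[OF t, of "%s. x + X s w"] by (simp add: jump_def start_at_def)
next
 fix t :: real and n assume "0 <= t"
 thus "arrival_time (arrivals w) n <= t <-> n <= N t w" by (rule arrival_le_iff[OF w])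
next
 show "0 <= arrival_time (arrivals w) n" for n using arr_nonneg[OF w, of n] by (simp add: arr_def)
 show "N (arrival_time (arrivals w) n) w = n" for n using N_arr[OF w, of n] by (simp add: arr_def)
qed (use surplus_cadlag[OF w] x b X_0[OF w] in \<open>auto simp: start_at_def\<close>)

text \<open>Process and random time are both cut off at \<open>t\<close>, which makes their
  composition measurable with respect to \<open>F t\<close>; on \<open>arr k w <= t\<close> the
  cut-off changes nothing.\<close>

lemma stopped_measurable:
 assumes Z: "!!t. 0 <= t ==> Z t \<in> Bor (F t)" and cad: "!!w. w \<in> space M ==> cadlag (%t. Z t w)" and t: "0 <= t"
 shows "(%w. if arr k w <= t then Z (arr k w) w else 0) \<in> Bor (F t)"
proof -
 have m1: "(%(s, w). Z (min (max 0 s) t) w) \<in> Bor (borel \<Otimes>\<^sub>M F t)"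
 proof (rule joint_measurable)
  show "Z (min s t) \<in> Bor (F t)" if "0 <= s" for s using F_le_F[of "min s t" t] Z[of "min s t"] that t by auto
  fix w s assume "w \<in> space (F t)" and s: "0 <= (s::real)"
  hence w: "w \<in> space M" using space_F[OF t] by simp
  show "((%s. Z (min s t) w) ---> Z (min s t) w) (at_right s)"
  proof (cases "s < t")
   case True
   have "((%s. Z s w) ---> Z (min s t) w) (at_right s)" using cadlag_right[OF cad[OF w] s] True by simp
   thus ?thesis by (rule Lim_transform_eventually) (use eventually_at_right_real[OF True] in eventually_elim, simp)
  next
   case False
   have "eventually (%u. Z (min s t) w = Z (min u t) w) (at_right s)" using eventually_at_right_less[of s] by eventually_elim (use False in simp)
   thus ?thesis by (rule Lim_transform_eventually[OF tendsto_const])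
  qed
 qed
 have m2: "(%w. (min (arr k w) t, w)) \<in> measurable (F t) (borel \<Otimes>\<^sub>M F t)"
 proof (rule measurable_Pair[OF borel_measurableI_less])
  fix u :: real
  show "{w \<in> space (F t). min (arr k w) t < u} \<in> sets (F t)"
  proof (cases "0 <= u & u <= t")
   case True
   hence "{w \<in> space M. arr k w < u} \<in> sets (F t)" using arr_less[of u k] F_mono[of u t] by auto
   moreover have "{w \<in> space (F t). min (arr k w) t < u} = {w \<in> space M. arr k w < u}" using True space_F[OF t] by auto
   ultimately show ?thesis by simp
  next
   case False
   hence "{w \<in> space (F t). min (arr k w) t < u} = (if u <= t then {} else space (F t))" using arr_nonneg[of _ k] t space_F[OF t] by (force simp: min_less_iff_disj)
   thus ?thesis by (simp only:) auto
  qed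
 qed simp
 from measurable_compose[OF m2 m1] have m: "(%w. Z (min (max 0 (min (arr k w) t)) t) w) \<in> Bor (F t)" by simp
 have "(%w. real (N t w)) \<in> Bor (F t)" by (rule N_F[OF t])
 hence "(%w. if real k <= real (N t w) then Z (min (max 0 (min (arr k w) t)) t) w else 0) \<in> Bor (F t)" using m by measurable
 thus ?thesis by (rule measurable_cong[THEN iffD1, rotated]) (use arr_le_iff[OF _ t, of _ k] arr_nonneg[of _ k] space_F[OF t] in auto)
qed

lemma injections_F:
 assumes x: "0 <= x" and d: "!!t. 0 <= t ==> (%w. d w t) \<in> Bor (F t)" and cad: "!!w. w \<in> space M ==> cadlag (d w)" and t: "0 <= t"
 shows "(%w. injections (surplus x w) (d w) t) \<in> Bor (F t)" unfolding injections_eq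
proof (rule wsup_measurable[OF _ _ order_refl t])
 show "cadlag (%s. max (d w s - surplus x w s) 0)" if "w \<in> space (F t)" for w using that space_F[OF t] barrier_path.shortfall_cadlag[OF barrier_path[OF _ x order_refl] cad, of w] by simp
 fix s assume s: "0 <= s" "s <= t"
 note [measurable] = F_le_F[OF s d[OF s(1)]] F_le_F[OF s X_F[OF s(1)]]
 show "(%w. max (d w s - surplus x w s) 0) \<in> Bor (F t)" unfolding start_at_def by measurable
qed

context
 fixes x b :: real
 assumes x: "0 <= x" and b: "0 <= b"
begin

lemma dividends_upto_F: "0 <= t ==> (%w. barrier_path.e (surplus x w) (arrivals w) b n t) \<in> Bor (F t)"
proof (induction n arbitrary: t)
 case 0
 have "(%w. 0) \<in> Bor (F t)" by simp
 thus ?case by (rule measurable_cong[THEN iffD1, rotated]) (use barrier_path.e_0[OF barrier_path[OF _ x b]] space_F[OF 0] in simp)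
next
 case (Suc n)
 define Z where "Z t w = controlled (surplus x w) (barrier_path.e (surplus x w) (arrivals w) b n) t" for t w
 have cad: "cadlag (barrier_path.e (surplus x w) (arrivals w) b n)" if "w \<in> space M" for w using barrier_path.e_mono_cadlag[OF barrier_path[OF that x b]] by blast
 have "Z t \<in> Bor (F t)" if t: "0 <= t" for t
 proof -
  note [measurable] = injections_F[OF x Suc.IH cad t] Suc.IH[OF t] X_F[OF t]
  show ?thesis unfolding Z_def[abs_def] controlled_def start_at_def[of x X t] by measurable
 qed
 moreover have "cadlag (%t. Z t w)" if w: "w \<in> space M" for w unfolding Z_def controlled_def injections_eq
  by (intro cadlag_add cadlag_diff surplus_cadlag w cad cadlag_wsup(1) barrier_path.shortfall_cadlag[OF barrier_path[OF w x b]])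
 ultimately have "(%w. if arr (Suc n) w <= t then Z (arr (Suc n) w) w else 0) \<in> Bor (F t)" using Suc.prems by (rule stopped_measurable)
 hence "(%w. max ((if arr (Suc n) w <= t then Z (arr (Suc n) w) w else 0) - b) 0) \<in> Bor (F t)" by measurable
 hence "(%w. barrier_path.e (surplus x w) (arrivals w) b n t + max ((if arr (Suc n) w <= t then Z (arr (Suc n) w) w else 0) - b) 0) \<in> Bor (F t)" using Suc.IH[OF Suc.prems] by measurable
 thus ?case by (rule measurable_cong[THEN iffD1, rotated])
   (use b barrier_path.e_Suc[OF barrier_path[OF _ x b]] space_F[OF Suc.prems] in \<open>simp add: Z_def arr_def\<close>)
qed

lemma Db_eq: "w \<in> space M ==> Db x b t w = barrier_path.d (surplus x w) (arrivals w) b t" by (simp add: Db_def barrier_path.d_def[OF barrier_path[OF _ x b]])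

lemma Rb_eq: "w \<in> space M ==> Rb x b t w = injections (surplus x w) (barrier_path.d (surplus x w) (arrivals w) b) t" by (simp add: Rb_def barrier_path.d_def[OF barrier_path[OF _ x b]])

lemma d_F: "0 <= t ==> (%w. barrier_path.d (surplus x w) (arrivals w) b t) \<in> Bor (F t)"
proof -
 assume t: "0 <= t"
 have "N t \<in> measurable (F t) (count_space UNIV)"
 proof (rule measurable_count_space_eq2_countable[THEN iffD2], intro conjI ballI)
  fix n
  have "(%w. real (N t w)) -` {real n} Int space (F t) \<in> sets (F t)" using measurable_sets[OF N_F[OF t]] by simp
  thus "N t -` {n} Int space (F t) \<in> sets (F t)" by (simp add: vimage_def)
 qed auto
 from measurable_compose_countable[OF dividends_upto_F[OF t] this]
 show ?thesis by (rule measurable_cong[THEN iffD1, rotated]) (use barrier_path.d_at[OF barrier_path[OF _ x b] t] space_F[OF t] in simp)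
qed

text \<open>Each of the \<open>N t w + 1\<close> stages adds at most the fall of the path within it,
  which is at most twice the supremum of its absolute value. The bound is crude, but independence of
  \<open>N\<close> and \<open>X\<close> makes the product integrable.\<close>

lemma Rb_bound:
 assumes w: "w \<in> space M" and t: "0 <= t"
 shows "Rb x b t w <= (real (N t w) + 1) * (2 * wsup (%s. abs (Xi 0 s w)) 0 t)"
proof -
 interpret p: barrier_path "surplus x w" "arrivals w" b by (rule barrier_path[OF w x b])
 define S where "S t = wsup (%s. abs (Xi 0 s w)) 0 t" for t
 have c: "cadlag (%s. abs (Xi 0 s w))" by (rule cadlag_compose[OF Xi_cadlag[OF w order_refl], of abs]) (intro continuous_intros)
 have S: "0 <= S t" if "0 <= t" for t using wsup_upper[OF c, of 0 0 t] that by (simp add: S_def)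
 have S_mono: "S s <= S t" if "0 <= s" "s <= t" for s t unfolding S_def using that by (intro wsup_mono[OF c]) auto
 have "ALL t. arr n w <= t --> t <= arr (Suc n) w --> injections (surplus x w) p.d t <= (real n + 1) * (2 * S t)" for n
 proof (induction n)
  case (Suc n)
  show ?case
  proof (intro allI impI)
   fix t assume t: "arr (Suc n) w <= t" "t <= arr (Suc (Suc n)) w"
   define s where "s = arr (Suc n) w"
   have s: "0 <= s" "s <= t" using arr_nonneg[OF w] t by (auto simp: s_def)
   have "arr n w <= s" using p.T_less[of n] by (simp add: s_def arr_def)
   hence "injections (surplus x w) p.d s <= (real n + 1) * (2 * S s)" using Suc by (simp add: s_def)
   also have "... <= (real n + 1) * (2 * S t)" using S_mono[OF s] by (intro mult_left_mono) auto
   finally have 1: "injections (surplus x w) p.d s <= (real n + 1) * (2 * S t)" .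
   have "wsup (%r. surplus x w s - surplus x w (s + r)) 0 (t - s) <= 2 * S t"
   proof (rule wsup_least)
    fix r assume "0 <= r" "r <= t - s"
    hence "abs (Xi 0 (s + r) w) <= S t" "abs (Xi 0 s w) <= S t" unfolding S_def using s by (auto intro!: wsup_upper[OF c])
    thus "surplus x w s - surplus x w (s + r) <= 2 * S t" by (simp add: start_at_def Xi_def)
   qed (use s in simp)
   moreover have "0 <= controlled (surplus x w) p.d s" by (rule p.injections_bounds[OF p.d_cadlag s(1)])
   ultimately have "injections (surplus x w) p.d t <= injections (surplus x w) p.d s + 2 * S t" using p.barrier_cycle(1)[of "t - s" "Suc n"] t s S[of t] by (simp add: s_def arr_def)
   thus "injections (surplus x w) p.d t <= (real (Suc n) + 1) * (2 * S t)" using 1 by (simp add: algebra_simps)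
  qed
 next
  case 0
  show ?case
  proof (intro allI impI)
   fix t assume t: "arr 0 w <= t" "t <= arr (Suc 0) w"
   have t0: "0 <= t" using t arr_0[OF w] by simp
   have "wsup (%s. max (p.d s - surplus x w s) 0) 0 t <= 2 * S t"
   proof (rule wsup_least[OF t0])
    fix s assume s: "0 <= s" "s <= t"
    have R0: "injections (surplus x w) p.d 0 = 0" using p.d_0 p.y_0 by (simp add: injections_eq)
    have "injections (surplus x w) p.d s <= 2 * S t"
    proof -
     have "wsup (%r. surplus x w 0 - surplus x w r) 0 s <= S t"
     proof (rule wsup_least[OF s(1)])
      fix r assume "0 <= r" "r <= s"
      hence "abs (Xi 0 r w) <= S t" unfolding S_def using s by (auto intro!: wsup_upper[OF c])
      thus "surplus x w 0 - surplus x w r <= S t" by (simp add: start_at_def Xi_def)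
     qed
     moreover have "0 <= controlled (surplus x w) p.d 0" by (rule p.injections_bounds[OF p.d_cadlag]) simp
     ultimately show ?thesis using p.barrier_cycle(1)[of s 0] R0 arr_0[OF w] t s S[OF t0] by (simp add: arr_def)
    qed
    moreover have "max (p.d s - surplus x w s) 0 <= injections (surplus x w) p.d s" unfolding injections_eq using s by (intro wsup_upper[OF p.shortfall_cadlag[OF p.d_cadlag]]) auto
    ultimately show "max (p.d s - surplus x w s) 0 <= 2 * S t" by simp
   qed
   thus "injections (surplus x w) p.d t <= (real 0 + 1) * (2 * S t)" by (simp add: injections_eq)
  qed
 qed
 moreover have "arr (N t w) w <= t" "t <= arr (Suc (N t w)) w" using arr_le_iff[OF w t, of "N t w"] arr_le_iff[OF w t, of "Suc (N t w)"] by auto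
 ultimately show ?thesis unfolding Rb_eq[OF w] S_def by blast
qed

end

end

context poisson_model
begin

text \<open>The objective after \<tau> and discounting have been merged into one exponential clock
  of rate \<open>q\<close>.\<close>

definition J :: "real => (real => 'a => real) => (real => 'a => real) => real" where
 "J x D R = (LINT w|M. (LINT t|expo q. D (max 0 t) w - \<phi> * R (max 0 t) w + lam / q * \<Psi> (max 0 (x + X (max 0 t) w - D (max 0 t) w + R (max 0 t) w))))"

lemma strategy_value:
 assumes "strategy M F X N \<gamma> lam r \<phi> \<Psi> x D R" and v: "tame \<phi> v" and W: "tame \<phi> W"
  and fp: "!!u. 0 <= u ==> st.stage W u = v u" and dom: "!!u d. 0 <= u ==> 0 <= d ==> d + v u <= W (u + d)"
 shows "J x D R <= v x"
proof -
 interpret s: strategy M F X N \<gamma> lam r \<phi> \<Psi> x D R by fact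
 have "J x D R = (LINT w|M. s.payoff w)" unfolding J_def s.payoff_def s.G_def s.U_def ..
 also have "... <= v x" using s.verification(2)[OF v W fp] s.increment_le[OF _ W dom] by blast
 finally show ?thesis .
qed

lemma path_supremum_mean:
 assumes t: "0 <= t"
 shows "(%w. wsup (%s. abs (Xi 0 s w)) 0 t) \<in> Bor (X_future 0)"
  "(\<integral>\<^sup>+w. ennreal ((real (N t w) + 1) * (2 * wsup (%s. abs (Xi 0 s w)) 0 t)) \<partial>M)
   = ennreal (\<gamma> * t + 1) * (\<integral>\<^sup>+w. ennreal (2 * wsup (%s. abs (Xi 0 s w)) 0 t) \<partial>M)"
proof -
 define S where "S w = wsup (%s. abs (Xi 0 s w)) 0 t" for w
 have c: "cadlag (%s. abs (Xi 0 s w))" if "w \<in> space M" for w by (rule cadlag_compose[OF Xi_cadlag[OF that order_refl], of abs]) (intro continuous_intros)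
 have Sm: "S \<in> Bor (X_future 0)" unfolding S_def using c future_sub(4)[OF order_refl] by (intro wsup_measurable[OF _ _ order_refl t] borel_measurable_abs Xi_measurable) (auto simp: subalgebra_def)
 thus "(%w. wsup (%s. abs (Xi 0 s w)) 0 t) \<in> Bor (X_future 0)" by (simp add: S_def[abs_def])
 have SM: "S \<in> Bor M" by (rule measurable_from_subalg[OF future_sub(4)[OF order_refl] Sm])
 have S0: "0 <= S w" if "w \<in> space M" for w using wsup_upper[OF c[OF that], of 0 0 t] t by (simp add: S_def)
 have ind: "indep_set {S -` A Int space M | A. A \<in> sets borel} (sets (N_future 0))"
  using measurable_sets[OF Sm] future_sub(4)[OF order_refl] by (intro indep_set_mono[OF XN_future_indep[OF order_refl]]) (auto simp: subalgebra_def)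
 have Nm: "(%w. real (N t w) - real (N 0 w)) \<in> Bor (N_future 0)" using N_incr_measurable[OF order_refl t] by simp
 have inner: "(\<integral>\<^sup>+w. ennreal (2 * y) * ennreal (real (N t w) - real (N 0 w) + 1) \<partial>M) = ennreal (2 * y) * ennreal (\<gamma> * t + 1)" for y
 proof -
  have "(\<integral>\<^sup>+w. ennreal (real (N t w) - real (N 0 w) + 1) \<partial>M) = (\<integral>\<^sup>+w. ennreal (real (N t w)) + 1 \<partial>M)"
   by (intro nn_integral_cong) (simp add: N_0 ennreal_plus)
  also have "... = ennreal (\<gamma> * t + 1)" using N_meas[OF t] N_mean[OF t] intensity_pos t emeasure_space_1 by (subst nn_integral_add) (auto simp: ennreal_plus)
  finally show ?thesis using measurable_from_subalg[OF future_sub(5)[OF order_refl] Nm] by (subst nn_integral_cmult) auto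
 qed
 have "(\<integral>\<^sup>+w. ennreal ((real (N t w) + 1) * (2 * S w)) \<partial>M) = (\<integral>\<^sup>+w. ennreal (2 * S w) * ennreal (real (N t w) - real (N 0 w) + 1) \<partial>M)"
  by (intro nn_integral_cong, subst ennreal_mult[symmetric]) (auto simp: N_0 S0 mult.commute)
 also have "... = (\<integral>\<^sup>+y. (\<integral>\<^sup>+w. ennreal (2 * y) * ennreal (real (N t w) - real (N 0 w) + 1) \<partial>M) \<partial>distr M borel S)"
  by (rule indep_nn_integral[OF SM future_sub(5)[OF order_refl] ind, where g = "%(y, w). ennreal (2 * y) * ennreal (real (N t w) - real (N 0 w) + 1)", simplified])
   (use Nm in measurable)
 also have "... = (\<integral>\<^sup>+y. ennreal (2 * y) * ennreal (\<gamma> * t + 1) \<partial>distr M borel S)" unfolding inner ..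
 also have "... = (\<integral>\<^sup>+w. ennreal (2 * S w) * ennreal (\<gamma> * t + 1) \<partial>M)" by (rule nn_integral_distr[OF SM]) simp
 also have "... = ennreal (\<gamma> * t + 1) * (\<integral>\<^sup>+w. ennreal (2 * S w) \<partial>M)" using SM by (subst nn_integral_multc) (auto simp: mult.commute)
 finally show "(\<integral>\<^sup>+w. ennreal ((real (N t w) + 1) * (2 * wsup (%s. abs (Xi 0 s w)) 0 t)) \<partial>M)
   = ennreal (\<gamma> * t + 1) * (\<integral>\<^sup>+w. ennreal (2 * wsup (%s. abs (Xi 0 s w)) 0 t) \<partial>M)" by (simp add: S_def)
qed

context
 fixes x b :: real
 assumes x: "0 <= x" and b: "0 <= b"
begin

lemma Rb_F: "0 <= t ==> Rb x b t \<in> Bor (F t)" by (rule measurable_cong[THEN iffD1, OF _ injections_F[OF x d_F[OF x b] barrier_path.d_cadlag[OF barrier_path[OF _ x b]]]])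
  (simp_all add: Rb_eq[OF x b] space_F)

lemma Rb_cadlag: "w \<in> space M ==> cadlag (%t. Rb x b t w)" unfolding Rb_eq[OF x b] injections_eq
 by (intro cadlag_wsup(1) barrier_path.shortfall_cadlag[OF barrier_path[OF _ x b]] barrier_path.d_cadlag[OF barrier_path[OF _ x b]])

lemma Rb_finite: "(\<integral>\<^sup>+w. (\<integral>\<^sup>+t. ennreal (Rb x b (max 0 t) w) \<partial>expo q) \<partial>M) < \<infinity>"
proof -
 interpret Eq: prob_space "expo q" by (rule prob_space_expo[OF q_pos(1)])
 interpret P: pair_prob_space "expo q" M ..
 \<comment> \<open>One quarter of \<open>q\<close> for the path envelope and another to absorb
   \<open>\<gamma> * t + 1\<close> leave growth \<open>exp (q / 2 * t)\<close>, integrable under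
   \<open>expo q\<close>.\<close>
 have q4: "0 < q / 4" using q_pos by simp
 obtain Z where Z: "integrable M Z" "AE w in M. 0 <= Z w" and "AE w in M. ALL t>=0. abs (X t w) <= exp (q / 4 * t) * Z w"
  and Z3: "AE w in M. ALL s>=0. ALL t>=0. abs (Xi s t w) <= exp (q / 4 * (s + t)) * Z w & abs (Ii s t w) <= exp (q / 4 * (s + t)) * Z w" by (rule domination[OF q4])
 define z where "z = (LINT w|M. Z w)"
 have z: "0 <= z" unfolding z_def using Z(2) by (rule integral_nonneg_AE)
 define K where "K = (1 + 4 * \<gamma> / q) * (2 * z)"
 have K: "0 <= K" using z intensity_pos q_pos by (simp add: K_def)
 have mean: "(\<integral>\<^sup>+w. ennreal (Rb x b t w) \<partial>M) <= ennreal (K * exp (q / 2 * t))" if t: "0 <= t" for t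
 proof -
  let ?S = "%w. wsup (%s. abs (Xi 0 s w)) 0 t"
  have "(\<integral>\<^sup>+w. ennreal (Rb x b t w) \<partial>M) <= (\<integral>\<^sup>+w. ennreal ((real (N t w) + 1) * (2 * ?S w)) \<partial>M)"
   by (intro nn_integral_mono ennreal_leI Rb_bound[OF x b _ t])
  also have "... = ennreal (\<gamma> * t + 1) * (\<integral>\<^sup>+w. ennreal (2 * ?S w) \<partial>M)" by (rule path_supremum_mean(2)[OF t])
  also have "(\<integral>\<^sup>+w. ennreal (2 * ?S w) \<partial>M) <= (\<integral>\<^sup>+w. ennreal (2 * (exp (q / 4 * t) * Z w)) \<partial>M)"
  proof (rule nn_integral_mono_AE)
   show "AE w in M. ennreal (2 * ?S w) <= ennreal (2 * (exp (q / 4 * t) * Z w))" using Z(2) Z3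
  proof eventually_elim
   case (elim w)
   have "?S w <= exp (q / 4 * t) * Z w"
   proof (rule wsup_least[OF t])
    fix s assume s: "0 <= s" "s <= t"
    have "abs (Xi 0 s w) <= exp (q / 4 * (0 + s)) * Z w" using elim(2) s by blast
    also have "... <= exp (q / 4 * t) * Z w" using s q_pos elim(1) by (intro mult_right_mono) auto
    finally show "abs (Xi 0 s w) <= exp (q / 4 * t) * Z w" .
   qed
   thus ?case by (intro ennreal_leI) simp
  qed
  qed
  also have "... = ennreal (2 * exp (q / 4 * t) * z)" using Z(1,2) by (subst nn_integral_eq_integral) (auto simp: z_def mult.assoc elim!: eventually_mono)
  also have "ennreal (\<gamma> * t + 1) * ennreal (2 * exp (q / 4 * t) * z) = ennreal ((\<gamma> * t + 1) * (2 * exp (q / 4 * t) * z))" using intensity_pos t by (intro ennreal_mult'[symmetric]) simp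
  also have "... <= ennreal (K * exp (q / 2 * t))"
  proof (rule ennreal_leI)
   have "q / 4 * t <= exp (q / 4 * t)" "1 <= exp (q / 4 * t)" using exp_ge_add_one_self[of "q / 4 * t"] mult_nonneg_nonneg[OF less_imp_le[OF q4] t] by linarith+
   hence "(4 * \<gamma> / q) * (q / 4 * t) + 1 <= (4 * \<gamma> / q) * exp (q / 4 * t) + exp (q / 4 * t)" using intensity_pos q_pos by (intro add_mono mult_left_mono) auto
   hence "\<gamma> * t + 1 <= (1 + 4 * \<gamma> / q) * exp (q / 4 * t)" using q_pos by (simp add: algebra_simps)
   hence "(\<gamma> * t + 1) * (2 * exp (q / 4 * t) * z) <= ((1 + 4 * \<gamma> / q) * exp (q / 4 * t)) * (2 * exp (q / 4 * t) * z)" using z by (intro mult_right_mono) auto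
   also have "... = K * (exp (q / 4 * t) * exp (q / 4 * t))" by (simp add: K_def)
   finally show "(\<gamma> * t + 1) * (2 * exp (q / 4 * t) * z) <= K * exp (q / 2 * t)" by (simp add: mult_exp_exp mult.commute)
  qed
  finally show ?thesis by (simp add: mult_left_mono)
 qed
 have m: "(%(t, w). ennreal (Rb x b (max 0 t) w)) \<in> Bor (expo q \<Otimes>\<^sub>M M)"
 proof -
  have "(%(t, w). Rb x b (max 0 t) w) \<in> Bor (borel \<Otimes>\<^sub>M M)" using F_le_M[OF _ Rb_F] cadlag_right[OF Rb_cadlag] by (intro joint_measurable) auto
  thus ?thesis by (simp add: case_prod_unfold)
 qed
 have "(\<integral>\<^sup>+w. (\<integral>\<^sup>+t. ennreal (Rb x b (max 0 t) w) \<partial>expo q) \<partial>M) = (\<integral>\<^sup>+t. (\<integral>\<^sup>+w. ennreal (Rb x b (max 0 t) w) \<partial>M) \<partial>expo q)"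
  using P.Fubini[OF m] by simp
 also have "... <= (\<integral>\<^sup>+t. ennreal (K * exp (q / 2 * t)) \<partial>expo q)"
  using expo_pos[of q] by (intro nn_integral_mono_AE, eventually_elim) (use mean in \<open>simp add: max_def\<close>)
 also have "... < \<infinity>" using expo_exp_integrable(1)[OF q_pos(2,3)] K by (subst nn_integral_eq_integral) auto
 finally show ?thesis .
qed

lemma barrier_strategy: "strategy M F X N \<gamma> lam r \<phi> \<Psi> x (Db x b) (Rb x b)"
proof
 show "Db x b t \<in> Bor (F t)" if "0 <= t" for t by (rule measurable_cong[THEN iffD1, OF _ d_F[OF x b that]]) (simp add: Db_eq[OF x b] space_F[OF that])
 fix w assume w: "w \<in> space M"
 interpret p: barrier_path "surplus x w" "arrivals w" b by (rule barrier_path[OF w x b])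
 note eqs = Db_eq[OF x b w] Rb_eq[OF x b w]
 show "mono_on {0..} (%t. Db x b t w)" "cadlag (%t. Db x b t w)" "Db x b 0 w = 0" unfolding eqs using p.d_mono p.d_cadlag p.d_0 by auto
 show "mono_on {0..} (%t. Rb x b t w)" unfolding eqs injections_eq by (intro cadlag_wsup(2) p.shortfall_cadlag p.d_cadlag)
 show "0 <= Rb x b 0 w" unfolding eqs by (intro p.injections_bounds p.d_cadlag order_refl)
 show "0 <= x + X t w - Db x b t w + Rb x b t w" if "0 <= t" for t using p.injections_bounds(2)[OF p.d_cadlag that] unfolding eqs controlled_def start_at_def .
 show "Db x b s w = Db x b t w" if "0 <= s" "s <= t" "N s w = N t w" for s t unfolding eqs using p.d_idle[OF that] .
qed (use x Rb_F Rb_cadlag Rb_finite in auto)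

text \<open>Both inequalities behind \<open>increment_le\<close> are equalities here: the injections
  are exactly those of reflection, and the payment leaves \<open>min z b\<close>, so that dividend
  plus continuation value is \<open>barrier_op b v z\<close>.\<close>

lemma barrier_value:
 assumes v: "tame \<phi> v" and fp: "!!u. 0 <= u ==> v u = st.stage (barrier_op b v) u"
 shows "J x (Db x b) (Rb x b) = v x"
proof -
 interpret s: strategy M F X N \<gamma> lam r \<phi> \<Psi> x "Db x b" "Rb x b" by (rule barrier_strategy)
 have W: "tame \<phi> (barrier_op b v)" using tame_barrier_op[OF v _ b] cost_gt_1 by simp
 have "J x (Db x b) (Rb x b) = (LINT w|M. s.payoff w)" unfolding J_def s.payoff_def s.G_def s.U_def ..
 also have "... = v x"
 proof (rule s.verification(3)[OF v W fp[symmetric]])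
  fix w assume w: "w \<in> space M"
  interpret p: barrier_path "surplus x w" "arrivals w" b by (rule barrier_path[OF w x b])
  note eqs = Db_eq[OF x b w] Rb_eq[OF x b w]
  show "Rb x b 0 w = 0" unfolding eqs using p.d_0 p.y_0 by (simp add: injections_eq)
  fix n
  define u where "u = s.U (arr n w) w"
  define a where "a = wait (arr n w) w"
  have a: "0 < a" using wait_pos[OF w arr_nonneg[OF w]] by (simp add: a_def)
  have Suc: "arr n w + a = arr (Suc n) w" using arr_Suc[OF w] by (simp add: a_def)
  have u: "controlled (surplus x w) p.d (arr n w) = u" by (simp add: u_def s.U_def eqs controlled_def start_at_def)
  have R: "Rb x b (arr n w + t) w - Rb x b (arr n w) w = max u (Ii (arr n w) t w) - u" if "0 <= t" "t <= a" for t
   using p.barrier_cycle(1)[of t n] that Suc u unfolding eqs by (simp add: arr_def[symmetric] Ii_def Xi_def start_at_def)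
  have U: "s.U (arr n w + t) w = reflected u (XI (arr n w) t w) - (Db x b (arr n w + t) w - Db x b (arr n w) w)" if "0 <= t" "t <= a" for t
   using R[OF that] Ii_upper[OF w arr_nonneg[OF w] that(1) order_refl, of n] by (simp add: reflected_def u_def s.U_def Xi_def)
  have idle: "Db x b (arr n w + t) w = Db x b (arr n w) w" if "0 <= t" "t < a" for t
   using s.D_idle[OF w arr_nonneg[OF w], of n "arr n w + t"] N_arr[OF w, of n] N_idle[OF w, of n "arr n w + t"] Suc that by simp
  define z where "z = reflected u (XI (arr n w) a w)"
  have z: "z = u + Xi (arr n w) a w + (Rb x b (arr n w + a) w - Rb x b (arr n w) w)" using R[of a] Ii_upper[OF w arr_nonneg[OF w] _ order_refl, of a n] a by (simp add: z_def reflected_def)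
  have D: "Db x b (arr n w + a) w - Db x b (arr n w) w = max (z - b) 0" using p.barrier_cycle(2)[of a n] a Suc u unfolding z eqs by (simp add: arr_def[symmetric] Xi_def start_at_def)
  have "(LINT t|expo q. indicator {..<a} t * (lam / q * \<Psi> (max 0 (s.U (arr n w + max 0 t) w)) - \<phi> * (Rb x b (arr n w + max 0 t) w - Rb x b (arr n w) w)))
    = (LINT t|expo q. indicator {..<a} t * flow u (XI (arr n w) (max 0 t) w))" using a by (intro Bochner_Integration.integral_cong refl) (auto simp: indicator_def lump_def R U idle reflected_def)
  moreover have "Db x b (arr n w + a) w - Db x b (arr n w) w - \<phi> * (Rb x b (arr n w + a) w - Rb x b (arr n w) w) + v (s.U (arr n w + a) w)
    = lump (barrier_op b v) u (XI (arr n w) a w)"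
  proof -
   have "s.U (arr n w + a) w = min z b" using U[of a] a D by (simp add: z_def[symmetric])
   thus ?thesis unfolding D R[OF less_imp_le[OF a] order_refl] by (simp add: lump_def z_def[symmetric] barrier_op_def max.commute)
  qed
  ultimately show "s.increment v (arr n w) w = H (barrier_op b v) (arr n w) (s.U (arr n w) w) w" unfolding s.increment_def H_def a_def[symmetric] u_def[symmetric] by simp
 qed
 finally show ?thesis .
qed

end

end

section \<open>Stieltjes integrals\<close>

locale increasing_path =
 fixes f :: "real => real"
 assumes f_mono: "mono_on {0..} f" and f_cadlag: "cadlag f" and f_0: "0 <= f 0"
begin

lemma f_nonneg: "0 <= t ==> 0 <= f t" using mono_onD[OF f_mono, of 0 t] f_0 by simp

lemma ext_mono: "a <= b ==> zero_ext f a <= zero_ext f b" using mono_onD[OF f_mono, of a b] f_nonneg[of b] by (auto simp: zero_ext_def)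

lemma ext_right: "continuous (at_right a) (zero_ext f)"
proof (cases "0 <= a")
 case True
 have "(f ---> zero_ext f a) (at_right a)" using cadlag_right[OF f_cadlag True] True by (simp add: zero_ext_def)
 hence "(zero_ext f ---> zero_ext f a) (at_right a)" by (rule Lim_transform_eventually) (use eventually_at_right_less[of a] in eventually_elim, use True in \<open>auto simp: zero_ext_def\<close>)
 thus ?thesis by (simp add: continuous_within)
next
 case False
 hence "a < 0" by simp
 from eventually_at_right_real[OF this]
 have "(zero_ext f ---> zero_ext f a) (at_right a)" using False by (intro tendsto_eventually) (auto elim!: eventually_mono simp: zero_ext_def)
 thus ?thesis by (simp add: continuous_within)
qed

abbreviation \<mu> where "\<mu> \<equiv> stieltjes_measure f"

lemma sets_\<mu> [simp, measurable_cong]: "sets \<mu> = sets borel" by (simp add: stieltjes_measure_def)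

lemma Ioc: "a <= b ==> emeasure \<mu> {a<..b} = ennreal (zero_ext f b - zero_ext f a)" unfolding stieltjes_measure_def by (rule emeasure_interval_measure_Ioc[OF _ ext_mono ext_right])

text \<open>The right end is excluded because the path may jump there; the open interval is
  exhausted by half-open ones, whose measure is explicit.\<close>

lemma Ioo_null:
 assumes "!!t. a <= t ==> t < b ==> zero_ext f t = zero_ext f a"
 shows "{a<..<b} \<in> null_sets \<mu>"
proof -
 have "{a<..b - 1 / real (Suc n)} \<in> null_sets \<mu>" for n
 proof (cases "a <= b - 1 / real (Suc n)")
  case True
  thus ?thesis using Ioc[OF True] assms[OF True] by (simp add: null_sets_def)
 qed simp
 hence "(\<Union>n. {a<..b - 1 / real (Suc n)}) \<in> null_sets \<mu>" by (rule null_sets_UN)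
 moreover have "{a<..<b} <= (\<Union>n. {a<..b - 1 / real (Suc n)})"
 proof
  fix t assume t: "t \<in> {a<..<b}"
  then obtain n where "inverse (real (Suc n)) < b - t" using reals_Archimedean[of "b - t"] by auto
  thus "t \<in> (\<Union>n. {a<..b - 1 / real (Suc n)})" using t by (auto simp: inverse_eq_divide intro!: exI[of _ n])
 qed
 ultimately show ?thesis using null_sets_subset[of _ \<mu> "{a<..<b}"] by simp
qed

lemma AE_nonneg: "AE t in \<mu>. 0 <= t"
proof (rule AE_I')
 have "(\<Union>n::nat. {- real n<..<0}) \<in> null_sets \<mu>" by (intro null_sets_UN Ioo_null) (auto simp: zero_ext_def)
 moreover have "{..<0::real} <= (\<Union>n::nat. {- real n<..<0})"
 proof
  fix t :: real assume "t \<in> {..<0}"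
  moreover obtain n where "- t < real n" using reals_Archimedean2 by blast
  ultimately show "t \<in> (\<Union>n::nat. {- real n<..<0})" by (auto intro!: exI[of _ n])
 qed
 ultimately show "{..<0} \<in> null_sets \<mu>" using null_sets_subset[of _ \<mu> "{..<0}"] by simp
qed auto

lemma Icc: "0 <= b ==> emeasure \<mu> {0..b} = ennreal (f b)"
proof -
 assume b: "0 <= b"
 have "emeasure \<mu> {0..b} = emeasure \<mu> {- 1<..b}" using AE_nonneg by (intro emeasure_eq_AE) (auto elim!: eventually_mono)
 thus ?thesis using Ioc[of "- 1" b] b by (simp add: zero_ext_def)
qed

text \<open>\<open>exp (- l * t)\<close> is the probability that an exponential clock exceeds
  \<open>t\<close>. Exchanging the integrals turns the discounted measure of \<open>A\<close> into
  the mean of the measure of \<open>A\<close> up to the clock.\<close>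

lemma discounted_measure:
 assumes l: "0 < l" and A: "A \<in> sets borel"
 shows "(\<integral>\<^sup>+t\<in>A. ennreal (exp (- l * t)) \<partial>\<mu>) = (\<integral>\<^sup>+v. emeasure \<mu> (A Int {..v}) \<partial>expo l)"
proof -
 interpret E: prob_space "expo l" by (rule prob_space_expo[OF l])
 interpret m: sigma_finite_measure \<mu> unfolding stieltjes_measure_def by (rule sigma_finite_interval_measure[OF ext_mono ext_right])
 interpret P: pair_sigma_finite \<mu> "expo l" ..
 have disc: "(\<integral>\<^sup>+v. indicator {t..} v \<partial>expo l) = ennreal (exp (- l * t))" if "0 <= t" for t
  using expo_shift[OF l that, of "%_. 1"] E.prob_space by (simp add: E.emeasure_eq_measure)
 have "(\<integral>\<^sup>+t\<in>A. ennreal (exp (- l * t)) \<partial>\<mu>) = (\<integral>\<^sup>+t. (\<integral>\<^sup>+v. indicator (A Int {..v}) t \<partial>expo l) \<partial>\<mu>)"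
 proof (rule nn_integral_cong_AE)
  show "AE t in \<mu>. ennreal (exp (- l * t)) * indicator A t = (\<integral>\<^sup>+v. indicator (A Int {..v}) t \<partial>expo l)" using AE_nonneg
  proof eventually_elim
   case (elim t)
   have "(\<integral>\<^sup>+v. indicator (A Int {..v}) t \<partial>expo l) = (\<integral>\<^sup>+v. indicator A t * indicator {t..} v \<partial>expo l)"
    by (intro nn_integral_cong) (auto simp: indicator_def)
   also have "... = indicator A t * (\<integral>\<^sup>+v. indicator {t..} v \<partial>expo l)" by (rule nn_integral_cmult) simp
   finally show ?case using disc[OF elim] by (simp add: mult.commute)
  qed
 qed
 also have "... = (\<integral>\<^sup>+v. (\<integral>\<^sup>+t. indicator (A Int {..v}) t \<partial>\<mu>) \<partial>expo l)"
 proof (rule P.Fubini'[symmetric])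
  have "(%(t, v). indicator A t * (if t <= v then 1 else 0) :: ennreal) \<in> Bor (\<mu> \<Otimes>\<^sub>M expo l)" using A by measurable
  thus "(%(t, v). indicator (A Int {..v}) t :: ennreal) \<in> Bor (\<mu> \<Otimes>\<^sub>M expo l)" by (rule measurable_cong[THEN iffD1, rotated]) (auto simp: indicator_def)
 qed
 finally show ?thesis using A by simp
qed

lemma discounted_total:
 assumes l: "0 < l"
 shows "(\<integral>\<^sup>+t\<in>{0..}. ennreal (exp (- l * t)) \<partial>\<mu>) = (\<integral>\<^sup>+v. ennreal (f (max 0 v)) \<partial>expo l)"
proof -
 have eq: "{0..} Int {..v} = {0..v}" for v :: real by auto
 show ?thesis unfolding discounted_measure[OF l borel_closed[OF closed_real_atLeast]] eq
  by (rule nn_integral_cong_AE) (use expo_pos[of l] in \<open>eventually_elim, use Icc in \<open>simp add: max_def\<close>\<close>)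
qed

lemma discounted_upto:
 assumes l: "0 < l" and T: "0 <= T"
 shows "(LINT t:{0..T}|\<mu>. exp (- l * t)) = (LINT v|expo l. f (max 0 (min v T)))"
proof -
 have m: "(%v. f (max 0 (min v T))) \<in> Bor (expo l)" using measurable_compose[OF _ cadlag_measurable[OF f_cadlag], of "%v. min v T"] by simp
 have "(LINT t:{0..T}|\<mu>. exp (- l * t)) = enn2real (\<integral>\<^sup>+t\<in>{0..T}. ennreal (exp (- l * t)) \<partial>\<mu>)" unfolding set_lebesgue_integral_def
  by (subst integral_eq_nn_integral) (auto intro!: arg_cong[where f = enn2real] nn_integral_cong simp: indicator_def)
 also have "(\<integral>\<^sup>+t\<in>{0..T}. ennreal (exp (- l * t)) \<partial>\<mu>) = (\<integral>\<^sup>+v. ennreal (f (max 0 (min v T))) \<partial>expo l)"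
  unfolding discounted_measure[OF l borel_closed[OF closed_real_atLeastAtMost]]
 proof (rule nn_integral_cong_AE)
  have eq: "{0..T} Int {..v} = {0..min v T}" for v :: real by auto
  show "AE v in expo l. emeasure \<mu> ({0..T} Int {..v}) = ennreal (f (max 0 (min v T)))" using expo_pos[of l] by eventually_elim (use Icc T in \<open>simp add: eq max_absorb2 min.commute\<close>)
 qed
 also have "enn2real ... = (LINT v|expo l. f (max 0 (min v T)))" using m f_nonneg by (intro integral_eq_nn_integral[symmetric]) auto
 finally show ?thesis .
qed

lemma left_lim_exists: "0 <= t ==> (zero_ext f ---> left_lim f t) (at_left t)"
proof -
 assume t: "0 <= t"
 have "EX l. (zero_ext f ---> l) (at_left t)"
 proof (cases "t = 0")
  case True
  have "(zero_ext f ---> 0) (at_left t)" by (rule tendsto_eventually) (auto simp: eventually_at_filter zero_ext_def True)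
  thus ?thesis by blast
 next
  case False
  hence "0 < t" using t by simp
  then obtain l where l: "(f ---> l) (at_left t)" using cadlag_left[OF f_cadlag] by blast
  have "(zero_ext f ---> l) (at_left t)"
   by (rule Lim_transform_eventually[OF l]) (use eventually_at_left_real[OF \<open>0 < t\<close>] in \<open>auto elim!: eventually_mono simp: zero_ext_def\<close>)
  thus ?thesis by blast
 qed
 thus ?thesis unfolding left_lim_def using tendsto_Lim[of "at_left t"] trivial_limit_at_left_real by metis
qed

lemma jump_measurable: "(%s. indicator {0..t} s * jump f s) \<in> Bor borel"
proof -
 have m: "zero_ext f \<in> Bor borel" by (rule borel_measurable_mono) (auto simp: mono_def ext_mono)
 have "(%s. indicator {0..t} s * (zero_ext f s - left_lim f s)) \<in> Bor borel"
 proof (rule borel_measurable_LIMSEQ_real)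
  fix s :: real
  show "(%n. indicator {0..t} s * (zero_ext f s - zero_ext f (s - 1 / real (Suc n)))) ----> indicator {0..t} s * (zero_ext f s - left_lim f s)"
  proof (cases "0 <= s")
   case True
   have "filterlim (%n. s - 1 / real (Suc n)) (at_left s) sequentially" unfolding filterlim_at using tendsto_diff[OF tendsto_const[of s] LIMSEQ_Suc[OF lim_1_over_n]] by simp
   from filterlim_compose[OF left_lim_exists[OF True] this] show ?thesis by (intro tendsto_intros)
  qed simp
 qed (use m in measurable)
 thus ?thesis by (rule measurable_cong[THEN iffD1, rotated]) (auto simp: jump_def zero_ext_def indicator_def)
qed

end

locale counting_path =
 fixes m :: "real => nat"
 assumes m_mono: "mono_on {0..} m" and m_cadlag: "cadlag (%t. real (m t))" and m_0: "m 0 = 0"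
  and m_unbounded: "!!n. EX t>=0. n <= m t" and m_simple: "!!n. m (arrival_time m n) = n"
begin

sublocale c: increasing_path "%t. real (m t)" by standard (use m_mono m_cadlag in \<open>auto simp: monotone_on_def\<close>)

abbreviation T where "T \<equiv> arrival_time m"

lemma T_le: "0 <= t ==> T n <= t <-> n <= m t" by (rule arrival_time_le_iff[OF m_mono m_cadlag m_unbounded])

lemma T_nonneg: "0 <= T n" unfolding arrival_time_def using m_unbounded[of n] by (intro cInf_greatest) auto

lemma T_0: "T 0 = 0" using T_le[of 0 0] T_nonneg[of 0] by simp

lemma T_less: "T n < T (Suc n)" using T_le[OF T_nonneg, of "Suc n" n] m_simple[of n] by auto

lemma idle_null:
 assumes "0 <= s" "s <= t" "m s = m t" shows "{s<..t} \<in> null_sets c.\<mu>" using c.Ioc[OF assms(2)] assms by (auto simp: null_sets_def zero_ext_def)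

lemma zero_null: "AE s in c.\<mu>. s ~= 0"
proof (rule AE_I')
 show "{0} \<in> null_sets c.\<mu>" using c.Icc[of 0] m_0 by (simp add: null_sets_def)
qed auto

lemma gap_null: "AE s in c.\<mu>. ~ (T n < s & s < T (Suc n))"
proof (rule AE_I')
 have *: "m t = n" if "T n <= t" "t < T (Suc n)" for t using T_le[of t n] T_le[of t "Suc n"] T_nonneg[of n] that by linarith
 show "{T n<..<T (Suc n)} \<in> null_sets c.\<mu>" by (rule c.Ioo_null) (use * m_simple[of n] T_nonneg[of n] in \<open>auto simp: zero_ext_def\<close>)
qed auto

lemma atom: "measure c.\<mu> {T (Suc n)} = 1"
proof -
 have "emeasure c.\<mu> {T (Suc n)} = emeasure c.\<mu> {T n<..T (Suc n)}" using gap_null[of n] T_less[of n] by (intro emeasure_eq_AE) (auto elim!: eventually_mono)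
 also have "... = 1" using c.Ioc[of "T n" "T (Suc n)"] T_less[of n] T_nonneg[of n] T_nonneg[of "Suc n"] by (simp add: zero_ext_def m_simple)
 finally show ?thesis by (simp add: measure_def)
qed

text \<open>The measure of a counting path charges neither time 0 nor an interval on which the path
  is constant, so an integral against it cannot change there.\<close>

lemma stieltjes_idle:
 assumes D: "increasing_path D" and eq: "!!t. 0 <= t ==> D t = (LINT s:{0..t}|c.\<mu>. jump D s)"
 shows "D 0 = 0" "0 <= s ==> s <= t ==> m s = m t ==> D s = D t"
proof -
 have jm: "(%s. indicator {0..t} s *\<^sub>R jump D s) \<in> Bor c.\<mu>" for t using increasing_path.jump_measurable[OF D, of t] by simp
 have "D 0 = (LINT s|c.\<mu>. 0)" unfolding eq[OF order_refl] set_lebesgue_integral_def by (intro integral_cong_AE jm eventually_mono[OF zero_null]) (auto simp: indicator_def)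
 thus "D 0 = 0" by simp
 assume st: "0 <= s" "s <= t" "m s = m t"
 have "D t = (LINT u:{0..s}|c.\<mu>. jump D u)" unfolding eq[OF order_trans[OF st(1,2)]] set_lebesgue_integral_def
  by (intro integral_cong_AE jm eventually_mono[OF AE_not_in[OF idle_null[OF st]]]) (use st in \<open>auto simp: indicator_def\<close>)
 thus "D s = D t" using eq[OF st(1)] by simp
qed

text \<open>Up to a null set the measure lives on the arrivals, each an atom of mass 1, so the
  integral is the sum of the jumps of \<open>D\<close> there. Idleness makes each jump the increment
  over a whole stage, and the sum telescopes.\<close>

lemma idle_stieltjes:
 assumes D: "increasing_path D" and D0: "D 0 = 0" and idle: "!!s t. 0 <= s ==> s <= t ==> m s = m t ==> D s = D t" and t: "0 <= t"
 shows "D t = (LINT s:{0..t}|c.\<mu>. jump D s)"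
proof -
 have jm: "(%s. indicator {0..t} s *\<^sub>R jump D s) \<in> Bor c.\<mu>" using increasing_path.jump_measurable[OF D, of t] by simp
 have fin: "integrable c.\<mu> (%s. indicator {T (Suc n)} s *\<^sub>R a)" for n and a :: real
 proof -
  have "emeasure c.\<mu> {T (Suc n)} < \<infinity>" using atom[of n] by (auto simp: measure_def less_top dest: enn2real_eq_0_iff[THEN iffD2, OF disjI2])
  thus ?thesis by (intro integrable_scaleR_left integrable_real_indicator) auto
 qed
 have "AE s in c.\<mu>. ALL n. ~ (T n < s & s < T (Suc n))" using gap_null by (simp add: AE_all_countable)
 hence "(LINT s:{0..t}|c.\<mu>. jump D s) = (LINT s|c.\<mu>. (\<Sum>n<m t. indicator {T (Suc n)} s *\<^sub>R jump D (T (Suc n))))" unfolding set_lebesgue_integral_def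
 proof (intro integral_cong_AE jm)
  assume "AE s in c.\<mu>. ALL n. ~ (T n < s & s < T (Suc n))"
  thus "AE s in c.\<mu>. indicator {0..t} s *\<^sub>R jump D s = (\<Sum>n<m t. indicator {T (Suc n)} s *\<^sub>R jump D (T (Suc n)))" using zero_null
  proof eventually_elim
   case (elim s)
   show ?case
   proof (cases "0 <= s & s <= t")
    case True
    have "T (m s) <= s" "s < T (Suc (m s))" using T_le[of s "m s"] T_le[of s "Suc (m s)"] True by auto
    hence s: "s = T (m s)" using elim(1) by (metis order_le_less)
    then obtain k where k: "m s = Suc k" using elim(2) T_0 by (metis not0_implies_Suc)
    have le: "m s <= m t" using T_le[of t "m s"] s True by auto
    have "(\<Sum>n<m t. indicator {T (Suc n)} s *\<^sub>R jump D (T (Suc n))) = (\<Sum>n<m t. if n = k then jump D s else 0)"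
    proof (rule sum.cong[OF refl])
     fix n
     have "s = T (Suc n) <-> n = k" by (metis s k m_simple nat.inject)
     thus "indicator {T (Suc n)} s *\<^sub>R jump D (T (Suc n)) = (if n = k then jump D s else 0)" by (cases "n = k") (simp_all add: indicator_def)
    qed
    thus ?thesis using True k le by (simp add: Suc_le_eq)
   next
    case False
    have "s ~= T (Suc n)" if "n < m t" for n using T_le[OF t, of "Suc n"] T_nonneg[of "Suc n"] that False by auto
    thus ?thesis using False by (auto simp: indicator_def)
   qed
  qed
 qed (intro borel_measurable_sum borel_measurable_scaleR borel_measurable_indicator borel_measurable_const, simp)
 also have "... = (\<Sum>n<m t. jump D (T (Suc n)))" using fin by (subst Bochner_Integration.integral_sum) (auto simp: atom)
 also have "... = (\<Sum>n<m t. D (T (Suc n)) - D (T n))"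
 proof (rule sum.cong[OF refl])
  fix n
  have "D (T n) = D s" if "s \<in> {T n<..<T (Suc n)}" for s
  proof -
   have "m s = n" using T_le[of s n] T_le[of s "Suc n"] T_nonneg[of n] that by auto
   thus ?thesis using idle[OF T_nonneg[of n], of s] that m_simple[of n] by simp
  qed
  hence "eventually (%s. D (T n) = D s) (at_left (T (Suc n)))" using eventually_at_left_real[OF T_less[of n]] by (rule eventually_mono[rotated])
  hence "(D ---> D (T n)) (at_left (T (Suc n)))" by (rule Lim_transform_eventually[OF tendsto_const])
  thus "jump D (T (Suc n)) = D (T (Suc n)) - D (T n)" using left_lim_eq[of "T (Suc n)"] T_less[of n] T_nonneg[of n] by (simp add: jump_def)
 qed
 also have "... = D (T (m t)) - D (T 0)" by (rule sum_lessThan_telescope)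
 also have "... = D t" using idle[of "T (m t)" t] T_le[OF t, of "m t"] T_nonneg m_simple t by (simp add: T_0 D0)
 finally show ?thesis by simp
qed

end

lemma regular_counting_path: "regular_model M F X N \<gamma> ==> w \<in> space M ==> counting_path (%t. N t w)"
 by (simp add: counting_path_def regular_model.N_mono regular_model.N_cadlag regular_model.N_0 regular_model.N_unbounded regular_model.N_simple)

section \<open>Regular versions\<close>

context prob_space
begin

text \<open>Agreement up to null sets is preserved by complements and countable unions. This carries
  independence from the given processes to their regular versions.\<close>

lemma sigma_sets_AE:
 assumes G: "!!g. g \<in> G' ==> \<exists>g0\<in>sigma_sets (space M) G. AE w in M. w \<in> g <-> w \<in> g0" and a: "a \<in> sigma_sets (space M) G'"
 shows "\<exists>a0\<in>sigma_sets (space M) G. AE w in M. w \<in> a <-> w \<in> a0" using a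
proof induction
 case (Compl a)
 then obtain a0 where "a0 \<in> sigma_sets (space M) G" "AE w in M. w \<in> a <-> w \<in> a0" by blast
 thus ?case by (intro bexI[of _ "space M - a0"] sigma_sets.Compl) auto
next
 case (Union a)
 hence "ALL i. EX a0. a0 \<in> sigma_sets (space M) G & (AE w in M. w \<in> a i <-> w \<in> a0)" by blast
 then obtain a0 where a0: "!!i. a0 i \<in> sigma_sets (space M) G" "!!i. AE w in M. w \<in> a i <-> w \<in> a0 i" by metis
 hence "AE w in M. ALL i. w \<in> a i <-> w \<in> a0 i" by (simp add: AE_all_countable)
 thus ?case by (intro bexI[of _ "\<Union>i. a0 i"] sigma_sets.Union a0) auto
qed (use G in \<open>auto intro: sigma_sets.Empty\<close>)

lemma events_of_AE:
 assumes "!!t. t \<in> I ==> AE w in M. Y' t w = Y t w" "a \<in> events_of M Y' I"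
 shows "\<exists>a0\<in>events_of M Y I. AE w in M. w \<in> a <-> w \<in> a0" using assms(2) unfolding events_of_def
proof (rule sigma_sets_AE[rotated])
 fix g assume "g \<in> {Y' t -` A Int space M |t A. t \<in> I & A \<in> sets borel}"
 then obtain t A where g: "g = Y' t -` A Int space M" "t \<in> I" "A \<in> sets borel" by blast
 have "AE w in M. w \<in> g <-> w \<in> Y t -` A Int space M" using assms(1)[OF g(2)] by eventually_elim (auto simp: g)
 thus "\<exists>g0\<in>sigma_sets (space M) {Y t -` A Int space M |t A. t \<in> I & A \<in> sets borel}. AE w in M. w \<in> g <-> w \<in> g0"
  using g by (intro bexI[of _ "Y t -` A Int space M"] sigma_sets.Basic) auto
qed

lemma indep_set_AE:
 assumes ind: "indep_set A B" and "A' <= events" "B' <= events"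
  and A: "!!a. a \<in> A' ==> \<exists>a0\<in>A. AE w in M. w \<in> a <-> w \<in> a0" and B: "!!b. b \<in> B' ==> \<exists>b0\<in>B. AE w in M. w \<in> b <-> w \<in> b0"
 shows "indep_set A' B'"
proof (rule indep_setI[OF assms(2,3)])
 fix a b assume ab: "a \<in> A'" "b \<in> B'"
 obtain a0 where a0: "a0 \<in> A" "AE w in M. w \<in> a <-> w \<in> a0" using A[OF ab(1)] by blast
 obtain b0 where b0: "b0 \<in> B" "AE w in M. w \<in> b <-> w \<in> b0" using B[OF ab(2)] by blast
 have ev: "a \<in> events" "b \<in> events" "a0 \<in> events" "b0 \<in> events" using ab a0 b0 assms(2,3) indep_setD_ev1[OF ind] indep_setD_ev2[OF ind] by auto
 have "prob (a Int b) = prob (a0 Int b0)" using a0(2) b0(2) ev by (intro finite_measure_eq_AE) (auto elim: eventually_elim2)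
 also have "... = prob a0 * prob b0" using indep_setD[OF ind a0(1) b0(1)] .
 also have "prob a0 = prob a" using a0(2) ev by (intro finite_measure_eq_AE) (auto elim!: eventually_mono)
 also have "prob b0 = prob b" using b0(2) ev by (intro finite_measure_eq_AE) (auto elim!: eventually_mono)
 finally show "prob (a Int b) = prob a * prob b" .
qed

text \<open>The exceptional set lies in every \<open>A j\<close>, so vanishing probabilities
  suffice, without summability.\<close>

lemma AE_exists_not:
 assumes A: "!!j::nat. A j \<in> events" "!!j. prob (A j) <= a j" and a: "a ----> 0"
 shows "AE w in M. EX j. w \<notin> A j"
proof -
 have "prob (\<Inter>j. A j) <= prob (A j)" for j using A(1) by (intro finite_measure_mono) auto
 hence "prob (\<Inter>j. A j) <= 0" using A(2) by (intro LIMSEQ_le_const[OF a]) (meson order_trans)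
 hence "(\<Inter>j. A j) \<in> null_sets M" using A(1) by (simp add: emeasure_eq_measure null_sets_def measure_le_0_iff sets.countable_INT)
 from AE_not_in[OF this] show ?thesis by simp
qed

end

lemma nat_right_const:
 fixes m :: "real => nat"
 assumes "cadlag (%t. real (m t))" "0 <= t" shows "eventually (%u. m u = m t) (at_right t)"
proof -
 have "((%u. real (m u)) ---> real (m t)) (at_right t)" by (rule cadlag_right[OF assms])
 from tendstoD[OF this, of 1] show ?thesis by (auto elim!: eventually_mono simp: dist_real_def)
qed

text \<open>A right-continuous integer path is constant just after each time, so each of its values
  is taken again at a slightly later rational time.\<close>

lemma mono_from_rationals:
 fixes m :: "real => nat"
 assumes c: "cadlag (%t. real (m t))" and rat: "!!s t. s \<in> \<rat> ==> t \<in> \<rat> ==> 0 <= s ==> s <= t ==> m s <= m t"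
 shows "mono_on {0..} m"
proof (rule mono_onI)
 fix s t :: real assume st: "s \<in> {0..}" "t \<in> {0..}" "s <= t"
 have right: "\<exists>u\<in>\<rat>. v < u & u < k & m u = m v" if "0 <= v" "v < k" for v k
 proof -
  have "eventually (%u. m u = m v & u < k) (at_right v)" using nat_right_const[OF c that(1)] eventually_at_right_real[OF that(2)] by eventually_elim auto
  then obtain d where d: "v < d" "!!u. v < u ==> u < d ==> m u = m v & u < k" unfolding eventually_at_right_field by blast
  obtain u where "u \<in> \<rat>" "v < u" "u < d" using Rats_dense_in_real[OF d(1)] by blast
  thus ?thesis using d(2) by blast
 qed
 show "m s <= m t"
 proof (cases "s = t")
  case False
  obtain u where u: "u \<in> \<rat>" "s < u" "u < t" "m u = m s" using right[of s t] st False by auto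
  obtain v where v: "v \<in> \<rat>" "t < v" "m v = m t" using right[of t "t + 1"] st by auto
  show ?thesis using rat[OF u(1) v(1)] u v st by auto
 qed simp
qed

text \<open>If two or more counts arrived at once at \<open>t\<close>, the dyadic cell containing
  \<open>t\<close> would have an increment of at least 2 at every level, against \<open>dy\<close>
  for a horizon beyond \<open>t\<close>.\<close>

lemma simple_from_dyadics:
 fixes m :: "real => nat"
 assumes c: "cadlag (%t. real (m t))" and mono: "mono_on {0..} m" and m0: "m 0 = 0" and unb: "!!n. EX t>=0. n <= m t"
  and dy: "!!K::nat. \<exists>j::nat. ALL i<K * 2 ^ j. m ((real i + 1) / 2 ^ j) <= m (real i / 2 ^ j) + 1"
 shows "m (arrival_time m n) = n"
proof -
 define t where "t = arrival_time m n"
 have T: "t <= s <-> n <= m s" if "0 <= s" for s unfolding t_def by (rule arrival_time_le_iff[OF mono c unb that])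
 have t0: "0 <= t" unfolding t_def arrival_time_def using unb[of n] by (intro cInf_greatest) auto
 have ge: "n <= m t" using T[OF t0] by simp
 have "m t <= n"
 proof (rule ccontr)
  assume "~ m t <= n"
  hence lt: "n < m t" by simp
  hence tpos: "0 < t" using t0 m0 by (cases "t = 0") auto
  obtain K :: nat where K: "t < real K" using reals_Archimedean2 by blast
  obtain j where j: "!!i. i < K * 2 ^ j ==> m ((real i + 1) / 2 ^ j) <= m (real i / 2 ^ j) + 1" using dy[of K] by blast
  \<comment> \<open>The cells are open on the left and closed on the right, hence the ceiling minus
    one: the left end lies strictly before \<open>t\<close>, where the count is still below
    \<open>n\<close>.\<close>
  define i where "i = nat (\<lceil>t * 2 ^ j\<rceil> - 1)"
  have pos: "0 < t * 2 ^ j" using tpos by simp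
  hence i: "real i < t * 2 ^ j" "t * 2 ^ j <= real i + 1" unfolding i_def by linarith+
  have "real i < real K * 2 ^ j" using i(1) K by (meson less_trans mult_strict_right_mono zero_less_numeral zero_less_power)
  hence "real i < real (K * 2 ^ j)" by simp
  hence "i < K * 2 ^ j" by (simp only: of_nat_less_iff)
  note le = j[OF this]
  have "real i / 2 ^ j < t" "t <= (real i + 1) / 2 ^ j" using i by (auto simp: field_simps)
  hence "m (real i / 2 ^ j) < n" "m t <= m ((real i + 1) / 2 ^ j)" using T[of "real i / 2 ^ j"] mono_onD[OF mono, of t "(real i + 1) / 2 ^ j"] t0 by auto
  thus False using le lt by simp
 qed
 thus ?thesis using ge by (simp add: t_def)
qed

text \<open>Quadratic smallness beats the number of cells, which grows like the inverse of their
  length.\<close>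

lemma poisson_ge_2:
 assumes l: "0 < l" shows "measure_pmf.prob (poisson_pmf l) {n. 2 <= n} <= l\<^sup>2"
proof -
 have "{n::nat. 2 <= n} = UNIV - {0, 1}" by auto
 hence "measure_pmf.prob (poisson_pmf l) {n. 2 <= n} = 1 - measure_pmf.prob (poisson_pmf l) {0, 1}" using measure_pmf.prob_compl[of "{0, 1}" "poisson_pmf l"] by simp
 also have "measure_pmf.prob (poisson_pmf l) {0, 1} = exp (- l) * (1 + l)" using l by (simp add: measure_measure_pmf_finite algebra_simps)
 also have "(1 - l) * (1 + l) <= exp (- l) * (1 + l)" using l exp_ge_add_one_self[of "- l"] by (intro mult_right_mono) auto
 hence "1 - exp (- l) * (1 + l) <= l\<^sup>2" by (simp add: algebra_simps power2_eq_square)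
 finally show ?thesis .
qed

lemma poisson_less_limit:
 assumes g: "0 < g" shows "(%i. measure_pmf.prob (poisson_pmf (g * real (Suc i))) {k. k < n}) ----> 0"
proof -
 have top: "filterlim (%i. g * real (Suc i)) at_top sequentially" by (intro filterlim_tendsto_pos_mult_at_top[OF tendsto_const g] filterlim_compose[OF filterlim_real_sequentially filterlim_Suc])
 have "(%i. \<Sum>k<n. (1 / fact k) * ((g * real (Suc i)) ^ k / exp (g * real (Suc i)))) ----> (\<Sum>k<n. (1 / fact k) * 0)"
  by (intro tendsto_intros filterlim_compose[OF tendsto_power_div_exp_0 top])
 moreover have "measure_pmf.prob (poisson_pmf (g * real (Suc i))) {k. k < n} = (\<Sum>k<n. (1 / fact k) * ((g * real (Suc i)) ^ k / exp (g * real (Suc i))))" for i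
 proof -
  have "0 < g * real (Suc i)" using g by simp
  note [simp] = pmf_poisson[OF this]
  show ?thesis by (subst measure_measure_pmf_finite) (auto simp: lessThan_def[symmetric] exp_minus field_simps intro!: sum.cong simp del: of_nat_Suc)
 qed
 ultimately show ?thesis by simp
qed

lemma poisson_mean:
 assumes l: "0 < l" shows "(\<integral>\<^sup>+n. ennreal (real n) \<partial>measure_pmf (poisson_pmf l)) = ennreal l"
proof -
 have 1: "(%n. (l ^ n /\<^sub>R fact n) * (l * exp (- l))) sums (exp l * (l * exp (- l)))" by (intro sums_mult2 exp_converges)
 have 2: "(l ^ n /\<^sub>R fact n) * (l * exp (- l)) = pmf (poisson_pmf l) (Suc n) * real (Suc n)" for n using l by (simp add: field_simps del: of_nat_Suc)
 have 3: "exp l * (l * exp (- l)) = l" by (simp add: exp_minus)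
 from 1 have "(%n. pmf (poisson_pmf l) (Suc n) * real (Suc n)) sums l" unfolding 2 3 .
 hence "(%n. pmf (poisson_pmf l) n * real n) sums l" by (subst (asm) sums_Suc_iff) simp
 hence "(\<Sum>n. ennreal (pmf (poisson_pmf l) n * real n)) = ennreal l" by (intro suminf_ennreal_eq) auto
 thus ?thesis by (simp add: nn_integral_measure_pmf nn_integral_count_space_nat ennreal_mult)
qed

text \<open>A concrete counting path with unit jumps at the positive integers; it replaces
  \<open>N\<close> on the exceptional set.\<close>

lemma floor_path:
 "cadlag (%t. real (nat \<lfloor>t\<rfloor>))" "mono_on {0..} (%t::real. nat \<lfloor>t\<rfloor>)" "arrival_time (%t. nat \<lfloor>t\<rfloor>) n = real n"
proof -
 show m: "mono_on {0..} (%t::real. nat \<lfloor>t\<rfloor>)" by (auto intro!: mono_onI nat_mono floor_mono)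
 show "cadlag (%t. real (nat \<lfloor>t\<rfloor>))"
 proof (rule mono_cadlag)
  fix t :: real assume t: "0 <= t"
  have "t < real_of_int \<lfloor>t\<rfloor> + 1" by linarith
  from eventually_at_right_real[OF this] have "eventually (%u. real (nat \<lfloor>t\<rfloor>) = real (nat \<lfloor>u\<rfloor>)) (at_right t)"
  proof eventually_elim
   case (elim u)
   hence "\<lfloor>u\<rfloor> = \<lfloor>t\<rfloor>" by (intro floor_unique) (auto, linarith)
   thus ?case by simp
  qed
  thus "((%t. real (nat \<lfloor>t\<rfloor>)) ---> real (nat \<lfloor>t\<rfloor>)) (at_right t)" by (rule Lim_transform_eventually[OF tendsto_const])
 qed (auto intro!: mono_onI floor_mono)
 have "{t::real. 0 <= t & n <= nat \<lfloor>t\<rfloor>} = {real n..}" by (auto simp: le_nat_iff le_floor_iff)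
 thus "arrival_time (%t. nat \<lfloor>t\<rfloor>) n = real n" by (simp add: arrival_time_def)
qed

context levy_dividend_model
begin

lemmas filtration' = filtration[unfolded usual_filtration_def]
lemmas F_sub = filtration'[THEN conjunct1, rule_format]
lemmas F_mono = filtration'[THEN conjunct2, THEN conjunct1, rule_format]
lemmas M_complete = filtration'[THEN conjunct2, THEN conjunct2, THEN conjunct2, THEN conjunct1]

lemma null_F: "0 <= t ==> null_sets M <= sets (F t)" by (rule order_trans[OF filtration'[THEN conjunct2, THEN conjunct2, THEN conjunct2, THEN conjunct2] F_mono]) auto

lemma space_F: "0 <= t ==> space (F t) = space M" using F_sub[of t] by (simp add: subalgebra_def)

text \<open>Completeness makes every subset of a null set an event, and all null sets belong to
  \<open>F 0\<close>; so changing a variable on a null set keeps it adapted.\<close>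

lemma modify_measurable:
 assumes Z: "Z \<in> Bor (F t)" and t: "0 <= t" and B: "B \<in> null_sets M" and eq: "!!w. w \<in> space M - B ==> Z' w = (Z w :: real)"
 shows "Z' \<in> Bor (F t)"
proof (rule measurableI)
 fix A :: "real set" assume A: "A \<in> sets borel"
 have BF: "B \<in> sets (F t)" by (rule subsetD[OF null_F[OF t] B])
 have "Z' -` A Int B \<in> null_sets M" by (rule complete_measure.complete2[OF M_complete _ B]) simp
 hence "Z' -` A Int B \<in> sets (F t)" by (rule subsetD[OF null_F[OF t]])
 moreover have "Z -` A Int space (F t) - B \<in> sets (F t)" using measurable_sets[OF Z A] BF by auto
 moreover have "Z' -` A Int space (F t) = (Z -` A Int space (F t) - B) \<union> (Z' -` A Int B)" using eq space_F[OF t] sets.sets_into_space[OF BF] by auto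
 ultimately show "Z' -` A Int space (F t) \<in> sets (F t)" by simp
qed simp

lemma N_levy: "levy_process M (%t w. real (N t w))"
 and N_distr: "0 < t ==> distr M (count_space UNIV) (N t) = measure_pmf (poisson_pmf (\<gamma> * t))" using N_poisson unfolding poisson_process_def by blast+

lemma X_levy': "levy_process M X" "AE w in M. ALL t>0. jump (%s. X s w) t >= 0" "~ subordinator M X" using X_levy unfolding spectrally_positive_levy_process_def by blast+

lemma N_measurable: "0 <= t ==> N t \<in> measurable M (count_space UNIV)" "0 <= t ==> (%w. real (N t w)) \<in> Bor M"
proof -
 assume t: "0 <= t"
 show m: "(%w. real (N t w)) \<in> Bor M" using N_levy t unfolding levy_process_def by blast
 show "N t \<in> measurable M (count_space UNIV)"
 proof (rule measurable_count_space_eq2_countable[THEN iffD2], intro conjI ballI)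
  fix n
  have "(%w. real (N t w)) -` {real n} Int space M \<in> sets M" using measurable_sets[OF m] by simp
  thus "N t -` {n} Int space M \<in> sets M" by (simp add: vimage_def)
 qed auto
qed

lemma N_increment_prob:
 assumes "0 <= s" "0 < t" "B \<in> sets borel"
 shows "prob {w \<in> space M. real (N (s + t) w) - real (N s w) \<in> B} = measure_pmf.prob (poisson_pmf (\<gamma> * t)) {n. real n \<in> B}"
proof -
 have d: "distr M borel (%w. real (N (s + t) w) - real (N s w)) = distr M borel (%w. real (N t w))" using N_levy assms(1,2) unfolding levy_process_def by simp
 note [measurable] = N_measurable(2)[of s] N_measurable(2)[of t] N_measurable(2)[of "s + t"]
 have "prob {w \<in> space M. real (N (s + t) w) - real (N s w) \<in> B} = measure (distr M borel (%w. real (N (s + t) w) - real (N s w))) B"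
  using assms by (subst measure_distr) (auto intro!: arg_cong[where f = prob])
 also have "... = measure (distr M (count_space UNIV) (N t)) {n. real n \<in> B}" unfolding d using assms N_measurable[of t] by (subst (1 2) measure_distr) (auto intro!: arg_cong[where f = prob])
 finally show ?thesis using N_distr[OF assms(2)] by simp
qed

definition good :: "'a => bool" where
 "good w <-> X 0 w = 0 & cadlag (%t. X t w) & (ALL t>0. jump (%s. X s w) t >= 0) & N 0 w = 0 & cadlag (%t. real (N t w))
   & mono_on {0..} (%t. N t w) & (ALL n. EX t>=0. n <= N t w) & (ALL n. N (arrival_time (%t. N t w) n) w = n)"

lemma AE_good: "AE w in M. good w"
proof -
 have X: "AE w in M. X 0 w = 0 & cadlag (%t. X t w)" using X_levy'(1) unfolding levy_process_def by blast
 have N: "AE w in M. real (N 0 w) = 0 & cadlag (%t. real (N t w))" using N_levy unfolding levy_process_def by blast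
 note [measurable] = N_measurable(2)
 have le: "AE w in M. N s w <= N t w" if st: "0 <= s" "s <= t" for s t
 proof (cases "s = t")
  case False
  have "prob {w \<in> space M. real (N (s + (t - s)) w) - real (N s w) \<in> {0..}} = 1" using False st by (subst N_increment_prob) auto
  hence "AE w in M. w \<in> {w \<in> space M. real (N (s + (t - s)) w) - real (N s w) \<in> {0..}}" by (rule AE_prob_1)
  thus ?thesis by (auto elim!: eventually_mono)
 qed simp
 have "AE w in M. \<forall>s\<in>\<rat>. \<forall>t\<in>\<rat>. 0 <= s --> s <= t --> N s w <= N t w" using le by (intro AE_ball_countable[THEN iffD2] countable_rat ballI) (auto intro!: AE_impI)
 hence mono: "AE w in M. mono_on {0..} (%t. N t w)" using N by eventually_elim (intro mono_from_rationals, auto)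
 have "AE w in M. EX i. w \<notin> {w \<in> space M. N (real (Suc i)) w < n}" for n
 proof (rule AE_exists_not)
  fix i
  have m: "N (real (Suc i)) \<in> measurable M (count_space UNIV)" by (rule N_measurable) simp
  have eq: "{w \<in> space M. N (real (Suc i)) w < n} = N (real (Suc i)) -` {k. k < n} Int space M" by auto
  show "{w \<in> space M. N (real (Suc i)) w < n} \<in> events" unfolding eq by (rule measurable_sets[OF m]) simp
  have "prob {w \<in> space M. N (real (Suc i)) w < n} = measure (distr M (count_space UNIV) (N (real (Suc i)))) {k. k < n}" unfolding eq by (rule measure_distr[OF m, symmetric]) simp
  also have "... = measure_pmf.prob (poisson_pmf (\<gamma> * real (Suc i))) {k. k < n}" by (subst N_distr) auto
  finally show "prob {w \<in> space M. N (real (Suc i)) w < n} <= measure_pmf.prob (poisson_pmf (\<gamma> * real (Suc i))) {k. k < n}" by simp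
 qed (rule poisson_less_limit[OF gamma_pos])
 hence "AE w in M. ALL n. EX i. w \<notin> {w \<in> space M. N (real (Suc i)) w < n}" by (simp add: AE_all_countable)
 hence unb: "AE w in M. ALL n. EX t>=0. n <= N t w" using AE_space
 proof eventually_elim
  case (elim w)
  show ?case
  proof
   fix n
   obtain i where "~ N (real (Suc i)) w < n" using elim by blast
   thus "EX t>=0. n <= N t w" by (intro exI[of _ "real (Suc i)"]) auto
  qed
 qed
 \<comment> \<open>Some cell of level \<open>j\<close> before time \<open>K\<close> contains at
   least two arrivals. Each of the \<open>K * 2 ^ j\<close> cells contributes at most the square of
   \<open>\<gamma> / 2 ^ j\<close>, so the probability is of order \<open>1 / 2 ^ j\<close>.\<close>
 define A where "A K j = (\<Union>i<K * 2 ^ j. {w \<in> space M. real (N (real i / 2 ^ j + 1 / 2 ^ j) w) - real (N (real i / 2 ^ j) w) \<in> {2..}})" for K j :: nat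
 have "AE w in M. EX j. w \<notin> A K j" for K
 proof (rule AE_exists_not)
  have m: "{w \<in> space M. real (N (real i / 2 ^ j + 1 / 2 ^ j) w) - real (N (real i / 2 ^ j) w) \<in> {2..}} \<in> events" for i j :: nat
  proof -
   have "(%w. real (N (real i / 2 ^ j + 1 / 2 ^ j) w) - real (N (real i / 2 ^ j) w)) \<in> Bor M" by (intro borel_measurable_diff N_measurable(2)) auto
   thus ?thesis by measurable
  qed
  thus "A K j \<in> events" for j unfolding A_def by blast
  fix j
  have "prob (A K j) <= (\<Sum>i<K * 2 ^ j. prob {w \<in> space M. real (N (real i / 2 ^ j + 1 / 2 ^ j) w) - real (N (real i / 2 ^ j) w) \<in> {2..}})"
   unfolding A_def using m by (intro finite_measure_subadditive_finite) auto
  also have "... <= (\<Sum>i<K * 2 ^ j. (\<gamma> * (1 / 2 ^ j))\<^sup>2)"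
  proof (rule sum_mono)
   fix i
   have "{n. real n \<in> {2..}} = {n. 2 <= n}" by auto
   thus "prob {w \<in> space M. real (N (real i / 2 ^ j + 1 / 2 ^ j) w) - real (N (real i / 2 ^ j) w) \<in> {2..}} <= (\<gamma> * (1 / 2 ^ j))\<^sup>2"
    using poisson_ge_2[of "\<gamma> * (1 / 2 ^ j)"] gamma_pos by (subst N_increment_prob) auto
  qed
  also have "... = (real K * \<gamma>\<^sup>2) * (1 / 2) ^ j" by (simp add: power_mult_distrib power_divide power2_eq_square field_simps)
  finally show "prob (A K j) <= (real K * \<gamma>\<^sup>2) * (1 / 2) ^ j" .
 qed (intro tendsto_mult_right_zero LIMSEQ_power_zero, simp)
 hence "AE w in M. ALL K. EX j. w \<notin> A K j" by (simp add: AE_all_countable)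
 hence dy: "AE w in M. \<forall>K::nat. \<exists>j::nat. ALL i<K * 2 ^ j. N ((real i + 1) / 2 ^ j) w <= N (real i / 2 ^ j) w + 1" using AE_space
 proof eventually_elim
  case (elim w)
  show ?case
  proof
   fix K
   obtain j where j: "w \<notin> A K j" using elim by blast
   have "N ((real i + 1) / 2 ^ j) w <= N (real i / 2 ^ j) w + 1" if "i < K * 2 ^ j" for i
   proof -
    have "~ 2 <= real (N (real i / 2 ^ j + 1 / 2 ^ j) w) - real (N (real i / 2 ^ j) w)" using j elim(2) that unfolding A_def by auto
    thus ?thesis by (simp add: add_divide_distrib)
   qed
   thus "\<exists>j::nat. ALL i<K * 2 ^ j. N ((real i + 1) / 2 ^ j) w <= N (real i / 2 ^ j) w + 1" by blast
  qed
 qed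
 show ?thesis using X X_levy'(2) N mono unb dy
 proof eventually_elim
  case (elim w)
  have "N 0 w = 0" using elim(3) by simp
  hence "N (arrival_time (%t. N t w) n) w = n" for n by (rule simple_from_dyadics[OF conjunct2[OF elim(3)] elim(4) _ elim(5)[rule_format] elim(6)[rule_format]])
  thus ?case using elim \<open>N 0 w = 0\<close> unfolding good_def by blast
 qed
qed

definition bad :: "'a set" where "bad = {w \<in> space M. ~ good w}"

lemma bad_null: "bad \<in> null_sets M" unfolding bad_def by (rule complete_measure.AE_iff_null_sets[OF M_complete, THEN iffD1]) (rule AE_good)

definition Xr where "Xr t w = (if w \<in> bad then 0 else X t w)"
definition Nr where "Nr t w = (if w \<in> bad then nat \<lfloor>t\<rfloor> else N t w)"

lemma AE_r: "AE w in M. (ALL t. Xr t w = X t w) & (ALL t. Nr t w = N t w)" using AE_not_in[OF bad_null] by eventually_elim (simp add: Xr_def Nr_def)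

lemma r_F: "0 <= t ==> Xr t \<in> Bor (F t)" "0 <= t ==> (%w. real (Nr t w)) \<in> Bor (F t)"
 by (rule modify_measurable[OF X_adapted _ bad_null] modify_measurable[OF N_adapted _ bad_null]; simp add: Xr_def Nr_def)+

end

context levy_dividend_model
begin

lemma Nr_path:
 assumes w: "w \<in> space M"
 shows "mono_on {0..} (%t. Nr t w)" "cadlag (%t. real (Nr t w))" "Nr 0 w = 0" "EX t>=0. n <= Nr t w" "Nr (arrival_time (%t. Nr t w) n) w = n"
proof -
 have "mono_on {0..} (%t. Nr t w) & cadlag (%t. real (Nr t w)) & Nr 0 w = 0 & (EX t>=0. n <= Nr t w) & Nr (arrival_time (%t. Nr t w) n) w = n"
 proof (cases "w \<in> bad")
  case True
  thus ?thesis using floor_path by (auto simp: Nr_def intro!: exI[of _ "real n"])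
 next
  case False
  hence "good w" using w by (simp add: bad_def)
  thus ?thesis using False by (simp add: Nr_def good_def)
 qed
 thus "mono_on {0..} (%t. Nr t w)" "cadlag (%t. real (Nr t w))" "Nr 0 w = 0" "EX t>=0. n <= Nr t w" "Nr (arrival_time (%t. Nr t w) n) w = n" by blast+
qed

lemma Xr_path:
 assumes w: "w \<in> space M"
 shows "cadlag (%t. Xr t w)" "Xr 0 w = 0" "0 < t ==> 0 <= jump (%s. Xr s w) t"
proof -
 have "cadlag (%t. Xr t w) & Xr 0 w = 0 & (ALL t>0. 0 <= jump (%s. Xr s w) t)"
 proof (cases "w \<in> bad")
  case True
  have "left_lim (%s. 0) t = 0" if "0 < t" for t by (rule left_lim_eq[OF that]) simp
  thus ?thesis using True by (simp add: Xr_def cadlag_const jump_def)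
 next
  case False
  hence "good w" using w by (simp add: bad_def)
  thus ?thesis using False by (simp add: Xr_def good_def)
 qed
 thus "cadlag (%t. Xr t w)" "Xr 0 w = 0" "0 < t ==> 0 <= jump (%s. Xr s w) t" by blast+
qed

lemma r_M: "0 <= t ==> Xr t \<in> Bor M" "0 <= t ==> (%w. real (Nr t w)) \<in> Bor M" using measurable_from_subalg[OF F_sub r_F(1)] measurable_from_subalg[OF F_sub r_F(2)] by blast+

lemma events_sigma:
 assumes "!!t. t \<in> I ==> Y t \<in> Bor M" shows "events_of M Y I <= events" unfolding events_of_def by (rule sets.sigma_sets_subset) (use assms in \<open>auto intro: measurable_sets\<close>)

lemma N_no_arrival_r:
 assumes "0 <= s" "0 <= t" shows "prob {w \<in> space M. Nr (s + t) w = Nr s w} = exp (- \<gamma> * t)"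
proof (cases "t = 0")
 case False
 have Nm: "(%w. real (N (s + t) w) - real (N s w)) \<in> Bor M" using N_measurable(2)[of s] N_measurable(2)[of "s + t"] assms by simp
 have "(%w. real (Nr (s + t) w) - real (Nr s w)) \<in> Bor M" using r_M(2)[of s] r_M(2)[of "s + t"] assms by simp
 hence "{w \<in> space M. real (Nr (s + t) w) - real (Nr s w) = 0} \<in> events" by measurable
 hence 1: "{w \<in> space M. Nr (s + t) w = Nr s w} \<in> events" by simp
 have "prob {w \<in> space M. Nr (s + t) w = Nr s w} = prob {w \<in> space M. real (N (s + t) w) - real (N s w) \<in> {0}}"
 proof (rule finite_measure_eq_AE[OF _ 1])
  show "{w \<in> space M. real (N (s + t) w) - real (N s w) \<in> {0}} \<in> events" using Nm by measurable
  show "AE w in M. w \<in> {w \<in> space M. Nr (s + t) w = Nr s w} <-> w \<in> {w \<in> space M. real (N (s + t) w) - real (N s w) \<in> {0}}" using AE_r by eventually_elim simp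
 qed
 also have "... = measure_pmf.prob (poisson_pmf (\<gamma> * t)) {0}" using False assms by (subst N_increment_prob) auto
 also have "... = exp (- \<gamma> * t)" using False assms gamma_pos by (simp add: measure_pmf_single)
 finally show ?thesis .
qed (simp add: prob_space)

text \<open>Integrability is implicit in the Laplace transform: a non-integrable function has
  integral 0, which no exponential equals.\<close>

lemma exp_moment: "0 <= t ==> integrable M (%w. exp (- X t w))" using X_exponent[of t 1] not_integrable_integral_eq[of M "%w. exp (- X t w)"] by force

lemma regular: "regular_model M F Xr Nr \<gamma>"
proof
 show "subalgebra M (F t)" if "0 <= t" for t by (rule F_sub[OF that])
 show "sets (F s) <= sets (F t)" if "0 <= s" "s <= t" for s t by (rule F_mono[OF that])
 show "indep_set (sets (F t)) (sigma_sets (space M)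
   (events_of M (%s w. Xr s w - Xr t w) {t..} \<union> events_of M (%s w. real (Nr s w) - real (Nr t w)) {t..}))" if t: "0 <= t" for t
 proof (rule indep_set_AE[OF increments_indep[OF t]])
  show "sets (F t) <= events" using F_sub[OF t] by (simp add: subalgebra_def)
  have E: "events_of M (%s w. Xr s w - Xr t w) {t..} \<union> events_of M (%s w. real (Nr s w) - real (Nr t w)) {t..} <= events" using t by (intro Un_least events_sigma borel_measurable_diff r_M) auto
  thus "sigma_sets (space M) (events_of M (%s w. Xr s w - Xr t w) {t..} \<union> events_of M (%s w. real (Nr s w) - real (Nr t w)) {t..}) <= events" by (rule sets.sigma_sets_subset)
  show "\<exists>b0\<in>sigma_sets (space M) (events_of M (%s w. X s w - X t w) {t..} \<union> events_of M (%s w. real (N s w) - real (N t w)) {t..}). AE w in M. w \<in> b <-> w \<in> b0"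
   if b: "b \<in> sigma_sets (space M) (events_of M (%s w. Xr s w - Xr t w) {t..} \<union> events_of M (%s w. real (Nr s w) - real (Nr t w)) {t..})" for b
  proof (rule sigma_sets_AE[OF _ b])
   fix g assume "g \<in> events_of M (%s w. Xr s w - Xr t w) {t..} \<union> events_of M (%s w. real (Nr s w) - real (Nr t w)) {t..}"
   hence "\<exists>g0\<in>events_of M (%s w. X s w - X t w) {t..} \<union> events_of M (%s w. real (N s w) - real (N t w)) {t..}. AE w in M. w \<in> g <-> w \<in> g0"
   proof
    assume "g \<in> events_of M (%s w. Xr s w - Xr t w) {t..}"
    hence "\<exists>g0\<in>events_of M (%s w. X s w - X t w) {t..}. AE w in M. w \<in> g <-> w \<in> g0" by (rule events_of_AE[rotated]) (rule eventually_mono[OF AE_r], simp)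
    thus ?thesis by blast
   next
    assume "g \<in> events_of M (%s w. real (Nr s w) - real (Nr t w)) {t..}"
    hence "\<exists>g0\<in>events_of M (%s w. real (N s w) - real (N t w)) {t..}. AE w in M. w \<in> g <-> w \<in> g0" by (rule events_of_AE[rotated]) (rule eventually_mono[OF AE_r], simp)
    thus ?thesis by blast
   qed
   thus "\<exists>g0\<in>sigma_sets (space M) (events_of M (%s w. X s w - X t w) {t..} \<union> events_of M (%s w. real (N s w) - real (N t w)) {t..}). AE w in M. w \<in> g <-> w \<in> g0"
    by (elim bexE) (intro bexI[OF _ sigma_sets.Basic])
  qed
 qed auto
 show "indep_set (events_of M Xr {0..}) (events_of M (%t w. real (Nr t w)) {0..})"
 proof (rule indep_set_AE[OF X_N_indep])
  show "events_of M Xr {0..} <= events" "events_of M (%t w. real (Nr t w)) {0..} <= events" by (intro events_sigma r_M; simp)+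
  show "\<exists>a0\<in>events_of M X {0..}. AE w in M. w \<in> a <-> w \<in> a0" if "a \<in> events_of M Xr {0..}" for a
   using that by (rule events_of_AE[rotated]) (rule eventually_mono[OF AE_r], simp)
  show "\<exists>a0\<in>events_of M (%t w. real (N t w)) {0..}. AE w in M. w \<in> a <-> w \<in> a0" if "a \<in> events_of M (%t w. real (Nr t w)) {0..}" for a
   using that by (rule events_of_AE[rotated]) (rule eventually_mono[OF AE_r], simp)
 qed
 show "distr M borel (%w. Xr (s + t) w - Xr s w) = distr M borel (Xr t)" if st: "0 <= s" "0 <= t" for s t
 proof -
  have Xm: "X u \<in> Bor M" if "0 <= u" for u using X_levy'(1) that unfolding levy_process_def by blast
  have "distr M borel (%w. Xr (s + t) w - Xr s w) = distr M borel (%w. X (s + t) w - X s w)" using st by (intro distr_cong_AE borel_measurable_diff r_M Xm eventually_mono[OF AE_r]) auto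
  also have "... = distr M borel (X t)" using X_levy'(1) st unfolding levy_process_def by blast
  also have "... = distr M borel (Xr t)" using st by (intro distr_cong_AE r_M Xm eventually_mono[OF AE_r]) auto
  finally show ?thesis .
 qed
 show "integrable M (Xr 1)" by (intro integrable_cong_AE_imp[OF X_mean r_M(1)] eventually_mono[OF AE_r]) auto
 show "EX C. \<forall>t\<in>{0..1}. integrable M (%w. exp (- Xr t w)) & expectation (%w. exp (- Xr t w)) <= C"
 \<comment> \<open>At argument 1 the Laplace exponent is a single real number; its absolute value
   bounds \<open>t\<close> times it for all \<open>t\<close> in \<open>[0, 1]\<close>.\<close>
 proof (intro exI[of _ "exp (abs (laplace_exponent c \<sigma> \<nu> 1))"] ballI conjI)
  fix t :: real assume t: "t \<in> {0..1}"
  have m: "(%w. exp (- Xr t w)) \<in> Bor M" using r_M(1)[of t] t by simp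
  have eq: "AE w in M. exp (- X t w) = exp (- Xr t w)" using AE_r by eventually_elim simp
  note i = exp_moment[of t]
  show "integrable M (%w. exp (- Xr t w))" using eq t by (intro integrable_cong_AE_imp[OF i m]) auto
  have "expectation (%w. exp (- Xr t w)) = expectation (%w. exp (- X t w))" using eq i t m by (intro integral_cong_AE) auto
  also have "... = exp (t * laplace_exponent c \<sigma> \<nu> 1)" using X_exponent[of t 1] t by simp
  also have "t * laplace_exponent c \<sigma> \<nu> 1 <= 1 * abs (laplace_exponent c \<sigma> \<nu> 1)" using t by (intro order_trans[OF mult_left_mono[OF abs_ge_self] mult_right_mono]) auto
  finally show "expectation (%w. exp (- Xr t w)) <= exp (abs (laplace_exponent c \<sigma> \<nu> 1))" by simp
 qed
 show "~ (AE w in M. mono_on {0..} (%t. Xr t w))"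
 proof
  assume "AE w in M. mono_on {0..} (%t. Xr t w)"
  hence "AE w in M. mono_on {0..} (%t. X t w)" using AE_r by eventually_elim simp
  thus False using X_levy'(1,3) by (simp add: subordinator_def)
 qed
qed (use r_F Xr_path Nr_path N_no_arrival_r gamma_pos in auto)

lemma N_mean_r: "0 <= t ==> (\<integral>\<^sup>+w. ennreal (real (Nr t w)) \<partial>M) = ennreal (\<gamma> * t)"
proof -
 assume t: "0 <= t"
 show ?thesis
 proof (cases "t = 0")
  case True
  have "(\<integral>\<^sup>+w. ennreal (real (Nr t w)) \<partial>M) = (\<integral>\<^sup>+w. 0 \<partial>M)" by (intro nn_integral_cong) (simp add: True Nr_path(3))
  thus ?thesis using True by simp
 next
  case False
  hence t: "0 < t" using t by simp
  have "(\<integral>\<^sup>+w. ennreal (real (Nr t w)) \<partial>M) = (\<integral>\<^sup>+w. ennreal (real (N t w)) \<partial>M)" by (intro nn_integral_cong_AE eventually_mono[OF AE_r]) auto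
  also have "... = (\<integral>\<^sup>+n. ennreal (real n) \<partial>distr M (count_space UNIV) (N t))" using N_measurable(1)[of t] t by (subst nn_integral_distr) auto
  also have "... = ennreal (\<gamma> * t)" unfolding N_distr[OF t] using gamma_pos t by (intro poisson_mean) simp
  finally show ?thesis .
 qed
qed

end

text \<open>Bounds on the right derivative near 0 and at infinity become bounds on chords because
  the chords of a concave function flatten to the right. Monotonicity comes from the sign instead: a
  concave function that decreases somewhere eventually becomes negative.\<close>

lemma payoff_tame:
 assumes P: "payoff_function \<phi> \<Psi>" and phi: "1 < \<phi>"
 shows "tame \<phi> \<Psi>" "0 < ep ==> EX C. ALL u>=0. \<Psi> u <= (1 + ep) * u + C"
proof -
 have nn: "!!u. 0 <= u ==> 0 <= \<Psi> u" and cont: "continuous_on {0..} \<Psi>" and conc: "concave_on {0..} \<Psi>" using P by (auto simp: payoff_function_def)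
 obtain l0 where l0: "l0 <= \<phi>" "(right_deriv \<Psi> ---> l0) (at_right 0)" using P by (auto simp: payoff_function_def)
 obtain l1 where l1: "l1 <= 1" "(right_deriv \<Psi> ---> l1) at_top" using P by (auto simp: payoff_function_def)
 have slopes: "(\<Psi> z - \<Psi> x) / (z - x) <= (\<Psi> y - \<Psi> x) / (y - x) & (\<Psi> z - \<Psi> y) / (z - y) <= (\<Psi> y - \<Psi> x) / (y - x)"
  if "0 <= x" "x < y" "y < z" for x y z
 proof -
  have c: "convex_on {0..} (%u. - \<Psi> u)" using conc by (simp add: concave_on_def)
  show ?thesis using convex_on_slope_le[OF c, of x z y] that by (auto simp: divide_simps split: if_splits) (auto simp: algebra_simps)
 qed
 \<comment> \<open>For positive \<open>x\<close> the forward chords increase to a supremum, bounded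
   by the chord from 0; this supremum is the value that \<open>Lim\<close> picks in
   \<open>right_deriv\<close>.\<close>
 have right: "(\<Psi> y - \<Psi> x) / (y - x) <= right_deriv \<Psi> x" if x: "0 < x" "x < y" for x y
 proof -
  define s where "s u = (\<Psi> u - \<Psi> x) / (u - x)" for u
  have dec: "s v <= s u" if "x < u" "u <= v" for u v using slopes[of x u v] that x by (cases "u = v") (auto simp: s_def)
  have bdd: "s u <= (\<Psi> x - \<Psi> 0) / (x - 0)" if "x < u" for u using slopes[of 0 x u] that x by (simp add: s_def)
  have B: "bdd_above (s ` {x<..})" using bdd by (intro bdd_aboveI[of _ "(\<Psi> x - \<Psi> 0) / (x - 0)"]) auto
  have "(s ---> (SUP u\<in>{x<..}. s u)) (at_right x)"
  proof (rule order_tendstoI)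
   fix a assume "a < (SUP u\<in>{x<..}. s u)"
   then obtain v where v: "x < v" "a < s v" using less_cSUP_iff[OF _ B, of a] by auto
   show "eventually (%u. a < s u) (at_right x)" using eventually_at_right_real[OF v(1)] by eventually_elim (use dec v in \<open>force intro: less_le_trans\<close>)
  next
   fix a assume a: "(SUP u\<in>{x<..}. s u) < a"
   show "eventually (%u. s u < a) (at_right x)" using eventually_at_right_less[of x] by eventually_elim (use cSUP_upper[OF _ B] a in \<open>force intro: le_less_trans\<close>)
  qed
  hence "right_deriv \<Psi> x = (SUP u\<in>{x<..}. s u)" unfolding right_deriv_def s_def by (intro tendsto_Lim) auto
  thus ?thesis using cSUP_upper[OF _ B, of y] x by (simp add: s_def)
 qed
 have mono: "\<Psi> x <= \<Psi> y" if xy: "0 <= x" "x < y" for x y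
 proof (rule ccontr)
  assume "~ \<Psi> x <= \<Psi> y"
  hence d: "0 < \<Psi> x - \<Psi> y" by simp
  \<comment> \<open>At \<open>z\<close> the line through the graph points over \<open>x\<close> and
    \<open>y\<close> has reached the value -1.\<close>
  define z where "z = y + (\<Psi> y + 1) * (y - x) / (\<Psi> x - \<Psi> y)"
  have k: "0 < (\<Psi> y + 1) * (y - x) / (\<Psi> x - \<Psi> y)" using d xy nn[of y] by auto
  hence z: "y < z" by (simp add: z_def)
  have "(\<Psi> z - \<Psi> y) / (z - y) <= (\<Psi> y - \<Psi> x) / (y - x)" using slopes[of x y z] xy z by simp
  hence "\<Psi> z - \<Psi> y <= (\<Psi> y - \<Psi> x) / (y - x) * (z - y)" using z by (simp add: divide_le_eq)
  also have "... = - (\<Psi> y + 1)"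
  proof -
   have "- a / h * (c * h / a) = - c" if "0 < a" "0 < h" for a h c :: real using that by simp
   from this[OF d, of "y - x" "\<Psi> y + 1"] show ?thesis using xy by (simp add: z_def)
  qed
  finally show False using nn[of z] z xy by simp
 qed
 have lip: "\<Psi> y - \<Psi> x <= \<phi> * (y - x)" if xy: "0 < x" "x < y" for x y
 proof -
  have "eventually (%z. (\<Psi> y - \<Psi> x) / (y - x) <= right_deriv \<Psi> z) (at_right 0)" using eventually_at_right_real[OF xy(1)]
  proof eventually_elim
   case (elim z)
   thus ?case using slopes[of z x y] right[of z x] xy by simp
  qed
  hence "(\<Psi> y - \<Psi> x) / (y - x) <= l0" by (intro tendsto_lowerbound[OF l0(2)]) auto
  hence "(\<Psi> y - \<Psi> x) / (y - x) <= \<phi>" using l0 by simp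
  thus ?thesis using xy by (simp add: divide_le_eq)
 qed
 have lip0: "\<Psi> y - \<Psi> 0 <= \<phi> * (y - 0)" if y: "0 < y" for y
 proof -
  have c0: "(\<Psi> ---> \<Psi> 0) (at_right 0)" using cont by (auto simp: continuous_on_def intro: tendsto_within_subset)
  have "((%x. \<phi> * (y - x) - (\<Psi> y - \<Psi> x) + (\<Psi> y - \<Psi> 0)) ---> \<phi> * (y - 0) - (\<Psi> y - \<Psi> 0) + (\<Psi> y - \<Psi> 0)) (at_right 0)" by (intro tendsto_intros c0)
  moreover have "eventually (%x. \<Psi> y - \<Psi> 0 <= \<phi> * (y - x) - (\<Psi> y - \<Psi> x) + (\<Psi> y - \<Psi> 0)) (at_right 0)" using eventually_at_right_real[OF y]
  proof eventually_elim
   case (elim x)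
   thus ?case using lip[of x y] by simp
  qed
  ultimately show ?thesis using tendsto_lowerbound[of _ _ "at_right (0::real)" "\<Psi> y - \<Psi> 0"] by force
 qed
 show "tame \<phi> \<Psi>"
 proof (rule tameI)
  fix x y :: real assume xy: "0 <= x" "x <= y"
  show "\<Psi> x <= \<Psi> y" using mono[OF xy(1), of y] xy by (cases "x = y") auto
  show "\<Psi> y <= \<Psi> x + \<phi> * (y - x)"
  proof (cases "x = y")
   case False
   thus ?thesis using lip[of x y] lip0[of y] xy by (cases "x = 0") auto
  qed simp
 qed
 show "EX C. ALL u>=0. \<Psi> u <= (1 + ep) * u + C" if e: "0 < ep"
 proof -
  have "eventually (%z. right_deriv \<Psi> z < 1 + ep & 0 < z) at_top" using l1(1) e by (intro eventually_conj order_tendstoD(2)[OF l1(2)] eventually_gt_at_top) auto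
  then obtain z where z: "right_deriv \<Psi> z < 1 + ep" "0 < z" unfolding eventually_at_top_linorder by blast
  have "\<Psi> u <= (1 + ep) * u + \<Psi> z" if u: "0 <= u" for u
  proof (cases "z < u")
   case True
   hence "(\<Psi> u - \<Psi> z) / (u - z) <= 1 + ep" using right[of z u] z by simp
   hence "\<Psi> u - \<Psi> z <= (1 + ep) * (u - z)" using True by (simp add: divide_le_eq)
   also have "... <= (1 + ep) * u" using e z by (intro mult_left_mono) auto
   finally show ?thesis by simp
  next
   case False
   have "0 <= (1 + ep) * u" using e u by simp
   thus ?thesis using mono[OF u, of z] False by (cases "u = z") auto
  qed
  thus ?thesis by blast
 qed
qed

lemma (in levy_dividend_model) poisson_model_r:
 assumes "0 < r" "1 < \<phi>" "payoff_function \<phi> \<Psi>"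
 shows "poisson_model M F Xr Nr \<gamma> lam r \<phi> \<Psi>"
proof -
 interpret R: regular_model M F Xr Nr \<gamma> by (rule regular)
 show ?thesis by unfold_locales
   (use assms lam_pos payoff_tame[OF assms(3,2)] N_mean_r in \<open>auto simp: payoff_function_def\<close>)
qed

section \<open>The objective\<close>

context strategy
begin

text \<open>Both sources of growth are integrable at the clock of rate \<open>q\<close>: the path by
  its envelope, the injections through \<open>Rstar\<close>.\<close>

lemma process_finite:
 assumes c: "0 <= c" and Y: "!!w t. w \<in> space M ==> 0 <= t ==> Y t w <= c * (1 + abs (X t w) + R t w)"
 shows "(\<integral>\<^sup>+w. (\<integral>\<^sup>+t. ennreal (Y (max 0 t) w) \<partial>expo q) \<partial>M) < \<infinity>"
proof -
 interpret Eq: prob_space "expo q" by (rule prob_space_expo[OF q_pos(1)])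
 obtain Z where Z: "integrable M Z" "AE w in M. 0 <= Z w" "AE w in M. ALL t>=0. abs (X t w) <= exp (q / 2 * t) * Z w"
  and "AE w in M. ALL s>=0. ALL t>=0. abs (Xi s t w) <= exp (q / 2 * (s + t)) * Z w & abs (Ii s t w) <= exp (q / 2 * (s + t)) * Z w" by (rule domination[OF q_pos(4)])
 have "(\<integral>\<^sup>+w. (\<integral>\<^sup>+t. ennreal (Y (max 0 t) w) \<partial>expo q) \<partial>M) <= (\<integral>\<^sup>+w. ennreal (c * (1 + 2 * Z w + Rstar w)) \<partial>M)"
 proof (rule nn_integral_mono_AE)
  show "AE w in M. (\<integral>\<^sup>+t. ennreal (Y (max 0 t) w) \<partial>expo q) <= ennreal (c * (1 + 2 * Z w + Rstar w))" using Z(2,3) Rstar(2) AE_space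
  proof eventually_elim
   case (elim w)
   let ?g = "%t. c * (1 + exp (q / 2 * t) * Z w + R (max 0 t) w)"
   have "(\<integral>\<^sup>+t. ennreal (Y (max 0 t) w) \<partial>expo q) <= (\<integral>\<^sup>+t. ennreal (?g t) \<partial>expo q)"
   proof (rule nn_integral_mono_AE)
    show "AE t in expo q. ennreal (Y (max 0 t) w) <= ennreal (?g t)" using expo_pos[of q]
    proof eventually_elim
     case (elim t)
     have "abs (X t w) <= exp (q / 2 * t) * Z w" using \<open>ALL t>=0. \<bar>X t w\<bar> <= exp (q / 2 * t) * Z w\<close> elim by simp
     hence "c * (1 + abs (X t w) + R t w) <= ?g t" using c elim by (intro mult_left_mono) auto
     thus ?case using Y[OF \<open>w \<in> space M\<close>, of t] elim by (intro ennreal_leI) simp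
    qed
   qed
   also have "... = ennreal (LINT t|expo q. ?g t)" using expo_exp_integrable(1)[OF q_pos(2,3)] elim c R_nonneg[OF elim(4)] by (intro nn_integral_eq_integral) auto
   also have "(LINT t|expo q. ?g t) = c * (1 + 2 * Z w + Rstar w)" using expo_exp_integrable[OF q_pos(2,3)] elim(3) Eq.prob_space q_pos by (simp add: Rstar_def)
   finally show ?case .
  qed
 qed
 also have "... < \<infinity>"
 proof -
  have "AE w in M. 0 <= c * (1 + 2 * Z w + Rstar w)" using Z(2) Rstar(2) AE_space by eventually_elim (use Rstar_ge(3)[OF _ _ order_refl] c in auto)
  thus ?thesis using Z(1) Rstar(1) by (subst nn_integral_eq_integral) auto
 qed
 finally show ?thesis .
qed

lemma parts_finite:
 "(\<integral>\<^sup>+w. (\<integral>\<^sup>+t. ennreal (D (max 0 t) w) \<partial>expo q) \<partial>M) < \<infinity>"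
 "(\<integral>\<^sup>+w. (\<integral>\<^sup>+t. ennreal (\<Psi> (max 0 (U (max 0 t) w))) \<partial>expo q) \<partial>M) < \<infinity>"
proof -
 have b: "D t w <= (1 + x) * (1 + abs (X t w) + R t w)" "U t w <= (1 + x) * (1 + abs (X t w) + R t w)" if w: "w \<in> space M" "0 <= t" for w t
 proof -
  have "x + abs (X t w) + R t w <= (1 + x) * (1 + abs (X t w) + R t w)" using x_nonneg R_nonneg[OF w] mult_nonneg_nonneg[OF x_nonneg, of "abs (X t w) + R t w"] by (simp add: algebra_simps)
  thus "D t w <= (1 + x) * (1 + abs (X t w) + R t w)" "U t w <= (1 + x) * (1 + abs (X t w) + R t w)" using U_nonneg[OF w] D_nonneg[OF w] unfolding U_def by linarith+
 qed
 show "(\<integral>\<^sup>+w. (\<integral>\<^sup>+t. ennreal (D (max 0 t) w) \<partial>expo q) \<partial>M) < \<infinity>" using x_nonneg by (intro process_finite[of "1 + x"] b(1)) auto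
 show "(\<integral>\<^sup>+w. (\<integral>\<^sup>+t. ennreal (\<Psi> (max 0 (U (max 0 t) w))) \<partial>expo q) \<partial>M) < \<infinity>"
 proof (rule process_finite[of "abs (\<Psi> 0) + \<phi> * (1 + x)"])
  fix w t assume w: "w \<in> space M" "0 <= (t::real)"
  define A where "A = 1 + abs (X t w) + R t w"
  have "\<Psi> (max 0 (U t w)) <= \<Psi> 0 + \<phi> * U t w" using tameD(2)[OF terminal_tame, of 0 "U t w"] U_nonneg[OF w] by simp
  also have "... <= abs (\<Psi> 0) * A + \<phi> * ((1 + x) * A)"
  proof (intro add_mono mult_left_mono)
   have "abs (\<Psi> 0) * 1 <= abs (\<Psi> 0) * A" using R_nonneg[OF w] by (intro mult_left_mono) (auto simp: A_def)
   thus "\<Psi> 0 <= abs (\<Psi> 0) * A" by simp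
  qed (use b(2)[OF w] cost_gt_1 in \<open>auto simp: A_def\<close>)
  finally show "\<Psi> (max 0 (U t w)) <= (abs (\<Psi> 0) + \<phi> * (1 + x)) * (1 + abs (X t w) + R t w)" by (simp add: A_def distrib_right mult.assoc)
 qed (use x_nonneg cost_gt_1 in auto)
qed

end

lemma (in prob_space) pair_integral:
 fixes h :: "'a => real => real"
 assumes l: "0 < l" and m: "(%(w, t). h w t) \<in> Bor (M \<Otimes>\<^sub>M borel)" and nn: "!!w t. w \<in> space M ==> 0 <= h w t"
  and fin: "(\<integral>\<^sup>+w. (\<integral>\<^sup>+t. ennreal (h w t) \<partial>expo l) \<partial>M) < \<infinity>"
 shows "AE w in M. integrable (expo l) (h w)" "integrable M (%w. LINT t|expo l. h w t)"
  "(LINT w|M. (LINT t|expo l. h w t)) = enn2real (\<integral>\<^sup>+w. (\<integral>\<^sup>+t. ennreal (h w t) \<partial>expo l) \<partial>M)"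
proof -
 interpret El: prob_space "expo l" by (rule prob_space_expo[OF l])
 interpret P: pair_prob_space M "expo l" ..
 have m': "(%(w, t). h w t) \<in> Bor (M \<Otimes>\<^sub>M expo l)" using m by simp
 have eq: "(\<integral>\<^sup>+z. ennreal (case z of (w, t) => h w t) \<partial>(M \<Otimes>\<^sub>M expo l)) = (\<integral>\<^sup>+w. (\<integral>\<^sup>+t. ennreal (h w t) \<partial>expo l) \<partial>M)"
  using m' by (subst El.nn_integral_fst[symmetric]) auto
 have i: "integrable (M \<Otimes>\<^sub>M expo l) (%(w, t). h w t)" by (rule integrableI_nonneg[OF m' AE_I2]) (use nn fin in \<open>auto simp: eq space_pair_measure\<close>)
 show "AE w in M. integrable (expo l) (h w)" using P.AE_integrable_fst'[OF i] by simp
 show "integrable M (%w. LINT t|expo l. h w t)" using P.integrable_fst'[OF i] by simp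
 have "(LINT w|M. (LINT t|expo l. h w t)) = (LINT z|(M \<Otimes>\<^sub>M expo l). (case z of (w, t) => h w t))" using P.integral_fst'[OF i] by simp
 also have "... = enn2real (\<integral>\<^sup>+z. ennreal (case z of (w, t) => h w t) \<partial>(M \<Otimes>\<^sub>M expo l))"
  by (rule integral_eq_nn_integral[OF m' AE_I2]) (use nn in \<open>auto simp: space_pair_measure\<close>)
 finally show "(LINT w|M. (LINT t|expo l. h w t)) = enn2real (\<integral>\<^sup>+w. (\<integral>\<^sup>+t. ennreal (h w t) \<partial>expo l) \<partial>M)" by (simp add: eq)
qed

section \<open>Merging \<tau> and discounting into one clock\<close>

locale levy_control = levy_dividend_model M F X N \<tau> c \<sigma> \<nu> \<gamma> lam
 for M :: "'a measure" and F X N \<tau> c \<sigma> \<nu> \<gamma> lam +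
 fixes r \<phi> :: real and \<Psi> :: "real => real"
 assumes r_pos: "0 < r" and phi_gt_1: "1 < \<phi>" and payoff: "payoff_function \<phi> \<Psi>"
begin

sublocale P: poisson_model M F Xr Nr \<gamma> lam r \<phi> \<Psi> by (rule poisson_model_r[OF r_pos phi_gt_1 payoff])

abbreviation q where "q \<equiv> P.q"

lemma q_eq: "q = lam + r" by (simp add: P.q_def)

lemma tau_M: "\<tau> \<in> Bor M" and tau_distr: "distr M borel \<tau> = expo lam" and tau_pos: "AE w in M. 0 < \<tau> w"
proof -
 show m: "\<tau> \<in> Bor M" using tau_exponential by (simp add: distributed_def)
 have "distr M borel \<tau> = distr M lborel \<tau>" by (intro distr_cong) auto
 thus d: "distr M borel \<tau> = expo lam" using tau_exponential by (simp add: distributed_def expo_def)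
 have "AE t in distr M borel \<tau>. 0 < t" unfolding d by (rule expo_pos)
 thus "AE w in M. 0 < \<tau> w" by (subst (asm) AE_distr_iff) (use m in auto)
qed

text \<open>All events of the filtration together. \<tau> is independent of them, so the whole path
  can be frozen while \<tau> is integrated out.\<close>

definition Finf :: "'a measure" where "Finf = sigma (space M) (\<Union>t\<in>{0..}. sets (F t))"

lemma sets_Finf: "sets Finf = sigma_sets (space M) (\<Union>t\<in>{0..}. sets (F t))" and space_Finf: "space Finf = space M"
proof -
 have "(\<Union>t\<in>{0..}. sets (F t)) <= Pow (space M)" using F_sub sets.sets_into_space by (fastforce simp: subalgebra_def)
 thus "sets Finf = sigma_sets (space M) (\<Union>t\<in>{0..}. sets (F t))" "space Finf = space M" unfolding Finf_def by (auto intro: sets_measure_of space_measure_of)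
qed

lemma Finf_sub: "subalgebra M Finf" and F_Finf: "0 <= t ==> subalgebra Finf (F t)" unfolding subalgebra_def sets_Finf space_Finf
 by (auto intro!: sets.sigma_sets_subset sigma_sets.Basic simp: space_F) (use F_sub in \<open>auto simp: subalgebra_def\<close>)

context
 fixes Z :: "real => 'a => real"
 assumes Z_F: "!!t. 0 <= t ==> Z t \<in> Bor (F t)" and Z_cad: "!!w. w \<in> space M ==> cadlag (%t. Z t w)"
  and Z_nn: "!!w t. w \<in> space M ==> 0 <= t ==> 0 <= Z t w"
begin

abbreviation total where "total \<equiv> (\<integral>\<^sup>+w. (\<integral>\<^sup>+t. ennreal (Z (max 0 t) w) \<partial>expo q) \<partial>M)"

lemma Z_joint: "(%(t, w). Z (max 0 t) w) \<in> Bor (borel \<Otimes>\<^sub>M Finf)"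
 using measurable_from_subalg[OF F_Finf Z_F] cadlag_right[OF Z_cad] by (intro joint_measurable) (auto simp: space_Finf)

lemma Z_joint_M: "(%(t, w). Z (max 0 t) w) \<in> Bor (borel \<Otimes>\<^sub>M M)" by (rule P.pair_measure_sub[OF Finf_sub Z_joint])

text \<open>An integral discounted at rate \<open>r\<close> up to \<tau> is the mean of the path
  value at \<open>min v (\<tau> w)\<close> with \<open>v\<close> exponential of rate
  \<open>r\<close>; given the path, this minimum is exponential of rate \<open>q\<close>.\<close>

lemma killed_total: "(\<integral>\<^sup>+w. (\<integral>\<^sup>+v. ennreal (Z (max 0 (min v (\<tau> w))) w) \<partial>expo r) \<partial>M) = total"
proof -
 interpret Er: prob_space "expo r" by (rule prob_space_expo[OF r_pos])
 interpret El: prob_space "expo lam" by (rule prob_space_expo[OF lam_pos])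
 interpret PM: pair_prob_space "expo lam" M ..
 have m: "(%(z, v). ennreal (Z (max 0 (min v (fst z))) (snd z))) \<in> Bor ((borel \<Otimes>\<^sub>M Finf) \<Otimes>\<^sub>M expo r)"
  using measurable_compose[OF _ Z_joint, of "%y. (min (snd y) (fst (fst y)), snd (fst y))" "(borel \<Otimes>\<^sub>M Finf) \<Otimes>\<^sub>M expo r"] by (simp add: case_prod_unfold)
 note g = Er.borel_measurable_nn_integral[OF m]
 have "(\<integral>\<^sup>+w. (\<integral>\<^sup>+v. ennreal (Z (max 0 (min v (\<tau> w))) w) \<partial>expo r) \<partial>M)
   = (\<integral>\<^sup>+s. (\<integral>\<^sup>+w. (\<integral>\<^sup>+v. ennreal (Z (max 0 (min v s)) w) \<partial>expo r) \<partial>M) \<partial>expo lam)"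
  using indep_nn_integral[OF tau_M Finf_sub tau_indep[folded sets_Finf] g] by (simp add: tau_distr)
 also have "... = (\<integral>\<^sup>+w. (\<integral>\<^sup>+s. (\<integral>\<^sup>+v. ennreal (Z (max 0 (min v s)) w) \<partial>expo r) \<partial>expo lam) \<partial>M)"
 proof (rule PM.Fubini'[symmetric])
  have "(%z. \<integral>\<^sup>+v. ennreal (Z (max 0 (min v (fst z))) (snd z)) \<partial>expo r) \<in> Bor (borel \<Otimes>\<^sub>M M)" by (rule P.pair_measure_sub[OF Finf_sub g])
  thus "(%(s, w). \<integral>\<^sup>+v. ennreal (Z (max 0 (min v s)) w) \<partial>expo r) \<in> Bor (expo lam \<Otimes>\<^sub>M M)" by (simp add: case_prod_unfold)
 qed
 also have "... = total"
 proof (rule nn_integral_cong)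
  fix w assume w: "w \<in> space M"
  have f: "(%t. ennreal (Z (max 0 t) w)) \<in> Bor borel" using cadlag_measurable[OF Z_cad[OF w]] by simp
  have mm: "(%(s, v). min s v) \<in> Bor (expo lam \<Otimes>\<^sub>M expo r)" by measurable
  have "(\<integral>\<^sup>+s. (\<integral>\<^sup>+v. ennreal (Z (max 0 (min v s)) w) \<partial>expo r) \<partial>expo lam) = (\<integral>\<^sup>+z. ennreal (Z (max 0 (case z of (s, v) => min s v)) w) \<partial>(expo lam \<Otimes>\<^sub>M expo r))"
   using measurable_compose[OF mm f] by (subst Er.nn_integral_fst[symmetric]) (auto simp: min.commute)
  also have "... = (\<integral>\<^sup>+t. ennreal (Z (max 0 t) w) \<partial>distr (expo lam \<Otimes>\<^sub>M expo r) borel (%(s, v). min s v))" using mm f by (intro nn_integral_distr[symmetric]) auto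
  finally show "(\<integral>\<^sup>+s. (\<integral>\<^sup>+v. ennreal (Z (max 0 (min v s)) w) \<partial>expo r) \<partial>expo lam) = (\<integral>\<^sup>+t. ennreal (Z (max 0 t) w) \<partial>expo q)"
   by (simp add: expo_min[OF lam_pos r_pos] q_eq)
 qed
 finally show ?thesis .
qed

text \<open>Here the discount factor merges with the density of \<tau> itself, which leaves the mass
  \<open>lam / q\<close>.\<close>

lemma terminal_total: "(\<integral>\<^sup>+w. ennreal (exp (- r * \<tau> w) * Z (max 0 (\<tau> w)) w) \<partial>M) = ennreal (lam / q) * total"
proof -
 interpret Eq: prob_space "expo q" by (rule prob_space_expo[OF P.q_pos(1)])
 interpret El: prob_space "expo lam" by (rule prob_space_expo[OF lam_pos])
 interpret PM: pair_prob_space "expo lam" M ..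
 note [measurable] = Z_joint[unfolded case_prod_unfold]
 have g: "(%z. ennreal (exp (- r * fst z)) * ennreal (Z (max 0 (fst z)) (snd z))) \<in> Bor (borel \<Otimes>\<^sub>M Finf)" by measurable
 have split: "ennreal (exp a * Z (max 0 b) w) = ennreal (exp a) * ennreal (Z (max 0 b) w)" if "w \<in> space M" for a b w using Z_nn[OF that] by (simp add: ennreal_mult)
 have "(\<integral>\<^sup>+w. ennreal (exp (- r * \<tau> w) * Z (max 0 (\<tau> w)) w) \<partial>M) = (\<integral>\<^sup>+w. ennreal (exp (- r * \<tau> w)) * ennreal (Z (max 0 (\<tau> w)) w) \<partial>M)"
  by (intro nn_integral_cong split)
 also have "... = (\<integral>\<^sup>+s. (\<integral>\<^sup>+w. ennreal (exp (- r * s)) * ennreal (Z (max 0 s) w) \<partial>M) \<partial>expo lam)"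
  using indep_nn_integral[OF tau_M Finf_sub tau_indep[folded sets_Finf] g] by (simp add: tau_distr)
 also have "... = (\<integral>\<^sup>+w. (\<integral>\<^sup>+s. ennreal (exp (- r * s)) * ennreal (Z (max 0 s) w) \<partial>expo lam) \<partial>M)"
  using P.pair_measure_sub[OF Finf_sub g] by (intro PM.Fubini'[symmetric]) (simp add: case_prod_unfold)
 also have "... = (\<integral>\<^sup>+w. ennreal (lam / q) * (\<integral>\<^sup>+t. ennreal (Z (max 0 t) w) \<partial>expo q) \<partial>M)"
  using cadlag_measurable[OF Z_cad] by (intro nn_integral_cong) (subst expo_discount_nn[OF lam_pos r_pos], auto simp: q_eq)
 also have "... = ennreal (lam / q) * total"
 proof (rule nn_integral_cmult)
  have "(%(w, t). ennreal (Z (max 0 t) w)) \<in> Bor (M \<Otimes>\<^sub>M expo q)" using measurable_compose[OF measurable_pair_swap' Z_joint_M] by (simp add: case_prod_unfold)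
  from Eq.borel_measurable_nn_integral[OF this] show "(%w. \<integral>\<^sup>+t. ennreal (Z (max 0 t) w) \<partial>expo q) \<in> Bor M" .
 qed
 finally show ?thesis .
qed

lemma process_integrals:
 assumes fin: "total < \<infinity>"
 shows "AE w in M. integrable (expo q) (%t. Z (max 0 t) w)" "integrable M (%w. LINT t|expo q. Z (max 0 t) w)"
  "integrable M (%w. LINT v|expo r. Z (max 0 (min v (\<tau> w))) w)"
  "(LINT w|M. (LINT v|expo r. Z (max 0 (min v (\<tau> w))) w)) = (LINT w|M. (LINT t|expo q. Z (max 0 t) w))"
  "integrable M (%w. exp (- r * \<tau> w) * Z (max 0 (\<tau> w)) w)"
  "(LINT w|M. exp (- r * \<tau> w) * Z (max 0 (\<tau> w)) w) = lam / q * (LINT w|M. (LINT t|expo q. Z (max 0 t) w))"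
proof -
 note [measurable] = tau_M
 have m1: "(%(w, t). Z (max 0 t) w) \<in> Bor (M \<Otimes>\<^sub>M borel)" using measurable_compose[OF measurable_pair_swap' Z_joint_M] by (simp add: case_prod_unfold)
 note 1 = pair_integral[OF P.q_pos(1) m1 _ fin]
 show "AE w in M. integrable (expo q) (%t. Z (max 0 t) w)" "integrable M (%w. LINT t|expo q. Z (max 0 t) w)" by (rule 1(1) 1(2); simp add: Z_nn)+
 have J: "(LINT w|M. (LINT t|expo q. Z (max 0 t) w)) = enn2real total" by (rule 1(3)) (simp add: Z_nn)
 have m2: "(%(w, v). Z (max 0 (min v (\<tau> w))) w) \<in> Bor (M \<Otimes>\<^sub>M borel)"
  using measurable_compose[OF _ Z_joint_M, of "%y. (min (snd y) (\<tau> (fst y)), fst y)" "M \<Otimes>\<^sub>M borel"] by (simp add: case_prod_unfold)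
 note 2 = pair_integral[OF r_pos m2 _ fin[folded killed_total]]
 show "integrable M (%w. LINT v|expo r. Z (max 0 (min v (\<tau> w))) w)" by (rule 2(2)) (simp add: Z_nn)
 show "(LINT w|M. (LINT v|expo r. Z (max 0 (min v (\<tau> w))) w)) = (LINT w|M. (LINT t|expo q. Z (max 0 t) w))" unfolding J killed_total[symmetric] by (rule 2(3)) (simp add: Z_nn)
 have m3: "(%w. exp (- r * \<tau> w) * Z (max 0 (\<tau> w)) w) \<in> Bor M" using measurable_compose[OF _ Z_joint_M, of "%w. (\<tau> w, w)" M] by simp
 have nn: "AE w in M. 0 <= exp (- r * \<tau> w) * Z (max 0 (\<tau> w)) w" by (rule AE_I2) (simp add: Z_nn)
 show "integrable M (%w. exp (- r * \<tau> w) * Z (max 0 (\<tau> w)) w)" by (rule integrableI_nonneg[OF m3 nn]) (unfold terminal_total, use fin in \<open>simp add: ennreal_mult_less_top\<close>)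
 show "(LINT w|M. exp (- r * \<tau> w) * Z (max 0 (\<tau> w)) w) = lam / q * (LINT w|M. (LINT t|expo q. Z (max 0 t) w))"
  using lam_pos P.q_pos by (subst integral_eq_nn_integral[OF m3 nn]) (unfold terminal_total, simp add: J enn2real_mult)
qed

end

end

lemma (in strategy) increasing: "w \<in> space M ==> increasing_path (%t. D t w)" "w \<in> space M ==> increasing_path (%t. R t w)"
 by (simp_all add: increasing_path_def D_mono D_cadlag D_0 R_mono R_cadlag R_0)

lemma stieltjes_cong: "(!!t. 0 <= t ==> f t = g t) ==> stieltjes_measure f = stieltjes_measure g"
proof -
 assume "!!t. 0 <= t ==> f t = g t"
 hence "zero_ext f = zero_ext g" by (auto simp: zero_ext_def)
 thus ?thesis by (simp add: stieltjes_measure_def)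
qed

context levy_control
begin

text \<open>Completeness makes \<open>f\<close> measurable as soon as it agrees almost everywhere
  with a measurable \<open>g\<close>; this is how the integrand of the objective is handled, without
  a separate measurability proof.\<close>

lemma integral_AE_eq:
 fixes f g :: "'a => real"
 assumes eq: "AE w in M. f w = g w" and g: "g \<in> Bor M" shows "(LINT w|M. f w) = (LINT w|M. g w)"
proof (rule integral_cong_AE[OF _ g eq])
 show "f \<in> Bor M"
 proof (rule measurableI)
  fix A :: "real set" assume "A \<in> sets borel"
  hence "g -` A Int space M \<in> events" by (rule measurable_sets[OF g])
  moreover have "AE w in M. w \<in> g -` A Int space M <-> w \<in> f -` A Int space M" using eq by eventually_elim auto
  ultimately show "f -` A Int space M \<in> events" using complete_measure.in_sets_AE[OF M_complete] by blast
 qed simp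
qed

text \<open>Dividends, injections and terminal payoff are converted separately, as non-negative
  processes of finite mean, and recombined afterwards.\<close>

lemma objective_eq:
 assumes s: "strategy M F Xr Nr \<gamma> lam r \<phi> \<Psi> x D R" and eq: "AE w in M. ALL t>=0. D0 t w = D t w & R0 t w = R t w"
 shows "objective M \<tau> r \<phi> \<Psi> (start_at x X) (D0, R0) = P.J x D R"
proof -
 interpret s: strategy M F Xr Nr \<gamma> lam r \<phi> \<Psi> x D R by fact
 define Y where "Y t w = \<Psi> (max 0 (s.U t w))" for t w
 have Y_F: "Y t \<in> Bor (F t)" if "0 <= t" for t unfolding Y_def by (rule tame_measurable[OF P.terminal_tame s.U_F[OF that]])
 have Y_cad: "cadlag (%t. Y t w)" if "w \<in> space M" for w unfolding Y_def by (rule cadlag_compose[OF s.U_cadlag[OF that] tame_continuous[OF P.terminal_tame]])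
 have Y_nn: "0 <= Y t w" for t w unfolding Y_def by (rule P.terminal_nonneg) simp
 note d = process_integrals[OF s.D_F s.D_cadlag s.D_nonneg s.parts_finite(1)]
 note e = process_integrals[OF s.R_F s.R_cadlag s.R_nonneg s.R_finite]
 note y = process_integrals[OF Y_F Y_cad Y_nn s.parts_finite(2)[folded Y_def]]
 define a where "a Z w = (LINT v|expo r. Z (max 0 (min v (\<tau> w))) w)" for Z :: "real => 'a => real" and w
 define k where "k Z w = (LINT t|expo q. Z (max 0 t) w)" for Z :: "real => 'a => real" and w
 define p where "p w = exp (- r * \<tau> w) * Y (max 0 (\<tau> w)) w" for w
 note d = d[folded k_def a_def] and e = e[folded k_def a_def] and y = y[folded k_def p_def]
 have i: "AE w in M. integrable (expo q) (%t. D (max 0 t) w)" "AE w in M. integrable (expo q) (%t. R (max 0 t) w)" "AE w in M. integrable (expo q) (%t. Y (max 0 t) w)"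
  by (rule d(1) e(1) y(1); assumption)+
 have "objective M \<tau> r \<phi> \<Psi> (start_at x X) (D0, R0) = (LINT w|M. a D w - \<phi> * a R w + p w)" unfolding objective_def prod.case
 proof (rule integral_AE_eq)
  show "AE w in M. (LINT t:{0..\<tau> w}|stieltjes_measure (%t. D0 t w). exp (- r * t)) - \<phi> * (LINT t:{0..\<tau> w}|stieltjes_measure (%t. R0 t w). exp (- r * t))
    + exp (- r * \<tau> w) * \<Psi> (start_at x X (\<tau> w) w - D0 (\<tau> w) w + R0 (\<tau> w) w) = a D w - \<phi> * a R w + p w" using eq tau_pos AE_r AE_space
  proof eventually_elim
   case (elim w)
   have "stieltjes_measure (%t. D0 t w) = stieltjes_measure (%t. D t w)" "stieltjes_measure (%t. R0 t w) = stieltjes_measure (%t. R t w)" using elim(1) by (auto intro: stieltjes_cong)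
   moreover have "p w = exp (- r * \<tau> w) * \<Psi> (start_at x X (\<tau> w) w - D0 (\<tau> w) w + R0 (\<tau> w) w)"
    using elim s.U_nonneg[OF elim(4), of "\<tau> w"] by (simp add: p_def Y_def max_absorb2 s.U_def start_at_def)
   ultimately show ?case unfolding a_def using increasing_path.discounted_upto[OF s.increasing(1) r_pos, OF elim(4), of "\<tau> w"]
     increasing_path.discounted_upto[OF s.increasing(2) r_pos, OF elim(4), of "\<tau> w"] elim(2) by simp
  qed
 qed (use d e y in simp)
 also have "... = (LINT w|M. k D w) - \<phi> * (LINT w|M. k R w) + lam / q * (LINT w|M. k Y w)" using d e y by simp
 also have "... = (LINT w|M. k D w - \<phi> * k R w + lam / q * k Y w)" using d e y by simp
 also have "... = P.J x D R" unfolding P.J_def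
 proof (rule integral_AE_eq[symmetric])
  show "AE w in M. (LINT t|expo q. D (max 0 t) w - \<phi> * R (max 0 t) w + lam / q * \<Psi> (max 0 (x + Xr (max 0 t) w - D (max 0 t) w + R (max 0 t) w)))
    = k D w - \<phi> * k R w + lam / q * k Y w" using i by eventually_elim (simp add: k_def Y_def s.U_def)
 qed (use d e y in simp)
 finally show ?thesis .
qed

text \<open>The conditions on an admissible pair hold almost surely only; a modification on a null
  set makes them hold everywhere, which is what \<open>strategy\<close> asks for.\<close>

lemma admissible_strategy:
 assumes x: "0 <= x" and adm: "(D0, R0) \<in> admissible M F N (r + lam) (start_at x X)"
 obtains D R where "strategy M F Xr Nr \<gamma> lam r \<phi> \<Psi> x D R" "AE w in M. ALL t>=0. D0 t w = D t w & R0 t w = R t w"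
proof -
 define ok where "ok w <-> mono_on {0..} (%t. D0 t w) & 0 <= D0 0 w & cadlag (%t. D0 t w) &
    mono_on {0..} (%t. R0 t w) & 0 <= R0 0 w & cadlag (%t. R0 t w) &
    (ALL t>=0. start_at x X t w - D0 t w + R0 t w >= 0)" for w
 define jumps where "jumps w <-> (ALL t>=0. D0 t w = (LINT s:{0..t}|stieltjes_measure (%s. real (N s w)). jump (%s. D0 s w) s))" for w
 have F: "D0 t \<in> Bor (F t)" "R0 t \<in> Bor (F t)" if "0 <= t" for t using adm that by (auto simp: admissible_def)
 have ok: "AE w in M. ok w & jumps w" and fin: "(\<integral>\<^sup>+w. (\<integral>\<^sup>+t\<in>{0..}. ennreal (exp (- (r + lam) * t)) \<partial>stieltjes_measure (%t. R0 t w)) \<partial>M) < \<infinity>"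
  using adm unfolding admissible_def ok_def jumps_def by auto
 define B where "B = {w \<in> space M. ~ ((ok w & jumps w) & w \<notin> bad)}"
 have "AE w in M. (ok w & jumps w) & w \<notin> bad" using ok AE_not_in[OF bad_null] by eventually_elim simp
 hence B: "B \<in> null_sets M" unfolding B_def by (rule complete_measure.AE_iff_null_sets[OF M_complete, THEN iffD1])
 define D where "D t w = (if w \<in> B then 0 else D0 t w)" for t w
 \<comment> \<open>On the null set the pair must still be solvent at every time: no dividends, and
   the minimal injections for the regularised surplus.\<close>
 define R where "R t w = (if w \<in> B then injections (P.surplus x w) (%_. 0) t else R0 t w)" for t w
 have eq: "AE w in M. ALL t>=0. D0 t w = D t w & R0 t w = R t w" using AE_not_in[OF B] by eventually_elim (simp add: D_def R_def)
 have D0: "increasing_path (%t. D0 t w)" and R0: "increasing_path (%t. R0 t w)" if "w \<in> space M" "w \<notin> B" for w using that by (auto simp: B_def ok_def increasing_path_def)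
 have path: "mono_on {0..} (%t. D t w) & cadlag (%t. D t w) & D 0 w = 0 & mono_on {0..} (%t. R t w) & cadlag (%t. R t w) & 0 <= R 0 w
   & (ALL t>=0. 0 <= x + Xr t w - D t w + R t w) & (ALL s t. 0 <= s --> s <= t --> Nr s w = Nr t w --> D s w = D t w)" if w: "w \<in> space M" for w
 proof (cases "w \<in> B")
  case True
  interpret p: barrier_path "P.surplus x w" "P.arrivals w" 0 by (rule P.barrier_path[OF w x order_refl])
  note c = p.shortfall_cadlag[OF cadlag_const[of 0]]
  have "0 <= x + Xr t w + injections (P.surplus x w) (%_. 0) t" if "0 <= t" for t using p.injections_bounds(2)[OF cadlag_const[of 0] that] by (simp add: controlled_def start_at_def)
  thus ?thesis using True cadlag_wsup[OF c] p.injections_bounds(1)[OF cadlag_const[of 0] order_refl] by (simp add: D_def R_def cadlag_const monotone_on_def injections_eq[abs_def])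
 next
  case False
  hence w': "ok w" "jumps w" "w \<notin> bad" using w by (auto simp: B_def)
  interpret m: counting_path "%t. Nr t w" by (rule regular_counting_path[OF regular w])
  have Nr: "Nr t w = N t w" for t using w' by (simp add: Nr_def)
  have "D0 t w = (LINT s:{0..t}|m.c.\<mu>. jump (%s. D0 s w) s)" if "0 <= t" for t unfolding Nr by (rule w'(2)[unfolded jumps_def, rule_format, OF that])
  note idle = m.stieltjes_idle[OF D0[OF w False] this]
  show ?thesis using False w'(1,3) idle(1) unfolding D_def R_def Xr_def by (auto simp: ok_def start_at_def intro: idle(2))
 qed
 have "strategy M F Xr Nr \<gamma> lam r \<phi> \<Psi> x D R"
 proof (unfold_locales)
  show "D t \<in> Bor (F t)" "R t \<in> Bor (F t)" if t: "0 <= t" for t by (rule modify_measurable[OF F(1)[OF t] t B] modify_measurable[OF F(2)[OF t] t B]; simp add: D_def R_def)+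
  have "(\<integral>\<^sup>+w. (\<integral>\<^sup>+t. ennreal (R (max 0 t) w) \<partial>expo q) \<partial>M) = (\<integral>\<^sup>+w. (\<integral>\<^sup>+t\<in>{0..}. ennreal (exp (- (r + lam) * t)) \<partial>stieltjes_measure (%t. R0 t w)) \<partial>M)"
  proof (rule nn_integral_cong_AE)
   show "AE w in M. (\<integral>\<^sup>+t. ennreal (R (max 0 t) w) \<partial>expo q) = (\<integral>\<^sup>+t\<in>{0..}. ennreal (exp (- (r + lam) * t)) \<partial>stieltjes_measure (%t. R0 t w))"
    using AE_not_in[OF B] AE_space
   proof eventually_elim
    case (elim w)
    thus ?case using increasing_path.discounted_total[OF R0[OF elim(2,1)] P.q_pos(1)] by (simp add: R_def P.q_def)
   qed
  qed
  thus "(\<integral>\<^sup>+w. (\<integral>\<^sup>+t. ennreal (R (max 0 t) w) \<partial>expo q) \<partial>M) < \<infinity>" using fin by simp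
 qed (use x path in blast)+
 thus ?thesis using eq by (rule that)
qed

lemma double_barrier_eq: "w \<notin> bad ==> fst (double_barrier (start_at x X) N b) t w = P.Db x b t w & snd (double_barrier (start_at x X) N b) t w = P.Rb x b t w"
 by (simp add: double_barrier_def P.Db_def P.Rb_def start_at_def Xr_def Nr_def)

lemma barrier_objective:
 assumes "0 <= x" "0 <= b"
 shows "objective M \<tau> r \<phi> \<Psi> (start_at x X) (double_barrier (start_at x X) N b) = P.J x (P.Db x b) (P.Rb x b)"
proof -
 have "AE w in M. ALL t>=0. fst (double_barrier (start_at x X) N b) t w = P.Db x b t w & snd (double_barrier (start_at x X) N b) t w = P.Rb x b t w"
  using AE_not_in[OF bad_null] by eventually_elim (simp add: double_barrier_eq)
 from objective_eq[OF P.barrier_strategy[OF assms] this] show ?thesis by simp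
qed

lemma barrier_admissible:
 assumes x: "0 <= x" and b: "0 <= b"
 shows "double_barrier (start_at x X) N b \<in> admissible M F N (r + lam) (start_at x X)"
proof -
 interpret s: strategy M F Xr Nr \<gamma> lam r \<phi> \<Psi> x "P.Db x b" "P.Rb x b" by (rule P.barrier_strategy[OF x b])
 obtain D0 R0 where DR: "double_barrier (start_at x X) N b = (D0, R0)" by fastforce
 have eq: "(%t. D0 t w) = (%t. P.Db x b t w)" "(%t. R0 t w) = (%t. P.Rb x b t w)" "(%t. N t w) = (%t. Nr t w)" "(%t. X t w) = (%t. Xr t w)" if "w \<notin> bad" for w
  using double_barrier_eq[OF that, of x b] that by (auto simp: DR Xr_def Nr_def)
 have m: "D0 t \<in> Bor (F t)" "R0 t \<in> Bor (F t)" if t: "0 <= t" for t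
  by (rule modify_measurable[OF s.D_F[OF t] t bad_null] modify_measurable[OF s.R_F[OF t] t bad_null]; use eq in \<open>auto dest: fun_cong\<close>)+
 have path: "AE w in M. mono_on {0..} (%t. D0 t w) & 0 <= D0 0 w & cadlag (%t. D0 t w) &
    mono_on {0..} (%t. R0 t w) & 0 <= R0 0 w & cadlag (%t. R0 t w) &
    (ALL t>=0. start_at x X t w - D0 t w + R0 t w >= 0) &
    (ALL t>=0. D0 t w = (LINT s:{0..t}|stieltjes_measure (%s. real (N s w)). jump (%s. D0 s w) s))" using AE_not_in[OF bad_null] AE_space
 proof eventually_elim
  case (elim w)
  interpret m: counting_path "%t. Nr t w" by (rule regular_counting_path[OF regular elim(2)])
  note e = eq[OF elim(1)] and w = elim(2)
  have e0: "D0 t w = P.Db x b t w" "R0 t w = P.Rb x b t w" "X t w = Xr t w" "N t w = Nr t w" for t using e by (meson fun_cong)+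
  have "P.Db x b t w = (LINT s:{0..t}|m.c.\<mu>. jump (%s. P.Db x b s w) s)" if "0 <= t" for t by (rule m.idle_stieltjes[OF s.increasing(1)[OF w] s.D_0[OF w] s.D_idle[OF w] that])
  thus ?case unfolding e0 start_at_def using s.D_mono[OF w] s.R_mono[OF w] s.D_cadlag[OF w] s.R_cadlag[OF w] s.D_0[OF w] s.R_0[OF w] s.solvent[OF w] by simp
 qed
 have "(\<integral>\<^sup>+w. (\<integral>\<^sup>+t\<in>{0..}. ennreal (exp (- (r + lam) * t)) \<partial>stieltjes_measure (%t. R0 t w)) \<partial>M) = (\<integral>\<^sup>+w. (\<integral>\<^sup>+t. ennreal (P.Rb x b (max 0 t) w) \<partial>expo q) \<partial>M)"
 proof (rule nn_integral_cong_AE)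
  show "AE w in M. (\<integral>\<^sup>+t\<in>{0..}. ennreal (exp (- (r + lam) * t)) \<partial>stieltjes_measure (%t. R0 t w)) = (\<integral>\<^sup>+t. ennreal (P.Rb x b (max 0 t) w) \<partial>expo q)"
   using AE_not_in[OF bad_null] AE_space
  proof eventually_elim
   case (elim w)
   thus ?case unfolding eq(2)[OF elim(1)] using increasing_path.discounted_total[OF s.increasing(2)[OF elim(2)] P.q_pos(1)] by (simp add: P.q_def)
  qed
 qed
 hence "(\<integral>\<^sup>+w. (\<integral>\<^sup>+t\<in>{0..}. ennreal (exp (- (r + lam) * t)) \<partial>stieltjes_measure (%t. R0 t w)) \<partial>M) < \<infinity>" using s.R_finite by simp
 thus ?thesis unfolding DR admissible_def using m path by simp
qed

end

section \<open>Optimality and the barrier level\<close>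

lemma (in levy_control) optimal_double_barrier:
 "EX b>0. barrier_level M X N \<tau> r \<phi> \<Psi> = ereal b &
  (ALL x>0. double_barrier (start_at x X) N b \<in> admissible M F N (r + lam) (start_at x X) &
    value_function M F N \<tau> r lam \<phi> \<Psi> (start_at x X) =
     ereal (objective M \<tau> r \<phi> \<Psi> (start_at x X) (double_barrier (start_at x X) N b)))"
proof -
 obtain b V where b: "0 < b" and V: "tame \<phi> V" "!!x. 0 <= x ==> V x = P.st.stage (barrier_op b V) x"
  and dom: "!!u d. 0 <= u ==> 0 <= d ==> d + V u <= barrier_op b V (u + d)" and dV: "EX d<=1. (V has_real_derivative d) (at b)"
  and below: "!!b' v d. 0 < b' ==> b' < b ==> tame \<phi> v ==> (!!x. 0 <= x ==> v x = P.st.stage (barrier_op b' v) x) ==>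
    (v has_real_derivative d) (at b') ==> 1 < d"
 proof (rule P.st.optimal_barrier, goal_cases)
  case (1 b V)
  show ?case
  proof (rule 1(1)[OF 1(2-6)], assumption, assumption, assumption)
   fix b' v d assume *: "0 < b'" "b' < b" "tame \<phi> v" "!!x. 0 <= x ==> v x = P.st.stage (barrier_op b' v) x" "(v has_real_derivative d) (at b')"
   show "1 < d" by (rule 1(7)[OF *(1-4) *(5)])
  qed
 qed
 let ?J = "%b x. objective M \<tau> r \<phi> \<Psi> (start_at x X) (double_barrier (start_at x X) N b)"
 \<comment> \<open>As a function of its start, the objective of a barrier is any tame fixed point of
   the corresponding stage equation, so that derivatives can be transferred between the two.\<close>
 have J_eq: "?J b x = v x" if "0 <= x" "0 <= b" "tame \<phi> v" "!!x. 0 <= x ==> v x = P.st.stage (barrier_op b v) x" for b x v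
  using barrier_objective[OF that(1,2)] P.barrier_value[OF that(1,2,3,4)] by simp
 \<comment> \<open>The identification holds for \<open>x >= 0\<close>, which contains a
   neighbourhood of any positive barrier; derivatives there see nothing else.\<close>
 have near: "eventually (%x. 0 <= x) (nhds b')" if "0 < b'" for b' :: real using eventually_nhds_in_open[of "{0<..}" b'] that by (auto elim!: eventually_mono)
 have "barrier_level M X N \<tau> r \<phi> \<Psi> = ereal b" unfolding barrier_level_def
 proof (rule antisym)
  obtain d where d: "d <= 1" "(V has_real_derivative d) (at b)" using dV by blast
  have "(?J b has_real_derivative d) (at b)" by (rule has_real_derivative_transfer[OF d(2)], rule eventually_mono[OF near[OF b]]) (use J_eq[OF _ _ V] b in simp)
  thus "Inf {ereal b | b. b > 0 & (EX d<=1. (?J b has_real_derivative d) (at b))} <= ereal b" using b d(1) by (intro Inf_lower) blast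
  show "ereal b <= Inf {ereal b | b. b > 0 & (EX d<=1. (?J b has_real_derivative d) (at b))}"
  proof (rule Inf_greatest)
   fix z assume "z \<in> {ereal b | b. b > 0 & (EX d<=1. (?J b has_real_derivative d) (at b))}"
   then obtain b' d where z: "z = ereal b'" "0 < b'" "d <= 1" "(?J b' has_real_derivative d) (at b')" by blast
   show "ereal b <= z"
   proof (rule ccontr)
    assume "~ ereal b <= z"
    hence lt: "b' < b" using z by simp
    obtain v where v: "tame \<phi> v" "!!x. 0 <= x ==> v x = P.st.stage (barrier_op b' v) x" using P.st.barrier_fixed_point[OF less_imp_le[OF z(2)]] by metis
    have "(v has_real_derivative d) (at b')" by (rule has_real_derivative_transfer[OF z(4)], rule eventually_mono[OF near[OF z(2)]]) (use J_eq[OF _ _ v] z(2) in simp)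
    from below[OF z(2) lt v this] show False using z(3) by simp
   qed
  qed
 qed
 moreover have "double_barrier (start_at x X) N b \<in> admissible M F N (r + lam) (start_at x X) &
    value_function M F N \<tau> r lam \<phi> \<Psi> (start_at x X) = ereal (?J b x)" if x: "0 < x" for x
 proof (intro conjI antisym)
  have x0: "0 <= x" and b0: "0 <= b" using x b by auto
  show adm: "double_barrier (start_at x X) N b \<in> admissible M F N (r + lam) (start_at x X)" by (rule barrier_admissible[OF x0 b0])
  show "ereal (?J b x) <= value_function M F N \<tau> r lam \<phi> \<Psi> (start_at x X)" unfolding value_function_def by (rule SUP_upper[OF adm])
  show "value_function M F N \<tau> r lam \<phi> \<Psi> (start_at x X) <= ereal (?J b x)" unfolding value_function_def
  proof (rule SUP_least)
   fix \<pi> assume "\<pi> \<in> admissible M F N (r + lam) (start_at x X)"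
   then obtain D0 R0 where \<pi>: "\<pi> = (D0, R0)" "(D0, R0) \<in> admissible M F N (r + lam) (start_at x X)" by (cases \<pi>) auto
   obtain D R where s: "strategy M F Xr Nr \<gamma> lam r \<phi> \<Psi> x D R" "AE w in M. ALL t>=0. D0 t w = D t w & R0 t w = R t w" by (rule admissible_strategy[OF x0 \<pi>(2)])
   have W: "tame \<phi> (barrier_op b V)" using tame_barrier_op[OF V(1) _ b0] phi_gt_1 by simp
   have "objective M \<tau> r \<phi> \<Psi> (start_at x X) \<pi> = P.J x D R" unfolding \<pi>(1) by (rule objective_eq[OF s])
   also have "... <= V x" by (rule P.strategy_value[OF s(1) V(1) W V(2)[symmetric] dom])
   also have "V x = ?J b x" using J_eq[OF x0 b0 V] by simp
   finally show "ereal (objective M \<tau> r \<phi> \<Psi> (start_at x X) \<pi>) <= ereal (?J b x)" by simp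
  qed
 qed
 ultimately show ?thesis using b by blast
qed

theorem theorem3p11:
 fixes M :: "'a measure" and F :: "real \<Rightarrow> 'a measure"
  and X :: "real \<Rightarrow> 'a \<Rightarrow> real" and N :: "real \<Rightarrow> 'a \<Rightarrow> nat" and \<tau> :: "'a \<Rightarrow> real"
  and c \<sigma> \<gamma> lam r \<phi> :: real and \<nu> :: "real measure" and \<Psi> :: "real \<Rightarrow> real"
 assumes "levy_dividend_model M F X N \<tau> c \<sigma> \<nu> \<gamma> lam"
  and "r > 0" and "\<phi> > 1"
  and "payoff_function \<phi> \<Psi>"
 shows "\<exists>b>0. barrier_level M X N \<tau> r \<phi> \<Psi> = ereal b \<and>
  (\<forall>x>0. double_barrier (start_at x X) N b \<in> admissible M F N (r + lam) (start_at x X) \<and>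
    value_function M F N \<tau> r lam \<phi> \<Psi> (start_at x X) =
     ereal (objective M \<tau> r \<phi> \<Psi> (start_at x X) (double_barrier (start_at x X) N b)))"
 using assms by (intro levy_control.optimal_double_barrier) (simp add: levy_control_def levy_control_axioms_def)

end
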